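(* Let $Y\subseteq X$ be complex analytic subsets of $\mathbb C^n$ with $0\in Y$, $Y$ smooth (and taken to be linear), and $S(X)\subseteq Y$. With $\mathcal E_2$ and $\pi_1$ as defined in the context, $X$ satisfies $(t^1)$ over $Y$ at $0$ if and only if $\{C\in\mathcal E_2:\pi_1(C)\not\subseteq Y\}=\emptyset$.
   Context: $S(X)$ is the singular set of $X$. Condition $(t^1)$ over $Y$ at $0$: for every complex linear subspace $L$ complementary to $Y$ and every real $C^1$ submanifold germ $Q$ through $0$ with $T_0Q=L$, $Q$ is transverse to $X\setminus Y$ (a complex manifold) at all points near $0$. The conormal modification of an analytic set $X$ is the closure in $X\times\check{\mathbb P}^{n-1}$ of the set of pairs $(x,H)$ with $x$ a regular point of $X$ and $H$ a hyperplane containing $T_xX$; its fibre over $0$ is denoted $\mathcal C(X)$ (so $\mathcal C(Y)$ is the set of hyperplanes containing $Y$). Blow up the conormal modification of $X$ along the pull-back of the maximal ideal of $X$ at $0$, and let $E$ be the exceptional divisor, whose points are pairs $(\ell,H)$ with $\ell$ a line in the tangent cone of $X$ at $0$ and $H\in\mathcal C(X)$. Let $\pi_1(\ell,H)=\ell$ and $\pi_2(\ell,H)=H$; images under $\pi_1$ are subsets of the projectivised tangent cone and are identified with the corresponding subcones of the tangent cone. Let $\mathcal E$ be the set of irreducible components of $E$, $\mathcal E_1$ the set of those $C\in\mathcal E$ with $\pi_2(C)\subseteq\mathcal C(Y)$, and $\mathcal E_2=\mathcal E\setminus\mathcal E_1$. *)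

theory Defs
  imports "HOL-Analysis.Analysis"
begin

section \<open>Holomorphic functions and analytic sets in several variables\<close>

text \<open>Complex scalar multiplication on \<^typ>\<open>complex ^ 'm\<close> is \<open>(*s)\<close>; the complex subspaces, complex
  span and complex dimension are \<open>vec.subspace\<close>, \<open>vec.span\<close>, \<open>vec.dim\<close>, whereas \<^const>\<open>subspace\<close>
  refers to the underlying real vector space.\<close>

definition holomorphic_fun :: "(complex ^ 'm \<Rightarrow> complex) \<Rightarrow> (complex ^ 'm) set \<Rightarrow> bool" where
  "holomorphic_fun f V \<longleftrightarrow>
     (\<forall>z\<in>V. \<exists>f'. (f has_derivative f') (at z) \<and> (\<forall>c v. f' (c *s v) = c * f' v))"

definition holomorphic_map ::
    "(complex ^ 'm \<Rightarrow> complex ^ 'k) \<Rightarrow> (complex ^ 'm) set \<Rightarrow> bool" where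
  "holomorphic_map f V \<longleftrightarrow> (\<forall>i. holomorphic_fun (\<lambda>z. f z $ i) V)"

definition C1_map :: "('a::real_normed_vector \<Rightarrow> 'b::real_normed_vector) \<Rightarrow> 'a set \<Rightarrow> bool" where
  "C1_map f V \<longleftrightarrow>
     (\<exists>f'. (\<forall>x\<in>V. (f has_derivative blinfun_apply (f' x)) (at x)) \<and> continuous_on V f')"

definition analytic_subset :: "(complex ^ 'm) set \<Rightarrow> (complex ^ 'm) set \<Rightarrow> bool" where
  "analytic_subset U A \<longleftrightarrow> A \<subseteq> U \<and>
     (\<forall>p\<in>U. \<exists>V F. open V \<and> p \<in> V \<and> V \<subseteq> U \<and> finite F \<and> (\<forall>f\<in>F. holomorphic_fun f V) \<and>
        A \<inter> V = {z\<in>V. \<forall>f\<in>F. f z = 0})"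

section \<open>Submanifolds, tangent spaces, transversality\<close>

text \<open>The parameter \<open>D\<close> is the regularity of the charts and \<open>lin\<close> the class of model subspaces:
  \<open>holomorphic_map\<close> and \<open>vec.subspace\<close> give complex submanifolds, \<open>C1_map\<close> and \<open>subspace\<close>
  give real submanifolds of class \<open>C\<^sup>1\<close>.\<close>

definition submanifold_at ::
    "(('a::topological_space \<Rightarrow> 'a) \<Rightarrow> 'a set \<Rightarrow> bool) \<Rightarrow> ('a set \<Rightarrow> bool) \<Rightarrow> 'a set \<Rightarrow> 'a \<Rightarrow> bool" where
  "submanifold_at D lin M x \<longleftrightarrow>
     (\<exists>V W \<phi> \<psi> S. open V \<and> open W \<and> x \<in> V \<and> homeomorphism V W \<phi> \<psi> \<and> D \<phi> V \<and> D \<psi> W \<and>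
        lin S \<and> \<phi> ` (M \<inter> V) = W \<inter> S)"

definition C1_submanifold :: "'a::real_normed_vector set \<Rightarrow> bool" where
  "C1_submanifold Q \<longleftrightarrow> (\<forall>q\<in>Q. submanifold_at C1_map subspace Q q)"

definition regular_points :: "(complex ^ 'n) set \<Rightarrow> (complex ^ 'n) set" where
  "regular_points X = {x\<in>X. submanifold_at holomorphic_map vec.subspace X x}"

definition singular_set :: "(complex ^ 'n) set \<Rightarrow> (complex ^ 'n) set" where
  "singular_set X = X - regular_points X"

text \<open>Velocity vectors of curves in \<open>M\<close>.  This is only used where \<open>M\<close> is a submanifold near \<open>x\<close>;
  if it is a complex one, the result is its complex tangent space.\<close>

definition tangent_space :: "'a::real_normed_vector set \<Rightarrow> 'a \<Rightarrow> 'a set" where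
  "tangent_space M x =
     {v. \<exists>\<gamma>. \<gamma> 0 = x \<and> (\<forall>t. \<gamma> t \<in> M) \<and> (\<gamma> has_vector_derivative v) (at (0::real))}"

definition transverse_at :: "'a::real_normed_vector set \<Rightarrow> 'a set \<Rightarrow> 'a \<Rightarrow> bool" where
  "transverse_at M N x \<longleftrightarrow>
     (x \<in> M \<inter> N \<longrightarrow> {u + v | u v. u \<in> tangent_space M x \<and> v \<in> tangent_space N x} = UNIV)"

definition complementary :: "(complex ^ 'n) set \<Rightarrow> (complex ^ 'n) set \<Rightarrow> bool" where
  "complementary L Y \<longleftrightarrow> L \<inter> Y = {0} \<and> {u + v | u v. u \<in> L \<and> v \<in> Y} = UNIV"

definition condition_t1 :: "(complex ^ 'n) set \<Rightarrow> (complex ^ 'n) set \<Rightarrow> bool" where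
  "condition_t1 X Y \<longleftrightarrow>
     (\<forall>L Q. vec.subspace L \<and> complementary L Y \<and>
            C1_submanifold Q \<and> 0 \<in> Q \<and> tangent_space Q 0 = L \<longrightarrow>
        (\<forall>\<^sub>F x in nhds 0. transverse_at Q (X - Y) x))"

section \<open>Projective space and its dual\<close>

definition quotient_topology :: "'a topology \<Rightarrow> ('a \<Rightarrow> 'b) \<Rightarrow> 'b topology" where
  "quotient_topology T f =
     topology (\<lambda>U. U \<subseteq> f ` topspace T \<and> openin T {x \<in> topspace T. f x \<in> U})"

lemma openin_quotient_topology:
  "openin (quotient_topology T f) U \<longleftrightarrow>
     U \<subseteq> f ` topspace T \<and> openin T {x \<in> topspace T. f x \<in> U}"
proof -
  have "istopology (\<lambda>U. U \<subseteq> f ` topspace T \<and> openin T {x \<in> topspace T. f x \<in> U})"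
    unfolding istopology_def
  proof (intro conjI allI impI)
    fix S S' assume "S \<subseteq> f ` topspace T \<and> openin T {x \<in> topspace T. f x \<in> S}"
      and "S' \<subseteq> f ` topspace T \<and> openin T {x \<in> topspace T. f x \<in> S'}"
    moreover have "{x \<in> topspace T. f x \<in> S \<inter> S'} =
        {x \<in> topspace T. f x \<in> S} \<inter> {x \<in> topspace T. f x \<in> S'}" by auto
    ultimately show "S \<inter> S' \<subseteq> f ` topspace T" "openin T {x \<in> topspace T. f x \<in> S \<inter> S'}"
      by auto
  next
    fix K assume K: "\<forall>S\<in>K. S \<subseteq> f ` topspace T \<and> openin T {x \<in> topspace T. f x \<in> S}"
    show "\<Union>K \<subseteq> f ` topspace T" using K by blast
    have "{x \<in> topspace T. f x \<in> \<Union>K} = (\<Union>S\<in>K. {x \<in> topspace T. f x \<in> S})" by auto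
    then show "openin T {x \<in> topspace T. f x \<in> \<Union>K}" using K by auto
  qed
  then show ?thesis by (simp add: quotient_topology_def)
qed

lemma topspace_quotient_topology: "topspace (quotient_topology T f) = f ` topspace T"
proof -
  have "openin (quotient_topology T f) (f ` topspace T)"
    by (auto simp: openin_quotient_topology intro: back_subst[of "openin T", OF openin_topspace])
  then show ?thesis
    by (meson openin_quotient_topology openin_subset openin_topspace subset_antisym)
qed

lemma quotient_map_quotient_topology: "quotient_map T (quotient_topology T f) f"
  by (auto simp: quotient_map_def topspace_quotient_topology openin_quotient_topology)

definition line :: "complex ^ 'n \<Rightarrow> (complex ^ 'n) set" where
  "line v = vec.span {v}"

definition hyperplane :: "complex ^ 'n \<Rightarrow> (complex ^ 'n) set" where
  "hyperplane h = {v. (\<Sum>i\<in>UNIV. h $ i * v $ i) = 0}"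

text \<open>The points of projective space are the complex lines through the origin, those of the dual
  projective space the complex hyperplanes through the origin.\<close>

definition proj_space :: "(complex ^ 'n) set topology" where
  "proj_space = quotient_topology (top_of_set (- {0})) line"

definition dual_proj_space :: "(complex ^ 'n) set topology" where
  "dual_proj_space = quotient_topology (top_of_set (- {0})) hyperplane"

text \<open>Pairs \<open>(v, h)\<close> of vectors are coded as vectors indexed by \<^typ>\<open>'n + 'n\<close>.  Analyticity of a
  subset of the product of projective space and its dual is tested on the preimage under
  \<open>(v, h) \<mapsto> (line v, hyperplane h)\<close>, which is a surjective holomorphic submersion.\<close>

definition left_part :: "complex ^ ('n + 'n) \<Rightarrow> complex ^ 'n" where
  "left_part z = (\<chi> i. z $ Inl i)"

definition right_part :: "complex ^ ('n + 'n) \<Rightarrow> complex ^ 'n" where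
  "right_part z = (\<chi> i. z $ Inr i)"

definition proj_analytic :: "((complex ^ 'n) set \<times> (complex ^ 'n) set) set \<Rightarrow> bool" where
  "proj_analytic A \<longleftrightarrow>
     A \<subseteq> topspace proj_space \<times> topspace dual_proj_space \<and>
     analytic_subset {z. left_part z \<noteq> 0 \<and> right_part z \<noteq> 0}
       {z. left_part z \<noteq> 0 \<and> right_part z \<noteq> 0 \<and>
           (line (left_part z), hyperplane (right_part z)) \<in> A}"

definition proj_irreducible :: "((complex ^ 'n) set \<times> (complex ^ 'n) set) set \<Rightarrow> bool" where
  "proj_irreducible A \<longleftrightarrow> A \<noteq> {} \<and> proj_analytic A \<and>
     (\<forall>A1 A2. proj_analytic A1 \<and> proj_analytic A2 \<and> A = A1 \<union> A2 \<longrightarrow> A1 = A \<or> A2 = A)"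

definition irreducible_components ::
    "((complex ^ 'n) set \<times> (complex ^ 'n) set) set
       \<Rightarrow> ((complex ^ 'n) set \<times> (complex ^ 'n) set) set set" where
  "irreducible_components E =
     {C. C \<subseteq> E \<and> proj_irreducible C \<and>
         (\<forall>C'. C' \<subseteq> E \<and> proj_irreducible C' \<and> C \<subseteq> C' \<longrightarrow> C' = C)}"

section \<open>The conormal modification and its blow-up\<close>

definition conormal :: "(complex ^ 'n) set \<Rightarrow> ((complex ^ 'n) \<times> (complex ^ 'n) set) set" where
  "conormal X = prod_topology (top_of_set X) dual_proj_space closure_of
     {(x, H). x \<in> regular_points X \<and> H \<in> topspace dual_proj_space \<and> tangent_space X x \<subseteq> H}"

definition conormal_fibre :: "(complex ^ 'n) set \<Rightarrow> (complex ^ 'n) set set" where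
  "conormal_fibre X = {H. (0, H) \<in> conormal X}"

text \<open>The pull-back of the maximal ideal at \<open>0\<close> is generated by the coordinate functions
  \<open>x\<^sub>1, \<dots>, x\<^sub>n\<close>, so the blow-up is the closure of the graph of \<open>(x, H) \<mapsto> [x\<^sub>1 : \<dots> : x\<^sub>n]\<close>, defined
  where \<open>x \<noteq> 0\<close>.\<close>

definition conormal_blowup ::
    "(complex ^ 'n) set \<Rightarrow> (((complex ^ 'n) \<times> (complex ^ 'n) set) \<times> (complex ^ 'n) set) set" where
  "conormal_blowup X =
     prod_topology (subtopology (prod_topology (top_of_set X) dual_proj_space) (conormal X))
         proj_space closure_of
       {((x, H), line x) | x H. (x, H) \<in> conormal X \<and> x \<noteq> 0}"

definition exceptional_divisor ::
    "(complex ^ 'n) set \<Rightarrow> ((complex ^ 'n) set \<times> (complex ^ 'n) set) set" where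
  "exceptional_divisor X = {(l, H). ((0, H), l) \<in> conormal_blowup X}"

definition comps :: "(complex ^ 'n) set \<Rightarrow> ((complex ^ 'n) set \<times> (complex ^ 'n) set) set set" where
  "comps X = irreducible_components (exceptional_divisor X)"

definition comps1 ::
    "(complex ^ 'n) set \<Rightarrow> (complex ^ 'n) set \<Rightarrow> ((complex ^ 'n) set \<times> (complex ^ 'n) set) set set"
  where "comps1 X Y = {C \<in> comps X. snd ` C \<subseteq> conormal_fibre Y}"

definition comps2 ::
    "(complex ^ 'n) set \<Rightarrow> (complex ^ 'n) set \<Rightarrow> ((complex ^ 'n) set \<times> (complex ^ 'n) set) set set"
  where "comps2 X Y = comps X - comps1 X Y"

text \<open>The cone in \<open>\<complex>\<^sup>n\<close> that is the union of the lines in \<open>\<pi>\<^sub>1(C)\<close>.\<close>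

definition pi1_cone :: "((complex ^ 'n) set \<times> (complex ^ 'n) set) set \<Rightarrow> (complex ^ 'n) set" where
  "pi1_cone C = \<Union> (fst ` C)"

end

theory Submission
 imports Defs "HOL-Complex_Analysis.Complex_Analysis"
begin

no_notation fps_nth (infixl "$" 75)

text \<open>A pair of a line \<open>[e]\<close> and a hyperplane \<open>[h]\<close> lies in the exceptional divisor iff it is a limit of
 pairs \<open>([x], H)\<close> with \<open>x\<close> a regular point of \<open>X\<close> tending to \<open>0\<close> and \<open>H\<close> containing the tangent space at
 \<open>x\<close>.  Such a limit satisfies \<open>h e = 0\<close>: writing \<open>x = s u\<close> with \<open>u\<close> tending to \<open>e\<close>, choose a multivalued
 holomorphic curve of triples \<open>(s, u, h)\<close> along which \<open>h (s u)' = 0\<close>; Cauchy's estimate makes \<open>t u'\<close> small,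
 whereas \<open>t s' / s\<close> summed over the branches tends to a positive integer.

 If (t1) fails for \<open>Q\<close> tangent to \<open>L\<close>, the non-transverse points yield a limit with \<open>e\<close> in \<open>L\<close> and \<open>L\<close>
 contained in the hyperplane, so that neither the line lies in \<open>Y\<close> nor \<open>Y\<close> in the hyperplane.  Conversely
 such a limit gives a complement \<open>L\<close> of \<open>Y\<close> with \<open>e\<close> in \<open>L\<close> and \<open>L\<close> in the hyperplane, and \<open>Q\<close> is a graph
 over \<open>L\<close> that oscillates through non-transverse points of \<open>X\<close>.

 Finally, a component with \<open>\<pi>\<^sub>1\<close> not in \<open>Y\<close> and \<open>\<pi>\<^sub>2\<close> not in the conormal space of \<open>Y\<close> contains a single
 point with both properties, by irreducibility; and every point of the divisor lies on a component, because
 chains of irreducible analytic sets are bounded in length.  The local theory of analytic sets that is needed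
 is obtained from branched coverings of coordinate polydiscs, by induction on the dimension.\<close>

section \<open>Holomorphic functions of several variables\<close>

text \<open>The equations that define \<open>X\<close> need not generate the ideal of all functions
  vanishing on \<open>X\<close>, so their differentials may say nothing about its tangent spaces.
  These are therefore recovered only where they are wanted, along a sequence of pieces of
  \<open>X\<close> shrinking to the origin, from iterated partial derivatives of eliminants; for
  infinitely many pieces one and the same system of derivatives has simple roots at some point. The
  curves are kept multivalued over a punctured disc: products over all branches are single valued,
  which is all that the logarithmic derivative argument asks for. The condition quantifies over real
  submanifolds \<open>Q\<close>, and a failure of transversality yields at first only a real normal
  vector; it becomes a complex covector because the tangent spaces of \<open>X\<close> and the limit
  \<open>L\<close> are complex. For the converse, \<open>Q\<close> must have a continuous derivative
  although it meets infinitely many prescribed points in prescribed directions; this dictates scales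
  that at least halve, bumps in the squared norm of the projection to \<open>L\<close>, and errors
  of relative size \<open>(1/2)^j\<close>.\<close>

abbreviation "hol \<equiv> holomorphic_fun"

lemmas cmod_nth_le = Finite_Cartesian_Product.norm_nth_le

lemma norm_vector_smult: "norm (c *s (v::complex ^ 'm)) = cmod c * norm v"
 by (simp add: norm_vec_def L2_set_def norm_mult power_mult_distrib real_sqrt_mult
   flip: sum_distrib_left)

lemma scaleR_nth: "(r *\<^sub>R (v::complex ^ 'm)) $ i = complex_of_real r * v $ i"
 unfolding vector_scaleR_component by (rule scaleR_conv_of_real)

lemma of_real_smult: "complex_of_real r *s (v::complex ^ 'm) = r *\<^sub>R v"
 by (simp add: vec_eq_iff scaleR_nth del: vector_scaleR_component)

lemma bounded_linear_smult_left: "bounded_linear (%t. t *s (v::complex ^ 'm))"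
 by (rule bounded_linear_intro[where K = "norm v"])
  (auto simp: vec_eq_iff norm_vector_smult algebra_simps)

lemma has_derivative_line: "((%t. x + t *s (v::complex ^ 'm)) has_derivative (%t. t *s v)) (at t)"
 by (auto intro!: derivative_eq_intros bounded_linear_imp_has_derivative bounded_linear_smult_left)

lemma continuous_on_smult [continuous_intros]:
 assumes "continuous_on A f" "continuous_on A g"
 shows "continuous_on A (%t. f t *s (g t :: complex ^ 'm))"
 unfolding vector_scalar_mult_def
 by (intro continuous_on_vec_lambda continuous_on_mult assms continuous_on_component)

lemma holI:
 assumes "\<And>z. z \<in> V ==> (f has_derivative f' z) (at z)"
  and "\<And>z c v. z \<in> V ==> f' z (c *s v) = c * f' z v"
 shows "hol f V"
 using assms unfolding holomorphic_fun_def by blast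

abbreviation fd :: "(complex ^ 'm => complex) => complex ^ 'm => complex ^ 'm => complex" where
 "fd f z \<equiv> frechet_derivative f (at z)"

lemma hol_deriv:
 assumes "hol f V" "z \<in> V"
 shows "(f has_derivative fd f z) (at z)" "fd f z (c *s v) = c * fd f z v"
proof -
 obtain f' where f': "(f has_derivative f') (at z)" "\<forall>c v. f' (c *s v) = c * f' v"
  using assms unfolding holomorphic_fun_def by blast
 then have "fd f z = f'"
  by (metis frechet_derivative_at)
 with f' show "(f has_derivative fd f z) (at z)" "fd f z (c *s v) = c * fd f z v"
  by auto
qed

lemma fd_eqI: "(f has_derivative f') (at z) ==> fd f z = f'"
 by (metis frechet_derivative_at)

lemma fd_linear:
 assumes "hol f V" "z \<in> V"
 shows "fd f z (v + w) = fd f z v + fd f z w" "fd f z 0 = 0"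
  "fd f z (sum g A) = (\<Sum>i\<in>A. fd f z (g i))"
 using hol_deriv(1)[OF assms]
 by (simp_all add: has_derivative_linear linear_add linear_0 linear_sum)

lemma vec_as_sum: "(v::complex ^ 'm) = (\<Sum>i\<in>UNIV. v $ i *s axis i 1)"
 by (simp add: vec_eq_iff axis_def if_distrib cong: if_cong)

lemma fd_expand:
 fixes v :: "complex ^ 'm"
 assumes "hol f V" "z \<in> V"
 shows "fd f z v = (\<Sum>i\<in>UNIV. v $ i * fd f z (axis i 1))"
proof -
 have "fd f z v = fd f z (\<Sum>i\<in>UNIV. v $ i *s axis i 1)"
  by (subst vec_as_sum) simp
 then show ?thesis
  unfolding fd_linear(3)[OF assms] hol_deriv(2)[OF assms] .
qed

lemma hol_continuous_on: "hol f V ==> continuous_on V f"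
 by (meson continuous_at_imp_continuous_on has_derivative_continuous hol_deriv(1))

lemma hol_subset: "hol f V ==> W \<subseteq> V ==> hol f W"
 unfolding holomorphic_fun_def by blast

lemma hol_transform:
 assumes "hol f V" "open V" "\<And>z. z \<in> V ==> g z = f z"
 shows "hol g V"
proof (rule holI[where f' = "%z. fd f z"])
 fix z assume z: "z \<in> V"
 have "\<forall>\<^sub>F w in nhds z. w \<in> V"
  using assms(2) z by (rule eventually_nhds_in_open)
 then have "\<forall>\<^sub>F w in at z. f w = g w"
  unfolding eventually_at_filter by eventually_elim (simp add: assms(3))
 then show "(g has_derivative fd f z) (at z)"
  using has_derivative_transform_eventually[OF hol_deriv(1)[OF assms(1) z]] assms(3)[OF z]
  by simp
qed (use hol_deriv(2)[OF assms(1)] in auto)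

lemma hol_local:
 "(\<And>z. z \<in> V ==> \<exists>W. z \<in> W \<and> hol f W) ==> hol f V"
 unfolding holomorphic_fun_def by meson

lemma hol_const: "hol (%z. c) V"
 by (rule holI[where f' = "%z v. 0"]) auto

lemma hol_linear:
 assumes "bounded_linear f" "\<And>c v. f (c *s v) = c * f v"
 shows "hol f V"
 by (rule holI[where f' = "%z. f"]) (auto intro: assms bounded_linear_imp_has_derivative)

lemma hol_nth: "hol (%z. z $ i) V"
 by (rule hol_linear) (auto intro: bounded_linear_vec_nth)

lemma hol_add:
 "hol f V ==> hol g V ==> hol (%z. f z + g z) V"
 by (rule holI[where f' = "%z v. fd f z v + fd g z v"])
  (auto intro: has_derivative_add hol_deriv simp: hol_deriv(2) algebra_simps)

lemma hol_mult:
 "hol f V ==> hol g V ==> hol (%z. f z * g z) V"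
 by (rule holI[where f' = "%z v. f z * fd g z v + fd f z v * g z"])
  (use has_derivative_mult[OF hol_deriv(1) hol_deriv(1)] in blast,
   simp add: hol_deriv(2) algebra_simps)

lemma hol_minus: "hol f V ==> hol (%z. - f z) V"
 using hol_mult[OF hol_const[of "-1"], of f V] by simp

lemma hol_diff:
 "hol f V ==> hol g V ==> hol (%z. f z - g z) V"
 using hol_add[OF _ hol_minus, of f V g] by simp

lemma hol_sum:
 "(\<And>i. i \<in> I ==> hol (f i) V) ==> hol (%z. \<Sum>i\<in>I. f i z) V"
 by (induction I rule: infinite_finite_induct) (auto intro: hol_const hol_add)

lemma hol_prod:
 "(\<And>i. i \<in> I ==> hol (f i) V) ==> hol (%z. \<Prod>i\<in>I. f i z) V"
 by (induction I rule: infinite_finite_induct) (auto intro: hol_const hol_mult)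

lemma hol_power: "hol f V ==> hol (%z. f z ^ n) V"
 by (induction n) (auto intro: hol_const hol_mult)

lemma hol_compose_field:
 assumes "hol f V" "h holomorphic_on W" "open W" "\<And>z. z \<in> V ==> f z \<in> W"
 shows "hol (%z. h (f z)) V"
proof (rule holI[where f' = "%z v. deriv h (f z) * fd f z v"])
 fix z assume z: "z \<in> V"
 have "(h has_field_derivative deriv h (f z)) (at (f z))"
  using assms z holomorphic_derivI by blast
 then have "(h has_derivative (%v. deriv h (f z) * v)) (at (f z))"
  by (simp add: has_field_derivative_def)
 from has_derivative_compose[OF hol_deriv(1)[OF assms(1) z] this]
 show "((%z. h (f z)) has_derivative (%v. deriv h (f z) * fd f z v)) (at z)" .
qed (simp add: hol_deriv(2)[OF assms(1)])

lemma hol_inverse: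
 assumes "hol f V" "\<And>z. z \<in> V ==> f z \<noteq> 0"
 shows "hol (%z. inverse (f z)) V"
 by (rule hol_compose_field[OF assms(1), where W = "-{0}"])
  (auto intro!: holomorphic_intros simp: assms)

lemma hol_divide:
 assumes "hol f V" "hol g V" "\<And>z. z \<in> V ==> g z \<noteq> 0"
 shows "hol (%z. f z / g z) V"
 using hol_mult[OF assms(1) hol_inverse[OF assms(2,3)]]
 by (simp add: divide_inverse)

lemma holomorphic_map_deriv:
 assumes "holomorphic_map g V" "z \<in> V"
 shows "(g has_derivative (%v. \<chi> i. fd (%z. g z $ i) z v)) (at z)"
proof (subst has_derivative_componentwise_within, rule ballI)
 fix b :: "complex ^ 'b" assume "b \<in> Basis"
 then obtain k u where b: "b = axis k u"
  by (auto simp: Basis_vec_def)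
 have "((%z. g z $ k) has_derivative fd (%z. g z $ k) z) (at z)"
  using assms hol_deriv(1) unfolding holomorphic_map_def by blast
 from has_derivative_inner_left[OF this, of u]
 show "((%x. g x \<bullet> b) has_derivative (%v. (\<chi> i. fd (%z. g z $ i) z v) \<bullet> b)) (at z)"
  by (simp add: b inner_axis)
qed

lemma holomorphic_map_continuous_on: "holomorphic_map f V ==> continuous_on V f"
 by (meson continuous_at_imp_continuous_on has_derivative_continuous holomorphic_map_deriv)

lemma hol_compose:
 assumes "hol f V" "holomorphic_map g W" "\<And>z. z \<in> W ==> g z \<in> V"
 shows "hol (%z. f (g z)) W"
proof (rule holI[where f' = "%z v. fd f (g z) (\<chi> i. fd (%z. g z $ i) z v)"])
 fix z assume z: "z \<in> W"
 show "((%z. f (g z)) has_derivative (%v. fd f (g z) (\<chi> i. fd (%z. g z $ i) z v))) (at z)"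
  by (rule has_derivative_compose[OF holomorphic_map_deriv[OF assms(2) z]
     hol_deriv(1)[OF assms(1) assms(3)[OF z]]])
 fix c and v :: "complex ^ 'b"
 have "(\<chi> i. fd (%z. g z $ i) z (c *s v)) = c *s (\<chi> i. fd (%z. g z $ i) z v)"
  using assms(2) z hol_deriv(2) unfolding holomorphic_map_def vec_eq_iff by fastforce
 then show "fd f (g z) (\<chi> i. fd (%z. g z $ i) z (c *s v)) =
   c * fd f (g z) (\<chi> i. fd (%z. g z $ i) z v)"
  using hol_deriv(2)[OF assms(1) assms(3)[OF z]] by simp
qed

lemma hol_curve:
 assumes "hol f V" "(gam has_derivative (%h. h *s v)) (at t)" "gam t \<in> V"
 shows "((%t. f (gam t)) has_field_derivative fd f (gam t) v) (at t)"
proof -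
 have "((%t. f (gam t)) has_derivative (%h. fd f (gam t) (h *s v))) (at t)"
  by (rule has_derivative_compose[OF assms(2) hol_deriv(1)[OF assms(1,3)]])
 then show ?thesis
  by (simp add: has_field_derivative_def hol_deriv(2)[OF assms(1,3)])
   (simp add: mult.commute[of _ "fd f (gam t) v"])
qed

section \<open>Restriction to complex lines\<close>

lemma hol_line:
 assumes "hol f V" "x + t *s v \<in> V"
 shows "((%t. f (x + t *s v)) has_field_derivative fd f (x + t *s v) v) (at t)"
 by (rule hol_curve[OF assms(1) has_derivative_line assms(2)])

lemma holomorphic_on_line:
 assumes "hol f V" "\<And>t. t \<in> A ==> x + t *s v \<in> V"
 shows "(%t. f (x + t *s v)) holomorphic_on A"
 unfolding holomorphic_on_def field_differentiable_def
 using hol_line[OF assms(1)] assms(2) has_field_derivative_at_within by blast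

lemma open_line_preimage: "open V ==> open {t. x + t *s (v::complex ^ 'm) \<in> V}"
proof -
 assume "open V"
 moreover have "continuous_on UNIV (%t. x + t *s v)"
  by (intro continuous_intros)
 ultimately show ?thesis
  using open_vimage[of V "%t. x + t *s v"] by (simp add: vimage_def)
qed

lemma convex_line_preimage: "convex V ==> convex {t. x + t *s (v::complex ^ 'm) \<in> V}"
proof (rule convexI)
 fix s t :: complex and a b :: real
 assume "convex V" "s \<in> {t. x + t *s v \<in> V}" "t \<in> {t. x + t *s v \<in> V}" "0 \<le> a" "0 \<le> b" "a + b = 1"
 then have *: "convex V" "x + s *s v \<in> V" "x + t *s v \<in> V" "0 \<le> a" "0 \<le> b" "a + b = 1"
  by auto
 have "x + (a *\<^sub>R s + b *\<^sub>R t) *s v = (a + b) *\<^sub>R x + (a *\<^sub>R s + b *\<^sub>R t) *s v"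
  using * by simp
 also have "\<dots> = a *\<^sub>R (x + s *s v) + b *\<^sub>R (x + t *s v)"
  by (simp add: vec_eq_iff scaleR_nth scaleR_conv_of_real[where 'a = complex] algebra_simps
    del: vector_scaleR_component)
 finally have "x + (a *\<^sub>R s + b *\<^sub>R t) *s v = a *\<^sub>R (x + s *s v) + b *\<^sub>R (x + t *s v)" .
 then show "a *\<^sub>R s + b *\<^sub>R t \<in> {t. x + t *s v \<in> V}"
  using * by (simp add: convexD)
qed

section \<open>Cauchy estimates and Osgood's lemma\<close>

lemma holomorphic_on_linear_growth:
 assumes "h holomorphic_on ball 0 T" "\<And>t. t \<in> ball 0 T ==> cmod (h t) \<le> M" "h 0 = 0"
  and "0 < T" "cmod a \<le> T / 2"
 shows "cmod (h a) \<le> 4 * M / T * cmod a"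
proof -
 have bd: "cmod (deriv h t) \<le> 4 * M / T" if "t \<in> cball 0 (T / 2)" for t
 proof -
  have sub: "cball t (T / 4) \<subseteq> ball 0 T"
   using that \<open>0 < T\<close> by (intro subsetI) (simp add: dist_norm, smt (verit) norm_triangle_ineq4 norm_minus_commute norm_triangle_sub)
  have "norm ((deriv ^^ 1) h t) \<le> fact 1 * M / (T / 4) ^ 1"
   by (rule Cauchy_inequality)
    (use sub assms holomorphic_on_imp_continuous_on[OF assms(1)] in
     \<open>auto intro: holomorphic_on_subset continuous_on_subset simp: dist_norm subset_iff\<close>)
  then show ?thesis by (simp add: field_simps)
 qed
 have "norm (h a - h 0) \<le> 4 * M / T * norm (a - 0)"
 proof (rule field_differentiable_bound[where S = "cball 0 (T/2)" and f' = "deriv h"])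
  fix z :: complex assume "z \<in> cball 0 (T/2)"
  then have "z \<in> ball 0 T" using \<open>0 < T\<close> by auto
  then show "(h has_field_derivative deriv h z) (at z within cball 0 (T/2))"
   using assms(1) holomorphic_derivI[OF _ open_ball] by blast
 qed (use bd assms in auto)
 then show ?thesis by (simp add: assms(3))
qed

text \<open>As in the linear case, Cauchy's inequality is used on circles of radius
  \<open>T / 4\<close> about points of the half disc. It bounds the second derivative by
  \<open>2 * M * 16 / T^2\<close>, which is the constant in Taylor's remainder.\<close>

lemma holomorphic_on_quadratic_growth:
 assumes "h holomorphic_on ball 0 T" "\<And>t. t \<in> ball 0 T ==> cmod (h t) \<le> M"
  and "0 < T" "cmod a \<le> T / 2"
 shows "cmod (h a - h 0 - deriv h 0 * a) \<le> 32 * M / T\<^sup>2 * (cmod a)\<^sup>2"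
proof -
 have bd: "cmod ((deriv ^^ 2) h t) \<le> 32 * M / T\<^sup>2" if "t \<in> cball 0 (T / 2)" for t
 proof -
  have sub: "cball t (T / 4) \<subseteq> ball 0 T"
   using that \<open>0 < T\<close> by (intro subsetI) (simp add: dist_norm, smt (verit) norm_triangle_ineq4 norm_minus_commute norm_triangle_sub)
  have "norm ((deriv ^^ 2) h t) \<le> fact 2 * M / (T / 4) ^ 2"
   by (rule Cauchy_inequality)
    (use sub assms holomorphic_on_imp_continuous_on[OF assms(1)] in
     \<open>auto intro: holomorphic_on_subset continuous_on_subset simp: dist_norm subset_iff\<close>)
  then show ?thesis by (simp add: field_simps power2_eq_square)
 qed
 have "norm ((deriv ^^ 0) h a - (\<Sum>i\<le>1. (deriv ^^ i) h 0 * (a - 0) ^ i / fact i))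
   \<le> 32 * M / T\<^sup>2 * norm (a - 0) ^ Suc 1 / fact 1"
 proof (rule complex_Taylor[where S = "cball 0 (T/2)"])
  fix i z assume "z \<in> cball (0::complex) (T/2)"
  then have "z \<in> ball 0 T" using \<open>0 < T\<close> by auto
  moreover have "(deriv ^^ i) h holomorphic_on ball 0 T"
   using assms(1) by (rule holomorphic_higher_deriv) auto
  ultimately show "((deriv ^^ i) h has_field_derivative (deriv ^^ Suc i) h z) (at z within cball 0 (T/2))"
   using holomorphic_derivI[OF _ open_ball] by simp
 qed (use bd assms in "auto simp: numeral_2_eq_2")
 then show ?thesis by (simp add: algebra_simps power2_eq_square)
qed

text \<open>For integrals with a parameter only derivatives along complex lines are directly
  available; this is the intermediate notion for them.\<close>

definition gateaux_holomorphic :: "(complex ^ 'm => complex) => (complex ^ 'm) set => bool" where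
 "gateaux_holomorphic f V \<longleftrightarrow>
   (\<forall>x\<in>V. \<forall>v. (%t. f (x + t *s v)) field_differentiable at 0)"

lemma gateaux_holomorphic_line:
 assumes "gateaux_holomorphic f V" "\<And>t. t \<in> A ==> x + t *s v \<in> V"
 shows "(%t. f (x + t *s v)) holomorphic_on A"
 unfolding holomorphic_on_def
proof
 fix t assume "t \<in> A"
 then have "(%s. f ((x + t *s v) + s *s v)) field_differentiable at 0"
  using assms unfolding gateaux_holomorphic_def by blast
 then obtain d where "((%s. f ((x + t *s v) + s *s v)) has_field_derivative d) (at (t - t))"
  unfolding field_differentiable_def by auto
 from DERIV_chain'[where f = "%s. s - t" and s = UNIV and D = 1, OF _ this]
 have "((%s. f ((x + t *s v) + (s - t) *s v)) has_field_derivative d * 1) (at t)"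
  by (rule meta_mp) (auto intro!: derivative_eq_intros)
 moreover have "(%s. f ((x + t *s v) + (s - t) *s v)) = (%s. f (x + s *s v))"
  by (simp add: vector_ssub_ldistrib vec.scale_left_diff_distrib)
 ultimately show "(%t. f (x + t *s v)) field_differentiable at t within A"
  unfolding field_differentiable_def by (auto intro: has_field_derivative_at_within)
qed

text \<open>Along each line the Taylor remainder is quadratic, with a constant that depends only on
  a bound of \<open>f\<close> near the point and hence not on the direction. Homogeneity of
  \<open>D x\<close> is the chain rule on a line; additivity is the real content.\<close>

theorem gateaux_imp_hol:
 fixes f :: "complex ^ 'm => complex"
 assumes "open V" and cont: "continuous_on V f" and G: "gateaux_holomorphic f V"
 shows "hol f V"
proof -
 define D where "D x v = deriv (%t. f (x + t *s v)) 0" for x v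
 have D: "((%t. f (x + t *s v)) has_field_derivative D x v) (at 0)" if "x \<in> V" for x v
  using G that unfolding gateaux_holomorphic_def D_def by (simp add: DERIV_deriv_iff_field_differentiable)
 have hom: "D x (c *s v) = c * D x v" if "x \<in> V" for x c v
 proof -
  have "((%t. f (x + (c * t) *s v)) has_field_derivative D x v * c) (at 0)"
   by (rule DERIV_chain'[where g = "%t. f (x + t *s v)" and f = "%t. c * t"])
    (use D[OF that] in "auto intro!: derivative_eq_intros")
  moreover have "(%t. f (x + (c * t) *s v)) = (%t. f (x + t *s (c *s v)))"
   by (simp add: mult.commute)
  ultimately show ?thesis
   using D[OF that, of "c *s v"] DERIV_unique by (metis mult.commute)
 qed
 show ?thesis
 proof (rule holI[where f' = D])
  fix x assume x: "x \<in> V"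
  obtain R where R: "R > 0" "cball x (2 * R) \<subseteq> V"
   using \<open>open V\<close> x open_contains_cball[of V] by (metis field_sum_of_halves half_gt_zero mult_2)
  have "compact (f ` cball x (2 * R))"
   using cont R(2) by (intro compact_continuous_image) (auto intro: continuous_on_subset)
  then obtain C where C: "\<And>y. y \<in> cball x (2 * R) ==> cmod (f y) \<le> C"
   unfolding compact_eq_bounded_closed bounded_iff by blast
  then have "C \<ge> 0"
   using R by (smt (verit) centre_in_cball norm_ge_zero)
  have T: "x + s *s v + t *s w \<in> cball x (2 * R)" if "cmod s * norm v \<le> R" "cmod t * norm w \<le> R" for s t v w
  proof -
   have "norm (s *s v + t *s w) \<le> 2 * R"
    using that norm_triangle_ineq[of "s *s v" "t *s w"] by (simp add: norm_vector_smult)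
   then show ?thesis by (simp add: dist_norm norm_minus_commute add.commute add.left_commute)
  qed
  have E: "cmod (f (x + v) - f x - D x v) \<le> 32 * C / R\<^sup>2 * (norm v)\<^sup>2" if v: "norm v \<le> R / 2" for v
  proof (cases "v = 0")
   case True
   then show ?thesis
    using hom[OF x, of 0 0] by simp
  next
   case False
   define h where "h t = f (x + t *s v)" for t
   \<comment> \<open>Rescaling the parameter by \<open>norm v\<close> makes the resulting constant
     independent of the direction.\<close>
   define T where "T = R / norm v"
   have "T > 0" using False R by (simp add: T_def)
   have *: "x + t *s v \<in> cball x (2 * R)" if "t \<in> ball 0 T" for t
    using T[of t v 0 0] that False R by (simp add: T_def field_simps)
   have "cmod (h 1 - h 0 - deriv h 0 * 1) \<le> 32 * C / T\<^sup>2 * (cmod 1)\<^sup>2"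
   proof (rule holomorphic_on_quadratic_growth)
    show "h holomorphic_on ball 0 T"
     unfolding h_def using gateaux_holomorphic_line[OF G] * R(2) by blast
   qed (use C * \<open>T > 0\<close> v False in "auto simp: h_def T_def field_simps")
   then show ?thesis
    using False by (simp add: h_def[abs_def] D_def T_def field_simps)
  qed
  \<comment> \<open>The mixed second difference \<open>g\<close> vanishes on both axes, so applying
    the linear growth bound in each variable gives a bound of order \<open>a * b\<close>. The defect
    of additivity, multiplied by \<open>r\<close>, is therefore of order \<open>r^2\<close> and must
    vanish.\<close>
  have add: "D x (v + w) = D x v + D x w" for v w
  proof -
   define T where "T = R / (norm v + norm w + 1)"
   have "T > 0" using R by (simp add: T_def add_nonneg_pos)
   have small: "cmod t * norm v \<le> R" "cmod t * norm w \<le> R" if "cmod t \<le> T" for t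
   proof -
    have "cmod t * (norm v + norm w + 1) \<le> R"
     using that by (simp add: T_def pos_le_divide_eq add_nonneg_pos)
    then have "cmod t * norm v + cmod t * norm w + cmod t \<le> R" by (simp add: distrib_left)
    moreover have "cmod t * norm v \<ge> 0" "cmod t * norm w \<ge> 0" "cmod t \<ge> 0" by auto
    ultimately show "cmod t * norm v \<le> R" "cmod t * norm w \<le> R"
     by linarith+
   qed
   define g where "g a b = f (x + a *s v + b *s w) - f (x + a *s v) - f (x + b *s w) + f x" for a b
   have gb: "cmod (g a b) \<le> 4 * C" if "cmod a \<le> T" "cmod b \<le> T" for a b
   proof -
    have "cmod (f (x + a *s v + b *s w)) \<le> C" "cmod (f (x + a *s v)) \<le> C"
     "cmod (f (x + b *s w)) \<le> C" "cmod (f x) \<le> C"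
     using C T[of a v b w] T[of a v 0 w] T[of 0 v b w] T[of 0 v 0 w] small that R by auto
    then show ?thesis
     unfolding g_def by (smt (verit) norm_triangle_ineq norm_triangle_ineq4)
   qed
   have inV: "x + a *s v + b *s w \<in> V" if "cmod a \<le> T" "cmod b \<le> T" for a b
    using T[of a v b w] small that R by auto
   have lin: "cmod (g a b) \<le> 4 * (4 * C) / T * cmod a" if "cmod a \<le> T / 2" "cmod b \<le> T" for a b
   proof (rule holomorphic_on_linear_growth[where h = "%a. g a b"])
    have "(%a. f ((x + b *s w) + a *s v)) holomorphic_on ball 0 T"
     by (rule gateaux_holomorphic_line[OF G]) (use inV that in \<open>auto simp: add.assoc add.commute[of "b *s w"]\<close>)
    moreover have "(%a. f (x + a *s v)) holomorphic_on ball 0 T"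
     by (rule gateaux_holomorphic_line[OF G]) (use inV[of _ 0] \<open>T > 0\<close> in auto)
    ultimately show "(%a. g a b) holomorphic_on ball 0 T"
     unfolding g_def by (intro holomorphic_intros) (auto simp: add.assoc add.commute[of "b *s w"])
   qed (use gb that \<open>T > 0\<close> in "auto simp: g_def")
   have quad: "cmod (g a b) \<le> 64 * C / T\<^sup>2 * cmod a * cmod b" if "cmod a \<le> T / 2" "cmod b \<le> T / 2" for a b
   proof -
    have "cmod (g a b) \<le> 4 * (4 * (4 * C) / T * cmod a) / T * cmod b"
    proof (rule holomorphic_on_linear_growth[where h = "%b. g a b"])
     have "(%b. f ((x + a *s v) + b *s w)) holomorphic_on ball 0 T"
      by (rule gateaux_holomorphic_line[OF G]) (use inV that \<open>T > 0\<close> in auto)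
     moreover have "(%b. f (x + b *s w)) holomorphic_on ball 0 T"
      by (rule gateaux_holomorphic_line[OF G]) (use inV[of 0] \<open>T > 0\<close> in auto)
     ultimately show "(%b. g a b) holomorphic_on ball 0 T"
      unfolding g_def by (intro holomorphic_intros) auto
    qed (use lin that \<open>T > 0\<close> in "auto simp: g_def")
    then show ?thesis by (simp add: power2_eq_square field_simps)
   qed
   define Del where "Del = D x (v + w) - D x v - D x w"
   define K where "K = 64 * C / T\<^sup>2 + 32 * C / R\<^sup>2 * ((norm (v + w))\<^sup>2 + (norm v)\<^sup>2 + (norm w)\<^sup>2)"
   define T' where "T' = min (T / 2) (R / 2 / (norm v + norm w + 1))"
   have "T' > 0" using \<open>T > 0\<close> R by (simp add: T'_def add_nonneg_pos)
   have bound: "r * cmod Del \<le> K * r\<^sup>2" if r: "0 < r" "r \<le> T'" for r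
   proof -
    let ?t = "complex_of_real r"
    have r1: "r * (norm v + norm w + 1) \<le> R / 2"
    proof -
     have "r \<le> R / 2 / (norm v + norm w + 1)" using r(2) by (simp add: T'_def)
     then show ?thesis by (subst (asm) pos_le_divide_eq) (auto simp: add_nonneg_pos)
    qed
    then have r3: "r * norm v + r * norm w + r \<le> R / 2" by (simp add: algebra_simps)
    moreover have "r * norm v \<ge> 0" "r * norm w \<ge> 0" using r by auto
    moreover have "r * norm (v + w) \<le> r * norm v + r * norm w"
     using r norm_triangle_ineq[of v w] by (simp flip: distrib_left)
    ultimately have r2: "r * norm (v + w) \<le> R / 2" "r * norm v \<le> R / 2" "r * norm w \<le> R / 2"
     using r by linarith+
    have e1: "cmod (f (x + ?t *s u) - f x - ?t * D x u) \<le> 32 * C / R\<^sup>2 * (r\<^sup>2 * (norm u)\<^sup>2)"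
     if "r * norm u \<le> R / 2" for u
     using E[of "?t *s u"] that r by (simp add: norm_vector_smult hom[OF x] power_mult_distrib)
    have e2: "cmod (g ?t ?t) \<le> 64 * C / T\<^sup>2 * r\<^sup>2"
     using quad[of ?t ?t] r by (simp add: T'_def power2_eq_square mult.assoc)
    have "?t * Del = g ?t ?t - (f (x + ?t *s (v + w)) - f x - ?t * D x (v + w))
      + (f (x + ?t *s v) - f x - ?t * D x v) + (f (x + ?t *s w) - f x - ?t * D x w)"
     by (simp add: Del_def g_def vector_add_ldistrib algebra_simps)
    then have "cmod (?t * Del) \<le> 64 * C / T\<^sup>2 * r\<^sup>2 + 32 * C / R\<^sup>2 * (r\<^sup>2 * (norm (v + w))\<^sup>2)
      + 32 * C / R\<^sup>2 * (r\<^sup>2 * (norm v)\<^sup>2) + 32 * C / R\<^sup>2 * (r\<^sup>2 * (norm w)\<^sup>2)"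
     using e2 e1[OF r2(1)] e1[OF r2(2)] e1[OF r2(3)]
     by (smt (verit) norm_triangle_ineq norm_triangle_ineq4)
    then show ?thesis using r by (simp add: K_def norm_mult algebra_simps add_divide_distrib)
   qed
   have "Del = 0"
   proof (rule ccontr)
    assume "Del \<noteq> 0"
    have "K \<ge> 0" using \<open>C \<ge> 0\<close> by (simp add: K_def)
    define r where "r = min T' (cmod Del / (2 * (K + 1)))"
    have "r > 0" using \<open>T' > 0\<close> \<open>Del \<noteq> 0\<close> \<open>K \<ge> 0\<close> by (simp add: r_def)
    then have "cmod Del \<le> K * r"
     using bound[of r] by (simp add: r_def power2_eq_square)
    also have "\<dots> \<le> K * (cmod Del / (2 * (K + 1)))"
     using \<open>K \<ge> 0\<close> by (intro mult_left_mono) (auto simp: r_def)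
    also have "\<dots> < cmod Del"
     using \<open>K \<ge> 0\<close> \<open>Del \<noteq> 0\<close> by (simp add: field_simps add_nonneg_pos)
    finally show False by simp
   qed
   then show ?thesis by (simp add: Del_def diff_diff_eq)
  qed
  have lin: "linear (D x)"
   by (rule linearI) (use add hom[OF x] in "auto simp flip: of_real_smult simp: scaleR_conv_of_real[where 'a = complex]")
  show "(f has_derivative D x) (at x)"
   unfolding has_derivative_at2
  proof (intro conjI)
   show "bounded_linear (D x)" using lin linear_conv_bounded_linear by blast
   have "\<forall>\<^sub>F y in at x. norm ((1 / norm (y - x)) *\<^sub>R (f y - (f x + D x (y - x)))) \<le> 32 * C / R\<^sup>2 * norm (y - x)"
   proof -
    have "\<forall>\<^sub>F y in at x. dist y x < R / 2"
     using R by (auto simp: eventually_at intro!: exI[of _ "R / 2"])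
    then show ?thesis
    proof eventually_elim
     case (elim y)
     then have *: "cmod (f y - (f x + D x (y - x))) \<le> 32 * C / R\<^sup>2 * (norm (y - x))\<^sup>2"
      using E[of "y - x"] by (simp add: dist_norm diff_diff_eq)
     show ?case
     proof (cases "y = x")
      case False
      then show ?thesis
       unfolding norm_scaleR using *
       by (simp add: pos_divide_le_eq power2_eq_square mult.assoc)
     qed simp
    qed
   qed
   moreover have "((%y. 32 * C / R\<^sup>2 * norm (y - x)) \<longlongrightarrow> 0) (at x)"
    by (rule tendsto_mult_right_zero[OF tendsto_norm_zero[OF LIM_zero[OF tendsto_ident_at]]])
   ultimately show "((%y. (1 / norm (y - x)) *\<^sub>R (f y - (f x + D x (y - x)))) \<longlongrightarrow> 0) (at x)"
    by (rule Lim_null_comparison)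
  qed
  show "D x (c *s v) = c * D x v" for c v
   by (rule hom[OF x])
 qed
qed

text \<open>By Osgood's lemma, continuity and differentiability along lines suffice. On a line the
  Leibniz rule asks for a jointly continuous derivative of the integrand; Cauchy's formula supplies
  it by expressing the derivative as an integral of values on a circle.\<close>

lemma holomorphic_integral_param:
 fixes H :: "complex ^ 'm => real => complex"
 assumes V: "open V" and cont: "continuous_on (V \<times> {0..1}) (%(x, theta). H x theta)"
  and hol: "\<And>theta. theta \<in> {0..1} ==> hol (%x. H x theta) V"
 shows "hol (%x. integral {0..1} (H x)) V"
proof (rule gateaux_imp_hol[OF V])
 show "continuous_on V (%x. integral {0..1} (H x))"
  using integral_continuous_on_param[of V 0 1 H] cont by simp
 show "gateaux_holomorphic (%x. integral {0..1} (H x)) V"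
  unfolding gateaux_holomorphic_def
 proof (intro ballI allI)
  fix x v assume x: "x \<in> V"
  have "open {t. x + t *s v \<in> V}" "0 \<in> {t. x + t *s v \<in> V}"
   using open_line_preimage[OF V] x by auto
  then obtain rho where rho: "rho > 0" "ball 0 rho \<subseteq> {t. x + t *s v \<in> V}"
   using open_contains_ball by blast
  define r where "r = rho / 2"
  have r: "r > 0" "cball 0 r \<subseteq> ball 0 rho" using rho by (auto simp: r_def)
  define f where "f t theta = H (x + t *s v) theta" for t theta
  have hol_f: "(%t. f t theta) holomorphic_on ball 0 rho" if "theta \<in> {0..1}" for theta
   unfolding f_def by (rule holomorphic_on_line[OF hol[OF that]]) (use rho in auto)
  have cont_f: "continuous_on (ball 0 rho \<times> {0..1}) (%(t, theta). f t theta)"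
  proof -
   have "continuous_on (ball 0 rho \<times> {0..1}) ((%(x, theta). H x theta) \<circ> (%(t, theta). (x + t *s v, theta)))"
    by (intro continuous_on_compose continuous_on_subset[OF cont])
     (use rho in "auto simp: case_prod_unfold intro!: continuous_intros")
   then show ?thesis by (simp add: o_def case_prod_unfold f_def)
  qed
  define fx where "fx t theta = deriv (%t. f t theta) t" for t theta
  define G where "G p s = f (circlepath 0 r s) (snd p) / (circlepath 0 r s - fst p)\<^sup>2
    * (2 * pi * \<i> * r * exp (2 * of_real pi * \<i> * s))" for p :: "complex \<times> real" and s :: real
  have fx_eq: "fx t theta = integral {0..1} (G (t, theta)) / (2 * pi * \<i>)"
   if "t \<in> ball 0 r" "theta \<in> {0..1}" for t theta
  proof -
   have "contour_integral (circlepath 0 r) (%u. f u theta / (u - t)^2) = (2 * pi * \<i>) * deriv (%t. f t theta) t"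
    by (rule Cauchy_contour_integral_circlepath_2)
     (use holomorphic_on_subset[OF hol_f[OF that(2)] r(2)] that(1)
      holomorphic_on_subset[OF _ ball_subset_cball] in
      \<open>auto intro!: holomorphic_on_imp_continuous_on\<close>)
   then show ?thesis
    by (simp add: fx_def contour_integral_integral vector_derivative_circlepath G_def[abs_def])
  qed
  have "continuous_on ((ball 0 r \<times> {0..1}) \<times> {0..1::real}) (%(p, s). G p s)"
  proof -
   have "continuous_on ((ball 0 r \<times> {0..1}) \<times> {0..1::real})
     ((%(t, theta). f t theta) \<circ> (%(p, s). (circlepath 0 r s, snd p)))"
    by (intro continuous_on_compose continuous_on_subset[OF cont_f])
     (use r rho in "auto simp: case_prod_unfold circlepath norm_mult r_def intro!: continuous_intros")
   moreover have "circlepath 0 r s \<noteq> t" if "t \<in> ball 0 r" for s t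
    using that r by (auto simp: circlepath norm_mult)
   ultimately show ?thesis
    unfolding G_def case_prod_unfold o_def
    by (intro continuous_intros) (auto simp: circlepath intro!: continuous_intros)
  qed
  then have "continuous_on (ball 0 r \<times> {0..1}) (%p. integral {0..1} (G p))"
   using integral_continuous_on_param[of "ball 0 r \<times> {0..1}" 0 1 G] by simp
  then have "continuous_on (ball 0 r \<times> {0..1}) (%p. integral {0..1} (G p) / (2 * pi * \<i>))"
   by (intro continuous_intros) auto
  then have "continuous_on (ball 0 r \<times> {0..1}) (%(t, theta). fx t theta)"
   by (rule continuous_on_eq) (auto simp: fx_eq)
  then have cont_fx: "continuous_on (ball 0 r \<times> cbox 0 1) (%(t, theta). fx t theta)"
   by simp
  have "(%t. integral (cbox 0 1) (f t)) holomorphic_on ball 0 r"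
  proof (rule leibniz_rule_holomorphic[OF _ _ cont_fx])
   fix t theta assume t: "t \<in> ball (0::complex) r" "theta \<in> cbox (0::real) 1"
   then have "theta \<in> {0..1}" "t \<in> ball 0 rho"
    using subsetD[OF r(2), of t] by auto
   then have "((%t. f t theta) has_field_derivative fx t theta) (at t)"
    unfolding fx_def using holomorphic_derivI[OF hol_f open_ball] by blast
   then show "((%t. f t theta) has_field_derivative fx t theta) (at t within ball 0 r)"
    by (rule has_field_derivative_at_within)
  next
   fix t assume "t \<in> ball (0::complex) r"
   then have "t \<in> ball 0 rho" using r(2) ball_subset_cball by blast
   then have "continuous_on {0..1} ((%(t, theta). f t theta) \<circ> Pair t)"
    by (intro continuous_on_compose continuous_on_subset[OF cont_f] continuous_intros) auto
   then have "continuous_on (cbox 0 1) (f t)" by (simp add: o_def)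
   then show "f t integrable_on cbox 0 1"
    by (rule integrable_continuous)
  qed auto
  then have "(%t. integral {0..1} (f t)) field_differentiable at 0"
   using holomorphic_on_imp_differentiable_at[OF _ open_ball] r(1) by simp
  then show "(%t. integral {0..1} (H (x + t *s v))) field_differentiable at 0"
   unfolding f_def .
 qed
qed

lemma holomorphic_contour_param:
 fixes G :: "complex ^ 'm => complex => complex"
 assumes "open V" "r > 0" and cont: "continuous_on (V \<times> sphere c r) (%(x, w). G x w)"
  and hol: "\<And>w. w \<in> sphere c r ==> hol (%x. G x w) V"
 shows "hol (%x. contour_integral (circlepath c r) (G x)) V"
proof -
 have cp: "circlepath c r s \<in> sphere c r" for s
  using \<open>r > 0\<close> by (simp add: circlepath dist_norm norm_mult)
 have "hol (%x. integral {0..1} (%s. G x (circlepath c r s) *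
   (2 * pi * \<i> * r * exp (2 * of_real pi * \<i> * s)))) V"
 proof (rule holomorphic_integral_param[OF \<open>open V\<close>])
  have "continuous_on (V \<times> {0..1}) ((%(x, w). G x w) \<circ> (%(x, s). (x, circlepath c r s)))"
   by (intro continuous_on_compose continuous_on_subset[OF cont])
    (use cp in "auto simp: case_prod_unfold circlepath[abs_def] intro!: continuous_intros")
  then show "continuous_on (V \<times> {0..1}) (%(x, s). G x (circlepath c r s) *
   (2 * pi * \<i> * r * exp (2 * of_real pi * \<i> * s)))"
   by (auto simp: case_prod_unfold o_def intro!: continuous_intros)
  show "hol (%x. G x (circlepath c r theta) *
   (2 * pi * \<i> * r * exp (2 * of_real pi * \<i> * theta))) V" for theta
   by (intro hol_mult hol_const hol cp)
 qed
 then show ?thesis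
  by (simp add: contour_integral_integral vector_derivative_circlepath)
qed

text \<open>The compact image of \<open>K\<close> has positive distance from the complement of
  \<open>U\<close>, and moving the base point displaces the whole image by the same vector.\<close>

lemma compact_line_tube:
 fixes x0 v :: "complex ^ 'm"
 assumes "compact K" "open U" "\<And>t. t \<in> K ==> x0 + t *s v \<in> U"
 shows "\<exists>e>0. \<forall>x\<in>ball x0 e. \<forall>t\<in>K. x + t *s v \<in> U"
proof (cases "K = {}")
 case True
 then show ?thesis by (auto intro: exI[of _ 1])
next
 case False
 let ?A = "(%t. x0 + t *s v) ` K"
 have "compact ?A"
  by (intro compact_continuous_image assms(1) continuous_intros)
 then obtain e where e: "e > 0" "{x. infdist x ?A \<le> e} \<subseteq> U"
  using compact_in_open_separated[of ?A U] False assms by auto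
 show ?thesis
 proof (intro exI[of _ e] conjI ballI e(1))
  fix x t assume xt: "x \<in> ball x0 e" "t \<in> K"
  have "infdist (x + t *s v) ?A \<le> dist (x + t *s v) (x0 + t *s v)"
   using xt by (intro infdist_le) auto
  also have "\<dots> \<le> e" using xt by (simp add: dist_commute)
  finally show "x + t *s v \<in> U" using e(2) by auto
 qed
qed

text \<open>Cauchy's formula on a small circle in the direction \<open>v\<close> writes the
  derivative as a contour integral with parameter \<open>x\<close>.\<close>

lemma hol_fd:
 assumes hol: "hol f V" and V: "open V"
 shows "hol (%x. fd f x v) V"
proof (rule hol_local)
 fix x0 assume "x0 \<in> V"
 have "open {t. x0 + t *s v \<in> V}" "0 \<in> {t. x0 + t *s v \<in> V}"
  using open_line_preimage[OF V] \<open>x0 \<in> V\<close> by auto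
 then obtain r where r: "r > 0" "cball 0 r \<subseteq> {t. x0 + t *s v \<in> V}"
  using open_contains_cball by blast
 obtain e where "e > 0" "\<forall>x\<in>ball x0 e. \<forall>t\<in>cball 0 r. x + t *s v \<in> V"
  using compact_line_tube[OF compact_cball V, of 0 r x0 v] r(2) by blast
 then have e: "e > 0" "\<And>x t. x \<in> ball x0 e ==> t \<in> cball 0 r ==> x + t *s v \<in> V"
  by blast+
 have "hol (%x. contour_integral (circlepath 0 r) (%w. f (x + w *s v) / (w - 0)^2) / (2 * pi * \<i>)) (ball x0 e)"
 proof (intro hol_divide hol_const holomorphic_contour_param)
  have "continuous_on (ball x0 e \<times> sphere 0 r) (%p. f (fst p + snd p *s v))"
   by (rule continuous_on_compose2[OF hol_continuous_on[OF hol]])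
    (use e in "auto intro!: continuous_intros")
  then show "continuous_on (ball x0 e \<times> sphere 0 r) (%(x, w). f (x + w *s v) / (w - 0)^2)"
   using r(1) by (auto simp: case_prod_unfold intro!: continuous_intros)
  fix w :: complex assume w: "w \<in> sphere 0 r"
  show "hol (%x. f (x + w *s v)) (ball x0 e)"
   by (rule hol_compose[OF hol])
    (use e w in "auto simp: holomorphic_map_def intro!: hol_add hol_nth hol_const")
  show "(w - 0)\<^sup>2 \<noteq> 0" using w r(1) by auto
 qed (use r in auto)
 moreover have "contour_integral (circlepath 0 r) (%w. f (x + w *s v) / (w - 0)^2) / (2 * pi * \<i>) = fd f x v"
  if x: "x \<in> ball x0 e" for x
 proof -
  have xV: "x \<in> V" using e(2)[OF x, of 0] r(1) by simp
  have "contour_integral (circlepath 0 r) (%w. f (x + w *s v) / (w - 0)^2)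
    = (2 * pi * \<i>) * deriv (%t. f (x + t *s v)) 0"
   by (rule Cauchy_contour_integral_circlepath_2)
    (use holomorphic_on_line[OF hol, of "cball 0 r" x v] e(2)[OF x] r(1) in
     \<open>auto intro: holomorphic_on_imp_continuous_on holomorphic_on_subset\<close>)
  also have "deriv (%t. f (x + t *s v)) 0 = fd f x v"
   using hol_line[OF hol, of x 0 v] xV by (auto intro!: DERIV_imp_deriv)
  finally show ?thesis by simp
 qed
 ultimately have "hol (%x. fd f x v) (ball x0 e)"
  using hol_transform by (metis (no_types, lifting) open_ball)
 then show "\<exists>W. x0 \<in> W \<and> hol (%x. fd f x v) W"
  using e(1) by (intro exI[of _ "ball x0 e"]) auto
qed

section \<open>Zero sets and removable singularities\<close>

lemma holomorphic_on_zeros_finite: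
 assumes "f holomorphic_on S" "open S" "connected S" "b \<in> S" "f b \<noteq> 0" "compact K" "K \<subseteq> S"
 shows "finite {z\<in>K. f z = 0}"
proof (cases "f constant_on S")
 case True
 then obtain c where "\<And>z. z \<in> S ==> f z = c" unfolding constant_on_def by blast
 with assms(4,5,7) have "{z\<in>K. f z = 0} = {}" by auto
 then show ?thesis by (simp only: finite.emptyI)
qed (use assms holomorphic_compact_finite_zeros in blast)

lemma holomorphic_on_isolated_zero:
 assumes "f holomorphic_on S" "open S" "connected S" "b \<in> S" "f b \<noteq> 0" "a \<in> S"
 shows "\<exists>r>0. ball a r \<subseteq> S \<and> (\<forall>t\<in>ball a r - {a}. f t \<noteq> 0)"
proof (cases "f a = 0")
 case True
 show ?thesis
  by (rule isolated_zeros[OF assms(1-3) assms(6) True assms(4,5)]) blast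
next
 case False
 have "open {t\<in>S. f t \<noteq> 0}"
  using continuous_open_preimage[OF holomorphic_on_imp_continuous_on[OF assms(1)] assms(2), of "-{0}"]
  by (simp add: vimage_def Int_def open_delete Compl_eq_Diff_UNIV)
 then obtain r where "r > 0" "ball a r \<subseteq> {t\<in>S. f t \<noteq> 0}"
  using False assms(6) open_contains_ball by blast
 then show ?thesis by blast
qed

lemma open_nonzero: "hol f V ==> open V ==> open {x\<in>V. f x \<noteq> 0}"
 using continuous_open_preimage[OF hol_continuous_on, of f V "-{0}"]
 by (simp add: vimage_def Int_def open_delete Compl_eq_Diff_UNIV)

lemma hol_isolated_line:
 assumes "hol f V" "open V" "convex V" "y \<in> V" "f y \<noteq> 0" "x \<in> V"
 shows "\<exists>r>0. (\<forall>t\<in>ball 0 r. x + t *s (y - x) \<in> V) \<and>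
  (\<forall>t\<in>ball 0 r - {0}. f (x + t *s (y - x)) \<noteq> 0)"
proof -
 let ?S = "{t. x + t *s (y - x) \<in> V}"
 have "(%t. f (x + t *s (y - x))) holomorphic_on ?S"
  by (rule holomorphic_on_line[OF assms(1)]) auto
 moreover have "open ?S" "connected ?S"
  by (rule open_line_preimage[OF assms(2)], rule convex_connected[OF convex_line_preimage[OF assms(3)]])
 moreover have "1 \<in> ?S" "f (x + 1 *s (y - x)) \<noteq> 0" "0 \<in> ?S"
  using assms by auto
 ultimately have "\<exists>r>0. ball 0 r \<subseteq> ?S \<and> (\<forall>t\<in>ball 0 r - {0}. f (x + t *s (y - x)) \<noteq> 0)"
  by (rule holomorphic_on_isolated_zero)
 then show ?thesis by blast
qed

text \<open>On the line from \<open>x\<close> to \<open>y\<close> the zeros are isolated, so nonzero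
  values occur arbitrarily close to \<open>x\<close>.\<close>

lemma nonzero_dense:
 assumes "hol f V" "open V" "convex V" "y \<in> V" "f y \<noteq> 0" "x \<in> V"
  and "open U" "x \<in> U"
 shows "\<exists>z\<in>U \<inter> V. f z \<noteq> 0"
proof -
 obtain r where r: "r > 0" "\<And>t. t \<in> ball 0 r ==> x + t *s (y - x) \<in> V"
  "\<And>t. t \<in> ball 0 r - {0} ==> f (x + t *s (y - x)) \<noteq> 0"
  using hol_isolated_line[OF assms(1-6)] by blast
 have "open {t. x + t *s (y - x) \<in> U}" "0 \<in> {t. x + t *s (y - x) \<in> U}"
  by (rule open_line_preimage[OF assms(7)], use assms(8) in simp)
 then obtain r' where r': "r' > 0" "ball 0 r' \<subseteq> {t. x + t *s (y - x) \<in> U}"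
  using open_contains_ball by blast
 define t where "t = complex_of_real (min r r' / 2)"
 have t: "t \<in> ball 0 r - {0}" "t \<in> ball 0 r'"
  using r(1) r'(1) by (auto simp: t_def min_def)
 have "x + t *s (y - x) \<in> U" "x + t *s (y - x) \<in> V" "f (x + t *s (y - x)) \<noteq> 0"
  using r(2)[of t] r(3)[OF t(1)] t r'(2) by blast+
 then show ?thesis by blast
qed

text \<open>Two points are joined inside the complex line through them: there the zeros are
  countable, and a connected open subset of the plane stays connected when countably many points are
  removed.\<close>

lemma connected_nonzero:
 assumes "hol f V" "open V" "convex V"
 shows "connected {x\<in>V. f x \<noteq> 0}"
proof (subst connected_iff_connected_component, intro ballI)
 fix x y assume x: "x \<in> {x\<in>V. f x \<noteq> 0}" and y: "y \<in> {x\<in>V. f x \<noteq> 0}"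
 let ?S = "{t. x + t *s (y - x) \<in> V}"
 let ?g = "%t. f (x + t *s (y - x))"
 have hol: "?g holomorphic_on ?S"
  by (rule holomorphic_on_line[OF assms(1)]) auto
 have S: "open ?S" "connected ?S"
  by (rule open_line_preimage[OF assms(2)], rule convex_connected[OF convex_line_preimage[OF assms(3)]])
 have "countable {t\<in>?S. ?g t = 0}"
 proof (cases "?g constant_on ?S")
  case True
  then obtain c where c: "\<And>t. t \<in> ?S ==> ?g t = c" unfolding constant_on_def by blast
  have "0 \<in> ?S" "?g 0 \<noteq> 0" using x by auto
  then have "c \<noteq> 0" using c[of 0] by metis
  then have "{t\<in>?S. ?g t = 0} = {}" using c by blast
  then show ?thesis using countable_empty by metis
 next
  case False
  have "fsigma ?S"
  proof (rule open_Union_compact_subsets[OF S(1)])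
   fix C :: "nat => complex set"
   assume C: "\<And>n. compact (C n)" "\<Union> (range C) = ?S"
   then show "fsigma ?S"
    unfolding fsigma_Union_compact C(2)[symmetric] by (intro exI[of _ C]) auto
  qed
  then show ?thesis
   by (rule holomorphic_countable_zeros[OF hol S _ False])
 qed
 then have "connected (?S - {t\<in>?S. ?g t = 0})"
  by (intro connected_open_diff_countable) (use S in auto)
 then have conn: "connected ((%t. x + t *s (y - x)) ` (?S - {t\<in>?S. ?g t = 0}))"
  by (rule connected_continuous_image[rotated]) (intro continuous_intros)
 show "connected_component {x\<in>V. f x \<noteq> 0} x y"
  unfolding connected_component_def
 proof (intro exI conjI)
  show "x \<in> (%t. x + t *s (y - x)) ` (?S - {t\<in>?S. ?g t = 0})"
   using x by (intro image_eqI[where x = 0]) auto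
  show "y \<in> (%t. x + t *s (y - x)) ` (?S - {t\<in>?S. ?g t = 0})"
   using y by (intro image_eqI[where x = 1]) auto
 qed (use conn in auto)
qed

text \<open>Choose a direction \<open>v\<close> in which \<open>disc\<close> is nonzero on a
  punctured disc about \<open>x0\<close>. Circles in this direction avoid the zeros also for nearby
  base points, so the Cauchy integral over them is holomorphic in \<open>x\<close>; on each line it
  reproduces \<open>g\<close>, whose finitely many singularities there are removable by
  boundedness.\<close>

theorem riemann_extension:
 fixes g :: "complex ^ 'm => complex"
 assumes disc: "hol disc V" and V: "open V" "convex V" and y: "y \<in> V" "disc y \<noteq> 0"
  and g: "hol g {x\<in>V. disc x \<noteq> 0}"
  and B: "\<And>x. x \<in> V ==> disc x \<noteq> 0 ==> cmod (g x) \<le> B"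
  and x0: "x0 \<in> V"
 shows "\<exists>e>0. \<exists>g'. ball x0 e \<subseteq> V \<and> hol g' (ball x0 e) \<and>
  (\<forall>x\<in>ball x0 e. disc x \<noteq> 0 --> g' x = g x)"
proof -
 define v where "v = y - x0"
 obtain rho where rho: "rho > 0" "\<And>t. t \<in> ball 0 rho ==> x0 + t *s v \<in> V"
  "\<And>t. t \<in> ball 0 rho - {0} ==> disc (x0 + t *s v) \<noteq> 0"
  using hol_isolated_line[OF disc V y x0, folded v_def] by blast
 \<comment> \<open>A third leaves room beyond the circle of radius \<open>r\<close>: zeros are
   counted in a disc of radius \<open>3 / 2 * r\<close> inside one of radius
   \<open>2 * r\<close>.\<close>
 define r where "r = rho / 3"
 have r: "r > 0" "cball 0 (2 * r) \<subseteq> ball 0 rho" "sphere 0 r \<subseteq> ball 0 rho - {0}"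
  using rho(1) by (auto simp: r_def)
 have "x0 + t *s v \<in> V" if "t \<in> cball 0 (2 * r)" for t
  using rho(2) that r(2) by blast
 from compact_line_tube[OF compact_cball V(1) this]
 obtain e1 where e1: "e1 > 0" "\<And>x t. x \<in> ball x0 e1 ==> t \<in> cball 0 (2 * r) ==> x + t *s v \<in> V"
  by blast
 have "x0 + t *s v \<in> {x\<in>V. disc x \<noteq> 0}" if "t \<in> sphere 0 r" for t
  using rho(2,3) that r(3) by blast
 from compact_line_tube[OF compact_sphere open_nonzero[OF disc V(1)] this]
 obtain e2 where e2: "e2 > 0" "\<And>x t. x \<in> ball x0 e2 ==> t \<in> sphere 0 r ==> x + t *s v \<in> {x\<in>V. disc x \<noteq> 0}"
  by blast
 define e where "e = min e1 e2"
 have "e > 0" using e1 e2 by (simp add: e_def)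
 define g' where "g' x = contour_integral (circlepath 0 r) (%w. g (x + w *s v) / w) / (2 * pi * \<i>)" for x
 have hol: "hol g' (ball x0 e)"
  unfolding g'_def
 proof (intro hol_divide hol_const holomorphic_contour_param)
  have "continuous_on (ball x0 e \<times> sphere 0 r) (%p. g (fst p + snd p *s v))"
   by (rule continuous_on_compose2[OF hol_continuous_on[OF g]])
    (use e2(2) in "auto simp: e_def intro!: continuous_intros")
  then show "continuous_on (ball x0 e \<times> sphere 0 r) (%(x, w). g (x + w *s v) / w)"
   using r(1) by (auto simp: case_prod_unfold intro!: continuous_intros)
  fix w :: complex assume w: "w \<in> sphere 0 r"
  show "hol (%x. g (x + w *s v)) (ball x0 e)"
   by (rule hol_compose[OF g])
    (use e2(2) w in "auto simp: e_def holomorphic_map_def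
     intro!: hol_add hol_nth hol_const")
  show "w \<noteq> 0" using w r(1) by auto
 qed (use r in auto)
 have eq: "g' x = g x" if x: "x \<in> ball x0 e" "disc x \<noteq> 0" for x
 proof -
  define h where "h t = g (x + t *s v)" for t
  define S where "S = ball (0::complex) (2 * r)"
  define Z where "Z = {t\<in>cball 0 (3 / 2 * r). disc (x + t *s v) = 0}"
  have xV: "x + t *s v \<in> V" if "t \<in> S" for t
   using e1(2)[of x t] x that by (auto simp: e_def S_def)
  have holdisc: "(%t. disc (x + t *s v)) holomorphic_on S"
   by (rule holomorphic_on_line[OF disc xV])
  have fin: "finite Z"
   unfolding Z_def
   by (rule holomorphic_on_zeros_finite[OF holdisc, where b = 0])
    (use x r in "auto simp: S_def")
  define S' where "S' = ball (0::complex) (3 / 2 * r)"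
  have S'S: "S' \<subseteq> S" using r by (auto simp: S'_def S_def)
  define Z' where "Z' = Z \<inter> S'"
  have "\<exists>k. k holomorphic_on S' \<and> (\<forall>z\<in>S' - Z'. k z = h z)"
  proof (rule removable_singularities)
   show "finite Z'" using fin by (simp add: Z'_def)
   show "Z' \<subseteq> interior S'" by (auto simp: Z'_def S'_def interior_open)
   have nz: "disc (x + t *s v) \<noteq> 0" if "t \<in> S' - Z'" for t
    using that by (auto simp: Z'_def Z_def S'_def)
   show "h holomorphic_on (S' - Z')"
    unfolding h_def by (rule holomorphic_on_line[OF g]) (use nz xV S'S in auto)
   fix z assume z: "z \<in> Z'"
   have "open (S' - (Z' - {z}))" "z \<in> S' - (Z' - {z})"
    using \<open>finite Z'\<close> z by (auto simp: S'_def Z'_def intro!: open_Diff finite_imp_closed)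
   then have "\<forall>\<^sub>F t in at z. t \<in> S' - (Z' - {z}) - {z}"
    using eventually_at_in_open by blast
   then have "\<forall>\<^sub>F t in at z. norm (h t) \<le> B * norm (1::real)"
   proof eventually_elim
    case (elim t)
    then have "t \<in> S' - Z'" by auto
    then show ?case using B[of "x + t *s v"] nz xV S'S unfolding h_def by auto
   qed
   then show "h \<in> O[at z](%_. 1)"
    by (intro bigoI[where c = B]) auto
  qed
  then obtain k where k: "k holomorphic_on S'" "\<And>z. z \<in> S' - Z' ==> k z = h z" by blast
  have nzs: "t \<in> S' - Z'" if "t \<in> sphere 0 r" for t
   using e2(2)[of x t] x that r(1) by (auto simp: e_def S'_def Z'_def Z_def)
  have "contour_integral (circlepath 0 r) (%w. h w / w) = contour_integral (circlepath 0 r) (%w. k w / (w - 0))"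
   by (rule contour_integral_cong) (use k(2) nzs r(1) in "auto simp: path_image_circlepath")
  also have "\<dots> = 2 * of_real pi * \<i> * k 0"
  proof (rule contour_integral_unique, rule Cauchy_integral_circlepath)
   have "cball 0 r \<subseteq> S'" using r(1) by (auto simp: S'_def)
   then have "k holomorphic_on cball 0 r" using k(1) holomorphic_on_subset by blast
   then show "continuous_on (cball 0 r) k" "k holomorphic_on ball 0 r"
    using holomorphic_on_imp_continuous_on holomorphic_on_subset ball_subset_cball by blast+
  qed (use r(1) in simp)
  also have "k 0 = h 0"
   using k(2)[of 0] x r(1) by (auto simp: S'_def Z'_def Z_def)
  finally show ?thesis by (simp add: g'_def h_def)
 qed
 have sub: "ball x0 e \<subseteq> V"
  using e1(2)[of _ 0] r(1) by (auto simp: e_def)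
 show ?thesis
  by (intro exI[of _ e] exI[of _ g'] conjI \<open>e > 0\<close> sub hol ballI impI eq)
qed

section \<open>Roots in one coordinate and their traces\<close>

definition upd :: "complex ^ 'm => 'm => complex => complex ^ 'm" where
 "upd x i w = (\<chi> j. if j = i then w else x $ j)"

lemma upd_nth [simp]: "upd x i w $ j = (if j = i then w else x $ j)"
 by (simp add: upd_def)

lemma upd_triv [simp]: "upd x i (x $ i) = x"
 by (simp add: vec_eq_iff)

lemma upd_line: "upd x i w = upd x i 0 + w *s axis i 1"
 by (simp add: vec_eq_iff axis_def)

lemma upd_0 [simp]: "upd 0 i w = axis i w"
 by (simp add: vec_eq_iff axis_def)

lemma continuous_on_upd [continuous_intros]:
 assumes "continuous_on A f" "continuous_on A g"
 shows "continuous_on A (%t. upd (f t) i (g t))"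
 unfolding upd_def
proof (rule continuous_on_vec_lambda)
 fix j show "continuous_on A (%t. if j = i then g t else f t $ j)"
  using assms by (cases "j = i") (auto intro: continuous_on_component)
qed

lemma holomorphic_map_upd: "holomorphic_map (%x. upd x i w) V"
 unfolding holomorphic_map_def
proof
 fix j show "hol (%x. upd x i w $ j) V"
  by (cases "j = i") (auto intro: hol_const hol_nth)
qed

lemma open_upd_preimage: "open V ==> open {w. upd x i w \<in> V}"
 by (subst upd_line) (rule open_line_preimage)

lemma holomorphic_on_upd:
 assumes "hol f V" "\<And>w. w \<in> A ==> upd x i w \<in> V"
 shows "(%w. f (upd x i w)) holomorphic_on A"
 by (subst upd_line, rule holomorphic_on_line[OF assms(1)]) (metis assms(2) upd_line)

lemma deriv_upd:
 assumes "hol f V" "upd x i w \<in> V"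
 shows "((%w. f (upd x i w)) has_field_derivative fd f (upd x i w) (axis i 1)) (at w)"
 using hol_line[OF assms(1), of "upd x i 0" w "axis i 1"] assms(2)
 by (simp flip: upd_line)

text \<open>Zeros are repeated according to their order. \<open>zorder\<close> is integer valued,
  but positive at the zeros under consideration, so \<open>nat\<close> loses nothing there.\<close>

definition root_mset :: "(complex => complex) => complex => real => complex multiset" where
 "root_mset f c r = (\<Sum>w\<in>{w\<in>ball c r. f w = 0}. replicate_mset (nat (zorder f w)) w)"

lemma sum_mset_image_sum:
 "finite Z ==> (\<Sum>w\<in>#(\<Sum>z\<in>Z. g z). h w) = (\<Sum>z\<in>Z. \<Sum>w\<in>#g z. (h w :: complex))"
 by (induction Z rule: finite_induct) auto

lemma set_mset_sum: "finite Z ==> set_mset (\<Sum>z\<in>Z. g z) = (\<Union>z\<in>Z. set_mset (g z))"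
 by (induction Z rule: finite_induct) auto

lemma zorder_pos_disc:
 assumes "f holomorphic_on S" "open S" "connected S" "b \<in> S" "f b \<noteq> 0" "a \<in> S" "f a = 0"
 shows "zorder f a > 0"
proof -
 have "f analytic_on {a}" using assms analytic_at by blast
 moreover have "\<exists>\<^sub>F w in at a. f w \<noteq> 0"
 proof -
  obtain r where "r > 0" "ball a r \<subseteq> S" "\<forall>t\<in>ball a r - {a}. f t \<noteq> 0"
   using holomorphic_on_isolated_zero[OF assms(1-6)] by blast
  then have "\<forall>\<^sub>F w in at a. f w \<noteq> 0"
   by (auto simp: eventually_at dist_commute intro!: exI[of _ r])
  then show ?thesis by (rule eventually_frequently[rotated]) simp
 qed
 ultimately show ?thesis
  using zorder_pos_iff' assms(7) by blast
qed

text \<open>The argument principle with weight \<open>h\<close> turns sums over the roots into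
  contour integrals over a fixed circle. This is the source of all holomorphic dependence of roots
  on parameters.\<close>

lemma root_mset_props:
 assumes f: "f holomorphic_on S" and S: "open S" "cball c r \<subseteq> S" "r > 0"
  and nz: "\<And>w. w \<in> sphere c r ==> f w \<noteq> 0"
 shows "finite {w\<in>ball c r. f w = 0}"
  and "set_mset (root_mset f c r) = {w\<in>ball c r. f w = 0}"
  and "\<And>h. h holomorphic_on S ==> (\<Sum>w\<in>#root_mset f c r. h w) =
      contour_integral (circlepath c r) (%w. deriv f w * h w / f w) / (2 * pi * \<i>)"
  and "\<And>w. w \<in> ball c r ==> f w = 0 ==> zorder f w > 0"
proof -
 \<comment> \<open>The closed disc is enlarged to a concentric open disc inside \<open>S\<close>;
   being connected, it contains only finitely many zeros in each compact part.\<close>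
 obtain e where e: "e > 0" "{x. infdist x (cball c r) \<le> e} \<subseteq> S"
  using compact_in_open_separated[of "cball c r" S] S by auto
 define S' where "S' = ball c (r + e)"
 have S'S: "S' \<subseteq> S"
 proof
  fix x assume x: "x \<in> S'"
  show "x \<in> S"
  proof (cases "x \<in> cball c r")
   case False
   define p where "p = c + (r / dist x c) *\<^sub>R (x - c)"
   have d: "dist x c > 0" "dist x c > r" using False S(3) by (auto simp: dist_commute)
   have "p \<in> cball c r" using d S(3) by (simp add: p_def dist_norm)
   then have "infdist x (cball c r) \<le> dist x p" by (rule infdist_le)
   also have "x - p = (1 - r / dist x c) *\<^sub>R (x - c)" by (simp add: p_def algebra_simps)
   then have "dist x p = \<bar>1 - r / dist x c\<bar> * dist x c" by (simp add: dist_norm)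
   also have "\<dots> = dist x c - r" using d S(3) by (simp add: field_simps)
   also have "\<dots> \<le> e" using x by (simp add: S'_def dist_commute)
   finally show ?thesis using e(2) by blast
  qed (use S in blast)
 qed
 have f': "f holomorphic_on S'" using f S'S holomorphic_on_subset by blast
 obtain b where b: "b \<in> sphere c r" using S(3) by (metis sphere_eq_empty equals0I less_le_not_le)
 have bS: "b \<in> S'" "f b \<noteq> 0" using b nz[OF b] e(1) by (auto simp: S'_def)
 have conn: "open S'" "connected S'" by (auto simp: S'_def)
 have finK: "finite {w\<in>cball c (r + e / 2). f w = 0}"
  using e(1) by (intro holomorphic_on_zeros_finite[OF f' conn bS]) (auto simp: S'_def)
 then show fin: "finite {w\<in>ball c r. f w = 0}"
  by (rule rev_finite_subset) (use e(1) in auto)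
 show pos: "\<And>w. w \<in> ball c r ==> f w = 0 ==> zorder f w > 0"
  by (rule zorder_pos_disc[OF f' conn bS]) (use e(1) in "auto simp: S'_def")
 show "set_mset (root_mset f c r) = {w\<in>ball c r. f w = 0}"
  unfolding root_mset_def set_mset_sum[OF fin] using pos by (force split: if_splits)
 define T where "T = ball c (r + e / 2)"
 have TS': "T \<subseteq> S'" using e(1) by (auto simp: T_def S'_def)
 fix h assume h: "h holomorphic_on S"
 define pz where "pz = {w\<in>T. f w = 0 \<or> w \<in> {}}"
 have finpz: "finite pz"
  using finK by (rule rev_finite_subset) (auto simp: pz_def T_def)
 have "contour_integral (circlepath c r) (%x. deriv f x * h x / f x) =
   2 * pi * \<i> * (\<Sum>p\<in>pz. winding_number (circlepath c r) p * h p * zorder f p)"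
  unfolding pz_def
 proof (rule argument_principle)
  show "f holomorphic_on T - {}" using f' TS' holomorphic_on_subset by auto
  show "h holomorphic_on T" using h TS' S'S holomorphic_on_subset by blast
  show "path_image (circlepath c r) \<subseteq> T - {w \<in> T. f w = 0 \<or> w \<in> {}}"
   using nz e(1) S(3) by (auto simp: path_image_circlepath T_def)
  show "\<forall>z. z \<notin> T --> winding_number (circlepath c r) z = 0"
   using e(1) S(3) by (auto simp: T_def dist_norm norm_minus_commute intro!: winding_number_zero_outside[of _ "cball c r"]
    simp: path_image_circlepath)
  show "finite {w \<in> T. f w = 0 \<or> w \<in> {}}" using finpz by (simp add: pz_def)
 qed (auto simp: T_def)
 also have "(\<Sum>p\<in>pz. winding_number (circlepath c r) p * h p * zorder f p) =
   (\<Sum>p\<in>{w\<in>ball c r. f w = 0}. h p * zorder f p)"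
 proof (rule sum.mono_neutral_cong_right[OF finpz])
  show "{w \<in> ball c r. f w = 0} \<subseteq> pz" using e(1) by (auto simp: pz_def T_def)
  show "\<forall>i\<in>pz - {w \<in> ball c r. f w = 0}. winding_number (circlepath c r) i * h i * zorder f i = 0"
  proof
   fix p assume p: "p \<in> pz - {w \<in> ball c r. f w = 0}"
   then have "p \<notin> ball c r" "f p = 0" by (auto simp: pz_def)
   then have "p \<notin> cball c r" using nz[of p] by (auto simp: less_le)
   then have "winding_number (circlepath c r) p = 0"
    by (intro winding_number_zero_outside[of _ "cball c r"]) (use S(3) in "auto simp: path_image_circlepath")
   then show "winding_number (circlepath c r) p * h p * zorder f p = 0" by simp
  qed
  fix p assume "p \<in> {w \<in> ball c r. f w = 0}"
  then have "winding_number (circlepath c r) p = 1"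
   by (intro winding_number_circlepath) (simp add: dist_norm norm_minus_commute)
  then show "winding_number (circlepath c r) p * h p * zorder f p = h p * zorder f p" by simp
 qed
 also have "\<dots> = (\<Sum>w\<in>#root_mset f c r. h w)"
  unfolding root_mset_def sum_mset_image_sum[OF fin]
  by (rule sum.cong[OF refl]) (use pos in "auto simp: less_imp_le mult.commute")
 finally show "(\<Sum>w\<in>#root_mset f c r. h w) =
   contour_integral (circlepath c r) (%w. deriv f w * h w / f w) / (2 * pi * \<i>)"
  by simp
qed

text \<open>The circle of integration is the same for all \<open>x\<close> and carries no zeros of
  \<open>f\<close>, so the integrand of the trace is holomorphic in \<open>x\<close>.\<close>

theorem hol_trace:
 assumes f: "hol f V" and q: "hol q V" and V: "open V" and W: "open W"
  and r: "r > 0" and sub: "\<And>x w. x \<in> W ==> w \<in> cball c r ==> upd x i w \<in> V"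
  and nz: "\<And>x w. x \<in> W ==> w \<in> sphere c r ==> f (upd x i w) \<noteq> 0"
 shows "hol (%x. \<Sum>w\<in>#root_mset (%w. f (upd x i w)) c r. q (upd x i w)) W"
proof -
 let ?G = "%x w. fd f (upd x i w) (axis i 1) * q (upd x i w) / f (upd x i w)"
 have comp: "continuous_on (W \<times> sphere c r) (%p. g (upd (fst p) i (snd p)))"
  if "hol g V" for g
  by (rule continuous_on_compose2[OF hol_continuous_on[OF that]])
   (use sub in "auto intro!: continuous_intros")
 have hcomp: "hol (%x. g (upd x i w)) W" if "hol g V" "w \<in> sphere c r" for g w
  by (rule hol_compose[OF that(1) holomorphic_map_upd]) (use sub that in auto)
 have "hol (%x. contour_integral (circlepath c r) (?G x) / (2 * pi * \<i>)) W"
 proof (intro hol_divide hol_const holomorphic_contour_param W r)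
  show "continuous_on (W \<times> sphere c r) (%(x, w). ?G x w)"
   unfolding case_prod_unfold
   by (intro continuous_on_divide continuous_on_mult comp f q hol_fd V) (use nz in auto)
  fix w assume w: "w \<in> sphere c r"
  show "hol (%x. fd f (upd x i w) (axis i 1) * q (upd x i w)) W"
   by (intro hol_mult hcomp[OF _ w] q hol_fd[OF f V])
  show "hol (%x. f (upd x i w)) W"
   by (rule hcomp[OF f w])
  show "\<And>x. x \<in> W ==> f (upd x i w) \<noteq> 0" using nz w by auto
 qed auto
 moreover have "(\<Sum>w\<in>#root_mset (%w. f (upd x i w)) c r. q (upd x i w)) =
   contour_integral (circlepath c r) (?G x) / (2 * pi * \<i>)" if x: "x \<in> W" for x
 proof -
  let ?S = "{w. upd x i w \<in> V}"
  have "(\<Sum>w\<in>#root_mset (%w. f (upd x i w)) c r. q (upd x i w)) =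
   contour_integral (circlepath c r) (%w. deriv (%w. f (upd x i w)) w * q (upd x i w) / f (upd x i w)) / (2 * pi * \<i>)"
  proof (rule root_mset_props(3)[where S = ?S])
   show "(%w. f (upd x i w)) holomorphic_on ?S" "(%w. q (upd x i w)) holomorphic_on ?S"
    by (rule holomorphic_on_upd[OF f] holomorphic_on_upd[OF q], simp)+
   show "open ?S" by (rule open_upd_preimage[OF V])
  qed (use sub nz x r in auto)
  also have "contour_integral (circlepath c r) (%w. deriv (%w. f (upd x i w)) w * q (upd x i w) / f (upd x i w))
    = contour_integral (circlepath c r) (?G x)"
  proof (rule contour_integral_cong[OF refl])
   fix w assume "w \<in> path_image (circlepath c r)"
   then have "upd x i w \<in> V" using sub[OF x] r by (auto simp: path_image_circlepath)
   from DERIV_imp_deriv[OF deriv_upd[OF f this]]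
   show "deriv (%w. f (upd x i w)) w * q (upd x i w) / f (upd x i w) = ?G x w" by simp
  qed
  finally show ?thesis .
 qed
 ultimately show ?thesis
  by (rule hol_transform[OF _ W])
qed

section \<open>Symmetric functions\<close>

text \<open>The elementary symmetric functions, as coefficients of their generating series.\<close>

definition esym :: "nat => complex multiset => complex" where
 "esym k N = fps_nth (\<Prod>c\<in>#N. 1 + fps_const c * fps_X) k"

lemma esym_0 [simp]: "esym 0 N = 1"
 by (induction N) (auto simp: esym_def)

lemma esym_empty: "esym k {#} = (if k = 0 then 1 else 0)"
 by (simp add: esym_def)

lemma esym_Suc: "esym (Suc k) (add_mset c N) = esym (Suc k) N + c * esym k N"
 by (simp add: esym_def distrib_right mult.assoc)

text \<open>The largest index with a nonzero elementary symmetric function is the number of nonzero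
  members. In a holomorphic family this lets the zero set of one holomorphic function control a
  count.\<close>

lemma esym_nonzero:
 "(\<forall>k. k > size (filter_mset (%c. c \<noteq> 0) N) --> esym k N = 0) \<and>
  esym (size (filter_mset (%c. c \<noteq> 0) N)) N \<noteq> 0"
proof (induction N)
 case empty
 then show ?case by (simp add: esym_empty)
next
 case (add c N)
 have *: "esym k (add_mset c N) = esym k N + c * esym (k - 1) N" if "k > 0" for k
  using that esym_Suc[of "k - 1"] by simp
 show ?case
 proof (cases "c = 0")
  case True
  then have "esym k (add_mset c N) = esym k N" for k
   using *[of k] by (cases k) auto
  then show ?thesis using add True by simp
 next
  case False
  then show ?thesis using add by (auto simp: esym_Suc *)
 qed
qed

lemma esym_size: "esym (size N) N = prod_mset N"
proof (induction N)
 case (add c N)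
 have "esym (Suc (size N)) N = 0"
  using conjunct1[OF esym_nonzero[of N]] size_filter_mset_lesseq[of "%c. c \<noteq> 0" N]
   le_imp_less_Suc by blast
 then show ?case using add by (simp add: esym_Suc)
qed (simp add: esym_empty)

text \<open>Newton's identities, as the logarithmic derivative of the generating function.\<close>

lemma esym_newton:
 "of_nat (Suc k) * esym (Suc k) N = (\<Sum>i\<le>k. esym i N * ((-1) ^ (k - i) * (\<Sum>c\<in>#N. c ^ Suc (k - i))))"
proof -
 define E where "E N = (\<Prod>c\<in>#N. 1 + fps_const c * fps_X)" for N :: "complex multiset"
 define G where "G N = Abs_fps (%j. (-1) ^ j * (\<Sum>c\<in>#N. c ^ Suc j))" for N :: "complex multiset"
 have "fps_deriv (E N) = E N * G N" for N
 proof (induction N)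
  case empty
  then show ?case by (simp add: E_def G_def fps_zero_def[symmetric] fps_eq_iff)
 next
  case (add c N)
  \<comment> \<open>The geometric series of \<open>c / (1 + c X)\<close>, that is, the logarithmic
    derivative of the new factor.\<close>
  define g where "g = Abs_fps (%j. (-1) ^ j * c ^ Suc j)"
  have g: "(1 + fps_const c * fps_X) * g = fps_const c"
  proof (rule fps_ext)
   fix n show "fps_nth ((1 + fps_const c * fps_X) * g) n = fps_nth (fps_const c) n"
    by (cases n) (auto simp: g_def distrib_right mult.assoc)
  qed
  have G: "G (add_mset c N) = g + G N"
   by (rule fps_ext) (simp add: G_def g_def algebra_simps)
  have "fps_deriv (E (add_mset c N)) = fps_const c * E N + (1 + fps_const c * fps_X) * (E N * G N)"
   using add by (simp add: E_def algebra_simps)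
  also have "fps_const c * E N = (1 + fps_const c * fps_X) * g * E N"
   by (simp only: g)
  also have "(1 + fps_const c * fps_X) * g * E N + (1 + fps_const c * fps_X) * (E N * G N) =
    ((1 + fps_const c * fps_X) * E N) * (g + G N)"
   by (simp only: distrib_left[of _ g] mult.assoc mult.commute[of "E N" g])
  also have "\<dots> = E (add_mset c N) * G (add_mset c N)"
   unfolding G by (simp add: E_def)
  finally show ?case .
 qed
 then have "fps_nth (fps_deriv (E N)) k = fps_nth (E N * G N) k" by simp
 then show ?thesis
  by (simp add: fps_mult_nth E_def G_def esym_def atLeast0AtMost)
qed

text \<open>Newton's identities are solved recursively for \<open>esym k\<close>, dividing by
  \<open>k\<close>.\<close>

lemma hol_esym:
 assumes "\<And>k. k > 0 ==> hol (%x. \<Sum>c\<in>#N x. c ^ k) W"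
 shows "hol (%x. esym k (N x)) W"
proof (induction k rule: less_induct)
 case (less k)
 show ?case
 proof (cases k)
  case 0
  then show ?thesis by (simp add: hol_const)
 next
  case (Suc l)
  have "esym k (N x) = (\<Sum>i\<le>l. esym i (N x) * ((-1) ^ (l - i) * (\<Sum>c\<in>#N x. c ^ Suc (l - i)))) / of_nat k" for x
   unfolding Suc esym_newton[symmetric] by (simp del: of_nat_Suc)
  moreover have "(of_nat k :: complex) \<noteq> 0" using Suc by (simp del: of_nat_Suc)
  ultimately show ?thesis
   by (simp only:) (intro hol_divide hol_sum hol_mult
    hol_const assms less, use Suc in auto)
 qed
qed

text \<open>Holomorphy of a multivalued function without a choice of branches: every holomorphic
  test function has a holomorphic sum over the values.\<close>

definition trace_holomorphic ::
  "(complex ^ 'm => (complex ^ 'm) multiset) => (complex ^ 'm) set => (complex ^ 'm) set => bool" where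
 "trace_holomorphic Phi W V \<longleftrightarrow>
   (\<forall>q. hol q V --> hol (%x. \<Sum>y\<in>#Phi x. q y) W)"

lemma trace_holomorphic_esym:
 assumes "trace_holomorphic Phi W V" "hol q V"
 shows "hol (%x. esym k (image_mset q (Phi x))) W"
proof (rule hol_esym)
 fix k :: nat
 have "hol (%x. \<Sum>y\<in>#Phi x. q y ^ k) W"
  using assms hol_power unfolding trace_holomorphic_def by blast
 then show "hol (%x. \<Sum>c\<in>#image_mset q (Phi x). c ^ k) W"
  by (simp add: image_mset.compositionality o_def)
qed

text \<open>The constant test function \<open>1\<close> makes the size a continuous integer valued
  function.\<close>

lemma trace_holomorphic_size:
 assumes "trace_holomorphic Phi W V" "connected W" "x \<in> W" "y \<in> W"
 shows "size (Phi x) = size (Phi y)"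
proof -
 have "hol (%x. \<Sum>y\<in>#Phi x. 1) W"
  using assms(1) hol_const unfolding trace_holomorphic_def by blast
 then have "continuous_on W (%x. \<Sum>y\<in>#Phi x. 1 :: complex)"
  by (rule hol_continuous_on)
 then have cont: "continuous_on W (%x. of_nat (size (Phi x)) :: complex)"
  by simp
 have "(%x. of_nat (size (Phi x)) :: complex) constant_on W"
 proof (rule continuous_discrete_range_constant[OF assms(2) cont])
  fix x assume "x \<in> W"
  show "\<exists>e>0. \<forall>y. y \<in> W \<and> (of_nat (size (Phi y)) :: complex) \<noteq> of_nat (size (Phi x)) -->
    e \<le> norm (of_nat (size (Phi y)) - of_nat (size (Phi x)) :: complex)"
  proof (intro exI[of _ 1] conjI allI impI)
   fix y assume "y \<in> W \<and> (of_nat (size (Phi y)) :: complex) \<noteq> of_nat (size (Phi x))"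
   then have "size (Phi y) \<noteq> size (Phi x)" by auto
   have "(of_nat (size (Phi y)) - of_nat (size (Phi x)) :: complex) = of_int (int (size (Phi y)) - int (size (Phi x)))"
    by simp
   then have "norm (of_nat (size (Phi y)) - of_nat (size (Phi x)) :: complex) = \<bar>real_of_int (int (size (Phi y)) - int (size (Phi x)))\<bar>"
    by (simp only: norm_of_int)
   then show "1 \<le> norm (of_nat (size (Phi y)) - of_nat (size (Phi x)) :: complex)"
    using \<open>size (Phi y) \<noteq> size (Phi x)\<close> by linarith
  qed simp
 qed
 then show ?thesis
  using assms(3,4) unfolding constant_on_def by (metis of_nat_eq_iff)
qed

text \<open>The norm of \<open>q\<close>. The size is constant, so the product is the elementary
  symmetric function of one fixed index.\<close>

lemma trace_holomorphic_prod:
 assumes "trace_holomorphic Phi W V" "connected W" "open W" "hol q V"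
 shows "hol (%x. \<Prod>y\<in>#Phi x. q y) W"
proof (cases "W = {}")
 case True
 then show ?thesis by (simp add: holomorphic_fun_def)
next
 case False
 then obtain x0 where x0: "x0 \<in> W" by auto
 have hol: "hol (%x. esym (size (Phi x0)) (image_mset q (Phi x))) W"
  by (rule trace_holomorphic_esym[OF assms(1,4)])
 have eq: "(\<Prod>y\<in>#Phi x. q y) = esym (size (Phi x0)) (image_mset q (Phi x))" if "x \<in> W" for x
  using esym_size[of "image_mset q (Phi x)"] trace_holomorphic_size[OF assms(1,2) that x0] by simp
 show ?thesis
  by (rule hol_transform[OF hol assms(3) eq])
qed

section \<open>Elimination\<close>

text \<open>Functions of fewer variables stay functions on the full space; this records the
  coordinates that they see.\<close>

definition dep :: "'m set => (complex ^ 'm => 'b) => bool" where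
 "dep T f \<longleftrightarrow> (\<forall>x y. (\<forall>k\<in>T. x $ k = y $ k) --> f x = f y)"

lemma depD: "dep T f ==> (\<And>k. k \<in> T ==> x $ k = y $ k) ==> f x = f y"
 by (simp add: dep_def)

lemma norm_axis_complex [simp]: "norm (axis i (w::complex)) = cmod w"
proof -
 have "axis i w = w *s axis i 1" by (simp add: vec_eq_iff axis_def)
 then show ?thesis by (simp add: norm_vector_smult norm_Basis axis_in_Basis_iff)
qed

lemma axis_regular:
 assumes "hol f (ball 0 e)" "cmod b < e" "f (axis j b) \<noteq> 0"
 shows "\<exists>r>0. r \<le> e \<and> (\<forall>w. 0 < cmod w \<and> cmod w < r --> f (axis j w) \<noteq> 0)"
proof -
 have "(%w. f (upd 0 j w)) holomorphic_on ball 0 e"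
  by (rule holomorphic_on_upd[OF assms(1)]) simp
 moreover have "e > 0" using assms(2) norm_ge_zero[of b] by linarith
 ultimately have "\<exists>r>0. ball (0::complex) r \<subseteq> ball 0 e \<and> (\<forall>w\<in>ball 0 r - {0}. f (upd 0 j w) \<noteq> 0)"
  using holomorphic_on_isolated_zero[where f = "%w. f (upd 0 j w)" and b = b and a = 0 and S = "ball 0 e"] assms
  by simp
 then obtain r where r: "r > 0" "ball (0::complex) r \<subseteq> ball 0 e" "\<forall>w\<in>ball 0 r - {0}. f (upd 0 j w) \<noteq> 0"
  by blast
 then have "r \<le> e" using \<open>e > 0\<close> by (simp add: ball_subset_ball_iff)
 with r show ?thesis by auto
qed

lemma upd_tube:
 assumes "open U" "\<And>w. w \<in> K ==> axis j w \<in> U" "compact K"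
 shows "\<exists>d>0. \<forall>x. (\<forall>k. k \<noteq> j --> cmod (x $ k) < d) --> (\<forall>w\<in>K. upd x j w \<in> U)"
proof -
 have "0 + w *s axis j 1 \<in> U" if "w \<in> K" for w
  using assms(2)[OF that] by (metis add_0 axis_eq_0_iff upd_0 upd_line)
 from compact_line_tube[OF assms(3,1) this]
 obtain e where e: "e > 0" "\<forall>x\<in>ball 0 e. \<forall>w\<in>K. x + w *s axis j 1 \<in> U"
  by blast
 define d where "d = e / (real CARD('a) + 1)"
 have "d > 0" using e(1) by (simp add: d_def add_nonneg_pos)
 have "upd x j w \<in> U" if x: "\<forall>k. k \<noteq> j --> cmod (x $ k) < d" and w: "w \<in> K" for x w
 proof -
  have "norm (upd x j 0) \<le> (\<Sum>k\<in>UNIV. cmod (upd x j 0 $ k))" unfolding norm_vec_def by (rule L2_set_le_sum) simp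
  also have "\<dots> \<le> (\<Sum>k\<in>(UNIV::'a set). d)"
   using x \<open>d > 0\<close> by (intro sum_mono) (auto intro: less_imp_le)
  also have "\<dots> < e" using e(1) by (simp add: d_def divide_simps add_nonneg_pos)
  finally have "upd x j 0 \<in> ball 0 e" by simp
  then show ?thesis using e(2) w upd_line[of x j w] by auto
 qed
 then show ?thesis using \<open>d > 0\<close> by blast
qed

lemma poly_Poly_eq:
 fixes s :: complex
 shows "poly (Poly (map (%f. f y) fs)) s = (\<Sum>l<length fs. s ^ l * (fs ! l) y)"
proof (induction fs)
 case (Cons f fs)
 then show ?case
  by (simp add: sum.lessThan_Suc_shift sum_distrib_left mult.assoc del: sum.lessThan_Suc)
qed simp

lemma hol_Poly:
 assumes "\<And>f. f \<in> set fs ==> hol f V"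
 shows "hol (%y. poly (Poly (map (%f. f y) fs)) s) V"
 unfolding poly_Poly_eq
 by (intro hol_sum hol_mult hol_const assms) simp

text \<open>If no \<open>p y\<close> were zero, their product would be a nonzero polynomial of
  degree at most \<open>size Phi * D\<close>, yet every \<open>s < L\<close> is a root of it.
  Applied to polynomials whose coefficients are the values of given functions, this makes finitely
  many norms detect a common zero of all the functions at a single point of the fibre.\<close>

lemma common_zero_pigeonhole:
 fixes p :: "'a => complex poly"
 assumes deg: "\<And>y. y \<in># Phi ==> degree (p y) \<le> D" and L: "size Phi * D < L"
  and z: "\<And>s. s < L ==> \<exists>y\<in>#Phi. poly (p y) (of_nat s) = 0"
 shows "\<exists>y\<in>#Phi. p y = 0"
proof (rule ccontr)
 assume "\<not> ?thesis"
 then have nz: "(\<Prod>y\<in>#Phi. p y) \<noteq> 0" by (auto simp: prod_mset_zero_iff)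
 have "degree (\<Prod>y\<in>#Phi. p y) \<le> size Phi * D" using deg
 proof (induction Phi)
  case (add y Phi)
  have "degree (p y * (\<Prod>y\<in>#Phi. p y)) \<le> degree (p y) + degree (\<Prod>y\<in>#Phi. p y)"
   by (rule degree_mult_le)
  also have "\<dots> \<le> D + size Phi * D" using add by (intro add_mono) auto
  finally show ?case by simp
 qed simp
 have "L = card (of_nat ` {..<L} :: complex set)"
  by (simp add: card_image inj_on_def)
 also have "\<dots> \<le> card {x. poly (\<Prod>y\<in>#Phi. p y) x = 0}"
 proof (rule card_mono[OF poly_roots_finite[OF nz]], clarify)
  fix s assume "s < L"
  from z[OF this] obtain y where y: "y \<in># Phi" "poly (p y) (of_nat s) = 0" by blast
  then have "p y dvd (\<Prod>y\<in>#Phi. p y)"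
   by (metis dvd_prod_mset image_eqI set_image_mset)
  then show "poly (\<Prod>y\<in>#Phi. p y) (of_nat s) = 0"
   using y(2) by (auto elim!: dvdE)
 qed
 also have "\<dots> \<le> degree (\<Prod>y\<in>#Phi. p y)" by (rule card_poly_roots_bound[OF nz])
 finally show False using L \<open>degree _ \<le> _\<close> by linarith
qed

abbreviation eliminates where
 "eliminates F S i e g d b \<equiv> 0 < d \<and> d \<le> e \<and> hol g (ball 0 d) \<and> dep (insert i S) g \<and>
   cmod b < d \<and> g (axis i b) \<noteq> 0 \<and> (\<forall>x\<in>ball 0 d. (\<forall>f\<in>F. f x = 0) --> g x = (0::complex))"

text \<open>Coordinates in \<open>J\<close> are removed one at a time. Isolation makes some member
  of \<open>F\<close> nonzero on the \<open>j\<close>-th axis, so it has finitely many roots in that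
  coordinate; norms over these roots of suitable combinations of \<open>F\<close> no longer involve
  the coordinate \<open>j\<close>, and their common zeros are covered by common zeros of
  \<open>F\<close>.\<close>

lemma elimination:
 fixes F :: "(complex ^ 'm => complex) set"
 assumes "finite J" "J \<inter> insert i S = {}" "i \<notin> S" "finite F" "e > 0"
  and "\<And>f. f \<in> F ==> hol f (ball 0 e)"
  and "\<And>f. f \<in> F ==> dep (insert i S \<union> J) f"
  and "\<And>x k. x \<in> ball 0 e ==> (\<forall>k\<in>S. x $ k = 0) ==> (\<forall>f\<in>F. f x = 0) ==> k \<in> insert i J ==> x $ k = 0"
 shows "\<exists>g d b. eliminates F S i e g d b"
 using assms
proof (induction J arbitrary: F e rule: finite_induct)
 case empty
 \<comment> \<open>With nothing left to eliminate, isolation forces some member of \<open>F\<close>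
   to be nonzero at any chosen point other than \<open>0\<close> of the \<open>i\<close>-th axis;
   \<open>b\<close> is such a point.\<close>
 define b where "b = complex_of_real (e / 2)"
 have b: "cmod b < e" "b \<noteq> 0" using empty.prems(4) by (auto simp: b_def)
 have "\<exists>f\<in>F. f (axis i b) \<noteq> 0"
 proof (rule ccontr)
  assume "\<not> ?thesis"
  moreover have "\<forall>k\<in>S. axis i b $ k = 0" using empty.prems(2) by (auto simp: axis_def)
  ultimately have "axis i b $ i = 0" using b empty.prems(7)[of "axis i b" i] by auto
  then show False using b by (simp add: axis_def)
 qed
 then obtain f where f: "f \<in> F" "f (axis i b) \<noteq> 0" by blast
 show ?case
  by (rule exI[of _ f], rule exI[of _ e], rule exI[of _ b])
   (use f b empty.prems in auto)
next
 case (insert j J)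
 note prems = insert.prems
 define b where "b = complex_of_real (e / 2)"
 have b: "cmod b < e" "b \<noteq> 0" using prems(4) by (auto simp: b_def)
 have "\<exists>f\<in>F. f (axis j b) \<noteq> 0"
 proof (rule ccontr)
  assume "\<not> ?thesis"
  moreover have "\<forall>k\<in>S. axis j b $ k = 0" using prems(1) by (auto simp: axis_def)
  ultimately have "axis j b $ j = 0" using b prems(7)[of "axis j b" j] by auto
  then show False using b by (simp add: axis_def)
 qed
 then obtain f where f: "f \<in> F" "f (axis j b) \<noteq> 0" by blast
 obtain r0 where r0: "r0 > 0" "r0 \<le> e" "\<And>w. 0 < cmod w ==> cmod w < r0 ==> f (axis j w) \<noteq> 0"
  using axis_regular[OF prems(5)[OF f(1)] b(1) f(2)] by blast
 define r where "r = r0 / 2"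
 have r: "0 < r" "r < r0" using r0(1) by (auto simp: r_def)
 have fn: "open {x \<in> ball 0 e. f x \<noteq> 0}"
  by (rule open_nonzero[OF prems(5)[OF f(1)] open_ball])
 obtain d1 where d1: "d1 > 0" "\<And>x w. (\<forall>k. k \<noteq> j --> cmod (x $ k) < d1) ==> w \<in> cball 0 r ==> upd x j w \<in> ball 0 e"
  using upd_tube[OF open_ball _ compact_cball, of 0 r j 0 e] r r0(2) by auto
 have "axis j w \<in> {x \<in> ball 0 e. f x \<noteq> 0}" if "w \<in> sphere 0 r" for w
  using r0 r that by auto
 from upd_tube[OF fn this compact_sphere]
 obtain d2 where d2: "d2 > 0" "\<And>x w. (\<forall>k. k \<noteq> j --> cmod (x $ k) < d2) ==> w \<in> sphere 0 r ==> upd x j w \<in> {x \<in> ball 0 e. f x \<noteq> 0}"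
  by blast
 define d where "d = min (min d1 d2) (min r e)"
 have d: "d > 0" "d \<le> d1" "d \<le> d2" "d \<le> r" "d \<le> e" using d1 d2 r prems(4) by (auto simp: d_def)
 define W where "W = ball (0 :: complex ^ 'm) d"
 have comp_lt: "cmod (x $ k) < d" if "x \<in> W" for x :: "complex ^ 'm" and k
  using cmod_nth_le[of x k] that by (simp add: W_def)
 have sub: "upd x j w \<in> ball 0 e" if "x \<in> W" "w \<in> cball 0 r" for x w
  by (rule d1(2)[OF _ that(2)]) (use comp_lt[OF that(1)] d(2) less_le_trans in blast)
 have nz: "f (upd x j w) \<noteq> 0" if "x \<in> W" "w \<in> sphere 0 r" for x w
 proof -
  have "upd x j w \<in> {x \<in> ball 0 e. f x \<noteq> 0}"
   by (rule d2(2)[OF _ that(2)]) (use comp_lt[OF that(1)] d(3) less_le_trans in blast)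
  then show ?thesis by blast
 qed
 define R where "R x = root_mset (%w. f (upd x j w)) 0 r" for x
 define Phi where "Phi x = image_mset (upd x j) (R x)" for x
 have set_R: "set_mset (R x) = {w\<in>ball 0 r. f (upd x j w) = 0}" if "x \<in> W" for x
  unfolding R_def
 proof (rule root_mset_props(2)[where S = "{w. upd x j w \<in> ball 0 e}"])
  show "(%w. f (upd x j w)) holomorphic_on {w. upd x j w \<in> ball 0 e}"
   by (rule holomorphic_on_upd[OF prems(5)[OF f(1)]]) simp
  show "open {w. upd x j w \<in> ball 0 e}" by (rule open_upd_preimage[OF open_ball])
 qed (use that sub nz r in auto)
 have Phi: "trace_holomorphic Phi W (ball 0 e)"
  unfolding trace_holomorphic_def
 proof (intro allI impI)
  fix q :: "complex ^ 'm => complex" assume q: "hol q (ball 0 e)"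
  have "hol (%x. \<Sum>w\<in>#R x. q (upd x j w)) W"
   unfolding R_def
   by (rule hol_trace[OF prems(5)[OF f(1)] q open_ball _ r(1) sub nz]) (auto simp: W_def)
  then show "hol (%x. \<Sum>y\<in>#Phi x. q y) W"
   by (simp add: Phi_def image_mset.compositionality o_def)
 qed
 have connW: "connected W" "open W" "0 \<in> W" using d by (auto simp: W_def)
 obtain fs where fs: "set fs = F" using finite_list[OF prems(3)] by blast
 \<comment> \<open>The members of \<open>F\<close> become the coefficients of one polynomial per
   point \<open>y\<close>, evaluated at the integer \<open>s\<close>; the polynomial is zero exactly
   at common zeros of \<open>F\<close>.\<close>
 define q where "q s y = poly (Poly (map (%f. f y) fs)) (of_nat s)" for s y
 have q: "hol (q s) (ball 0 e)" for s
  unfolding q_def using hol_Poly[of fs "ball 0 e"] prems(5) fs by blast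
 \<comment> \<open>One more than the number of roots that the product of all these polynomials over
   a fibre can have.\<close>
 define L where "L = Suc (size (Phi 0) * length fs)"
 define g where "g s x = (\<Prod>y\<in>#Phi x. q s y)" for s x
 define F' where "F' = g ` {..<L}"
 have zeroF: "\<exists>w\<in>#R x. \<forall>f\<in>F. f (upd x j w) = 0" if x: "x \<in> W" and z: "\<forall>h\<in>F'. h x = 0" for x
 proof -
  have "\<exists>y\<in>#Phi x. Poly (map (%f. f y) fs) = 0"
  proof (rule common_zero_pigeonhole[where D = "length fs" and L = L])
   show "degree (Poly (map (%f. f y) fs)) \<le> length fs" for y
    using degree_Poly[of "map (%f. f y) fs"] by simp
   show "size (Phi x) * length fs < L"
    unfolding L_def trace_holomorphic_size[OF Phi connW(1) x connW(3)] by simp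
   fix s assume "s < L"
   then have "g s x = 0" using z by (auto simp: F'_def)
   then show "\<exists>y\<in>#Phi x. poly (Poly (map (%f. f y) fs)) (of_nat s) = 0"
    by (auto simp: g_def q_def prod_mset_zero_iff)
  qed
  then obtain w where w: "w \<in># R x" "Poly (map (%f. f (upd x j w)) fs) = 0"
   by (auto simp: Phi_def)
  have "\<forall>f\<in>F. f (upd x j w) = 0"
  proof
   fix f assume "f \<in> F"
   then obtain l where "l < length fs" "fs ! l = f" using fs by (metis in_set_conv_nth)
   then have "coeff (Poly (map (%f. f (upd x j w)) fs)) l = f (upd x j w)"
    by (simp add: nth_default_def)
   then show "f (upd x j w) = 0" using w by simp
  qed
  with w show ?thesis by blast
 qed
 have "\<exists>g d' b. 0 < d' \<and> d' \<le> d \<and> hol g (ball 0 d') \<and> dep (insert i S) g \<and>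
   cmod b < d' \<and> g (axis i b) \<noteq> 0 \<and> (\<forall>x\<in>ball 0 d'. (\<forall>f\<in>F'. f x = 0) --> g x = 0)"
 proof (rule insert.IH)
  show "J \<inter> insert i S = {}" using prems(1) by auto
  show "finite F'" by (simp add: F'_def)
  show "hol h (ball 0 d)" if h: "h \<in> F'" for h
  proof -
   obtain s where s: "h = (%x. \<Prod>y\<in>#Phi x. q s y)" using h by (auto simp: F'_def g_def[abs_def])
   show ?thesis
    unfolding s using trace_holomorphic_prod[OF Phi connW(1,2) q] by (simp add: W_def)
  qed
  show "dep (insert i S \<union> J) h" if h: "h \<in> F'" for h
  proof -
   have *: "h' (upd x j w) = h' (upd y j w)"
    if "h' \<in> F" "\<forall>k\<in>insert i S \<union> J. x $ k = y $ k" for h' x y w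
    by (rule depD[OF prems(6)[OF that(1)]]) (use that(2) in auto)
   have "g s x = g s y" if xy: "\<forall>k\<in>insert i S \<union> J. x $ k = y $ k" for x y s
   proof -
    have R: "R x = R y" unfolding R_def *[OF f(1) xy] ..
    have m: "map (%f. f (upd x j w)) fs = map (%f. f (upd y j w)) fs" for w
     using * xy fs by auto
    have gq: "g s x = (\<Prod>w\<in>#R x. poly (Poly (map (%f. f (upd x j w)) fs)) (of_nat s))" for x
     by (simp add: g_def Phi_def q_def image_mset.compositionality o_def)
    show ?thesis unfolding gq R m ..
   qed
   then show ?thesis using h by (auto simp: F'_def dep_def)
  qed
  \<comment> \<open>A common zero of the norms lifts to a common zero of \<open>F\<close> that
    differs only in the coordinate \<open>j\<close>; the isolation hypothesis applies to the
    lift.\<close>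
  show "x $ k = 0" if x: "x \<in> ball 0 d" "\<forall>k\<in>S. x $ k = 0" "\<forall>f\<in>F'. f x = 0" "k \<in> insert i J" for x k
  proof -
   obtain w where w: "w \<in># R x" "\<forall>f\<in>F. f (upd x j w) = 0"
    using zeroF[of x] x unfolding W_def by blast
   have "w \<in> cball 0 r" using w(1) set_R[of x] x(1) by (auto simp: W_def)
   have k: "k \<noteq> j" using x(4) insert.hyps(2) prems(1) by auto
   have "upd x j w $ k = 0"
   proof (rule prems(7))
    show "upd x j w \<in> ball 0 e" using sub[of x w] x(1) \<open>w \<in> cball 0 r\<close> by (simp add: W_def)
    show "\<forall>k\<in>S. upd x j w $ k = 0" using x(2) prems(1) by auto
   qed (use w x(4) in auto)
   then show ?thesis using k by simp
  qed
 qed (use prems d in auto)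
 then obtain h d' b' where h: "0 < d'" "d' \<le> d" "hol h (ball 0 d')" "dep (insert i S) h"
   "cmod b' < d'" "h (axis i b') \<noteq> 0" "\<And>x. x\<in>ball 0 d' ==> (\<forall>f\<in>F'. f x = 0) ==> h x = 0"
  by blast
 have "h x = 0" if x: "x \<in> ball 0 d'" "\<forall>f\<in>F. f x = 0" for x
 proof (rule h(7)[OF x(1)])
  have xW: "x \<in> W" using x(1) h(2) by (simp add: W_def)
  \<comment> \<open>The coordinate of a common zero of \<open>F\<close> is itself one of the roots,
    so one factor of every norm vanishes.\<close>
  have "x $ j \<in># R x"
   using set_R[OF xW] comp_lt[OF xW, of j] d(4) x(2) f(1) by auto
  then have "x \<in># Phi x" by (auto simp: Phi_def intro!: image_eqI[of _ _ "x $ j"])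
  moreover have "q s x = 0" for s
   unfolding q_def poly_Poly_eq using x(2) fs by (intro sum.neutral) auto
  ultimately have "g s x = 0" for s
   by (auto simp: g_def prod_mset_zero_iff intro!: image_eqI[of _ _ x])
  then show "\<forall>f\<in>F'. f x = 0" by (auto simp: F'_def)
 qed
 then show ?case using h d(5) by (meson order_trans)
qed

section \<open>Branched coverings of a coordinate polydisc\<close>

text \<open>Take the largest \<open>k\<close> for which \<open>esym k\<close> is not identically
  zero. No point has more than \<open>k\<close> nonzero members, and a point with
  \<open>esym k\<close> nonzero has at least \<open>k\<close>.\<close>

lemma generic_rank:
 assumes "x0 \<in> W" and M: "\<And>x. x \<in> W ==> size (N x) \<le> M"
 shows "\<exists>k. (\<exists>x\<in>W. esym k (N x) \<noteq> 0) \<and>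
  (\<forall>x\<in>W. esym k (N x) \<noteq> 0 --> size (filter_mset (%c. c \<noteq> 0) (N x)) = k)"
proof -
 let ?P = "%k. \<exists>x\<in>W. esym k (N x) \<noteq> 0"
 define nz where "nz x = size (filter_mset (%c. c \<noteq> 0) (N x))" for x
 have bound: "k \<le> nz x" if "esym k (N x) \<noteq> 0" for k x
  using that esym_nonzero[of "N x"] unfolding nz_def by (meson not_le_imp_less)
 have nzM: "nz x \<le> M" if "x \<in> W" for x
  using M[OF that] size_filter_mset_lesseq[of _ "N x"] le_trans unfolding nz_def by blast
 have P: "?P 0" using \<open>x0 \<in> W\<close> by auto
 have b: "k \<le> M" if "?P k" for k using that bound nzM le_trans by blast
 define k where "k = Greatest ?P"
 have k: "?P k" unfolding k_def by (rule GreatestI_nat[where P = ?P, OF P b])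
 have "nz x = k" if x: "x \<in> W" "esym k (N x) \<noteq> 0" for x
 proof (rule antisym)
  have "?P (nz x)" using esym_nonzero[of "N x"] x(1) unfolding nz_def by blast
  then show "nz x \<le> k" unfolding k_def by (rule Greatest_le_nat[where P = ?P, OF _ b])
  show "k \<le> nz x" by (rule bound[OF x(2)])
 qed
 with k show ?thesis unfolding nz_def by blast
qed

text \<open>All ordered differences, those of a member with itself included. Counting the zero ones
  measures coincidences of roots and takes the place of a discriminant, also when multiple roots are
  present everywhere.\<close>

definition pair_diffs :: "complex multiset => complex multiset" where
 "pair_diffs N = (\<Sum>t\<in>#N. image_mset (%t'. t - t') N)"

lemma sum_mset_Sum_mset: "(\<Sum>c\<in>#(\<Sum>t\<in>#N. g t). h c) = (\<Sum>t\<in>#N. \<Sum>c\<in>#g t. (h c :: complex))"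
 by (induction N) auto

lemma size_Sum_mset:
 fixes g :: "'a => 'b multiset"
 shows "size (\<Sum>t\<in>#N. g t) = (\<Sum>t\<in>#N. size (g t))"
 by (induction N) auto

lemma filter_Sum_mset: "filter_mset P (\<Sum>t\<in>#N. g t) = (\<Sum>t\<in>#N. filter_mset P (g t))"
 by (induction N) auto

lemma count_Sum_mset: "count (\<Sum>t\<in>#N. g t) y = (\<Sum>t\<in>#N. count (g t) y)"
 by (induction N) auto

lemma sum_mset_sum_swap: "(\<Sum>t\<in>#N. \<Sum>j\<in>A. g t j) = (\<Sum>j\<in>A. \<Sum>t\<in>#N. (g t j :: complex))"
 by (induction N) (auto simp: sum.distrib)

lemma pair_diffs_power:
 "(\<Sum>c\<in>#pair_diffs N. c ^ k) = (\<Sum>j\<le>k. of_nat (k choose j) * (\<Sum>t\<in>#N. t ^ j) * ((-1) ^ (k - j) * (\<Sum>t\<in>#N. t ^ (k - j))))"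
proof -
 have "(\<Sum>c\<in>#pair_diffs N. c ^ k) = (\<Sum>t\<in>#N. \<Sum>t'\<in>#N. (t + - t') ^ k)"
  by (simp add: pair_diffs_def sum_mset_Sum_mset image_mset.compositionality o_def)
 also have "\<dots> = (\<Sum>t\<in>#N. \<Sum>t'\<in>#N. \<Sum>j\<le>k. of_nat (k choose j) * t ^ j * (- t') ^ (k - j))"
  by (simp only: binomial_ring)
 also have "\<dots> = (\<Sum>j\<le>k. \<Sum>t\<in>#N. \<Sum>t'\<in>#N. of_nat (k choose j) * t ^ j * (- t') ^ (k - j))"
  by (simp only: sum_mset_sum_swap)
 also have "\<dots> = (\<Sum>j\<le>k. of_nat (k choose j) * (\<Sum>t\<in>#N. t ^ j) * ((-1) ^ (k - j) * (\<Sum>t\<in>#N. t ^ (k - j))))"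
 proof (rule sum.cong[OF refl])
  fix j
  have "(\<Sum>t'\<in>#N. of_nat (k choose j) * t ^ j * (- t') ^ (k - j)) =
    t ^ j * (of_nat (k choose j) * ((-1) ^ (k - j) * (\<Sum>t\<in>#N. t ^ (k - j))))" for t
  proof -
   have "of_nat (k choose j) * t ^ j * (- t') ^ (k - j) =
     (t ^ j * (of_nat (k choose j) * (-1) ^ (k - j))) * t' ^ (k - j)" for t'
    by (subst power_minus) (simp add: ac_simps)
   then show ?thesis
    by (simp only: sum_mset_distrib_left[symmetric] mult.assoc)
  qed
  then show "(\<Sum>t\<in>#N. \<Sum>t'\<in>#N. of_nat (k choose j) * t ^ j * (- t') ^ (k - j)) =
    of_nat (k choose j) * (\<Sum>t\<in>#N. t ^ j) * ((-1) ^ (k - j) * (\<Sum>t\<in>#N. t ^ (k - j)))"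
   by (simp only: sum_mset_distrib_right[symmetric]) (simp only: mult.assoc mult.left_commute)
 qed
 finally show ?thesis .
qed

text \<open>The sum runs over the multiset, so it is the sum of the squares of the
  multiplicities.\<close>

lemma pair_diffs_zero: "size (filter_mset (%c. c = 0) (pair_diffs N)) = (\<Sum>t\<in>#N. count N t)"
proof -
 have *: "size (filter_mset (%c. c = 0) (image_mset (%t'. t - t') M)) = count M t"
  for t and M :: "complex multiset"
  by (induction M) auto
 show ?thesis
  unfolding pair_diffs_def filter_Sum_mset size_Sum_mset * ..
qed

lemma sum_count_le: "(\<Sum>t\<in>#N. count N t) \<le> size N * size N"
proof -
 have "(\<Sum>t\<in>#N. count N t) \<le> (\<Sum>t\<in>#N. size N)"
  by (intro sum_mset_mono count_le_size)
 then show ?thesis by simp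
qed

text \<open>Each summand is at most \<open>size N\<close>, so equality forces the multiplicity of
  \<open>t\<close> to be the full size.\<close>

lemma sum_count_eq_square:
 assumes "(\<Sum>t\<in>#N. count N t) = size N * size N" "t \<in># N"
 shows "N = replicate_mset (size N) t"
proof -
 have "count N t = size N"
 proof (rule ccontr)
  assume "count N t \<noteq> size N"
  then have lt: "count N t < size N" using count_le_size[of N t] by linarith
  obtain N' where N': "N = add_mset t N'" using assms(2) by (metis mset_add)
  have "(\<Sum>s\<in>#N'. count N s) \<le> (\<Sum>s\<in>#N'. size N)"
   by (intro sum_mset_mono count_le_size)
  then have "(\<Sum>t\<in>#N. count N t) < size N + size N' * size N"
   using lt by (subst (2) N') simp
  then show False using assms(1) by (simp add: N')
 qed
 then show ?thesis
  by (metis count_le_replicate_mset_subset_eq le_refl mset_subset_size size_replicate_mset subset_mset.le_imp_less_or_eq less_irrefl)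
qed

lemma sum_count_disjoint:
 assumes "finite T" and dis: "\<And>s t. s \<in> T ==> t \<in> T ==> s \<noteq> t ==> set_mset (N s) \<inter> set_mset (N t) = {}"
 shows "(\<Sum>w\<in>#(\<Sum>t\<in>T. N t). count (\<Sum>t\<in>T. N t) w) = (\<Sum>t\<in>T. \<Sum>w\<in>#N t. count (N t) w)"
proof -
 have "count (\<Sum>t\<in>T. N t) w = count (N t) w" if "t \<in> T" "w \<in># N t" for t w
 proof -
  have "count (\<Sum>t\<in>T. N t) w = (\<Sum>s\<in>T. count (N s) w)" by (simp add: count_sum)
  also have "\<dots> = count (N t) w + (\<Sum>s\<in>T - {t}. count (N s) w)"
   by (rule sum.remove[OF \<open>finite T\<close> that(1)])
  also have "(\<Sum>s\<in>T - {t}. count (N s) w) = 0"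
  proof (rule sum.neutral, rule ballI)
   fix s assume "s \<in> T - {t}"
   then have "w \<notin># N s" using dis[of s t] that by blast
   then show "count (N s) w = 0" by (simp add: not_in_iff)
  qed
  finally show ?thesis by simp
 qed
 moreover have "(\<Sum>w\<in>#(\<Sum>t\<in>T. N t). g w) = (\<Sum>t\<in>T. \<Sum>w\<in>#N t. g w)" for g :: "_ => nat"
  using \<open>finite T\<close> by (induction T rule: finite_induct) auto
 ultimately show ?thesis
  by (auto intro!: sum.cong arg_cong[of _ _ sum_mset] image_mset_cong)
qed

lemma upd_tube_at:
 assumes "open U" "\<And>w. w \<in> K ==> upd x0 j w \<in> U" "compact K"
 shows "\<exists>d>0. \<forall>x\<in>ball x0 d. \<forall>w\<in>K. upd x j w \<in> U"
proof -
 have "upd x0 j 0 + w *s axis j 1 \<in> U" if "w \<in> K" for w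
  using assms(2)[OF that] by (simp flip: upd_line)
 from compact_line_tube[OF assms(3,1) this]
 obtain e where e: "e > 0" "\<forall>x\<in>ball (upd x0 j 0) e. \<forall>w\<in>K. x + w *s axis j 1 \<in> U"
  by blast
 have "upd x j w \<in> U" if x: "x \<in> ball x0 e" and w: "w \<in> K" for x w
 proof -
  have "norm (upd x0 j 0 - upd x j 0) \<le> norm (x0 - x)"
   by (rule norm_le_componentwise_cart) auto
  then have "upd x j 0 \<in> ball (upd x0 j 0) e" using x by (simp add: dist_norm)
  then show ?thesis using e(2) w upd_line[of x j w] by auto
 qed
 then show ?thesis using e(1) by blast
qed

text \<open>The coordinates in \<open>S\<close> are those of the base. Every other coordinate
  satisfies an equation in the base coordinates and itself alone, whose roots never meet the circle
  of radius \<open>r\<close>; the margin up to \<open>r1\<close> makes the closed discs lie in the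
  domain. Since the equations are decoupled, a fibre is a product of finite root sets, usually
  larger than the analytic set under study. By \<open>reg_f\<close> the only root over the origin is
  \<open>0\<close>.\<close>

locale branched_cover =
 fixes S :: "'m::finite set" and f :: "'m => complex ^ 'm => complex" and rho r r1 :: real
 assumes rho: "0 < rho" and r: "0 < r" "r < r1"
  and hol_f: "\<And>i. i \<notin> S ==>
   hol (f i) {x. (\<forall>k\<in>S. cmod (x $ k) < rho) \<and> (\<forall>k. k \<notin> S --> cmod (x $ k) < r1)}"
  and dep_f: "\<And>i. i \<notin> S ==> dep (insert i S) (f i)"
  and nz_f: "\<And>i x. i \<notin> S ==> (\<And>k. k \<in> S ==> cmod (x $ k) < rho) ==> cmod (x $ i) = r ==> f i x \<noteq> 0"
  and reg_f: "\<And>i w. i \<notin> S ==> w \<noteq> 0 ==> cmod w \<le> r ==> f i (axis i w) \<noteq> 0"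
begin

definition V :: "(complex ^ 'm) set" where
 "V = {x. (\<forall>k\<in>S. cmod (x $ k) < rho) \<and> (\<forall>k. k \<notin> S --> cmod (x $ k) < r1)}"

definition D :: "(complex ^ 'm) set" where
 "D = {x. (\<forall>k\<in>S. cmod (x $ k) < rho) \<and> (\<forall>k. k \<notin> S --> cmod (x $ k) < r)}"

definition Z :: "complex ^ 'm => (complex ^ 'm) set" where
 "Z x = {y\<in>D. (\<forall>k\<in>S. y $ k = x $ k) \<and> (\<forall>i. i \<notin> S --> f i y = 0)}"

lemma hol_fV: "i \<notin> S ==> hol (f i) V"
 unfolding V_def by (rule hol_f)

lemma polydisc_open_convex:
 fixes R :: "'m => real"
 shows "open {x :: complex ^ 'm. \<forall>k. cmod (x $ k) < R k}"
  and "convex {x :: complex ^ 'm. \<forall>k. cmod (x $ k) < R k}"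
proof -
 have eq: "{x :: complex ^ 'm. \<forall>k. cmod (x $ k) < R k} = (\<Inter>k\<in>UNIV. (%x. x $ k) -` ball 0 (R k))"
  by (auto simp: set_eq_iff)
 show "open {x :: complex ^ 'm. \<forall>k. cmod (x $ k) < R k}"
  unfolding eq by (intro open_INT finite ballI open_vimage open_ball continuous_on_component continuous_on_id)
 show "convex {x :: complex ^ 'm. \<forall>k. cmod (x $ k) < R k}"
  unfolding eq
  by (intro convex_INT convex_linear_vimage convex_ball bounded_linear.linear[OF bounded_linear_vec_nth])
qed

lemma V_eq: "V = {x. \<forall>k. cmod (x $ k) < (if k \<in> S then rho else r1)}"
 by (auto simp: V_def)

lemma D_eq: "D = {x. \<forall>k. cmod (x $ k) < (if k \<in> S then rho else r)}"
 by (auto simp: D_def)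

lemma V_topology: "open V" "convex V" "connected V" "0 \<in> V"
 using polydisc_open_convex[of "%k. if k \<in> S then rho else r1"] rho r
 by (auto simp: V_eq convex_connected)

lemma D_topology: "open D" "convex D" "connected D" "0 \<in> D" "D \<subseteq> V"
 using polydisc_open_convex[of "%k. if k \<in> S then rho else r"] rho r
 by (auto simp: D_eq V_eq convex_connected split: if_splits)
  (metis less_trans)

lemma upd_V: "x \<in> V ==> i \<notin> S ==> w \<in> cball 0 r ==> upd x i w \<in> V"
 using r by (auto simp: V_def)

lemma nz_upd: "x \<in> V ==> i \<notin> S ==> w \<in> sphere 0 r ==> f i (upd x i w) \<noteq> 0"
 by (rule nz_f) (auto simp: V_def)

lemma f_upd_cong: "i \<notin> S ==> (\<And>k. k \<in> S ==> x $ k = y $ k) ==> f i (upd x i w) = f i (upd y i w)"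
 by (rule depD[OF dep_f]) auto

definition R :: "'m => complex ^ 'm => complex multiset" where
 "R i x = root_mset (%w. f i (upd x i w)) 0 r"

lemma R_cong: "i \<notin> S ==> (\<And>k. k \<in> S ==> x $ k = y $ k) ==> R i x = R i y"
 unfolding R_def using f_upd_cong[of i x y] by presburger

lemma R_upd [simp]: "i \<notin> S ==> j \<notin> S ==> R i (upd x j w) = R i x"
 by (rule R_cong) auto

lemma R_props:
 assumes "x \<in> V" "i \<notin> S"
 shows "set_mset (R i x) = {w\<in>ball 0 r. f i (upd x i w) = 0}"
  and "finite {w\<in>ball 0 r. f i (upd x i w) = 0}"
proof -
 have *: "(%w. f i (upd x i w)) holomorphic_on {w. upd x i w \<in> V}" "open {w. upd x i w \<in> V}"
  "cball 0 r \<subseteq> {w. upd x i w \<in> V}" "\<And>w. w \<in> sphere 0 r ==> f i (upd x i w) \<noteq> 0"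
  using nz_upd assms upd_V[OF assms] by (auto intro: holomorphic_on_upd[OF hol_fV] open_upd_preimage V_topology)
 show "set_mset (R i x) = {w\<in>ball 0 r. f i (upd x i w) = 0}"
  unfolding R_def by (rule root_mset_props(2)[OF *(1-3) r(1) *(4)])
 show "finite {w\<in>ball 0 r. f i (upd x i w) = 0}"
  by (rule root_mset_props(1)[OF *(1-3) r(1) *(4)])
qed

lemma trace_R:
 assumes "i \<notin> S" "hol q V"
 shows "hol (%x. \<Sum>w\<in>#R i x. q (upd x i w)) V"
 unfolding R_def
 by (rule hol_trace[OF hol_fV[OF assms(1)] assms(2) V_topology(1,1) r(1) upd_V nz_upd])
  (use assms in auto)

text \<open>The fibre with multiplicities, built coordinate by coordinate so that holomorphic traces
  can be composed. The equations are decoupled, hence multiplicities multiply.\<close>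

fun Phis :: "'m list => complex ^ 'm => (complex ^ 'm) multiset" where
 "Phis [] x = {#x#}"
| "Phis (i # is) x = (\<Sum>w\<in>#R i x. Phis is (upd x i w))"

lemma trace_Phis: "set is \<inter> S = {} ==> trace_holomorphic (Phis is) V V"
proof (induction "is")
 case Nil
 then show ?case by (simp add: trace_holomorphic_def)
next
 case (Cons i "is")
 show ?case
  unfolding trace_holomorphic_def
 proof (intro allI impI)
  fix q :: "complex ^ 'm => complex" assume q: "hol q V"
  have "hol (%x. \<Sum>y\<in>#Phis is x. q y) V"
   using Cons q unfolding trace_holomorphic_def by auto
  then have "hol (%x. \<Sum>w\<in>#R i x. \<Sum>y\<in>#Phis is (upd x i w). q y) V"
   using Cons.prems by (intro trace_R[where q = "%x. \<Sum>y\<in>#Phis is x. q y"]) auto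
  then show "hol (%x. \<Sum>y\<in>#Phis (i # is) x. q y) V"
   by (simp add: sum_mset_Sum_mset)
 qed
qed

lemma Phis_cong:
 "set is \<inter> S = {} ==> (\<And>k. k \<notin> set is ==> x $ k = y $ k) ==> Phis is x = Phis is y"
proof (induction "is" arbitrary: x y)
 case Nil
 then have "x = y" by (simp add: vec_eq_iff)
 then show ?case by simp
next
 case (Cons i "is")
 have "R i x = R i y"
 proof (rule R_cong)
  show "i \<notin> S" using Cons.prems(1) by auto
  fix k assume "k \<in> S"
  then have "k \<notin> set (i # is)" using Cons.prems(1) by auto
  then show "x $ k = y $ k" by (rule Cons.prems(2))
 qed
 moreover have "Phis is (upd x i w) = Phis is (upd y i w)" for w
  by (rule Cons.IH) (use Cons.prems in auto)
 ultimately show ?case by simp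
qed

lemma count_Phis:
 "set is \<inter> S = {} ==> distinct is ==>
  count (Phis is x) y = (if \<forall>k. k \<notin> set is --> y $ k = x $ k then \<Prod>i\<in>set is. count (R i x) (y $ i) else 0)"
proof (induction "is" arbitrary: x)
 case Nil
 then show ?case by (auto simp: vec_eq_iff)
next
 case (Cons i "is")
 let ?P = "\<forall>k. k \<notin> set (i # is) --> y $ k = x $ k"
 have "count (Phis (i # is) x) y = (\<Sum>w\<in>#R i x. count (Phis is (upd x i w)) y)"
  by (simp add: count_Sum_mset)
 also have "\<dots> = (\<Sum>w\<in>#R i x. if w = y $ i then (if ?P then \<Prod>j\<in>set is. count (R j x) (y $ j) else 0) else 0)"
 proof (intro arg_cong[where f = sum_mset] image_mset_cong)
  fix w
  have "R j (upd x i w) = R j x" if "j \<in> set is" for j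
   using that Cons.prems by (intro R_upd) auto
  then show "count (Phis is (upd x i w)) y = (if w = y $ i then (if ?P then \<Prod>j\<in>set is. count (R j x) (y $ j) else 0) else 0)"
   using Cons.prems by (subst Cons.IH) (auto intro!: prod.cong)
 qed
 also have "\<dots> = (if ?P then count (R i x) (y $ i) * (\<Prod>j\<in>set is. count (R j x) (y $ j)) else 0)"
 proof -
  have "(\<Sum>w\<in>#N. if w = a then c else 0) = count N a * c" for N :: "complex multiset" and a and c :: nat
   by (induction N) auto
  then show ?thesis by auto
 qed
 finally have "count (Phis (i # is) x) y =
   (if ?P then count (R i x) (y $ i) * (\<Prod>j\<in>set is. count (R j x) (y $ j)) else 0)" .
 moreover have "(\<Prod>j\<in>set (i # is). count (R j x) (y $ j)) =
   count (R i x) (y $ i) * (\<Prod>j\<in>set is. count (R j x) (y $ j))"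
  using Cons.prems by simp
 ultimately show ?case by (simp only:)
qed

definition Phi :: "complex ^ 'm => (complex ^ 'm) multiset" where
 "Phi = Phis (SOME is. distinct is \<and> set is = - S)"

lemma trace_Phi: "trace_holomorphic Phi V V"
 and Phi_cong: "(\<And>k. k \<in> S ==> x $ k = y $ k) ==> Phi x = Phi y"
 and count_Phi: "count (Phi x) y = (if \<forall>k\<in>S. y $ k = x $ k then \<Prod>i\<in>-S. count (R i x) (y $ i) else 0)"
proof -
 have "\<exists>is. distinct is \<and> set is = - S" using finite_distinct_list[of "- S"] by auto
 then have *: "distinct (SOME is. distinct is \<and> set is = - S)" "set (SOME is. distinct is \<and> set is = - S) = - S"
  by (metis (mono_tags, lifting) someI_ex)+
 show "trace_holomorphic Phi V V" unfolding Phi_def by (rule trace_Phis) (use * in auto)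
 show "(\<And>k. k \<in> S ==> x $ k = y $ k) ==> Phi x = Phi y" unfolding Phi_def by (rule Phis_cong) (use * in auto)
 show "count (Phi x) y = (if \<forall>k\<in>S. y $ k = x $ k then \<Prod>i\<in>-S. count (R i x) (y $ i) else 0)"
  unfolding Phi_def by (subst count_Phis) (use * in auto)
qed

lemma set_Phi: "x \<in> V ==> set_mset (Phi x) = Z x"
proof -
 assume x: "x \<in> V"
 have "y \<in># Phi x \<longleftrightarrow> y \<in> Z x" for y
 proof -
  have "y \<in># Phi x \<longleftrightarrow> (\<forall>k\<in>S. y $ k = x $ k) \<and> (\<forall>i\<in>-S. y $ i \<in># R i x)"
   by (auto simp: count_greater_zero_iff[symmetric] count_Phi simp del: count_greater_zero_iff)
  also have "\<dots> \<longleftrightarrow> y \<in> Z x"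
  proof -
   have "f i (upd x i (y $ i)) = f i y" if "\<forall>k\<in>S. y $ k = x $ k" "i \<notin> S" for i
    using f_upd_cong[of i x y "y $ i"] that by simp
   then show ?thesis using x by (auto simp: Z_def D_def V_def R_props[OF x])
  qed
  finally show ?thesis .
 qed
 then show ?thesis by blast
qed

lemma finite_Z: "x \<in> V ==> finite (Z x)"
 using set_Phi[of x] by (metis finite_set_mset)

text \<open>\<open>generic_rank\<close> for the values of \<open>q\<close> on the fibre. Off the
  zeros of \<open>disc\<close> the weighted number of fibre points with \<open>q\<close> nonzero is
  constant, so that along a branch \<open>q\<close> cannot start to vanish.\<close>

lemma status_function:
 assumes "hol q V"
 shows "\<exists>disc a. hol disc V \<and> dep S disc \<and> (\<exists>x\<in>V. disc x \<noteq> 0) \<and>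
  (\<forall>x\<in>V. disc x \<noteq> 0 --> size (filter_mset (%y. q y \<noteq> 0) (Phi x)) = a)"
proof -
 define N where "N x = image_mset q (Phi x)" for x
 have "size (N x) \<le> size (Phi 0)" if "x \<in> V" for x
  using trace_holomorphic_size[OF trace_Phi V_topology(3) that V_topology(4)] by (simp add: N_def)
 then obtain k where k: "\<exists>x\<in>V. esym k (N x) \<noteq> 0"
  "\<And>x. x \<in> V ==> esym k (N x) \<noteq> 0 ==> size (filter_mset (%c. c \<noteq> 0) (N x)) = k"
  using generic_rank[OF V_topology(4), of N "size (Phi 0)"] by blast
 have "hol (%x. esym k (N x)) V"
  unfolding N_def by (rule trace_holomorphic_esym[OF trace_Phi assms])
 moreover have "dep S (%x. esym k (N x))"
  unfolding dep_def N_def using Phi_cong by metis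
 moreover have "size (filter_mset (%c. c \<noteq> 0) (N x)) = size (filter_mset (%y. q y \<noteq> 0) (Phi x))" for x
  by (simp add: N_def filter_mset_image_mset o_def)
 ultimately show ?thesis using k by (intro exI[of _ "%x. esym k (N x)"] exI[of _ k]) auto
qed

text \<open>\<open>generic_rank\<close> for the differences of roots: off the zeros of
  \<open>disc\<close> the sum of the squared multiplicities is constant, so roots neither merge nor
  split.\<close>

lemma discriminant_function:
 assumes i: "i \<notin> S"
 shows "\<exists>disc a. hol disc V \<and> dep S disc \<and> (\<exists>x\<in>V. disc x \<noteq> 0) \<and>
  (\<forall>x\<in>V. disc x \<noteq> 0 --> (\<Sum>t\<in>#R i x. count (R i x) t) = a)"
proof -
 define N where "N x = pair_diffs (R i x)" for x
 have tr: "hol (%x. \<Sum>t\<in>#R i x. t ^ j) V" for j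
  using trace_R[OF i, of "%x. (x $ i) ^ j"] by (simp add: hol_power hol_nth)
 have sizeR: "size (R i x) = size (R i 0)" if "x \<in> V" for x
 proof -
  have "trace_holomorphic (Phis [i]) V V" using i by (intro trace_Phis) auto
  from trace_holomorphic_size[OF this V_topology(3) that V_topology(4)]
  show ?thesis by (simp add: size_Sum_mset)
 qed
 have sizeN: "size (N x) = size (R i 0) * size (R i 0)" if "x \<in> V" for x
  unfolding N_def pair_diffs_def size_Sum_mset by (simp add: sizeR[OF that])
 then obtain k where k: "\<exists>x\<in>V. esym k (N x) \<noteq> 0"
  "\<And>x. x \<in> V ==> esym k (N x) \<noteq> 0 ==> size (filter_mset (%c. c \<noteq> 0) (N x)) = k"
  using generic_rank[OF V_topology(4), of N "size (R i 0) * size (R i 0)"] by fastforce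
 have "hol (%x. esym k (N x)) V"
  unfolding N_def
  by (rule hol_esym, unfold pair_diffs_power)
   (intro hol_sum hol_mult hol_const tr)
 moreover have "dep S (%x. esym k (N x))"
  unfolding dep_def N_def using R_cong[OF i] by metis
 moreover have "(\<Sum>t\<in>#R i x. count (R i x) t) = size (R i 0) * size (R i 0) - k"
  if "x \<in> V" "esym k (N x) \<noteq> 0" for x
 proof -
  have "size (N x) = size (filter_mset (%c. c = 0) (N x)) + size (filter_mset (%c. c \<noteq> 0) (N x))"
   by (metis multiset_partition size_union)
  then show ?thesis
   using k(2)[OF that] sizeN[OF that(1)] pair_diffs_zero[of "R i x"] by (simp add: N_def)
 qed
 ultimately show ?thesis using k by (intro exI[of _ "%x. esym k (N x)"] exI[of _ "size (R i 0) * size (R i 0) - k"]) auto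
qed

end

section \<open>Local branches and sheets away from the discriminant\<close>

lemma finite_pos_lower_bound:
 assumes "finite P" "\<And>p. p \<in> P ==> p > (0::real)"
 shows "\<exists>d>0. \<forall>p\<in>P. d < p"
proof (cases "P = {}")
 case True
 then show ?thesis by (intro exI[of _ 1]) auto
next
 case False
 then have "Min P > 0" using assms by simp
 moreover have "Min P / 2 < p" if "p \<in> P" for p
 proof -
  have "Min P \<le> p" by (rule Min_le[OF assms(1) that])
  then show ?thesis using \<open>Min P > 0\<close> by linarith
 qed
 ultimately show ?thesis by (intro exI[of _ "Min P / 2"]) auto
qed

text \<open>The nonzero set of the partial product is open and that of the next factor is dense, so
  they meet.\<close>

lemma prod_nonzero_exists:
 assumes "finite I" "open V" "convex V" "V \<noteq> {}"
  and "\<And>i. i \<in> I ==> hol (g i) V" "\<And>i. i \<in> I ==> \<exists>x\<in>V. g i x \<noteq> 0"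
 shows "\<exists>x\<in>V. (\<Prod>i\<in>I. g i x) \<noteq> 0"
 using assms(1,5,6)
proof (induction I rule: finite_induct)
 case empty
 then show ?case using assms(4) by auto
next
 case (insert i I)
 let ?h = "%x. \<Prod>i\<in>I. g i x"
 have "\<exists>x\<in>V. ?h x \<noteq> 0" using insert by auto
 then obtain x where x: "x \<in> V" "?h x \<noteq> 0" by blast
 obtain y where y: "y \<in> V" "g i y \<noteq> 0" using insert.prems(2)[of i] by blast
 have "hol ?h V" by (rule hol_prod) (use insert in auto)
 then have "open {x\<in>V. ?h x \<noteq> 0}" by (rule open_nonzero[OF _ assms(2)])
 moreover have "hol (g i) V" using insert by auto
 ultimately have "\<exists>z\<in>{x\<in>V. ?h x \<noteq> 0} \<inter> V. g i z \<noteq> 0"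
  using nonzero_dense[of "g i" V y x "{x\<in>V. ?h x \<noteq> 0}"] x y assms(2,3) by auto
 then show ?case using insert.hyps by auto
qed

lemma root_mset_partition:
 assumes fin: "finite {w\<in>ball c r. f w = 0}" and T: "{w\<in>ball c r. f w = 0} = (\<Union>t\<in>T. {w\<in>ball t h. f w = 0})"
  and "finite T" and dis: "\<And>s t. s \<in> T ==> t \<in> T ==> s \<noteq> t ==> ball s h \<inter> ball t h = {}"
 shows "root_mset f c r = (\<Sum>t\<in>T. root_mset f t h)"
 unfolding root_mset_def T
proof (rule sum.UNION_disjoint[OF \<open>finite T\<close>])
 show "\<forall>i\<in>T. finite {w \<in> ball i h. f w = 0}"
 proof
  fix i assume "i \<in> T"
  then have "{w \<in> ball i h. f w = 0} \<subseteq> {w\<in>ball c r. f w = 0}" unfolding T by blast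
  then show "finite {w \<in> ball i h. f w = 0}" using fin finite_subset by blast
 qed
 show "\<forall>i\<in>T. \<forall>j\<in>T. i \<noteq> j --> {w \<in> ball i h. f w = 0} \<inter> {w \<in> ball j h. f w = 0} = {}"
  using dis by blast
qed

context branched_cover
begin

lemma Z_iff: "x \<in> V ==> y \<in> Z x \<longleftrightarrow> (\<forall>k\<in>S. y $ k = x $ k) \<and> (\<forall>i. i \<notin> S --> y $ i \<in># R i x)"
proof -
 assume x: "x \<in> V"
 have "y \<in># Phi x \<longleftrightarrow> (\<forall>k\<in>S. y $ k = x $ k) \<and> (\<forall>i\<in>-S. y $ i \<in># R i x)"
  by (auto simp: count_greater_zero_iff[symmetric] count_Phi simp del: count_greater_zero_iff)
 then show ?thesis using set_Phi[OF x] by auto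
qed

abbreviation root_branches where
 "root_branches i x0 U tau \<equiv> open U \<and> x0 \<in> U \<and> U \<subseteq> V \<and>
   (\<forall>t. t \<in># R i x0 --> hol (tau t) U \<and> tau t x0 = t) \<and>
   (\<forall>x\<in>U. (\<forall>t. t \<in># R i x0 --> count (R i x) (tau t x) = count (R i x0) t) \<and>
    inj_on (%t. tau t x) (set_mset (R i x0)) \<and> set_mset (R i x) = (%t. tau t x) ` set_mset (R i x0))"

text \<open>Small disjoint discs about the roots over \<open>x0\<close> keep their numbers of roots.
  In each disc the sum of squared multiplicities is at most the square of this number, with equality
  at \<open>x0\<close>. The total being constant, equality persists, so each disc carries a single
  multiple root; it is the mean of the roots in the disc, a trace divided by a constant, and thus
  holomorphic.\<close>

lemma local_roots:
 assumes i: "i \<notin> S" and disc: "hol disc V"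
  and a: "\<And>x. x \<in> V ==> disc x \<noteq> 0 ==> (\<Sum>t\<in>#R i x. count (R i x) t) = a"
  and x0: "x0 \<in> V" "disc x0 \<noteq> 0"
 shows "\<exists>U tau. root_branches i x0 U tau"
proof -
 define T where "T = set_mset (R i x0)"
 have finT: "finite T" by (simp add: T_def)
 have T: "T = {w\<in>ball 0 r. f i (upd x0 i w) = 0}" unfolding T_def by (rule R_props(1)[OF x0(1) i])
 \<comment> \<open>A radius below all these numbers keeps the discs inside the disc of radius
   \<open>r\<close> and pairwise disjoint.\<close>
 define P where "P = (%t. r - cmod t) ` T \<union> (%(s, t). dist s t / 2) ` {(s, t) \<in> T \<times> T. s \<noteq> t}"
 have "finite {(s, t) \<in> T \<times> T. s \<noteq> t}"
  by (rule finite_subset[of _ "T \<times> T"]) (use finT in auto)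
 then have "finite P" "\<And>p. p \<in> P ==> p > 0" using finT by (auto simp: P_def T)
 from finite_pos_lower_bound[OF this]
 obtain h where h: "h > 0" "\<forall>p\<in>P. h < p" by blast
 have ht: "h < r - cmod t" if "t \<in> T" for t using h(2) that by (auto simp: P_def)
 have hst: "2 * h < dist s t" if "s \<in> T" "t \<in> T" "s \<noteq> t" for s t
 proof -
  have "(%(s, t). dist s t / 2) (s, t) \<in> P" unfolding P_def using that by blast
  then show ?thesis using h(2) by auto
 qed
 have sub_r: "cball t h \<subseteq> ball 0 r" if "t \<in> T" for t
 proof
  fix w assume "w \<in> cball t h"
  then have "cmod (w - t) \<le> h" by (simp add: dist_norm norm_minus_commute)
  then show "w \<in> ball 0 r" using ht[OF that] norm_triangle_ineq2[of w t] by simp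
 qed
 have dis: "cball s h \<inter> cball t h = {}" if "s \<in> T" "t \<in> T" "s \<noteq> t" for s t
 proof (rule ccontr)
  assume "\<not> ?thesis"
  then obtain w where "dist s w \<le> h" "dist t w \<le> h" by auto
  then show False using hst[OF that] dist_triangle2[of s t w] by simp
 qed
 have dis_ball: "ball s h \<inter> ball t h = {}" if "s \<in> T" "t \<in> T" "s \<noteq> t" for s t
  using dis[OF that] ball_subset_cball[of s h] ball_subset_cball[of t h] by blast
 \<comment> \<open>On the compact remainder of the disc the equation has no root over
   \<open>x0\<close>, hence none over nearby points.\<close>
 define K where "K = cball 0 r - (\<Union>t\<in>T. ball t h)"
 have "compact K" unfolding K_def by (intro compact_diff compact_cball open_UN ballI open_ball)
 have "upd x0 i w \<in> {y\<in>V. f i y \<noteq> 0}" if "w \<in> K" for w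
 proof -
  have w: "w \<in> cball 0 r" "w \<notin> T" using that h(1) by (auto simp: K_def)
  have "f i (upd x0 i w) \<noteq> 0"
  proof
   assume 0: "f i (upd x0 i w) = 0"
   then have "w \<notin> sphere 0 r" using nz_upd[OF x0(1) i] by blast
   then show False using w 0 T by auto
  qed
  then show ?thesis using upd_V[OF x0(1) i w(1)] by simp
 qed
 from upd_tube_at[OF open_nonzero[OF hol_fV[OF i] V_topology(1)] this \<open>compact K\<close>]
 obtain d1 where d1: "d1 > 0" "\<forall>x\<in>ball x0 d1. \<forall>w\<in>K. upd x i w \<in> {y\<in>V. f i y \<noteq> 0}" by blast
 have "open {x\<in>V. disc x \<noteq> 0}" by (rule open_nonzero[OF disc V_topology(1)])
 then obtain d2 where d2: "d2 > 0" "ball x0 d2 \<subseteq> {x\<in>V. disc x \<noteq> 0}"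
  using x0 open_contains_ball by blast
 define U where "U = ball x0 (min d1 d2)"
 have U: "open U" "x0 \<in> U" "connected U" using d1 d2 by (auto simp: U_def)
 have UV: "x \<in> V" "disc x \<noteq> 0" if "x \<in> U" for x using d2(2) that by (auto simp: U_def)
 have nzK: "f i (upd x i w) \<noteq> 0" if "x \<in> U" "w \<in> K" for x w using d1(2) that by (auto simp: U_def)
 have sphK: "w \<in> K" if "t \<in> T" "w \<in> sphere t h" for t w
 proof -
  have "w \<in> cball t h" using that by auto
  then have "w \<in> ball 0 r" using sub_r[OF that(1)] by blast
  moreover have "w \<notin> ball s h" if s: "s \<in> T" for s
  proof (cases "s = t")
   case False
   have "w \<notin> cball s h"
    using dis[OF s \<open>t \<in> T\<close> False] \<open>w \<in> cball t h\<close> by blast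
   then show ?thesis using ball_subset_cball by blast
  qed (use \<open>w \<in> sphere t h\<close> in auto)
  ultimately show ?thesis by (auto simp: K_def)
 qed
 define Rt where "Rt t x = root_mset (%w. f i (upd x i w)) t h" for t x
 have Rt_hol: "hol (%x. \<Sum>w\<in>#Rt t x. q (upd x i w)) U" if "t \<in> T" "hol q V" for t q
  unfolding Rt_def
 proof (rule hol_trace[OF hol_fV[OF i] that(2) V_topology(1) U(1) h(1)])
  fix x w assume x: "x \<in> U"
  show "upd x i w \<in> V" if "w \<in> cball t h"
   using upd_V[OF UV(1)[OF x] i] that sub_r[OF \<open>t \<in> T\<close>] ball_subset_cball by blast
  show "f i (upd x i w) \<noteq> 0" if "w \<in> sphere t h"
   using nzK[OF x sphK[OF \<open>t \<in> T\<close> that]] .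
 qed
 have zeros: "{w\<in>ball 0 r. f i (upd x i w) = 0} = (\<Union>t\<in>T. {w\<in>ball t h. f i (upd x i w) = 0})" if "x \<in> U" for x
 proof (intro equalityI subsetI)
  fix w assume w: "w \<in> {w\<in>ball 0 r. f i (upd x i w) = 0}"
  then have "w \<notin> K" using nzK[OF that] by blast
  then show "w \<in> (\<Union>t\<in>T. {w\<in>ball t h. f i (upd x i w) = 0})"
   using w by (auto simp: K_def)
 next
  fix w assume "w \<in> (\<Union>t\<in>T. {w\<in>ball t h. f i (upd x i w) = 0})"
  then obtain t where "t \<in> T" "w \<in> ball t h" "f i (upd x i w) = 0" by blast
  then show "w \<in> {w\<in>ball 0 r. f i (upd x i w) = 0}"
   using subsetD[OF sub_r, of t w] by simp
 qed
 have R_sum: "R i x = (\<Sum>t\<in>T. Rt t x)" if "x \<in> U" for x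
  unfolding R_def Rt_def
  by (rule root_mset_partition[OF R_props(2)[OF UV(1)[OF that] i] zeros[OF that] finT])
   (use dis_ball in blast)
 have set_Rt: "set_mset (Rt t x) = {w\<in>ball t h. f i (upd x i w) = 0}" if "x \<in> U" "t \<in> T" for x t
  unfolding Rt_def
 proof (rule root_mset_props(2)[where S = "{w. upd x i w \<in> V}"])
  show "(%w. f i (upd x i w)) holomorphic_on {w. upd x i w \<in> V}"
   by (rule holomorphic_on_upd[OF hol_fV[OF i]]) simp
  show "open {w. upd x i w \<in> V}" by (rule open_upd_preimage[OF V_topology(1)])
  show "cball t h \<subseteq> {w. upd x i w \<in> V}"
   using upd_V[OF UV(1)[OF that(1)] i] sub_r[OF that(2)] ball_subset_cball by blast
  show "\<And>w. w \<in> sphere t h ==> f i (upd x i w) \<noteq> 0" using nzK[OF that(1)] sphK[OF that(2)] by blast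
 qed (rule h(1))
 have sizeRt: "size (Rt t x) = size (Rt t x0)" if "t \<in> T" "x \<in> U" for t x
 proof -
  have "trace_holomorphic (%x. image_mset (upd x i) (Rt t x)) U V"
   using Rt_hol[OF that(1)] by (simp add: trace_holomorphic_def image_mset.compositionality o_def)
  from trace_holomorphic_size[OF this U(3) that(2) U(2)] show ?thesis by simp
 qed
 have disj: "set_mset (Rt s x) \<inter> set_mset (Rt t x) = {}" if "x \<in> U" "s \<in> T" "t \<in> T" "s \<noteq> t" for x s t
  using dis_ball[OF that(2-4)] set_Rt[OF that(1)] that(2,3) by blast
 have t_in: "set_mset (Rt t x0) = {t}" if "t \<in> T" for t
 proof -
  have "t \<in> set_mset (Rt t x0)" using set_Rt[OF U(2) that] h(1) that T by auto
  moreover have "w = t" if w: "w \<in> set_mset (Rt t x0)" for w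
  proof (rule ccontr)
   assume "w \<noteq> t"
   have w': "w \<in> ball t h" "f i (upd x0 i w) = 0" using w set_Rt[OF U(2) \<open>t \<in> T\<close>] by auto
   then have "w \<in> T" using sub_r[OF \<open>t \<in> T\<close>] ball_subset_cball unfolding T by blast
   then show False using hst[OF _ \<open>t \<in> T\<close> \<open>w \<noteq> t\<close>] w'(1) h(1) by (simp add: dist_commute)
  qed
  ultimately show ?thesis by blast
 qed
 define m where "m t = size (Rt t x0)" for t
 have mpos: "m t > 0" if "t \<in> T" for t
  using t_in[OF that] by (auto simp: m_def nonempty_has_size[symmetric])
 have R0: "Rt t x0 = replicate_mset (m t) t" if "t \<in> T" for t
  using t_in[OF that] set_mset_subset_singletonD[of "Rt t x0" t] by (simp add: m_def)
 have z_eq: "(\<Sum>w\<in>#Rt t x. count (Rt t x) w) = m t * m t" if t: "t \<in> T" and x: "x \<in> U" for t x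
 proof (rule ccontr)
  assume ne: "\<not> ?thesis"
  have le: "(\<Sum>w\<in>#Rt t x. count (Rt t x) w) \<le> m t * m t" if "t \<in> T" for t
   using sum_count_le[of "Rt t x"] sizeRt[OF that x] by (simp add: m_def)
  have "(\<Sum>t\<in>T. \<Sum>w\<in>#Rt t x. count (Rt t x) w) < (\<Sum>t\<in>T. m t * m t)"
   by (rule sum_strict_mono_ex1[OF finT]) (use le ne t in "auto intro: le_neq_implies_less")
  moreover have "(\<Sum>t\<in>T. \<Sum>w\<in>#Rt t x. count (Rt t x) w) = a"
   using sum_count_disjoint[OF finT, of "%t. Rt t x"] disj[OF x] R_sum[OF x] a[OF UV[OF x]] by simp
  moreover have "(\<Sum>t\<in>T. m t * m t) = (\<Sum>t\<in>T. \<Sum>w\<in>#Rt t x0. count (Rt t x0) w)"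
   by (rule sum.cong) (simp_all add: R0)
  moreover have "\<dots> = a"
   using sum_count_disjoint[OF finT, of "%t. Rt t x0"] disj[OF U(2)] R_sum[OF U(2)] a[OF x0] by simp
  ultimately show False by simp
 qed
 define tau where "tau t x = (\<Sum>w\<in>#Rt t x. w) / of_nat (m t)" for t x
 have Rrep: "Rt t x = replicate_mset (m t) (tau t x)" if t: "t \<in> T" and x: "x \<in> U" for t x
 proof -
  have sz: "size (Rt t x) = m t" using sizeRt[OF t x] by (simp add: m_def)
  then obtain w where w: "w \<in># Rt t x" using mpos[OF t] by (metis size_eq_0_iff_empty multiset_nonemptyE less_irrefl)
  have "Rt t x = replicate_mset (m t) w"
   using sum_count_eq_square[OF _ w] z_eq[OF t x] sz by simp
  moreover from this have "tau t x = w" using mpos[OF t] by (simp add: tau_def)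
  ultimately show ?thesis by simp
 qed
 have tau_ball: "tau t x \<in> ball t h" if t: "t \<in> T" and x: "x \<in> U" for t x
 proof -
  have "tau t x \<in># Rt t x" by (subst Rrep[OF t x]) (use mpos[OF t] in simp)
  then show ?thesis using set_Rt[OF x t] by blast
 qed
 have inj: "inj_on (%t. tau t x) T" if x: "x \<in> U" for x
 proof (rule inj_onI, rule ccontr)
  fix s t assume "s \<in> T" "t \<in> T" "tau s x = tau t x" "s \<noteq> t"
  then show False
   using tau_ball[OF _ x, of s] tau_ball[OF _ x, of t] dis_ball[of s t] by auto
 qed
 have cnt: "count (R i x) (tau t x) = m t" if t: "t \<in> T" and x: "x \<in> U" for t x
 proof -
  have "count (R i x) (tau t x) = (\<Sum>s\<in>T. count (Rt s x) (tau t x))"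
   by (simp add: R_sum[OF x] count_sum)
  also have "\<dots> = (\<Sum>s\<in>T. if s = t then m t else 0)"
   by (rule sum.cong[OF refl]) (use inj_onD[OF inj[OF x]] t in "auto simp: Rrep[OF _ x]")
  also have "\<dots> = m t" using finT t by simp
  finally show ?thesis .
 qed
 have tau0: "tau t x0 = t" if "t \<in> T" for t
  using mpos[OF that] by (simp add: tau_def R0[OF that])
 have tau_hol: "hol (tau t) U" if t: "t \<in> T" for t
 proof -
  have "hol (%x. (\<Sum>w\<in>#Rt t x. upd x i w $ i) / of_nat (m t)) U"
   by (intro hol_divide hol_const Rt_hol[OF t, of "%x. x $ i"] hol_nth)
    (use mpos[OF t] in simp)
  then show ?thesis by (simp add: tau_def[abs_def])
 qed
 show ?thesis
 proof (intro exI[of _ U] exI[of _ tau] conjI ballI allI impI)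
  show "U \<subseteq> V" using UV by blast
  fix x assume x: "x \<in> U"
  show "inj_on (%t. tau t x) (set_mset (R i x0))" using inj[OF x] by (simp add: T_def)
  have "set_mset (R i x) = (\<Union>t\<in>T. set_mset (Rt t x))"
   by (simp add: R_sum[OF x] set_mset_sum[OF finT])
  also have "\<dots> = (%t. tau t x) ` T"
   using mpos by (auto simp: Rrep[OF _ x] split: if_splits)
  finally show "set_mset (R i x) = (%t. tau t x) ` set_mset (R i x0)" by (simp add: T_def)
  fix t assume "t \<in># R i x0"
  then have t: "t \<in> T" by (simp add: T_def)
  show "count (R i x) (tau t x) = count (R i x0) t"
   using cnt[OF t x] cnt[OF t U(2)] tau0[OF t] by simp
 qed (use U tau0 tau_hol in "auto simp: T_def")
qed

abbreviation local_sheets where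
 "local_sheets Q x0 U sig \<equiv> open U \<and> x0 \<in> U \<and> U \<subseteq> V \<and>
   (\<forall>y\<in>Z x0. holomorphic_map (sig y) U \<and> sig y x0 = y \<and> (\<forall>x\<in>U. \<forall>q\<in>Q. q (sig y x) = 0 \<longleftrightarrow> q y = 0)) \<and>
   (\<forall>x\<in>U. inj_on (%y. sig y x) (Z x0) \<and> Z x = (%y. sig y x) ` Z x0)"

text \<open>\<open>disc\<close> is the product of one discriminant for every dependent coordinate
  and one status function for every \<open>q\<close> in \<open>Q\<close>. Where it is nonzero,
  choosing a branch in each coordinate gives the sections of the fibre.\<close>

theorem sheets:
 assumes "finite Q" and hol_q: "\<And>q. q \<in> Q ==> hol q V"
 shows "\<exists>disc. hol disc V \<and> dep S disc \<and> (\<exists>x\<in>V. disc x \<noteq> 0) \<and>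
  (\<forall>x0\<in>V. disc x0 \<noteq> 0 --> (\<exists>U sig. local_sheets Q x0 U sig))"
proof -
 have "\<forall>i\<in>-S. \<exists>disc a. hol disc V \<and> dep S disc \<and> (\<exists>x\<in>V. disc x \<noteq> 0) \<and>
  (\<forall>x\<in>V. disc x \<noteq> 0 --> (\<Sum>t\<in>#R i x. count (R i x) t) = a)"
  using discriminant_function by blast
 then obtain disc1 where "\<forall>i\<in>-S. \<exists>a. hol (disc1 i) V \<and> dep S (disc1 i) \<and> (\<exists>x\<in>V. disc1 i x \<noteq> 0) \<and>
  (\<forall>x\<in>V. disc1 i x \<noteq> 0 --> (\<Sum>t\<in>#R i x. count (R i x) t) = a)"
  by (rule bchoice[THEN exE]) blast
 then obtain a1 where d1: "\<forall>i\<in>-S. hol (disc1 i) V \<and> dep S (disc1 i) \<and> (\<exists>x\<in>V. disc1 i x \<noteq> 0) \<and>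
  (\<forall>x\<in>V. disc1 i x \<noteq> 0 --> (\<Sum>t\<in>#R i x. count (R i x) t) = a1 i)"
  by (rule bchoice[THEN exE]) blast
 have "\<forall>q\<in>Q. \<exists>disc a. hol disc V \<and> dep S disc \<and> (\<exists>x\<in>V. disc x \<noteq> 0) \<and>
  (\<forall>x\<in>V. disc x \<noteq> 0 --> size (filter_mset (%y. q y \<noteq> 0) (Phi x)) = a)"
  using status_function hol_q by blast
 then obtain disc2 where "\<forall>q\<in>Q. \<exists>a. hol (disc2 q) V \<and> dep S (disc2 q) \<and> (\<exists>x\<in>V. disc2 q x \<noteq> 0) \<and>
  (\<forall>x\<in>V. disc2 q x \<noteq> 0 --> size (filter_mset (%y. q y \<noteq> 0) (Phi x)) = a)"
  by (rule bchoice[THEN exE]) blast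
 then obtain a2 where d2: "\<forall>q\<in>Q. hol (disc2 q) V \<and> dep S (disc2 q) \<and> (\<exists>x\<in>V. disc2 q x \<noteq> 0) \<and>
  (\<forall>x\<in>V. disc2 q x \<noteq> 0 --> size (filter_mset (%y. q y \<noteq> 0) (Phi x)) = a2 q)"
  by (rule bchoice[THEN exE]) blast
 define g where "g = case_sum disc1 disc2"
 define I where "I = Inl ` (- S) \<union> Inr ` Q"
 have g: "hol (g j) V" "dep S (g j)" "\<exists>x\<in>V. g j x \<noteq> 0" if "j \<in> I" for j
  using that d1 d2 by (auto simp: I_def g_def)
 have finI: "finite I" using \<open>finite Q\<close> by (simp add: I_def)
 define disc where "disc x = (\<Prod>j\<in>I. g j x)" for x
 show ?thesis
 proof (intro exI[of _ disc] conjI ballI impI)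
  show "hol disc V"
   unfolding disc_def by (rule hol_prod) (rule g)
  have "g j x = g j y" if "j \<in> I" "\<forall>k\<in>S. x $ k = y $ k" for j x y
   using g(2)[OF that(1)] that(2) by (simp add: dep_def)
  then show "dep S disc" unfolding dep_def disc_def by (auto intro!: prod.cong)
  show "\<exists>x\<in>V. disc x \<noteq> 0"
   unfolding disc_def by (rule prod_nonzero_exists[OF finI V_topology(1,2)]) (use V_topology g in auto)
  fix x0 assume x0: "x0 \<in> V" "disc x0 \<noteq> 0"
  have nz: "g j x0 \<noteq> 0" if "j \<in> I" for j
   using x0(2) that finI by (auto simp: disc_def)
  have "\<forall>i\<in>-S. \<exists>U tau. root_branches i x0 U tau"
  proof
   fix i assume i: "i \<in> - S"
   have "disc1 i x0 \<noteq> 0" using nz[of "Inl i"] i by (simp add: I_def g_def)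
   then show "\<exists>U tau. root_branches i x0 U tau"
    using d1 i x0(1) by (intro local_roots[of i "disc1 i" "a1 i"]) auto
  qed
  then obtain Ui where "\<forall>i\<in>-S. \<exists>tau. open (Ui i) \<and> x0 \<in> Ui i \<and> Ui i \<subseteq> V \<and> (\<forall>t. t \<in># R i x0 --> hol (tau t) (Ui i) \<and> tau t x0 = t) \<and>
   (\<forall>x\<in>Ui i. (\<forall>t. t \<in># R i x0 --> count (R i x) (tau t x) = count (R i x0) t) \<and>
    inj_on (%t. tau t x) (set_mset (R i x0)) \<and> set_mset (R i x) = (%t. tau t x) ` set_mset (R i x0))"
   by (rule bchoice[THEN exE]) blast
  then obtain tau where tau: "\<forall>i\<in>-S. open (Ui i) \<and> x0 \<in> Ui i \<and> Ui i \<subseteq> V \<and> (\<forall>t. t \<in># R i x0 --> hol (tau i t) (Ui i) \<and> tau i t x0 = t) \<and>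
   (\<forall>x\<in>Ui i. (\<forall>t. t \<in># R i x0 --> count (R i x) (tau i t x) = count (R i x0) t) \<and>
    inj_on (%t. tau i t x) (set_mset (R i x0)) \<and> set_mset (R i x) = (%t. tau i t x) ` set_mset (R i x0))"
   by (rule bchoice[THEN exE]) blast
  have tau_dom: "open (Ui i)" "x0 \<in> Ui i" if "i \<notin> S" for i
   using tau that by blast+
  have tau_hol: "hol (tau i t) (Ui i)" "tau i t x0 = t" if "i \<notin> S" "t \<in># R i x0" for i t
   using tau that by blast+
  have tau_cnt: "count (R i x) (tau i t x) = count (R i x0) t" if "i \<notin> S" "x \<in> Ui i" "t \<in># R i x0" for i t x
   using tau that by blast
  have tau_inj: "inj_on (%t. tau i t x) (set_mset (R i x0))"
   and tau_set: "set_mset (R i x) = (%t. tau i t x) ` set_mset (R i x0)" if "i \<notin> S" "x \<in> Ui i" for i x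
   using tau that by blast+
  define U0 where "U0 = V \<inter> {x\<in>V. disc x \<noteq> 0} \<inter> (\<Inter>i\<in>-S. Ui i)"
  have "open {x\<in>V. disc x \<noteq> 0}"
   by (rule open_nonzero[OF \<open>hol disc V\<close> V_topology(1)])
  moreover have "open (\<Inter>i\<in>-S. Ui i)" by (rule open_INT) (use tau_dom in auto)
  ultimately have U0: "open U0" "x0 \<in> U0"
   using tau_dom V_topology(1) x0 unfolding U0_def by (auto intro!: open_Int)
  have U0V: "U0 \<subseteq> V" by (auto simp: U0_def)
  define sig where "sig y x = (\<chi> k. if k \<in> S then x $ k else tau k (y $ k) x)" for y x :: "complex ^ 'm"
  have sig_hol: "holomorphic_map (sig y) U0" if y: "y \<in> Z x0" for y
   unfolding holomorphic_map_def
  proof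
   fix k show "hol (%x. sig y x $ k) U0"
   proof (cases "k \<in> S")
    case False
    then have "y $ k \<in># R k x0" using y Z_iff[OF x0(1)] by blast
    then have "hol (tau k (y $ k)) (Ui k)" by (rule tau_hol(1)[OF False])
    moreover have "U0 \<subseteq> Ui k" using False by (auto simp: U0_def)
    ultimately show ?thesis using False hol_subset by (auto simp: sig_def)
   qed (auto simp: sig_def hol_nth)
  qed
  have sig0: "sig y x0 = y" if y: "y \<in> Z x0" for y
  proof -
   have "sig y x0 $ k = y $ k" for k
    using y tau_hol(2) unfolding Z_iff[OF x0(1)] by (cases "k \<in> S") (simp_all add: sig_def)
   then show ?thesis by (simp add: vec_eq_iff)
  qed
  have Zx: "Z x = (%y. sig y x) ` Z x0" if x: "x \<in> U0" for x
  proof -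
   have xV: "x \<in> V" using x U0V by blast
   have R: "set_mset (R k x) = (%t. tau k t x) ` set_mset (R k x0)" if "k \<notin> S" for k
    by (rule tau_set[OF that]) (use x that in "auto simp: U0_def")
   have "sig y x \<in> Z x" if "y \<in> Z x0" for y
    using that unfolding Z_iff[OF x0(1)] Z_iff[OF xV] by (auto simp: sig_def R)
   moreover have "z \<in> (%y. sig y x) ` Z x0" if z: "z \<in> Z x" for z
   proof -
    have "\<forall>k. \<exists>t. k \<notin> S --> t \<in># R k x0 \<and> z $ k = tau k t x"
     using z R unfolding Z_iff[OF xV] by (metis imageE)
    then obtain t where t: "\<And>k. k \<notin> S ==> t k \<in># R k x0 \<and> z $ k = tau k (t k) x" by metis
    define y where "y = (\<chi> k. if k \<in> S then x0 $ k else t k)"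
    have "y \<in> Z x0" unfolding Z_iff[OF x0(1)] by (auto simp: y_def t)
    moreover have "z = sig y x"
     using z t unfolding Z_iff[OF xV] by (auto simp: vec_eq_iff sig_def y_def)
    ultimately show ?thesis by blast
   qed
   ultimately show ?thesis by blast
  qed
  have inj: "inj_on (%y. sig y x) (Z x0)" if x: "x \<in> U0" for x
  proof (rule inj_onI)
   fix y y' assume yy: "y \<in> Z x0" "y' \<in> Z x0" "sig y x = sig y' x"
   have "y $ k = y' $ k" for k
   proof (cases "k \<in> S")
    case True
    then show ?thesis using yy(1,2) unfolding Z_iff[OF x0(1)] by auto
   next
    case False
    then have "inj_on (%t. tau k t x) (set_mset (R k x0))"
     by (rule tau_inj) (use x False in "auto simp: U0_def")
    moreover have "tau k (y $ k) x = tau k (y' $ k) x"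
     using arg_cong[OF yy(3), of "%v. v $ k"] False by (simp add: sig_def)
    moreover have "y $ k \<in># R k x0" "y' $ k \<in># R k x0"
     using yy(1,2) False unfolding Z_iff[OF x0(1)] by auto
    ultimately show ?thesis by (auto dest: inj_onD)
   qed
   then show "y = y'" by (simp add: vec_eq_iff)
  qed
  have cnt: "count (Phi x) (sig y x) = count (Phi x0) y" if x: "x \<in> U0" and y: "y \<in> Z x0" for x y
  proof -
   have *: "\<forall>k\<in>S. y $ k = x0 $ k" "\<And>i. i \<notin> S ==> y $ i \<in># R i x0"
    using y unfolding Z_iff[OF x0(1)] by auto
   have "count (R i x) (sig y x $ i) = count (R i x0) (y $ i)" if "i \<in> - S" for i
    using tau_cnt[of i x "y $ i"] that x *(2) by (auto simp: sig_def U0_def)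
   moreover have "\<forall>k\<in>S. sig y x $ k = x $ k" by (simp add: sig_def)
   ultimately show ?thesis using *(1) unfolding count_Phi by simp
  qed
  have inD: "sig y x \<in> V" if "x \<in> U0" "y \<in> Z x0" for x y
   using Zx[OF that(1)] that(2) D_topology(5) by (auto simp: Z_def)
  define J where "J = {p\<in>Q \<times> Z x0. fst p (snd p) \<noteq> 0}"
  have finJ: "finite J" unfolding J_def using \<open>finite Q\<close> finite_Z[OF x0(1)] by auto
  define U where "U = U0 \<inter> (\<Inter>p\<in>J. {x\<in>U0. fst p (sig (snd p) x) \<noteq> 0})"
  have "open {x\<in>U0. q (sig y x) \<noteq> 0}" if "q \<in> Q" "y \<in> Z x0" for q y
   by (rule open_nonzero[OF _ U0(1)])
    (rule hol_compose[OF hol_q[OF that(1)] sig_hol[OF that(2)] inD[OF _ that(2)]])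
  then have "open (\<Inter>p\<in>J. {x\<in>U0. fst p (sig (snd p) x) \<noteq> 0})"
   by (intro open_INT finJ) (auto simp: J_def)
  then have U: "open U" "x0 \<in> U"
   using U0 sig0 by (auto simp: U_def J_def intro!: open_Int)
  have UU0: "U \<subseteq> U0" by (auto simp: U_def)
  \<comment> \<open>The weighted count of sections with \<open>q\<close> nonzero is
    \<open>a2 q\<close> both at \<open>x\<close> and at \<open>x0\<close>. Nonvanishing at
    \<open>x0\<close> persists on \<open>U\<close>, so one index set contains the other; as the
    weights are positive, equal sums make the sets equal.\<close>
  have status: "q (sig y x) = 0 \<longleftrightarrow> q y = 0" if x: "x \<in> U" and q: "q \<in> Q" and y: "y \<in> Z x0" for x q y
  proof -
   have xU0: "x \<in> U0" "x \<in> V" using x UU0 U0V by auto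
   define c where "c y = count (Phi x0) y" for y
   have cpos: "c y > 0" if "y \<in> Z x0" for y
    using set_Phi[OF x0(1)] that by (simp add: c_def)
   have "disc2 q z \<noteq> 0" if "z \<in> U0" for z
   proof -
    have "g (Inr q) z \<noteq> 0"
     using that q finI by (auto simp: U0_def disc_def I_def)
    then show ?thesis by (simp add: g_def)
   qed
   then have a: "size (filter_mset (%y. q y \<noteq> 0) (Phi z)) = a2 q" if "z \<in> U0" for z
    using d2 q that U0V by blast
   have "a2 q = (\<Sum>z\<in>{z\<in>Z x. q z \<noteq> 0}. count (Phi x) z)"
    using set_Phi[OF xU0(2)] by (simp add: a[OF xU0(1), symmetric] size_multiset_overloaded_eq)
   also have "{z\<in>Z x. q z \<noteq> 0} = (%y. sig y x) ` {y\<in>Z x0. q (sig y x) \<noteq> 0}"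
    using Zx[OF xU0(1)] by auto
   also have "(\<Sum>z\<in>\<dots>. count (Phi x) z) = (\<Sum>y\<in>{y\<in>Z x0. q (sig y x) \<noteq> 0}. count (Phi x) (sig y x))"
    by (subst sum.reindex) (auto intro: inj_on_subset[OF inj[OF xU0(1)]])
   also have "\<dots> = (\<Sum>y\<in>{y\<in>Z x0. q (sig y x) \<noteq> 0}. c y)"
    by (rule sum.cong) (auto simp: c_def cnt[OF xU0(1)])
   finally have 1: "a2 q = (\<Sum>y\<in>{y\<in>Z x0. q (sig y x) \<noteq> 0}. c y)" .
   have 2: "a2 q = (\<Sum>y\<in>{y\<in>Z x0. q y \<noteq> 0}. c y)"
    using set_Phi[OF x0(1)] by (simp add: a[OF U0(2), symmetric] size_multiset_overloaded_eq c_def)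
   have sub: "{y\<in>Z x0. q y \<noteq> 0} \<subseteq> {y\<in>Z x0. q (sig y x) \<noteq> 0}"
    using x q by (auto simp: U_def J_def)
   have "{y\<in>Z x0. q (sig y x) \<noteq> 0} \<subseteq> {y\<in>Z x0. q y \<noteq> 0}"
   proof (rule ccontr)
    assume "\<not> ?thesis"
    then obtain b where b: "b \<in> {y\<in>Z x0. q (sig y x) \<noteq> 0} - {y\<in>Z x0. q y \<noteq> 0}" by blast
    have "(\<Sum>y\<in>{y\<in>Z x0. q y \<noteq> 0}. c y) < (\<Sum>y\<in>{y\<in>Z x0. q (sig y x) \<noteq> 0}. c y)"
     by (rule sum_strict_mono2[OF _ sub b]) (use finite_Z[OF x0(1)] cpos b in auto)
    then show False using 1 2 by simp
   qed
   then show ?thesis using sub y by blast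
  qed
  show "\<exists>U sig. local_sheets Q x0 U sig"
  proof (intro exI[of _ U] exI[of _ sig] conjI ballI)
   show "U \<subseteq> V" using UU0 U0V by blast
   fix y assume y: "y \<in> Z x0"
   show "holomorphic_map (sig y) U"
    using sig_hol[OF y] UU0 hol_subset unfolding holomorphic_map_def by blast
  qed (use U sig0 status inj Zx UU0 in auto)
 qed
qed

end

section \<open>Existence of branched coverings and continuity of their fibres\<close>

lemma norm_lt_sum_components:
 fixes x :: "complex ^ 'm"
 assumes "\<And>k. cmod (x $ k) \<le> c" "real CARD('m) * c < m"
 shows "norm x < m"
proof -
 have "norm x \<le> (\<Sum>k\<in>UNIV. cmod (x $ k))" unfolding norm_vec_def by (rule L2_set_le_sum) simp
 also have "\<dots> \<le> (\<Sum>k\<in>(UNIV::'m set). c)" by (intro sum_mono assms)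
 also have "\<dots> < m" using assms(2) by simp
 finally show ?thesis .
qed

text \<open>The equations are the eliminants for the single dependent coordinates. The radii are
  chosen in order: \<open>r1\<close> within the range where every eliminant is nonzero on its
  punctured axis, \<open>r\<close> as half of it, and \<open>rho\<close> so small that no root
  reaches the circle of radius \<open>r\<close>.\<close>

lemma branched_cover_exists:
 fixes F :: "(complex ^ 'm => complex) set"
 assumes "finite F" "e > 0" and hol: "\<And>f. f \<in> F ==> hol f (ball 0 e)"
  and iso: "\<And>x. x \<in> ball 0 e ==> (\<forall>k\<in>S. x $ k = 0) ==> (\<forall>f\<in>F. f x = 0) ==> x = 0"
 shows "\<exists>rho r r1 f. branched_cover S f rho r r1 \<and> branched_cover.V S rho r1 \<subseteq> ball 0 e \<and>
  (\<forall>x\<in>branched_cover.V S rho r1. (\<forall>g\<in>F. g x = 0) --> (\<forall>i. i \<notin> S --> f i x = 0))"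
proof -
 have "\<forall>i\<in>-S. \<exists>g d b. eliminates F S i e g d b"
 proof
  fix i assume i: "i \<in> - S"
  show "\<exists>g d b. eliminates F S i e g d b"
  proof (rule elimination[where J = "UNIV - insert i S"])
   show "dep (insert i S \<union> (UNIV - insert i S)) f" for f :: "complex ^ 'm => complex"
    by (auto simp: dep_def vec_eq_iff[symmetric])
   show "x $ k = 0" if "x \<in> ball 0 e" "\<forall>k\<in>S. x $ k = 0" "\<forall>f\<in>F. f x = 0" for x k
    using iso[OF that] by simp
  qed (use assms i in auto)
 qed
 then obtain g where "\<forall>i\<in>-S. \<exists>d b. eliminates F S i e (g i) d b"
  by (rule bchoice[THEN exE]) blast
 then obtain d where "\<forall>i\<in>-S. \<exists>b. eliminates F S i e (g i) (d i) b"
  by (rule bchoice[THEN exE]) blast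
 then obtain b where gdb: "\<forall>i\<in>-S. eliminates F S i e (g i) (d i) (b i)"
  by (rule bchoice[THEN exE]) blast
 have g_hol: "hol (g i) (ball 0 (d i))" and g_dep: "dep (insert i S) (g i)"
  and g_zero: "\<And>x. x\<in>ball 0 (d i) ==> (\<forall>f\<in>F. f x = 0) ==> g i x = 0" if "i \<notin> S" for i
  using gdb that by blast+
 have "\<forall>i\<in>-S. \<exists>r>0. r \<le> d i \<and> (\<forall>w. 0 < cmod w \<and> cmod w < r --> g i (axis i w) \<noteq> 0)"
  using gdb axis_regular by blast
 then obtain ra where ra: "\<forall>i\<in>-S. ra i > 0 \<and> ra i \<le> d i \<and> (\<forall>w. 0 < cmod w \<and> cmod w < ra i --> g i (axis i w) \<noteq> 0)"
  by (rule bchoice[THEN exE]) blast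
 have "\<exists>m>0. \<forall>p\<in>insert e (ra ` (- S)). m < p"
  by (rule finite_pos_lower_bound) (use ra \<open>e > 0\<close> in auto)
 then obtain m where m: "m > 0" "m < e" "\<And>i. i \<notin> S ==> m < ra i" by auto
 define r1 where "r1 = m / (real CARD('m) + 1)"
 have r1: "r1 > 0" "real CARD('m) * r1 < m" using m(1) by (simp_all add: r1_def divide_simps add_nonneg_pos)
 have "r1 \<le> m" unfolding r1_def using m(1) by (simp add: divide_simps add_nonneg_pos)
 define r where "r = r1 / 2"
 have r: "0 < r" "r < r1" using r1 by (auto simp: r_def)
 have "\<forall>i\<in>-S. \<exists>c>0. \<forall>x. (\<forall>k. k \<noteq> i --> cmod (x $ k) < c) --> (\<forall>w\<in>sphere 0 r. upd x i w \<in> {x\<in>ball 0 (d i). g i x \<noteq> 0})"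
 proof
  fix i assume i: "i \<in> - S"
  have i': "i \<notin> S" using i by simp
  have *: "axis i w \<in> {x\<in>ball 0 (d i). g i x \<noteq> 0}" if "w \<in> sphere 0 r" for w
  proof -
   have "cmod w < ra i" "0 < cmod w" using that r \<open>r1 \<le> m\<close> m(3)[of i] i by auto
   then show ?thesis using ra i by force
  qed
  show "\<exists>c>0. \<forall>x. (\<forall>k. k \<noteq> i --> cmod (x $ k) < c) --> (\<forall>w\<in>sphere 0 r. upd x i w \<in> {x\<in>ball 0 (d i). g i x \<noteq> 0})"
   by (rule upd_tube[OF open_nonzero[OF g_hol[OF i'] open_ball] * compact_sphere])
 qed
 then obtain c where c: "\<forall>i\<in>-S. c i > 0 \<and> (\<forall>x. (\<forall>k. k \<noteq> i --> cmod (x $ k) < c i) --> (\<forall>w\<in>sphere 0 r. upd x i w \<in> {x\<in>ball 0 (d i). g i x \<noteq> 0}))"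
  by (rule bchoice[THEN exE]) blast
 have "\<exists>rho>0. \<forall>p\<in>insert r1 (c ` (- S)). rho < p"
  by (rule finite_pos_lower_bound) (use c r1 in auto)
 then obtain rho where rho: "rho > 0" "rho < r1" "\<And>i. i \<notin> S ==> rho < c i" by auto
 let ?V = "{x. (\<forall>k\<in>S. cmod (x $ k) < rho) \<and> (\<forall>k. k \<notin> S --> cmod (x $ k) < r1)}"
 have Vm: "?V \<subseteq> ball 0 m"
 proof
  fix x assume x: "x \<in> ?V"
  have "cmod (x $ k) \<le> r1" for k using x rho(2) by (cases "k \<in> S") (auto intro: less_imp_le order.strict_trans)
  from norm_lt_sum_components[OF this r1(2)] show "x \<in> ball 0 m" by simp
 qed
 have Vd: "?V \<subseteq> ball 0 (d i)" if "i \<notin> S" for i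
 proof -
  have "m \<le> d i" using m(3)[OF that] ra that by force
  then show ?thesis using Vm by auto
 qed
 have bc: "branched_cover S g rho r r1"
 proof (rule branched_cover.intro)
  show "hol (g i) ?V" if i: "i \<notin> S" for i
   by (rule hol_subset[OF g_hol[OF i] Vd[OF i]])
  show "dep (insert i S) (g i)" if i: "i \<notin> S" for i by (rule g_dep[OF i])
 next
  fix i and x :: "complex ^ 'm"
  assume i: "i \<notin> S" and x: "\<And>k. k \<in> S ==> cmod (x $ k) < rho" "cmod (x $ i) = r"
  show "g i x \<noteq> 0"
  proof -
   \<comment> \<open>\<open>g i\<close> sees only the base and the coordinate \<open>i\<close>;
     clearing the other coordinates brings the point into the range of the tube.\<close>
   define x' where "x' = (\<chi> k. if k \<in> S then x $ k else 0)"
   have "\<forall>k. k \<noteq> i --> cmod (x' $ k) < c i"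
    using x(1) rho(1) rho(3)[OF i] by (auto simp: x'_def intro: order.strict_trans)
   moreover have "x $ i \<in> sphere 0 r" using x(2) by simp
   ultimately have "upd x' i (x $ i) \<in> {x\<in>ball 0 (d i). g i x \<noteq> 0}" using c i by blast
   moreover have "g i (upd x' i (x $ i)) = g i x"
    by (rule depD[OF g_dep[OF i]]) (use i in "auto simp: x'_def")
   ultimately show ?thesis by simp
  qed
 next
  show "g i (axis i w) \<noteq> 0" if i: "i \<notin> S" and "w \<noteq> 0" "cmod w \<le> r" for i w
  proof -
   have "cmod w < ra i" "0 < cmod w" using that r \<open>r1 \<le> m\<close> m(3)[OF i] by auto
   then show ?thesis using ra i by force
  qed
 qed (use rho r in auto)
 have Veq: "branched_cover.V S rho r1 = ?V" by (rule branched_cover.V_def[OF bc])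
 show ?thesis
 proof (rule exI[of _ rho], rule exI[of _ r], rule exI[of _ r1], rule exI[of _ g], intro conjI bc ballI impI allI)
  show "branched_cover.V S rho r1 \<subseteq> ball 0 e" unfolding Veq using Vm m(2) by auto
  fix x i assume "x \<in> branched_cover.V S rho r1" "\<forall>g\<in>F. g x = 0" "i \<notin> S"
  then show "g i x = 0" unfolding Veq using Vd g_zero by blast
 qed
qed

context branched_cover
begin

text \<open>Continuity of roots: outside small discs about the roots over \<open>x0\<close> the
  equations are nonzero over \<open>x0\<close>, and by compactness also over nearby points.\<close>

lemma Z_near:
 assumes x0: "x0 \<in> V" and "kap > 0"
 shows "\<exists>d>0. \<forall>x\<in>ball x0 d \<inter> V. \<forall>y\<in>Z x. \<exists>y'\<in>Z x0. dist y y' < kap"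
proof -
 define kap1 where "kap1 = kap / (real CARD('m) + 1)"
 have kap1: "kap1 > 0" "real CARD('m) * kap1 < kap" using \<open>kap > 0\<close> by (simp_all add: kap1_def divide_simps add_nonneg_pos)
 have "\<forall>i\<in>-S. \<exists>d>0. \<forall>x\<in>ball x0 d. \<forall>w\<in>cball 0 r - (\<Union>t\<in>set_mset (R i x0). ball t kap1). f i (upd x i w) \<noteq> 0"
 proof
  fix i assume "i \<in> - S"
  then have i: "i \<notin> S" by simp
  let ?K = "cball 0 r - (\<Union>t\<in>set_mset (R i x0). ball t kap1)"
  have "compact ?K" by (intro compact_diff compact_cball open_UN ballI open_ball)
  moreover have "upd x0 i w \<in> {y\<in>V. f i y \<noteq> 0}" if w: "w \<in> ?K" for w
  proof -
   have "f i (upd x0 i w) \<noteq> 0"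
   proof
    assume 0: "f i (upd x0 i w) = 0"
    then have "w \<notin> sphere 0 r" using nz_upd[OF x0 i] by blast
    then have "w \<in> set_mset (R i x0)" using w 0 R_props(1)[OF x0 i] by auto
    then show False using w kap1 by auto
   qed
   then show ?thesis using upd_V[OF x0 i] w by simp
  qed
  ultimately show "\<exists>d>0. \<forall>x\<in>ball x0 d. \<forall>w\<in>?K. f i (upd x i w) \<noteq> 0"
   using upd_tube_at[OF open_nonzero[OF hol_fV[OF i] V_topology(1)], of ?K x0 i] by blast
 qed
 then obtain d where d: "\<forall>i\<in>-S. d i > 0 \<and> (\<forall>x\<in>ball x0 (d i). \<forall>w\<in>cball 0 r - (\<Union>t\<in>set_mset (R i x0). ball t kap1). f i (upd x i w) \<noteq> 0)"
  by (rule bchoice[THEN exE]) blast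
 have "\<exists>d0>0. \<forall>p\<in>insert kap1 (d ` (- S)). d0 < p"
  by (rule finite_pos_lower_bound) (use d kap1 in auto)
 then obtain d0 where d0: "d0 > 0" "d0 < kap1" "\<And>i. i \<notin> S ==> d0 < d i" by auto
 have "\<exists>y'\<in>Z x0. dist y y' < kap" if x: "x \<in> ball x0 d0" "x \<in> V" and y: "y \<in> Z x" for x y
 proof -
  have "\<exists>t. i \<notin> S --> t \<in># R i x0 \<and> dist t (y $ i) < kap1" for i
  proof (cases "i \<in> S")
   case False
   have "y $ i \<in># R i x" using y False unfolding Z_iff[OF x(2)] by blast
   then have yi: "y $ i \<in> ball 0 r" "f i (upd x i (y $ i)) = 0" using R_props(1)[OF x(2) False] by auto
   have "x \<in> ball x0 (d i)" using x(1) d0(3)[OF False] by auto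
   then have "y $ i \<notin> cball 0 r - (\<Union>t\<in>set_mset (R i x0). ball t kap1)" using d False yi(2) by blast
   then show ?thesis using yi(1) by auto
  qed auto
  then obtain t where t: "\<And>i. i \<notin> S ==> t i \<in># R i x0 \<and> dist (t i) (y $ i) < kap1" by metis
  define y' where "y' = (\<chi> k. if k \<in> S then x0 $ k else t k)"
  have "y' \<in> Z x0" unfolding Z_iff[OF x0] using t by (auto simp: y'_def)
  moreover have "norm (y - y') < kap"
  proof (rule norm_lt_sum_components[OF _ kap1(2)])
   fix k show "cmod ((y - y') $ k) \<le> kap1"
   proof (cases "k \<in> S")
    case True
    have "y $ k = x $ k" using y True unfolding Z_iff[OF x(2)] by blast
    then have "cmod ((y - y') $ k) = cmod ((x - x0) $ k)" using True by (simp add: y'_def)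
    also have "\<dots> \<le> norm (x - x0)" by (rule cmod_nth_le)
    also have "\<dots> \<le> kap1" using x(1) d0(2) by (simp add: dist_norm norm_minus_commute)
    finally show ?thesis .
   next
    case False
    then show ?thesis using t[OF False] by (simp add: y'_def dist_norm norm_minus_commute)
   qed
  qed
  ultimately show ?thesis by (auto simp: dist_norm)
 qed
 then show ?thesis using d0(1) by blast
qed

lemma card_Z_le: "x \<in> V ==> card (Z x) \<le> size (Phi 0)"
proof -
 assume x: "x \<in> V"
 have "card (Z x) = card (set_mset (Phi x))" by (simp add: set_Phi[OF x])
 also have "\<dots> \<le> size (Phi x)"
 proof -
  have "card (set_mset N) \<le> size N" for N :: "(complex ^ 'm) multiset"
   by (induction N) (auto simp: card_insert_if)
  then show ?thesis .
 qed
 also have "\<dots> = size (Phi 0)" by (rule trace_holomorphic_size[OF trace_Phi V_topology(3) x V_topology(4)])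
 finally show ?thesis .
qed

end

section \<open>Germs of analytic sets\<close>

text \<open>The condition of \<open>analytic_subset\<close> at a single point and free of the
  ambient open set, so that it can be transported along holomorphic maps.\<close>

definition analytic_near :: "(complex ^ 'm) set => complex ^ 'm => bool" where
 "analytic_near A p \<longleftrightarrow> (\<exists>V F. open V \<and> p \<in> V \<and> finite F \<and> (\<forall>f\<in>F. hol f V) \<and>
   A \<inter> V = {z\<in>V. \<forall>f\<in>F. f z = 0})"

lemma analytic_nearE:
 assumes "analytic_near A p"
 shows "\<exists>e F. e > 0 \<and> finite F \<and> (\<forall>f\<in>F. hol f (ball p e)) \<and>
  A \<inter> ball p e = {z\<in>ball p e. \<forall>f\<in>F. f z = 0}"
proof -
 obtain V F where V: "open V" "p \<in> V" "finite F" "\<forall>f\<in>F. hol f V"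
  "A \<inter> V = {z\<in>V. \<forall>f\<in>F. f z = 0}"
  using assms unfolding analytic_near_def by blast
 obtain e where e: "e > 0" "ball p e \<subseteq> V" using V open_contains_ball by blast
 have "A \<inter> ball p e = {z\<in>ball p e. \<forall>f\<in>F. f z = 0}" using V(5) e(2) by blast
 moreover have "\<forall>f\<in>F. hol f (ball p e)"
  using V(4) hol_subset[OF _ e(2)] by auto
 ultimately show ?thesis
  using e(1) V(3) by (intro exI[of _ e] exI[of _ F]) simp
qed

lemma analytic_near_shrink:
 assumes "e' \<le> e" "\<forall>f\<in>F. hol f (ball p e)" "A \<inter> ball p e = {z\<in>ball p e. \<forall>f\<in>F. f z = 0}"
 shows "\<forall>f\<in>F. hol f (ball p e')" "A \<inter> ball p e' = {z\<in>ball p e'. \<forall>f\<in>F. f z = 0}"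
proof -
 have sub: "ball p e' \<subseteq> ball p e" using assms(1) by auto
 show "\<forall>f\<in>F. hol f (ball p e')" using assms(2) hol_subset[OF _ sub] by auto
 show "A \<inter> ball p e' = {z\<in>ball p e'. \<forall>f\<in>F. f z = 0}" using assms(3) sub by blast
qed

lemma analytic_near_cong:
 assumes "analytic_near A p" "open U" "p \<in> U" "A \<inter> U = B \<inter> U"
 shows "analytic_near B p"
proof -
 obtain V F where V: "open V" "p \<in> V" "finite F" "\<forall>f\<in>F. hol f V"
  "A \<inter> V = {z\<in>V. \<forall>f\<in>F. f z = 0}"
  using assms(1) unfolding analytic_near_def by blast
 have "B \<inter> (V \<inter> U) = {z\<in>V \<inter> U. \<forall>f\<in>F. f z = 0}" using V(5) assms(4) by blast
 then show ?thesis
  unfolding analytic_near_def using V assms(2,3)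
  by (intro exI[of _ "V \<inter> U"] exI[of _ F]) (auto intro: hol_subset[OF _ Int_lower1])
qed

lemma analytic_near_preimage:
 assumes "analytic_near A (g p)" "holomorphic_map g W" "open W" "p \<in> W"
 shows "analytic_near (g -` A) p"
proof -
 obtain V F where V: "open V" "g p \<in> V" "finite F" "\<forall>f\<in>F. hol f V"
  "A \<inter> V = {z\<in>V. \<forall>f\<in>F. f z = 0}"
  using assms(1) unfolding analytic_near_def by blast
 define V' where "V' = {x\<in>W. g x \<in> V}"
 have "open V'"
  using continuous_open_preimage[OF holomorphic_map_continuous_on[OF assms(2)] assms(3) V(1)]
  by (simp add: V'_def vimage_def Int_def)
 have hg: "holomorphic_map g V'"
  using assms(2) hol_subset[of _ W V'] unfolding holomorphic_map_def by (auto simp: V'_def)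
 have "hol (%x. f (g x)) V'" if "f \<in> F" for f
  by (rule hol_compose[OF _ hg, of f V]) (use V(4) that in "auto simp: V'_def")
 then have "\<forall>h\<in>(%f x. f (g x)) ` F. hol h V'"
  by blast
 moreover note \<open>open V'\<close>
 moreover have "g -` A \<inter> V' = {z\<in>V'. \<forall>h\<in>(%f x. f (g x)) ` F. h z = 0}"
  using V(5) by (auto simp: V'_def)
 ultimately show ?thesis
  unfolding analytic_near_def using V(2,3) assms(4)
  by (intro exI[of _ V'] exI[of _ "(%f x. f (g x)) ` F"]) (auto simp: V'_def)
qed

lemma analytic_near_Int:
 assumes "analytic_near A p" "analytic_near B p"
 shows "analytic_near (A \<inter> B) p"
proof -
 obtain V F where V: "open V" "p \<in> V" "finite F" "\<forall>f\<in>F. hol f V"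
  "A \<inter> V = {z\<in>V. \<forall>f\<in>F. f z = 0}"
  using assms(1) unfolding analytic_near_def by blast
 obtain W G where W: "open W" "p \<in> W" "finite G" "\<forall>f\<in>G. hol f W"
  "B \<inter> W = {z\<in>W. \<forall>f\<in>G. f z = 0}"
  using assms(2) unfolding analytic_near_def by blast
 have "(A \<inter> B) \<inter> (V \<inter> W) = {z\<in>V \<inter> W. \<forall>f\<in>F \<union> G. f z = 0}" using V(5) W(5) by blast
 moreover have "\<forall>f\<in>F \<union> G. hol f (V \<inter> W)"
  using V(4) W(4) by (auto intro: hol_subset[OF _ Int_lower1] hol_subset[OF _ Int_lower2])
 ultimately show ?thesis
  unfolding analytic_near_def using V(1-3) W(1-3)
  by (intro exI[of _ "V \<inter> W"] exI[of _ "F \<union> G"]) auto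
qed

lemma analytic_near_Un:
 assumes "analytic_near A p" "analytic_near B p"
 shows "analytic_near (A \<union> B) p"
proof -
 obtain V F where V: "open V" "p \<in> V" "finite F" "\<forall>f\<in>F. hol f V"
  "A \<inter> V = {z\<in>V. \<forall>f\<in>F. f z = 0}"
  using assms(1) unfolding analytic_near_def by blast
 obtain W G where W: "open W" "p \<in> W" "finite G" "\<forall>f\<in>G. hol f W"
  "B \<inter> W = {z\<in>W. \<forall>f\<in>G. f z = 0}"
  using assms(2) unfolding analytic_near_def by blast
 let ?H = "(%(f, g) z. f z * g z) ` (F \<times> G)"
 have A: "z \<in> A \<longleftrightarrow> (\<forall>f\<in>F. f z = 0)" if "z \<in> V" for z using V(5) that by blast
 have B: "z \<in> B \<longleftrightarrow> (\<forall>f\<in>G. f z = 0)" if "z \<in> W" for z using W(5) that by blast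
 have "(A \<union> B) \<inter> (V \<inter> W) = {z\<in>V \<inter> W. \<forall>h\<in>?H. h z = 0}"
  using A B by auto
 moreover have "\<forall>h\<in>?H. hol h (V \<inter> W)"
  using V(4) W(4)
  by (auto intro!: hol_mult intro: hol_subset[OF _ Int_lower1] hol_subset[OF _ Int_lower2])
 ultimately show ?thesis
  unfolding analytic_near_def using V(1-3) W(1-3)
  by (intro exI[of _ "V \<inter> W"] exI[of _ ?H]) auto
qed

lemma analytic_near_empty:
 assumes "open U" "p \<in> U" "A \<inter> U = {}"
 shows "analytic_near A p"
 unfolding analytic_near_def
 by (intro exI[of _ U] exI[of _ "{%z. 1}"]) (use assms in "auto intro: hol_const")

section \<open>Local dimension and its drop over a discriminant\<close>

lemma holomorphic_map_matrix: "holomorphic_map (%x. (M :: complex ^ 'm ^ 'k) *v x) V"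
 unfolding holomorphic_map_def matrix_vector_mult_def
 by (auto intro!: hol_sum hol_mult hol_const hol_nth)

text \<open>Dimension of the germ at the origin, bounded by the number of linear equations that
  isolate the origin in \<open>A\<close>. The matrix \<open>M\<close> makes these equations
  coordinate equations, as the branched coverings require.\<close>

definition local_dim_le :: "nat => (complex ^ 'm) set => bool" where
 "local_dim_le d A \<longleftrightarrow> (\<exists>M M' S. M ** M' = mat 1 \<and> M' ** M = mat 1 \<and> card S = d \<and>
   (\<exists>e>0. \<forall>y\<in>ball 0 e. (\<forall>k\<in>S. y $ k = 0) --> (M :: complex ^ 'm ^ 'm) *v y \<in> A --> y = 0))"

lemma local_dim_le_UNIV: "local_dim_le (CARD('m)) (A :: (complex ^ 'm) set)"
 unfolding local_dim_le_def
 by (rule exI[of _ "mat 1"], rule exI[of _ "mat 1"], rule exI[of _ UNIV])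
  (auto simp: vec_eq_iff intro: exI[of _ 1])

lemma dim_drop:
 fixes A :: "(complex ^ 'm) set"
 assumes iso: "e > 0" "\<And>x. x \<in> ball 0 e ==> (\<forall>k\<in>S. x $ k = 0) ==> x \<in> A ==> x = 0"
  and disc: "hol disc V" "open V" "convex V" "0 \<in> V" "dep S disc" "y \<in> V" "disc y \<noteq> 0"
 shows "(\<exists>e>0. \<forall>x\<in>ball 0 e. disc x \<noteq> 0) \<or> (card S > 0 \<and> local_dim_le (card S - 1) {x\<in>A. disc x = 0})"
proof (cases "disc 0 = 0")
 case False
 have "open {x\<in>V. disc x \<noteq> 0}" by (rule open_nonzero[OF disc(1,2)])
 then obtain e where "e > 0" "ball 0 e \<subseteq> {x\<in>V. disc x \<noteq> 0}" using False disc(4) open_contains_ball by blast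
 then show ?thesis by blast
next
 case True
 \<comment> \<open>\<open>disc\<close> sees only the base coordinates, so clearing the others in
   \<open>y\<close> leaves its values along the line unchanged.\<close>
 define v where "v = (\<chi> k. if k \<in> S then y $ k else 0)"
 have discv: "disc (t *s y) = disc (t *s v)" for t
  by (rule depD[OF disc(5)]) (simp add: v_def)
 have "disc v \<noteq> 0" using discv[of 1] disc(7) by simp
 then have "v \<noteq> 0" using True by auto
 then obtain i where i: "v $ i \<noteq> 0" by (auto simp: vec_eq_iff)
 then have iS: "i \<in> S" by (auto simp: v_def split: if_splits)
 obtain r where r: "r > 0" "\<And>t. t \<in> ball 0 r - {0} ==> disc (0 + t *s (y - 0)) \<noteq> 0"
  using hol_isolated_line[OF disc(1-3,6,7,4)] by blast
 define M :: "complex ^ 'm ^ 'm" where "M = (\<chi> k l. if l = i then v $ k else if k = l then 1 else 0)"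
 have M: "(M *v z) $ k = (if k = i then 0 else z $ k) + z $ i * v $ k" for z k
 proof -
  have "(M *v z) $ k = (\<Sum>l\<in>UNIV. M $ k $ l * z $ l)"
   by (simp add: matrix_vector_mult_def)
  also have "\<dots> = (\<Sum>l\<in>UNIV. (if l = i then v $ k * z $ i else 0) + (if l = k then (if k = i then 0 else z $ k) else 0))"
   by (rule sum.cong) (auto simp: M_def)
  finally show ?thesis by (simp add: sum.distrib mult.commute)
 qed
 have Minj: "z = 0" if "M *v z = 0" for z
 proof -
  have "z $ i * v $ i = 0" using M[of z i] that by simp
  then have "z $ i = 0" using i by simp
  have "z $ k = 0" for k
   using M[of z k] that \<open>z $ i = 0\<close> by (cases "k = i") auto
  then show ?thesis by (simp add: vec_eq_iff)
 qed
 have "inj ((*v) M)"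
  by (rule injI) (metis Minj eq_iff_diff_eq_0 matrix_vector_mult_diff_distrib)
 then obtain M' where M': "M' ** M = mat 1"
  using matrix_left_invertible_injective[of M] by blast
 then have MM': "M ** M' = mat 1" using matrix_left_right_inverse by blast
 have "continuous_on UNIV ((*v) M)" by (rule holomorphic_map_continuous_on[OF holomorphic_map_matrix])
 then have "open ((*v) M -` ball 0 e)" by (rule open_vimage[OF open_ball])
 moreover have "0 \<in> (*v) M -` ball 0 e" using iso(1) by simp
 ultimately obtain e' where e': "e' > 0" "ball 0 e' \<subseteq> (*v) M -` ball 0 e" using open_contains_ball by blast
 have "z = 0" if z: "z \<in> ball 0 (min e' r)" "\<forall>k\<in>S - {i}. z $ k = 0" "M *v z \<in> {x\<in>A. disc x = 0}" for z
 proof -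
  have "disc (M *v z) = disc (z $ i *s v)"
   by (rule depD[OF disc(5)]) (use z(2) in "simp add: M")
  then have "disc (z $ i *s y) = 0" using z(3) discv by simp
  moreover have "z $ i \<in> ball 0 r" using z(1) cmod_nth_le[of z i] by simp
  ultimately have "z $ i = 0" using r(2)[of "z $ i"] by auto
  then have "M *v z = z" using M[of z] by (simp add: vec_eq_iff)
  moreover have "\<forall>k\<in>S. z $ k = 0" using z(2) \<open>z $ i = 0\<close> by blast
  moreover have "M *v z \<in> ball 0 e" using z(1) e'(2) by auto
  ultimately show ?thesis using iso(2)[of z] z(3) by auto
 qed
 then have "local_dim_le (card S - 1) {x\<in>A. disc x = 0}"
  unfolding local_dim_le_def
  by (intro exI[of _ M] exI[of _ M'] exI[of _ "S - {i}"] conjI MM' M' exI[of _ "min e' r"])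
   (use e' r(1) iS in auto)
 moreover have "card S > 0" using iS by (auto simp: card_gt_0_iff)
 ultimately show ?thesis by blast
qed

text \<open>A branched covering that contains the germ of \<open>B\<close> and is split, off the
  zeros of \<open>disc\<close>, into sheets on which the defining functions of both \<open>A\<close>
  and \<open>B\<close> vanish either everywhere or nowhere.\<close>

locale cover_germ = branched_cover S f rho r r1
 for S :: "'m::finite set" and f :: "'m => complex ^ 'm => complex" and rho r r1 :: real +
 fixes A B :: "(complex ^ 'm) set" and FA FB :: "(complex ^ 'm => complex) set"
  and disc :: "complex ^ 'm => complex"
 assumes fin: "finite FA" "finite FB"
  and hol_FA: "\<And>g. g \<in> FA ==> hol g V" and hol_FB: "\<And>g. g \<in> FB ==> hol g V"
  and A_eq: "A \<inter> V = {z\<in>V. \<forall>g\<in>FA. g z = 0}" and B_eq: "B \<inter> V = {z\<in>V. \<forall>g\<in>FB. g z = 0}"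
  and Bf: "\<And>x i. x \<in> V ==> x \<in> B ==> i \<notin> S ==> f i x = 0"
  and disc: "hol disc V" "dep S disc" "\<exists>x\<in>V. disc x \<noteq> 0"
  and sheet: "\<And>x0. x0 \<in> V ==> disc x0 \<noteq> 0 ==> \<exists>U sig. local_sheets (FA \<union> FB) x0 U sig"

section \<open>Germs that are finite over a coordinate subspace\<close>

lemma cover_germ_exists:
 fixes A B :: "(complex ^ 'm) set"
 assumes A: "analytic_near A 0" and B: "analytic_near B 0"
  and e: "e > 0" and iso: "\<And>x. x \<in> ball 0 e ==> (\<forall>k\<in>S. x $ k = 0) ==> x \<in> B ==> x = 0"
 shows "\<exists>rho r r1 f FA FB disc. cover_germ S f rho r r1 A B FA FB disc"
proof -
 obtain eA FA where FA: "eA > 0" "finite FA" "\<forall>g\<in>FA. hol g (ball 0 eA)"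
  "A \<inter> ball 0 eA = {z\<in>ball 0 eA. \<forall>g\<in>FA. g z = 0}"
  using analytic_nearE[OF A] by blast
 obtain eB FB where FB: "eB > 0" "finite FB" "\<forall>g\<in>FB. hol g (ball 0 eB)"
  "B \<inter> ball 0 eB = {z\<in>ball 0 eB. \<forall>g\<in>FB. g z = 0}"
  using analytic_nearE[OF B] by blast
 define e' where "e' = min e (min eA eB)"
 have e': "e' > 0" "e' \<le> e" "e' \<le> eA" "e' \<le> eB" using e FA(1) FB(1) by (auto simp: e'_def)
 note FA' = analytic_near_shrink[OF e'(3) FA(3,4)] and FB' = analytic_near_shrink[OF e'(4) FB(3,4)]
 have "x = 0" if "x \<in> ball 0 e'" "\<forall>k\<in>S. x $ k = 0" "\<forall>f\<in>FB. f x = 0" for x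
  by (rule iso) (use that FB'(2) e'(2) in auto)
 from branched_cover_exists[OF FB(2) e'(1) bspec[OF FB'(1)] this]
 obtain rho r r1 f where bc: "branched_cover S f rho r r1" and V: "branched_cover.V S rho r1 \<subseteq> ball 0 e'"
  and z: "\<forall>x\<in>branched_cover.V S rho r1. (\<forall>g\<in>FB. g x = 0) --> (\<forall>i. i \<notin> S --> f i x = 0)"
  by blast
 interpret branched_cover S f rho r r1 by (rule bc)
 have hA: "hol g V" if "g \<in> FA" for g
  using FA'(1) that hol_subset[OF _ V] by auto
 have hB: "hol g V" if "g \<in> FB" for g
  using FB'(1) that hol_subset[OF _ V] by auto
 have "finite (FA \<union> FB)" using FA(2) FB(2) by simp
 moreover have "hol q V" if "q \<in> FA \<union> FB" for q using hA hB that by auto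
 ultimately obtain disc where disc0: "hol disc V \<and> dep S disc \<and> (\<exists>x\<in>V. disc x \<noteq> 0) \<and>
  (\<forall>x0\<in>V. disc x0 \<noteq> 0 --> (\<exists>U sig. local_sheets (FA \<union> FB) x0 U sig))"
  by (rule sheets[THEN exE])
 note disc = conjunct1[OF disc0] conjunct1[OF conjunct2[OF disc0]]
  conjunct1[OF conjunct2[OF conjunct2[OF disc0]]] conjunct2[OF conjunct2[OF conjunct2[OF disc0]]]
 have AV: "A \<inter> V = {z\<in>V. \<forall>g\<in>FA. g z = 0}" and BV: "B \<inter> V = {z\<in>V. \<forall>g\<in>FB. g z = 0}"
  using FA'(2) FB'(2) V by blast+
 have "cover_germ S f rho r r1 A B FA FB disc"
 proof (unfold_locales)
  show "f i x = 0" if "x \<in> V" "x \<in> B" "i \<notin> S" for x i using z BV that by blast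
  show "\<exists>U sig. local_sheets (FA \<union> FB) x0 U sig" if "x0 \<in> V" "disc x0 \<noteq> 0" for x0
   by (rule mp[OF bspec[OF disc(4) that(1)] that(2)])
 qed (rule FA(2) FB(2) hA hB AV BV disc(1-3), assumption?)+
 then show ?thesis by blast
qed

context cover_germ
begin

text \<open>The generic part of \<open>B - A\<close>; off the zeros of \<open>disc\<close> it is a
  union of full sheets.\<close>

definition K :: "(complex ^ 'm) set" where "K = {x\<in>D. x \<in> B \<and> x \<notin> A \<and> disc x \<noteq> 0}"

definition Kx :: "complex ^ 'm => (complex ^ 'm) set" where "Kx x = {y\<in>K. \<forall>k\<in>S. y $ k = x $ k}"

lemma disc_cong: "(\<And>k. k \<in> S ==> x $ k = y $ k) ==> disc x = disc y"
 by (rule depD[OF disc(2)])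

lemma B_in_Z: "x \<in> D ==> x \<in> B ==> x \<in> Z x"
 using Bf D_topology(5) by (auto simp: Z_def)

lemma Kx_sub: "Kx x \<subseteq> Z x"
 using Bf D_topology(5) by (auto simp: Kx_def K_def Z_def)

lemma finite_Kx: "x \<in> V ==> finite (Kx x)"
 using finite_Z Kx_sub finite_subset by metis

lemma open_disc: "open {x\<in>V. disc x \<noteq> 0}"
 by (rule open_nonzero[OF disc(1) V_topology(1)])

lemma sheetK:
 assumes x0: "x0 \<in> V" "disc x0 \<noteq> 0"
 shows "\<exists>U sig. open U \<and> x0 \<in> U \<and> U \<subseteq> V \<and> (\<forall>x\<in>U. disc x \<noteq> 0) \<and>
    (\<forall>y\<in>Kx x0. holomorphic_map (sig y) U \<and> sig y x0 = y) \<and>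
    (\<forall>x\<in>U. inj_on (%y. sig y x) (Kx x0) \<and> Kx x = (%y. sig y x) ` Kx x0)"
proof -
 obtain U sig where *: "local_sheets (FA \<union> FB) x0 U sig"
  using sheet[OF x0] by (elim exE)
 have U: "open U" "x0 \<in> U" "U \<subseteq> V" using * by blast+
 have sig: "\<And>y. y \<in> Z x0 ==> holomorphic_map (sig y) U" "\<And>y. y \<in> Z x0 ==> sig y x0 = y"
  and st: "\<And>x y q. x \<in> U ==> y \<in> Z x0 ==> q \<in> FA \<union> FB ==> q (sig y x) = 0 \<longleftrightarrow> q y = 0"
  and Z: "\<And>x. x \<in> U ==> inj_on (%y. sig y x) (Z x0)" "\<And>x. x \<in> U ==> Z x = (%y. sig y x) ` Z x0"
  using * by blast+
 define U' where "U' = U \<inter> {x\<in>V. disc x \<noteq> 0}"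
 have U': "open U'" "x0 \<in> U'" "U' \<subseteq> V" "U' \<subseteq> U" using U open_disc x0 by (auto simp: U'_def)
 have inA: "z \<in> A \<longleftrightarrow> (\<forall>g\<in>FA. g z = 0)" and inB: "z \<in> B \<longleftrightarrow> (\<forall>g\<in>FB. g z = 0)" if "z \<in> V" for z
  using A_eq B_eq that by blast+
 have ZV: "y \<in> V" "y \<in> D" if "y \<in> Z x" for x y using that D_topology(5) by (auto simp: Z_def)
 have K_iff: "sig y x \<in> Kx x \<longleftrightarrow> y \<in> Kx x0" if x: "x \<in> U'" and y: "y \<in> Z x0" for x y
 proof -
  have xU: "x \<in> U" and dx: "disc x \<noteq> 0" using x by (auto simp: U'_def)
  have sy: "sig y x \<in> Z x" using Z(2)[OF xU] y by blast
  have "disc (sig y x) = disc x" "disc y = disc x0"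
   using sy y by (auto simp: Z_def intro: disc_cong)
  moreover have "sig y x \<in> A \<longleftrightarrow> y \<in> A" "sig y x \<in> B \<longleftrightarrow> y \<in> B"
   using st[OF xU y] inA[OF ZV(1)[OF sy]] inA[OF ZV(1)[OF y]] inB[OF ZV(1)[OF sy]] inB[OF ZV(1)[OF y]]
   by blast+
  ultimately show ?thesis
   using sy y x0(2) dx ZV(2)[OF sy] ZV(2)[OF y] by (auto simp: Kx_def K_def Z_def)
 qed
 have "Kx x = (%y. sig y x) ` Kx x0" if x: "x \<in> U'" for x
 proof (intro equalityI subsetI)
  fix z assume z: "z \<in> Kx x"
  then obtain y where "y \<in> Z x0" "z = sig y x" using Kx_sub Z(2)[of x] x U'(4) by blast
  then show "z \<in> (%y. sig y x) ` Kx x0" using K_iff[OF x] z by blast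
 next
  fix z assume "z \<in> (%y. sig y x) ` Kx x0"
  then show "z \<in> Kx x" using K_iff[OF x] Kx_sub by blast
 qed
 moreover have "holomorphic_map (sig y) U'" if "y \<in> Kx x0" for y
  using sig(1)[of y] that Kx_sub hol_subset[OF _ U'(4)] unfolding holomorphic_map_def by blast
 moreover have "inj_on (%y. sig y x) (Kx x0)" if "x \<in> U'" for x
  using Z(1)[of x] that U'(4) Kx_sub inj_on_subset by blast
 moreover have "sig y x0 = y" if "y \<in> Kx x0" for y using sig(2) that Kx_sub by blast
 moreover have "disc x \<noteq> 0" if "x \<in> U'" for x using that by (auto simp: U'_def)
 ultimately show ?thesis
  by (intro exI[of _ U'] exI[of _ sig] conjI ballI U') blast+
qed

text \<open>Sheets make the cardinality locally constant, and the complement of the zeros of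
  \<open>disc\<close> is connected.\<close>

lemma card_Kx_const:
 assumes "x \<in> V" "disc x \<noteq> 0" "y \<in> V" "disc y \<noteq> 0"
 shows "card (Kx x) = card (Kx y)"
proof -
 let ?W = "{x\<in>V. disc x \<noteq> 0}"
 have "(%x. card (Kx x)) constant_on ?W"
 proof (rule locally_constant_imp_constant[OF connected_nonzero[OF disc(1) V_topology(1,2)]])
  fix a assume "a \<in> ?W"
  then have a: "a \<in> V" "disc a \<noteq> 0" by auto
  obtain U sig where U: "open U" "a \<in> U" "U \<subseteq> V" "\<forall>x\<in>U. disc x \<noteq> 0"
   "\<forall>x\<in>U. inj_on (%y. sig y x) (Kx a) \<and> Kx x = (%y. sig y x) ` Kx a"
   using sheetK[OF a] by blast
  have "card (Kx x) = card (Kx a)" if "x \<in> U" for x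
   using U(5) that card_image by metis
  moreover have "openin (top_of_set ?W) U"
   using U by (intro open_subset) auto
  ultimately show "\<exists>T. openin (top_of_set ?W) T \<and> a \<in> T \<and> (\<forall>x\<in>T. card (Kx x) = card (Kx a))"
   using U(2) by blast
 qed
 then show ?thesis using assms unfolding constant_on_def by auto
qed

text \<open>For a linear form the product of its values at \<open>x - y\<close>, with
  \<open>y\<close> in the fibre of \<open>K\<close>, is bounded and holomorphic off the zeros of
  \<open>disc\<close>, hence extends across them, and it vanishes on \<open>K\<close>. If a point
  lies outside the closure of \<open>K\<close>, a form that separates it from the other points of
  its fibre keeps the product away from zero nearby. Finitely many forms serve all points.\<close>

lemma closure_K_analytic: "analytic_near (closure K) 0"
proof -
 obtain n :: "'m => nat" where n: "bij_betw n UNIV {..<CARD('m)}"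
  using ex_bij_betw_finite_nat[of "UNIV :: 'm set"] by (auto simp: atLeast0LessThan)
 have ninj: "n i = n j \<longleftrightarrow> i = j" for i j using n by (auto simp: bij_betw_def inj_on_def)
 have nlt: "n i < CARD('m)" for i using n by (auto simp: bij_betw_def)
 \<comment> \<open>\<open>n\<close> numbers the coordinates, so \<open>pol v\<close> has the
   components of \<open>v\<close> as coefficients. The linear forms \<open>lam s\<close> are its
   values at integers, and a nonzero \<open>v\<close> is annihilated by at most
   \<open>CARD('m)\<close> of them.\<close>
 define pol where "pol v = (\<Sum>i\<in>UNIV. monom (v $ i) (n i))" for v :: "complex ^ 'm"
 define lam where "lam s v = poly (pol v) (of_nat s)" for s :: nat and v :: "complex ^ 'm"
 have lam: "lam s v = (\<Sum>i\<in>UNIV. v $ i * of_nat s ^ n i)" for s v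
  by (simp add: lam_def pol_def poly_sum poly_monom)
 have pol0: "v = 0" if "pol v = 0" for v
 proof -
  have "coeff (pol v) (n i) = v $ i" for i
   by (simp add: pol_def coeff_sum ninj)
  then show ?thesis using that by (simp add: vec_eq_iff)
 qed
 have degpol: "degree (pol v) \<le> CARD('m)" for v
  unfolding pol_def
  by (rule degree_sum_le[OF finite]) (rule order_trans[OF degree_monom_le less_imp_le[OF nlt]])
 define N where "N = size (Phi 0)"
 \<comment> \<open>More integers than roots of a product of \<open>N\<close> nonzero polynomials of
   degree at most \<open>CARD('m)\<close>; some \<open>s < L\<close> thus works for all points of a
   fibre at once.\<close>
 define L where "L = Suc (N * CARD('m))"
 define Rs where "Rs s x = (\<Prod>y\<in>Kx x. lam s (x - y))" for s x
 have Rs_hol: "hol (Rs s) {x\<in>D. disc x \<noteq> 0}" for s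
 proof (rule hol_local)
  fix x0 assume "x0 \<in> {x\<in>D. disc x \<noteq> 0}"
  then have x0: "x0 \<in> V" "disc x0 \<noteq> 0" using D_topology(5) by auto
  obtain U sig where U: "open U" "x0 \<in> U" "U \<subseteq> V" "\<forall>x\<in>U. disc x \<noteq> 0"
   "\<forall>y\<in>Kx x0. holomorphic_map (sig y) U \<and> sig y x0 = y"
   "\<forall>x\<in>U. inj_on (%y. sig y x) (Kx x0) \<and> Kx x = (%y. sig y x) ` Kx x0"
   using sheetK[OF x0] by blast
  have "hol (%x. \<Prod>y\<in>Kx x0. lam s (x - sig y x)) U"
   unfolding lam
   by (intro hol_prod hol_sum hol_mult hol_const)
    (use U(5) in "auto simp: holomorphic_map_def intro!: hol_diff hol_nth")
  moreover have "Rs s x = (\<Prod>y\<in>Kx x0. lam s (x - sig y x))" if "x \<in> U" for x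
  proof -
   have "Kx x = (%y. sig y x) ` Kx x0" "inj_on (%y. sig y x) (Kx x0)" using U(6) that by blast+
   then show ?thesis unfolding Rs_def by (simp add: prod.reindex)
  qed
  ultimately have "hol (Rs s) U"
   by (rule hol_transform[OF _ U(1)])
  then show "\<exists>W. x0 \<in> W \<and> hol (Rs s) W" using U(2) by blast
 qed
 have Rs_bound: "\<exists>C. \<forall>x. x \<in> D --> disc x \<noteq> 0 --> cmod (Rs s x) \<le> C" for s
 proof -
  define c where "c = max 1 (\<Sum>i\<in>(UNIV::'m set). 2 * (rho + r) * real s ^ n i)"
  have lam_bd: "cmod (lam s (x - y)) \<le> c" if "x \<in> D" "y \<in> D" for x y
  proof -
   have comp: "cmod ((x - y) $ i) \<le> 2 * (rho + r)" for i
   proof -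
    have "cmod (x $ i) < rho + r" "cmod (y $ i) < rho + r"
     using that rho r unfolding D_def by (cases "i \<in> S"; force)+
    then show ?thesis using norm_triangle_ineq4[of "x $ i" "y $ i"] by simp
   qed
   have "cmod (lam s (x - y)) \<le> (\<Sum>i\<in>UNIV. cmod ((x - y) $ i * of_nat s ^ n i))"
    unfolding lam by (rule norm_sum)
   also have "\<dots> \<le> (\<Sum>i\<in>(UNIV::'m set). 2 * (rho + r) * real s ^ n i)"
    by (intro sum_mono) (use comp in "auto simp: norm_mult norm_power intro!: mult_right_mono")
   finally show ?thesis unfolding c_def by simp
  qed
  have "cmod (Rs s x) \<le> c ^ N" if x: "x \<in> D" for x
  proof -
   have xV: "x \<in> V" using x D_topology(5) by blast
   have "cmod (Rs s x) \<le> (\<Prod>y\<in>Kx x. c)"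
    unfolding Rs_def prod_norm[symmetric]
    by (rule prod_mono) (use lam_bd x in "auto simp: Kx_def K_def")
   also have "\<dots> = c ^ card (Kx x)" by simp
   also have "\<dots> \<le> c ^ N"
   proof (rule power_increasing)
    show "card (Kx x) \<le> N"
     using card_mono[OF finite_Z[OF xV] Kx_sub] card_Z_le[OF xV] by (simp add: N_def)
   qed (simp add: c_def)
   finally show ?thesis .
  qed
  then show ?thesis by blast
 qed
 obtain y1 where y1: "y1 \<in> D" "disc y1 \<noteq> 0"
 proof -
  obtain y where "y \<in> V" "disc y \<noteq> 0" using disc(3) by blast
  then obtain z where "z \<in> D \<inter> V" "disc z \<noteq> 0"
   using nonzero_dense[OF disc(1) V_topology(1,2) _ _ V_topology(4) D_topology(1,4)] by blast
  then show ?thesis using that by blast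
 qed
 have discD: "hol disc D" by (rule hol_subset[OF disc(1) D_topology(5)])
 have "\<forall>s\<in>{..<L}. \<exists>e>0. \<exists>g. ball 0 e \<subseteq> D \<and> hol g (ball 0 e) \<and> (\<forall>x\<in>ball 0 e. disc x \<noteq> 0 --> g x = Rs s x)"
 proof
  fix s
  obtain C where "\<forall>x. x \<in> D --> disc x \<noteq> 0 --> cmod (Rs s x) \<le> C" using Rs_bound by blast
  then show "\<exists>e>0. \<exists>g. ball 0 e \<subseteq> D \<and> hol g (ball 0 e) \<and> (\<forall>x\<in>ball 0 e. disc x \<noteq> 0 --> g x = Rs s x)"
   by (intro riemann_extension[OF discD D_topology(1,2) y1 Rs_hol _ D_topology(4)]) blast
 qed
 then obtain es where "\<forall>s\<in>{..<L}. es s > 0 \<and> (\<exists>g. ball 0 (es s) \<subseteq> D \<and> hol g (ball 0 (es s)) \<and> (\<forall>x\<in>ball 0 (es s). disc x \<noteq> 0 --> g x = Rs s x))"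
  by (rule bchoice[THEN exE]) blast
 then obtain G where G: "\<forall>s\<in>{..<L}. es s > 0 \<and> ball 0 (es s) \<subseteq> D \<and> hol (G s) (ball 0 (es s)) \<and> (\<forall>x\<in>ball 0 (es s). disc x \<noteq> 0 --> G s x = Rs s x)"
  by (metis bchoice)
 have "\<exists>e>0. \<forall>p\<in>es ` {..<L}. e < p" by (rule finite_pos_lower_bound) (use G in auto)
 then obtain e where e: "e > 0" "\<And>s. s < L ==> e < es s" by blast
 define W where "W = ball (0::complex ^ 'm) e"
 have sub: "W \<subseteq> ball 0 (es s)" if "s < L" for s using e(2)[OF that] by (auto simp: W_def)
 have WD: "W \<subseteq> D" using sub[of 0] G by (force simp: L_def)
 have G_hol: "hol (G s) W" and G_eq: "\<And>x. x \<in> W ==> disc x \<noteq> 0 ==> G s x = Rs s x" if "s < L" for s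
  using G that sub[OF that] hol_subset[OF _ sub[OF that]] by blast+
 have W: "open W" "0 \<in> W" using e(1) by (auto simp: W_def)
 have zero_closure: "g x = 0" if "hol g W" "x \<in> W" "x \<in> closure K" "\<And>y. y \<in> K ==> y \<in> W ==> g y = 0" for g x
 proof (rule ccontr)
  assume "g x \<noteq> 0"
  then have "x \<in> {x\<in>W. g x \<noteq> 0}" using that(2) by simp
  moreover have "open {x\<in>W. g x \<noteq> 0}" by (rule open_nonzero[OF that(1) W(1)])
  ultimately have "{x\<in>W. g x \<noteq> 0} \<inter> K \<noteq> {}" using that(3) by (metis (no_types, lifting) closure_iff_nhds_not_empty subset_refl inf_commute)
  then show False using that(4) by blast
 qed
 have "closure K \<inter> W = {x\<in>W. \<forall>g\<in>f ` (- S) \<union> G ` {..<L}. g x = 0}"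
 proof (intro equalityI subsetI)
  fix x assume x: "x \<in> closure K \<inter> W"
  have "f i x = 0" if "i \<notin> S" for i
  proof (rule zero_closure)
   show "hol (f i) W"
    using hol_fV[OF that] WD D_topology(5) hol_subset by blast
   show "f i y = 0" if "y \<in> K" for y using that Bf[OF _ _ \<open>i \<notin> S\<close>] D_topology(5) by (auto simp: K_def)
  qed (use x in auto)
  moreover have "G s x = 0" if "s < L" for s
  proof (rule zero_closure[OF G_hol[OF that]])
   fix y assume y: "y \<in> K" "y \<in> W"
   then have yK: "y \<in> Kx y" and dy: "disc y \<noteq> 0" by (auto simp: Kx_def K_def)
   have "finite (Kx y)" using y(2) WD D_topology(5) by (intro finite_Kx) auto
   then have "Rs s y = 0" unfolding Rs_def using yK by (auto simp: lam intro!: bexI[of _ y])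
   then show "G s y = 0" using G_eq[OF that y(2) dy] by simp
  qed (use x in auto)
  ultimately show "x \<in> {x\<in>W. \<forall>g\<in>f ` (- S) \<union> G ` {..<L}. g x = 0}" using x by auto
 next
  fix x0 assume "x0 \<in> {x\<in>W. \<forall>g\<in>f ` (- S) \<union> G ` {..<L}. g x = 0}"
  then have x0: "x0 \<in> W" "\<And>i. i \<notin> S ==> f i x0 = 0" "\<And>s. s < L ==> G s x0 = 0" by auto
  have x0D: "x0 \<in> D" "x0 \<in> V" using x0(1) WD D_topology(5) by auto
  show "x0 \<in> closure K \<inter> W"
  proof (rule ccontr)
   assume "x0 \<notin> closure K \<inter> W"
   then have "x0 \<in> - closure K" using x0(1) by blast
   moreover have "open (- closure K)" using closed_closure by (rule open_Compl)
   ultimately obtain eps where eps: "eps > 0" "ball x0 eps \<subseteq> - closure K" using open_contains_ball by blast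
   have Keps: "dist x0 y \<ge> eps" if "y \<in> K" for y using eps(2) that closure_subset[of K] by force
   \<comment> \<open>The full fibre is used, since points of \<open>K\<close> over nearby base
     points accumulate only at points of \<open>Z x0\<close>; they stay away from \<open>x0\<close>
     itself because \<open>x0\<close> is not in the closure of \<open>K\<close>.\<close>
   define Z0 where "Z0 = Z x0 - {x0}"
   have finZ0: "finite Z0" using finite_Z[OF x0D(2)] by (simp add: Z0_def)
   have cardZ0: "card Z0 \<le> N" using card_Z_le[OF x0D(2)] card_mono[OF finite_Z[OF x0D(2)], of Z0] by (simp add: Z0_def N_def)
   obtain s where s: "s < L" "\<forall>y\<in>Z0. lam s (x0 - y) \<noteq> 0"
   proof (rule ccontr)
    assume "\<not> thesis"
    then have "\<forall>s<L. \<exists>y\<in>#mset_set Z0. poly (pol (x0 - y)) (of_nat s) = 0"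
     using that finZ0 by (auto simp: lam_def)
    then have "\<exists>y\<in>#mset_set Z0. pol (x0 - y) = 0"
     by (intro common_zero_pigeonhole[where D = "CARD('m)" and L = L] degpol)
      (use cardZ0 in "auto simp: L_def less_Suc_eq_le")
    then show False using pol0 finZ0 by (force simp: Z0_def)
   qed
   have "finite ((%y. cmod (lam s (x0 - y))) ` Z0)" "\<And>p. p \<in> (%y. cmod (lam s (x0 - y))) ` Z0 ==> p > 0"
    using finZ0 s(2) by auto
   from finite_pos_lower_bound[OF this]
   obtain eta0 where eta0: "eta0 > 0" "\<forall>y\<in>Z0. eta0 < cmod (lam s (x0 - y))" by blast
   define eta where "eta = min 1 (eta0 / 2)"
   have eta: "eta > 0" "eta \<le> 1" using eta0 by (auto simp: eta_def)
   have "continuous_on UNIV (lam s)"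
    unfolding lam[abs_def] by (intro continuous_intros)
   then have "\<exists>d>0. \<forall>q\<in>UNIV. dist q p < d --> dist (lam s q) (lam s p) < eta0 / 2" for p
    using continuous_on_iff[THEN iffD1, rule_format, of UNIV "lam s" p "eta0 / 2"] eta0(1) by simp
   then have "\<forall>y\<in>Z0. \<exists>d>0. \<forall>q. dist q (x0 - y) < d --> dist (lam s q) (lam s (x0 - y)) < eta0 / 2" by blast
   then obtain dd where dd: "\<forall>y\<in>Z0. dd y > 0 \<and> (\<forall>q. dist q (x0 - y) < dd y --> dist (lam s q) (lam s (x0 - y)) < eta0 / 2)"
    by (rule bchoice[THEN exE]) blast
   have "\<exists>kap>0. \<forall>p\<in>insert eps (dd ` Z0). kap < p"
    by (rule finite_pos_lower_bound) (use finZ0 dd eps in auto)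
   then obtain kap where kap: "kap > 0" "kap < eps" "\<And>y. y \<in> Z0 ==> kap < dd y" by auto
   obtain d where d: "d > 0" "\<forall>x\<in>ball x0 d \<inter> V. \<forall>y\<in>Z x. \<exists>y'\<in>Z x0. dist y y' < kap / 2"
    using Z_near[OF x0D(2), of "kap / 2"] kap(1) by auto
   have low: "eta ^ N \<le> cmod (Rs s x)" if x: "x \<in> ball x0 (min d (kap / 2))" "x \<in> V" for x
   proof -
    have each: "eta \<le> cmod (lam s (x - y))" if y: "y \<in> Kx x" for y
    proof -
     obtain y' where y': "y' \<in> Z x0" "dist y y' < kap / 2" using d(2) x y Kx_sub by fastforce
     have "y \<in> K" using y by (simp add: Kx_def)
     then have "y' \<noteq> x0" using Keps[of y] y'(2) kap(1,2) by (auto simp: dist_commute)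
     then have y'Z: "y' \<in> Z0" using y'(1) by (simp add: Z0_def)
     have "dist (x - y) (x0 - y') \<le> dist x x0 + dist y y'"
      using norm_triangle_ineq4[of "x - x0" "y - y'"] by (simp add: dist_norm algebra_simps)
     also have "\<dots> < kap" using x(1) y'(2) by (simp add: dist_commute)
     finally have "dist (x - y) (x0 - y') < dd y'" using kap(3)[OF y'Z] by simp
     then have "dist (lam s (x - y)) (lam s (x0 - y')) < eta0 / 2" using dd y'Z by blast
     moreover have "eta0 < cmod (lam s (x0 - y'))" using eta0(2) y'Z by blast
     ultimately have "eta0 / 2 < cmod (lam s (x - y))"
      using norm_triangle_ineq2[of "lam s (x0 - y')" "lam s (x - y)"] by (simp add: dist_norm norm_minus_commute)
     then show ?thesis by (simp add: eta_def)
    qed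
    have "eta ^ N \<le> eta ^ card (Kx x)"
    proof (rule power_decreasing)
     show "card (Kx x) \<le> N"
      using card_mono[OF finite_Z[OF x(2)] Kx_sub] card_Z_le[OF x(2)] by (simp add: N_def)
    qed (use eta in auto)
    also have "\<dots> = (\<Prod>y\<in>Kx x. eta)" by simp
    also have "\<dots> \<le> cmod (Rs s x)"
     unfolding Rs_def prod_norm[symmetric] by (rule prod_mono) (use each eta in auto)
    finally show ?thesis .
   qed
   have "continuous_on W (G s)" by (rule hol_continuous_on[OF G_hol[OF s(1)]])
   then have "open (W \<inter> G s -` ball 0 (eta ^ N))" by (rule continuous_open_preimage[OF _ W(1) open_ball])
   then have "open (W \<inter> G s -` ball 0 (eta ^ N) \<inter> ball x0 (min d (kap / 2)))" by (rule open_Int[OF _ open_ball])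
   moreover have "x0 \<in> W \<inter> G s -` ball 0 (eta ^ N) \<inter> ball x0 (min d (kap / 2))"
    using x0(1) x0(3)[OF s(1)] eta d(1) kap(1) by simp
   ultimately obtain x where x: "x \<in> W \<inter> G s -` ball 0 (eta ^ N) \<inter> ball x0 (min d (kap / 2))" "x \<in> V" "disc x \<noteq> 0"
    using nonzero_dense[OF disc(1) V_topology(1,2) _ _ x0D(2)] disc(3) by blast
   have "G s x = Rs s x" using G_eq[OF s(1)] x by blast
   then show False using low[of x] x by simp
  qed
 qed
 moreover have "\<forall>g\<in>f ` (- S) \<union> G ` {..<L}. hol g W"
  using G_hol hol_fV WD D_topology(5) hol_subset by blast
 ultimately show ?thesis
  unfolding analytic_near_def using W by (intro exI[of _ W] exI[of _ "f ` (- S) \<union> G ` {..<L}"]) auto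
qed

end

section \<open>Invariance under linear changes of coordinates\<close>

lemma closure_vimage_homeo:
 assumes h: "continuous_on UNIV h" and h': "continuous_on UNIV h'"
  and inv: "\<And>x. h (h' x) = x" "\<And>x. h' (h x) = x"
 shows "closure (h -` X) = h -` closure X"
proof
 show "closure (h -` X) \<subseteq> h -` closure X"
  by (rule closure_minimal) (use closure_subset in "auto intro: closed_vimage[OF closed_closure h]")
 show "h -` closure X \<subseteq> closure (h -` X)"
 proof
  fix x assume x: "x \<in> h -` closure X"
  show "x \<in> closure (h -` X)"
   unfolding closure_iff_nhds_not_empty
  proof (intro allI impI)
   fix U V assume "V \<subseteq> U" "open V" "x \<in> V"
   have "open (h' -` V)" by (rule open_vimage[OF \<open>open V\<close> h'])
   moreover have "h x \<in> h' -` V" using \<open>x \<in> V\<close> inv by simp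
   ultimately obtain z where "z \<in> X" "h' z \<in> V"
    using x unfolding vimage_def mem_Collect_eq closure_iff_nhds_not_empty by blast
   then have "h' z \<in> (h -` X) \<inter> V" using inv by simp
   then show "(h -` X) \<inter> U \<noteq> {}" using \<open>V \<subseteq> U\<close> by blast
  qed
 qed
qed

lemma matrix_cont: "continuous_on UNIV ((*v) (N :: complex ^ 'm ^ 'm))"
 by (rule holomorphic_map_continuous_on[OF holomorphic_map_matrix])

context
 fixes M M' :: "complex ^ 'm ^ 'm"
 assumes MM: "M ** M' = mat 1" "M' ** M = mat 1"
begin

lemma matrix_inv: "M *v (M' *v x) = x" "M' *v (M *v x) = x"
 by (simp_all add: matrix_vector_mul_assoc MM)

lemma closure_matrix_vimage: "closure ((*v) M -` X) = (*v) M -` closure X"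
 by (rule closure_vimage_homeo[OF matrix_cont matrix_cont, of _ M']) (rule matrix_inv)+

lemma analytic_near_matrix: "analytic_near ((*v) M -` X) 0 \<longleftrightarrow> analytic_near X 0"
proof
 assume "analytic_near ((*v) M -` X) 0"
 then have "analytic_near ((*v) M' -` ((*v) M -` X)) 0"
  by (intro analytic_near_preimage[where g="(*v) M'", OF _ holomorphic_map_matrix open_UNIV]) auto
 moreover have "(*v) M' -` ((*v) M -` X) = X" by (auto simp only: vimage_def matrix_inv mem_Collect_eq)
 ultimately show "analytic_near X 0" by simp
next
 assume "analytic_near X 0"
 then show "analytic_near ((*v) M -` X) 0"
  by (intro analytic_near_preimage[where g="(*v) M", OF _ holomorphic_map_matrix open_UNIV]) auto
qed

lemma local_dim_le_matrix:
 assumes "local_dim_le d ((*v) M -` X)"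
 shows "local_dim_le d X"
proof -
 obtain N N' :: "complex ^ 'm ^ 'm" and S e where N: "N ** N' = mat 1" "N' ** N = mat 1" "card S = d" "e > 0"
  "\<forall>y\<in>ball 0 e. (\<forall>k\<in>S. y $ k = 0) --> N *v y \<in> (*v) M -` X --> y = 0"
  using assms unfolding local_dim_le_def by blast
 have "(M ** N) ** (N' ** M') = M ** (N ** N') ** M'" by (simp only: matrix_mul_assoc)
 also have "\<dots> = mat 1" by (simp add: N MM)
 finally have 1: "(M ** N) ** (N' ** M') = mat 1" .
 have "(N' ** M') ** (M ** N) = N' ** (M' ** M) ** N" by (simp only: matrix_mul_assoc)
 also have "\<dots> = mat 1" by (simp add: N MM)
 finally have 2: "(N' ** M') ** (M ** N) = mat 1" .
 show ?thesis
  unfolding local_dim_le_def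
  by (intro exI[of _ "M ** N"] exI[of _ "N' ** M'"] exI[of _ S] conjI 1 2 N(3) exI[of _ e] N(4))
   (use N(5) in "simp add: matrix_vector_mul_assoc[symmetric]")
qed

end

lemma local_dim_le_mono:
 fixes A B :: "(complex ^ 'm) set"
 assumes "local_dim_le d B" "open U" "0 \<in> U" "A \<inter> U \<subseteq> B"
 shows "local_dim_le d A"
proof -
 obtain N N' :: "complex ^ 'm ^ 'm" and S e where N: "N ** N' = mat 1" "N' ** N = mat 1" "card S = d" "e > 0"
  "\<forall>y\<in>ball 0 e. (\<forall>k\<in>S. y $ k = 0) --> N *v y \<in> B --> y = 0"
  using assms(1) unfolding local_dim_le_def by blast
 have "open ((*v) N -` U)" by (rule open_vimage[OF assms(2) matrix_cont])
 moreover have "0 \<in> (*v) N -` U" using assms(3) by simp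
 ultimately obtain e' where e': "e' > 0" "ball 0 e' \<subseteq> (*v) N -` U" using open_contains_ball by blast
 have "\<forall>y\<in>ball 0 (min e e'). (\<forall>k\<in>S. y $ k = 0) --> N *v y \<in> A --> y = 0"
  using N(5) e'(2) assms(4) by (auto simp: subset_iff)
 moreover have "min e e' > 0" using N(4) e'(1) by simp
 ultimately show ?thesis
  unfolding local_dim_le_def using N(1-3)
  by (intro exI[of _ N] exI[of _ N'] exI[of _ S] conjI exI[of _ "min e e'"])
qed

abbreviation drops where
 "drops d B disc \<equiv> (\<exists>e>0. \<forall>x\<in>ball 0 e. disc x \<noteq> (0::complex)) \<or> d > 0 \<and> local_dim_le (d - 1) {x \<in> B. disc x = 0}"

text \<open>Every statement about a germ of dimension at most \<open>d\<close> is proved by induction on \<open>d\<close>, in linear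
 coordinates in which the germ is finite over a coordinate subspace; the part of the germ over the
 zero set of \<open>disc\<close> has smaller dimension.\<close>

lemma cover_germ_coordinates:
 fixes A B :: "(complex ^ 'm) set"
 assumes "local_dim_le d B" "analytic_near A 0" "analytic_near B 0"
 shows "\<exists>(M :: complex ^ 'm ^ 'm) (M' :: complex ^ 'm ^ 'm) S rho r r1 f FA FB disc. M ** M' = mat 1 \<and> M' ** M = mat 1 \<and>
  cover_germ S f rho r r1 ((*v) M -` A) ((*v) M -` B) FA FB disc \<and>
  (drops d ((*v) M -` B) disc)"
proof -
 obtain M M' :: "complex ^ 'm ^ 'm" and S e where M: "M ** M' = mat 1" "M' ** M = mat 1" "card S = d" "e > 0"
  "\<forall>y\<in>ball 0 e. (\<forall>k\<in>S. y $ k = 0) --> M *v y \<in> B --> y = 0"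
  using assms(1) unfolding local_dim_le_def by blast
 have an: "analytic_near ((*v) M -` A) 0" "analytic_near ((*v) M -` B) 0"
  using assms(2,3) by (simp_all add: analytic_near_matrix[OF M(1,2)])
 have iso: "x = 0" if "x \<in> ball 0 e" "\<forall>k\<in>S. x $ k = 0" "x \<in> (*v) M -` B" for x
  using M(5) that by blast
 obtain rho r r1 f FA FB disc where cg: "cover_germ S f rho r r1 ((*v) M -` A) ((*v) M -` B) FA FB disc"
  using cover_germ_exists[OF an M(4) iso] by blast
 interpret cover_germ S f rho r r1 "(*v) M -` A" "(*v) M -` B" FA FB disc by (rule cg)
 obtain y where "y \<in> V" "disc y \<noteq> 0" using disc(3) by blast
 then have "(\<exists>e>0. \<forall>x\<in>ball 0 e. disc x \<noteq> 0) \<or>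
   (card S > 0 \<and> local_dim_le (card S - 1) {x \<in> (*v) M -` B. disc x = 0})"
  by (intro dim_drop[OF M(4) iso disc(1) V_topology(1,2,4) disc(2)]) auto
 then have d: "drops d ((*v) M -` B) disc"
  unfolding M(3) .
 show ?thesis
  by (rule exI[of _ M], rule exI[of _ M'], rule exI[of _ S], rule exI[of _ rho], rule exI[of _ r],
   rule exI[of _ r1], rule exI[of _ f], rule exI[of _ FA], rule exI[of _ FB], rule exI[of _ disc],
   intro conjI M(1,2) cg d)
qed

section \<open>Closures of differences and chains of analytic germs\<close>

context cover_germ
begin

lemma split_closure:
 assumes "x \<in> D"
 shows "x \<in> closure (B - A) \<longleftrightarrow> x \<in> closure K \<or> x \<in> closure ({x\<in>B. disc x = 0} - A)"
proof -
 have "closure K \<subseteq> closure (B - A)" "closure ({x\<in>B. disc x = 0} - A) \<subseteq> closure (B - A)"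
  by (intro closure_mono; auto simp: K_def)+
 moreover have "x \<in> closure K \<or> x \<in> closure ({x\<in>B. disc x = 0} - A)" if "x \<in> closure (B - A)"
 proof -
  have "x \<in> closure ((B - A) \<inter> D)"
   using open_Int_closure_subset[OF D_topology(1), of "B - A"] that assms by (auto simp: Int_commute)
  also have "\<dots> \<subseteq> closure (K \<union> ({x\<in>B. disc x = 0} - A))"
   by (intro closure_mono) (auto simp: K_def)
  finally show ?thesis by (simp add: closure_Un)
 qed
 ultimately show ?thesis by blast
qed

lemma analytic_near_disc_zero: "analytic_near B 0 ==> analytic_near {x\<in>B. disc x = 0} 0"
proof -
 assume "analytic_near B 0"
 moreover have "analytic_near {x\<in>V. disc x = 0} 0"
  unfolding analytic_near_def
  by (intro exI[of _ V] exI[of _ "{disc}"]) (use V_topology disc in auto)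
 ultimately have "analytic_near (B \<inter> {x\<in>V. disc x = 0}) 0" by (rule analytic_near_Int)
 then show ?thesis by (rule analytic_near_cong[OF _ V_topology(1,4)]) auto
qed

lemma Z_0_sub: "y \<in> Z 0 ==> y = 0"
proof -
 assume y: "y \<in> Z 0"
 have "y $ i = 0" if i: "i \<notin> S" for i
 proof (rule ccontr)
  assume "y $ i \<noteq> 0"
  then have "f i (axis i (y $ i)) \<noteq> 0" using y i by (intro reg_f) (auto simp: Z_def D_def less_imp_le)
  moreover have "f i (axis i (y $ i)) = f i y"
   by (rule depD[OF dep_f[OF i]]) (use y i in "auto simp: Z_def axis_def")
  ultimately show False using y i by (auto simp: Z_def)
 qed
 then show ?thesis using y by (auto simp: Z_def vec_eq_iff)
qed

text \<open>Near a point with \<open>disc\<close> nonzero, \<open>B\<close> lies on a single sheet,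
  along which the equations of \<open>A\<close> hold if they hold at the point. Then
  \<open>B\<close> is contained in \<open>A\<close> near the point, which excludes it from the
  closure of \<open>B - A\<close>.\<close>

lemma closed_inside:
 assumes "A \<subseteq> B" "A \<inter> U' \<subseteq> closure (B - A)"
 shows "A \<inter> D \<inter> U' \<subseteq> {x. disc x = 0}"
proof (rule subsetI, rule CollectI, rule ccontr)
 fix x0 assume x0': "x0 \<in> A \<inter> D \<inter> U'" and nz: "disc x0 \<noteq> 0"
 then have x0: "x0 \<in> A" "x0 \<in> B" "x0 \<in> D" "x0 \<in> V" using assms(1) D_topology(5) by auto
 obtain U sig where *: "local_sheets (FA \<union> FB) x0 U sig"
  using sheet[OF x0(4) nz] by (elim exE)
 have U: "open U" "x0 \<in> U" "U \<subseteq> V" using * by blast+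
 have hol: "\<And>y. y \<in> Z x0 ==> holomorphic_map (sig y) U" and sig0: "\<And>y. y \<in> Z x0 ==> sig y x0 = y"
  and st: "\<And>x y q. x \<in> U ==> y \<in> Z x0 ==> q \<in> FA \<union> FB ==> q (sig y x) = 0 \<longleftrightarrow> q y = 0"
  and Z: "\<And>x. x \<in> U ==> Z x = (%y. sig y x) ` Z x0"
  using * by blast+
 \<comment> \<open>On \<open>W\<close> no sheet through another point of the fibre passes through
   its own base point \<open>x\<close>, so points of \<open>B\<close> in \<open>W\<close> lie on the
   sheet of \<open>x0\<close>.\<close>
 define W where "W = U \<inter> D \<inter> (\<Inter>y\<in>Z x0 - {x0}. {x\<in>U. sig y x \<noteq> x})"
 have "open {x\<in>U. sig y x \<noteq> x}" if "y \<in> Z x0" for y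
 proof -
  have "continuous_on U (%x. sig y x - x)"
   by (intro continuous_intros holomorphic_map_continuous_on hol that)
  from continuous_open_preimage[OF this U(1), of "-{0}"]
  show ?thesis by (simp add: vimage_def Int_def open_delete Compl_eq_Diff_UNIV)
 qed
 then have "open (\<Inter>y\<in>Z x0 - {x0}. {x\<in>U. sig y x \<noteq> x})"
  using finite_Z[OF x0(4)] by (intro open_INT) auto
 then have "open W" "x0 \<in> W"
  using U D_topology(1) x0(3) sig0 by (auto simp: W_def intro!: open_Int)
 have "W \<inter> B \<subseteq> A"
 proof
  fix x assume x: "x \<in> W \<inter> B"
  then have xU: "x \<in> U" "x \<in> V" "x \<in> D" using U by (auto simp: W_def)
  obtain y where y: "y \<in> Z x0" "x = sig y x" using B_in_Z[of x] x xU Z[OF xU(1)] by auto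
  have "y = x0"
  proof (rule ccontr)
   assume "y \<noteq> x0"
   then have "sig y x \<noteq> x" using x y(1) by (auto simp: W_def)
   then show False using y(2) by simp
  qed
  have "g x = 0" if g: "g \<in> FA" for g
  proof -
   have "g x0 = 0" using A_eq x0(1,4) g by blast
   then show ?thesis using st[OF xU(1) y(1), of g] g y(2) \<open>y = x0\<close> by simp
  qed
  then show "x \<in> A" using A_eq xU(2) by blast
 qed
 moreover have "x0 \<in> closure (B - A)" using assms(2) x0' by blast
 then have "W \<inter> (B - A) \<noteq> {}" using \<open>open W\<close> \<open>x0 \<in> W\<close>
  unfolding closure_iff_nhds_not_empty by blast
 ultimately show False by blast
qed

end

lemma closure_diff_analytic_0:
 fixes A B :: "(complex ^ 'm) set"
 assumes "local_dim_le d B" "analytic_near A 0" "analytic_near B 0"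
 shows "analytic_near (closure (B - A)) 0"
 using assms
proof (induction d arbitrary: A B rule: less_induct)
 case (less d)
 obtain M M' :: "complex ^ 'm ^ 'm" and S rho r r1 f FA FB disc where M: "M ** M' = mat 1" "M' ** M = mat 1"
  and cg: "cover_germ S f rho r r1 ((*v) M -` A) ((*v) M -` B) FA FB disc"
  and d: "drops d ((*v) M -` B) disc"
  using cover_germ_coordinates[OF less.prems] by (elim exE conjE)
 interpret cover_germ S f rho r r1 "(*v) M -` A" "(*v) M -` B" FA FB disc by (rule cg)
 let ?A = "(*v) M -` A" and ?B = "(*v) M -` B"
 let ?C = "{x\<in>?B. disc x = 0}"
 have an: "analytic_near ?A 0" "analytic_near ?B 0"
  using less.prems(2,3) by (simp_all add: analytic_near_matrix[OF M])
 have "analytic_near (closure (?C - ?A)) 0"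
  using d
 proof (elim disjE conjE exE)
  fix e assume e: "e > 0" "\<forall>x\<in>ball 0 e. disc x \<noteq> 0"
  have "ball 0 e \<inter> closure (?C - ?A) \<subseteq> closure (ball 0 e \<inter> (?C - ?A))"
   by (rule open_Int_closure_subset) simp
  also have "ball 0 e \<inter> (?C - ?A) = {}" using e(2) by blast
  finally show ?thesis using e(1) by (intro analytic_near_empty[of "ball 0 e"]) auto
 next
  assume "d > 0" "local_dim_le (d - 1) ?C"
  then show ?thesis
   by (intro less.IH[of "d - 1"] an analytic_near_disc_zero) auto
 qed
 then have "analytic_near (closure K \<union> closure (?C - ?A)) 0"
  by (intro analytic_near_Un closure_K_analytic)
 then have "analytic_near (closure (?B - ?A)) 0"
  by (rule analytic_near_cong[OF _ D_topology(1,4)]) (use split_closure in blast)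
 also have "?B - ?A = (*v) M -` (B - A)" by auto
 finally show ?case
  by (simp only: closure_matrix_vimage[OF M] analytic_near_matrix[OF M])
qed

text \<open>By \<open>closed_inside\<close> the germ of \<open>A\<close> lies in the part of
  \<open>B\<close> where \<open>disc\<close> vanishes, and there the dimension has dropped.\<close>

lemma nowhere_dense_dim_drop:
 fixes A B :: "(complex ^ 'm) set"
 assumes "local_dim_le d B" "analytic_near A 0" "analytic_near B 0"
  and "A \<subseteq> B" "0 \<in> A" and U: "open U" "0 \<in> U" "A \<inter> U \<subseteq> closure (B - A)"
 shows "d > 0 \<and> local_dim_le (d - 1) A"
proof -
 obtain M M' :: "complex ^ 'm ^ 'm" and S rho r r1 f FA FB disc where M: "M ** M' = mat 1" "M' ** M = mat 1"
  and cg: "cover_germ S f rho r r1 ((*v) M -` A) ((*v) M -` B) FA FB disc"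
  and d: "drops d ((*v) M -` B) disc"
  using cover_germ_coordinates[OF assms(1-3)] by (elim exE conjE)
 interpret cover_germ S f rho r r1 "(*v) M -` A" "(*v) M -` B" FA FB disc by (rule cg)
 let ?A = "(*v) M -` A" and ?B = "(*v) M -` B"
 define U' where "U' = (*v) M -` U \<inter> D"
 have U': "open U'" "0 \<in> U'"
  using open_vimage[OF U(1) matrix_cont[of M]] U(2) D_topology by (auto simp: U'_def)
 have AU: "?A \<inter> (*v) M -` U \<subseteq> closure (?B - ?A)"
 proof -
  have "?B - ?A = (*v) M -` (B - A)" by auto
  then show ?thesis using U(3) by (auto simp: closure_matrix_vimage[OF M])
 qed
 have AU': "?A \<inter> U' \<subseteq> {x. disc x = 0}"
  using closed_inside[OF _ AU] assms(4) by (auto simp: U'_def)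
 have "0 \<in> ?A \<inter> U'" using U'(2) assms(5) by simp
 then have "disc 0 = 0" using AU' by blast
 then have d': "d > 0" "local_dim_le (d - 1) {x \<in> ?B. disc x = 0}" using d by force+
 have "local_dim_le (d - 1) ?A"
  by (rule local_dim_le_mono[OF d'(2) U']) (use AU' assms(4) in auto)
 from local_dim_le_matrix[OF M this] d'(1) show ?thesis by (rule conjI[rotated])
qed

lemma holomorphic_map_translate: "holomorphic_map (%x. x + p) V"
 unfolding holomorphic_map_def
 by (auto intro!: hol_add hol_const hol_nth)

lemma analytic_near_translate: "analytic_near ((%x. x + p) -` A) 0 \<longleftrightarrow> analytic_near A p"
proof
 assume "analytic_near ((%x. x + p) -` A) 0"
 then have "analytic_near ((%x. x + (- p)) -` ((%x. x + p) -` A)) p"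
  by (intro analytic_near_preimage[where g="%x. x + (- p)", OF _ holomorphic_map_translate open_UNIV]) auto
 then show "analytic_near A p" by (simp add: vimage_def)
next
 assume "analytic_near A p"
 then show "analytic_near ((%x. x + p) -` A) 0"
  by (intro analytic_near_preimage[where g="%x. x + p", OF _ holomorphic_map_translate open_UNIV]) auto
qed

lemma closure_translate_vimage:
 "closure ((%x. x + p) -` A) = (%x. x + p) -` closure (A :: 'a::real_normed_vector set)"
 by (rule closure_vimage_homeo[where h'="%x. x - p"]) (auto intro!: continuous_intros)

theorem closure_diff_analytic:
 assumes "analytic_near A p" "analytic_near B p"
 shows "analytic_near (closure (B - A)) p"
proof -
 have "analytic_near (closure ((%x. x + p) -` B - (%x. x + p) -` A)) 0"
  by (rule closure_diff_analytic_0[OF local_dim_le_UNIV]) (use assms in "simp_all add: analytic_near_translate")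
 then show ?thesis
  unfolding vimage_Diff[symmetric] closure_translate_vimage analytic_near_translate .
qed

text \<open>Descending from the largest set, every step lowers the bound for the local dimension at
  \<open>p\<close>, which starts at \<open>CARD('m)\<close>.\<close>

lemma analytic_chain_bound:
 fixes A :: "nat => (complex ^ 'm) set"
 assumes an: "\<And>j. j \<le> N ==> analytic_near (A j) p" and "p \<in> A 0"
  and sub: "\<And>j. j < N ==> A j \<subseteq> A (Suc j)"
  and nd: "\<And>j. j < N ==> \<exists>U. open U \<and> p \<in> U \<and> A j \<inter> U \<subseteq> closure (A (Suc j) - A j)"
 shows "N \<le> CARD('m)"
proof -
 let ?A = "%j. (%x. x + p) -` A j"
 have p: "p \<in> A j" if "j \<le> N" for j
  using that assms(2) sub by (induction j) (auto simp: Suc_le_eq subset_iff)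
 have "k \<le> CARD('m) \<and> local_dim_le (CARD('m) - k) (?A (N - k))" if "k \<le> N" for k
  using that
 proof (induction k)
  case 0 show ?case by (simp add: local_dim_le_UNIV)
 next
  case (Suc k)
  define j where "j = N - Suc k"
  have j: "N - k = Suc j" "j < N" using Suc.prems by (auto simp: j_def)
  obtain U where U: "open U" "p \<in> U" "A j \<inter> U \<subseteq> closure (A (Suc j) - A j)" using nd[OF j(2)] by blast
  have "CARD('m) - k > 0 \<and> local_dim_le (CARD('m) - k - 1) (?A j)"
  proof (rule nowhere_dense_dim_drop)
   show "local_dim_le (CARD('m) - k) (?A (Suc j))" using Suc j(1) by simp
   show "analytic_near (?A j) 0" "analytic_near (?A (Suc j)) 0"
    using j(2) by (auto simp: analytic_near_translate intro!: an)
   show "?A j \<subseteq> ?A (Suc j)" using sub[OF j(2)] by auto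
   show "0 \<in> ?A j" using p j(2) by simp
   show "open ((%x. x + p) -` U)" by (intro open_vimage U continuous_intros)
   show "0 \<in> (%x. x + p) -` U" using U by simp
   show "?A j \<inter> (%x. x + p) -` U \<subseteq> closure (?A (Suc j) - ?A j)"
    unfolding vimage_Diff[symmetric] closure_translate_vimage using U(3) by blast
  qed
  then show ?case by (simp add: j_def)
 qed
 from this[of N] show ?thesis by simp
qed

section \<open>Multivalued curves\<close>

definition curve_sheets ::
  "real => (complex => (complex ^ 'm) set) => complex => complex set =>
   (complex ^ 'm => complex => complex ^ 'm) => bool" where
 "curve_sheets tau Gam t U sig \<longleftrightarrow> open U \<and> t \<in> U \<and> U \<subseteq> ball 0 tau - {0} \<and>
   (\<forall>y\<in>Gam t. sig y t = y \<and> (\<forall>i. (%s. sig y s $ i) holomorphic_on U)) \<and>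
   (\<forall>s\<in>U. inj_on (%y. sig y s) (Gam t) \<and> Gam s = (%y. sig y s) ` Gam t)"

text \<open>A curve with \<open>N\<close> distinct branches over a punctured disc. The branches may
  be permuted when the parameter runs around \<open>0\<close>, so only the finite set of values is a
  function of it.\<close>

definition multi_curve :: "real => nat => (complex => (complex ^ 'm) set) => bool" where
 "multi_curve tau N Gam \<longleftrightarrow> tau > 0 \<and> N > 0 \<and>
   (\<forall>t\<in>ball 0 tau - {0}. finite (Gam t) \<and> card (Gam t) = N \<and> (\<exists>U sig. curve_sheets tau Gam t U sig))"

definition curve_limit :: "(complex => (complex ^ 'm) set) => complex ^ 'm => bool" where
 "curve_limit Gam p \<longleftrightarrow> (\<forall>eps>0. \<exists>tau>0. \<forall>t\<in>ball 0 tau - {0}. Gam t \<subseteq> ball p eps)"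

lemma curve_sheetsD:
 assumes "curve_sheets tau Gam t U sig"
 shows "open U" "t \<in> U" "U \<subseteq> ball 0 tau - {0}" "y \<in> Gam t ==> sig y t = y"
  "y \<in> Gam t ==> (%s. sig y s $ i) holomorphic_on U"
  "s \<in> U ==> inj_on (%y. sig y s) (Gam t)" "s \<in> U ==> Gam s = (%y. sig y s) ` Gam t"
 using assms unfolding curve_sheets_def by blast+

lemma curve_sheets_cont:
 assumes "curve_sheets tau Gam t U sig" "y \<in> Gam t"
 shows "continuous_on U (sig y)"
proof -
 have "continuous_on U (%s. \<chi> i. sig y s $ i)"
  by (intro continuous_on_vec_lambda holomorphic_on_imp_continuous_on curve_sheetsD(5)[OF assms])
 then show ?thesis by (simp add: vec_lambda_eta)
qed

lemma multi_curve_image: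
 assumes mc: "multi_curve tau N Gam" and inv: "\<And>x. h (g x) = x"
  and hol: "\<And>U c. (\<forall>i. (%s. c s $ i) holomorphic_on U) ==> (\<forall>i. (%s. g (c s) $ i) holomorphic_on U)"
 shows "multi_curve tau N (%t::complex. g ` Gam t)"
 unfolding multi_curve_def
proof (intro conjI ballI)
 show "tau > 0" "N > 0" using mc by (auto simp: multi_curve_def)
 fix t :: complex assume t: "t \<in> ball 0 tau - {0}"
 then have f: "finite (Gam t)" "card (Gam t) = N" and ex: "\<exists>U sig. curve_sheets tau Gam t U sig"
  using mc by (auto simp: multi_curve_def)
 have ginj: "inj_on g X" for X by (rule inj_on_inverseI[of _ h]) (rule inv)
 show "finite (g ` Gam t)" "card (g ` Gam t) = N" using f card_image[OF ginj] by auto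
 obtain U sig where s: "curve_sheets tau Gam t U sig" using ex by (elim exE)
 have "curve_sheets tau (%t. g ` Gam t) t U (%z s. g (sig (h z) s))"
  unfolding curve_sheets_def
 proof (intro conjI ballI)
  show "open U" "t \<in> U" "U \<subseteq> ball 0 tau - {0}" by (rule curve_sheetsD[OF s])+
  fix z assume "z \<in> g ` Gam t"
  then obtain y where y: "y \<in> Gam t" "z = g y" by blast
  show "g (sig (h z) t) = z" using curve_sheetsD(4)[OF s y(1)] y by (simp add: inv)
  show "\<forall>i. (%s. g (sig (h z) s) $ i) holomorphic_on U"
   by (rule hol) (use curve_sheetsD(5)[OF s y(1)] y in "simp add: inv")
 next
  fix v assume v: "v \<in> U"
  have inj: "inj_on (%y. sig y v) (Gam t)" and G: "Gam v = (%y. sig y v) ` Gam t"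
   by (rule curve_sheetsD[OF s], rule v)+
  show "inj_on (%y. g (sig (h y) v)) (g ` Gam t)"
  proof (rule inj_onI)
   fix a b assume "a \<in> g ` Gam t" "b \<in> g ` Gam t" "g (sig (h a) v) = g (sig (h b) v)"
   then obtain a' b' where ab: "a = g a'" "b = g b'" "a' \<in> Gam t" "b' \<in> Gam t" "g (sig a' v) = g (sig b' v)"
    by (elim imageE) (simp add: inv)
   then have "h (g (sig a' v)) = h (g (sig b' v))" by simp
   then have "sig a' v = sig b' v" unfolding inv .
   then have "a' = b'" using inj ab(3,4) by (auto simp: inj_on_def)
   then show "a = b" using ab by simp
  qed
  show "g ` Gam v = (%y. g (sig (h y) v)) ` g ` Gam t"
   unfolding G by (simp add: image_image inv)
 qed
 then show "\<exists>U sig. curve_sheets tau (%t. g ` Gam t) t U sig" by blast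
qed

lemma curve_limit_image:
 assumes "curve_limit Gam p" "continuous_on UNIV g"
 shows "curve_limit (%t::complex. g ` Gam t) (g p)"
 unfolding curve_limit_def
proof (intro allI impI)
 fix eps :: real assume "eps > 0"
 have "open (g -` ball (g p) eps)" by (rule open_vimage[OF open_ball assms(2)])
 moreover have "p \<in> g -` ball (g p) eps" using \<open>eps > 0\<close> by simp
 ultimately obtain e where e: "e > 0" "ball p e \<subseteq> g -` ball (g p) eps" using open_contains_ball by blast
 obtain tau where "tau > 0" "\<forall>t\<in>ball 0 tau - {0}. Gam t \<subseteq> ball p e"
  using assms(1) e(1) unfolding curve_limit_def by blast
 then show "\<exists>tau>0. \<forall>t\<in>ball 0 tau - {0}. g ` Gam t \<subseteq> ball (g p) eps" using e(2) by blast
qed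

section \<open>Curves in the fibres over complex lines\<close>

context cover_germ
begin

text \<open>The fibres of \<open>K\<close> over the line spanned by \<open>x1\<close>. Along this
  line \<open>disc\<close> has no zero close to \<open>0\<close> other than possibly
  \<open>0\<close> itself, so there the fibres form sheets of constant number.\<close>

lemma multi_curve_K:
 assumes x1: "x1 \<in> K"
 shows "\<exists>tau N. multi_curve tau N (%t. Kx (t *s x1))"
proof -
 have x1V: "x1 \<in> V" "disc x1 \<noteq> 0" "x1 \<in> Kx x1" using x1 D_topology(5) by (auto simp: K_def Kx_def)
 obtain tau where tau: "tau > 0" "\<And>t. t \<in> ball 0 tau ==> t *s x1 \<in> V" "\<And>t. t \<in> ball 0 tau - {0} ==> disc (t *s x1) \<noteq> 0"
  using hol_isolated_line[OF disc(1) V_topology(1,2) x1V(1,2) V_topology(4)] by auto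
 define N where "N = card (Kx x1)"
 have "multi_curve tau N (%t. Kx (t *s x1))"
  unfolding multi_curve_def
 proof (intro conjI ballI)
  show "tau > 0" by fact
  show "N > 0" using x1V finite_Kx[of x1] by (auto simp: N_def card_gt_0_iff)
  fix t :: complex assume t: "t \<in> ball 0 tau - {0}"
  then have tV: "t *s x1 \<in> V" "disc (t *s x1) \<noteq> 0" using tau by auto
  show "finite (Kx (t *s x1))" by (rule finite_Kx[OF tV(1)])
  show "card (Kx (t *s x1)) = N" unfolding N_def by (rule card_Kx_const[OF tV x1V(1,2)])
  obtain U sig where *: "open U \<and> t *s x1 \<in> U \<and> U \<subseteq> V \<and> (\<forall>x\<in>U. disc x \<noteq> 0) \<and>
    (\<forall>y\<in>Kx (t *s x1). holomorphic_map (sig y) U \<and> sig y (t *s x1) = y) \<and>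
    (\<forall>x\<in>U. inj_on (%y. sig y x) (Kx (t *s x1)) \<and> Kx x = (%y. sig y x) ` Kx (t *s x1))"
   using sheetK[OF tV] by (elim exE)
  define W where "W = {s. 0 + s *s x1 \<in> U} \<inter> (ball 0 tau - {0})"
  have "curve_sheets tau (%t. Kx (t *s x1)) t W (%y s. sig y (s *s x1))"
   unfolding curve_sheets_def
  proof (intro conjI ballI allI)
   show "open W"
    unfolding W_def using * by (intro open_Int open_line_preimage open_Diff open_ball) auto
   show "t \<in> W" using * t by (auto simp: W_def)
   show "W \<subseteq> ball 0 tau - {0}" by (auto simp: W_def)
   fix y i assume y: "y \<in> Kx (t *s x1)"
   show "sig y (t *s x1) = y" using * y by blast
   have "hol (%x. sig y x $ i) U" using * y unfolding holomorphic_map_def by blast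
   then have "(%s. sig y (0 + s *s x1) $ i) holomorphic_on W"
    by (rule holomorphic_on_line) (auto simp: W_def)
   then show "(%s. sig y (s *s x1) $ i) holomorphic_on W" by simp
  next
   fix s assume "s \<in> W"
   then have "s *s x1 \<in> U" by (simp add: W_def)
   then show "inj_on (%y. sig y (s *s x1)) (Kx (t *s x1))" "Kx (s *s x1) = (%y. sig y (s *s x1)) ` Kx (t *s x1)"
    using * by blast+
  qed
  then show "\<exists>U sig. curve_sheets tau (%t. Kx (t *s x1)) t U sig" by blast
 qed
 then show ?thesis by blast
qed

text \<open>The fibre over the origin is the origin alone, and fibres vary continuously.\<close>

lemma curve_limit_K: "curve_limit (%t::complex. Kx (t *s x1)) 0"
 unfolding curve_limit_def
proof (intro allI impI)
 fix eps :: real assume "eps > 0"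
 obtain d where d: "d > 0" "\<forall>x\<in>ball 0 d \<inter> V. \<forall>y\<in>Z x. \<exists>y'\<in>Z 0. dist y y' < eps"
  using Z_near[OF V_topology(4) \<open>eps > 0\<close>] by blast
 have "open {t. 0 + t *s x1 \<in> ball 0 d \<inter> V}"
  by (rule open_line_preimage) (intro open_Int open_ball V_topology)
 moreover have "0 \<in> {t. 0 + t *s x1 \<in> ball 0 d \<inter> V}" using d(1) V_topology(4) by simp
 ultimately obtain tau where tau: "tau > 0" "ball 0 tau \<subseteq> {t. 0 + t *s x1 \<in> ball 0 d \<inter> V}"
  using open_contains_ball by blast
 have "Kx (t *s x1) \<subseteq> ball 0 eps" if t: "t \<in> ball 0 tau" for t :: complex
 proof
  fix y assume "y \<in> Kx (t *s x1)"
  then have "y \<in> Z (t *s x1)" using Kx_sub by blast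
  moreover have "t *s x1 \<in> ball 0 d \<inter> V" using tau(2) t by auto
  ultimately obtain y' where "y' \<in> Z 0" "dist y y' < eps" using d(2) by blast
  then show "y \<in> ball 0 eps" using Z_0_sub[of y'] by simp
 qed
 then show "\<exists>tau>0. \<forall>t\<in>ball 0 tau - {0}. Kx (t *s x1) \<subseteq> ball 0 eps" using tau(1) by blast
qed

end

lemma matrix_holomorphic_on:
 fixes M :: "complex ^ 'k ^ 'm"
 assumes "\<forall>i. (%s. c s $ i) holomorphic_on U"
 shows "\<forall>i. (%s. (M *v c s) $ i) holomorphic_on U"
 unfolding matrix_vector_mult_def
 using assms by (auto intro!: holomorphic_intros)

text \<open>A complex curve selection lemma. If the origin is a limit of the generic part
  \<open>K\<close>, fibres over a line give the curve; otherwise it is a limit of points with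
  \<open>disc\<close> zero, and the induction applies there.\<close>

lemma multi_curve_exists_0:
 fixes A B :: "(complex ^ 'm) set"
 assumes "local_dim_le d B" "analytic_near A 0" "analytic_near B 0" "0 \<in> closure (B - A)"
 shows "\<exists>tau N Gam. multi_curve tau N Gam \<and> (\<forall>t. Gam t \<subseteq> B - A) \<and> curve_limit Gam 0"
 using assms
proof (induction d arbitrary: A B rule: less_induct)
 case (less d)
 obtain M M' :: "complex ^ 'm ^ 'm" and S rho r r1 f FA FB disc where M: "M ** M' = mat 1" "M' ** M = mat 1"
  and cg: "cover_germ S f rho r r1 ((*v) M -` A) ((*v) M -` B) FA FB disc"
  and d: "drops d ((*v) M -` B) disc"
  using cover_germ_coordinates[OF less.prems(1-3)] by (elim exE conjE)
 interpret cover_germ S f rho r r1 "(*v) M -` A" "(*v) M -` B" FA FB disc by (rule cg)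
 let ?A = "(*v) M -` A" and ?B = "(*v) M -` B"
 let ?C = "{x\<in>?B. disc x = 0}"
 have an: "analytic_near ?A 0" "analytic_near ?B 0"
  using less.prems(2,3) by (simp_all add: analytic_near_matrix[OF M])
 have "?B - ?A = (*v) M -` (B - A)" by auto
 then have "0 \<in> closure (?B - ?A)"
  using less.prems(4) by (simp add: closure_matrix_vimage[OF M])
 then consider "0 \<in> closure K" | "0 \<in> closure (?C - ?A)"
  using split_closure[OF D_topology(4)] by blast
 then have "\<exists>tau N Gam. multi_curve tau N Gam \<and> (\<forall>t. Gam t \<subseteq> ?B - ?A) \<and> curve_limit Gam 0"
 proof cases
  case 1
  then have "K \<noteq> {}" by auto
  then obtain x1 where x1: "x1 \<in> K" by blast
  obtain tau N where "multi_curve tau N (%t. Kx (t *s x1))" using multi_curve_K[OF x1] by blast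
  moreover have "\<forall>t. Kx (t *s x1) \<subseteq> ?B - ?A" by (auto simp: Kx_def K_def)
  ultimately show ?thesis using curve_limit_K
   by (intro exI[of _ tau] exI[of _ N] exI[of _ "%t. Kx (t *s x1)"] conjI)
 next
  case 2
  have "\<not> (\<exists>e>0. \<forall>x\<in>ball 0 e. disc x \<noteq> 0)"
  proof
   assume "\<exists>e>0. \<forall>x\<in>ball 0 e. disc x \<noteq> 0"
   then obtain e where e: "e > 0" "\<forall>x\<in>ball 0 e. disc x \<noteq> 0" by blast
   have "ball 0 e \<inter> (?C - ?A) \<noteq> {}"
   proof
    assume "ball 0 e \<inter> (?C - ?A) = {}"
    then have "ball 0 e \<inter> closure (?C - ?A) = {}"
     by (simp only: open_Int_closure_eq_empty[OF open_ball])
    moreover have "0 \<in> ball 0 e" using e(1) by simp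
    ultimately show False using 2 by blast
   qed
   then show False using e(2) by blast
  qed
  then have d': "d > 0" "local_dim_le (d - 1) ?C" using d by blast+
  have "d - 1 < d" using d'(1) by simp
  from less.IH[OF this d'(2) an(1) analytic_near_disc_zero[OF an(2)] 2]
  obtain tau N Gam where "multi_curve tau N Gam \<and> (\<forall>t. Gam t \<subseteq> ?C - ?A) \<and> curve_limit Gam 0"
   by (elim exE)
  then show ?thesis by (intro exI[of _ tau] exI[of _ N] exI[of _ Gam]) blast
 qed
 then obtain tau N Gam where G: "multi_curve tau N Gam" "\<forall>t. Gam t \<subseteq> ?B - ?A" "curve_limit Gam 0" by (elim exE conjE)
 have "multi_curve tau N (%t. (*v) M ` Gam t)"
  by (rule multi_curve_image[OF G(1), where h="(*v) M'"]) (rule matrix_inv[OF M], rule matrix_holomorphic_on)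
 moreover have "\<forall>t. (*v) M ` Gam t \<subseteq> B - A" using G(2) by blast
 moreover have "curve_limit (%t. (*v) M ` Gam t) 0"
  using curve_limit_image[OF G(3) matrix_cont[of M]] by simp
 ultimately show ?case by (intro exI[of _ tau] exI[of _ N] exI[of _ "%t. (*v) M ` Gam t"] conjI)
qed

theorem multi_curve_exists:
 assumes "analytic_near A p" "analytic_near B p" "p \<in> closure (B - A)"
 shows "\<exists>tau N Gam. multi_curve tau N Gam \<and> (\<forall>t. Gam t \<subseteq> B - A) \<and> curve_limit Gam p"
proof -
 let ?A = "(%x. x + p) -` A" and ?B = "(%x. x + p) -` B"
 have "0 \<in> closure (?B - ?A)"
  unfolding vimage_Diff[symmetric] closure_translate_vimage using assms(3) by simp
 then have "\<exists>tau N Gam. multi_curve tau N Gam \<and> (\<forall>t. Gam t \<subseteq> ?B - ?A) \<and> curve_limit Gam 0"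
  by (intro multi_curve_exists_0[OF local_dim_le_UNIV]) (use assms in "simp_all add: analytic_near_translate")
 then obtain tau N Gam where G: "multi_curve tau N Gam" "\<forall>t. Gam t \<subseteq> ?B - ?A" "curve_limit Gam 0" by (elim exE conjE)
 have "multi_curve tau N (%t. (%x. x + p) ` Gam t)"
  by (rule multi_curve_image[OF G(1), where h="%x. x - p"]) (auto intro!: holomorphic_intros)
 moreover have "\<forall>t. (%x. x + p) ` Gam t \<subseteq> B - A" using G(2) by blast
 moreover have "curve_limit (%t. (%x. x + p) ` Gam t) p"
  using curve_limit_image[OF G(3), of "%x. x + p"] by (simp add: continuous_intros)
 ultimately show ?thesis by (intro exI[of _ tau] exI[of _ N] exI[of _ "%t. (%x. x + p) ` Gam t"] conjI)
qed

section \<open>Single-valued branches over convex sets\<close>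

lemma curve_sheets_section:
 assumes s: "curve_sheets tau Gam t U sig" "finite (Gam t)"
  and zeta: "continuous_on Del zeta" "open Del" "t \<in> Del" "\<And>s. s \<in> Del ==> zeta s \<in> Gam s"
 shows "\<exists>W. open W \<and> t \<in> W \<and> W \<subseteq> U \<inter> Del \<and> (\<forall>s\<in>W. zeta s = sig (zeta t) s)"
proof -
 note U = curve_sheetsD(1,2)[OF s(1)] and G = curve_sheetsD(7)[OF s(1)] and st = curve_sheetsD(4)[OF s(1)]
 define W where "W = U \<inter> Del \<inter> (\<Inter>y\<in>Gam t - {zeta t}. {s\<in>U \<inter> Del. zeta s \<noteq> sig y s})"
 have "open {s\<in>U \<inter> Del. zeta s \<noteq> sig y s}" if "y \<in> Gam t" for y
 proof -
  have "continuous_on (U \<inter> Del) (%s. zeta s - sig y s)"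
   by (intro continuous_intros continuous_on_subset[OF zeta(1)] continuous_on_subset[OF curve_sheets_cont[OF s(1) that]]) auto
  from continuous_open_preimage[OF this open_Int[OF U(1) zeta(2)], of "-{0}"]
  show ?thesis by (simp add: vimage_def Int_def open_delete Compl_eq_Diff_UNIV)
 qed
 then have "open W" unfolding W_def using s(2) U zeta(2) by (intro open_Int open_INT) auto
 moreover have "t \<in> W" using U zeta(3) st by (auto simp: W_def)
 moreover have "zeta v = sig (zeta t) v" if v: "v \<in> W" for v
 proof -
  have "v \<in> U" "v \<in> Del" using v by (auto simp: W_def)
  then obtain y where y: "y \<in> Gam t" "zeta v = sig y v" using zeta(4)[of v] G[of v] by blast
  then have "y = zeta t" using v by (auto simp: W_def)
  then show ?thesis using y by simp
 qed
 moreover have "W \<subseteq> U \<inter> Del" by (auto simp: W_def)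
 ultimately show ?thesis by (intro exI[of _ W] conjI ballI)
qed

text \<open>A sheet is relatively open in the graph, because over \<open>U\<close> it is the set of
  points that avoid the finitely many other sheets.\<close>

lemma multi_curve_covering:
 assumes mc: "multi_curve tau N Gam"
 shows "covering_space {(t, y). t \<in> ball 0 tau - {0} \<and> y \<in> Gam t} fst (ball 0 tau - {0})"
proof
 let ?c = "{(t, y). t \<in> ball 0 tau - {0} \<and> y \<in> Gam t}"
 show "continuous_on ?c fst" by (intro continuous_intros)
 have "\<exists>y. y \<in> Gam t" if "t \<in> ball 0 tau - {0}" for t :: complex
 proof -
  have "card (Gam t) > 0" using mc that unfolding multi_curve_def by simp
  then have "Gam t \<noteq> {}" by auto
  then show ?thesis by blast
 qed
 then show "fst ` ?c = ball 0 tau - {0}" by force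
 fix t :: complex assume t: "t \<in> ball 0 tau - {0}"
 have "finite (Gam t)" and ex: "\<exists>U sig. curve_sheets tau Gam t U sig" using mc t by (auto simp: multi_curve_def)
 obtain U sig where s: "curve_sheets tau Gam t U sig" using ex by (elim exE)
 note U = curve_sheetsD(1-3)[OF s] and inj = curve_sheetsD(6)[OF s] and G = curve_sheetsD(7)[OF s]
 define g where "g y = (%s. (s, sig y s)) ` U" for y
 have g_eq: "g y = ?c \<inter> ((U \<times> UNIV) \<inter> (\<Inter>y'\<in>Gam t - {y}. {x \<in> U \<times> UNIV. snd x \<noteq> sig y' (fst x)}))" (is "_ = ?c \<inter> ?O")
  if y: "y \<in> Gam t" for y
 proof (intro equalityI subsetI)
  fix x assume "x \<in> g y"
  then obtain v where v: "v \<in> U" "x = (v, sig y v)" by (auto simp: g_def)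
  then show "x \<in> ?c \<inter> ?O" using U(3) G[of v] inj[of v] y by (auto simp: inj_on_def)
 next
  fix x assume x: "x \<in> ?c \<inter> ?O"
  obtain v z where vz: "x = (v, z)" by (cases x)
  have v: "v \<in> U" "z \<in> Gam v" using x vz by auto
  then obtain y' where "y' \<in> Gam t" "z = sig y' v" using G by blast
  then show "x \<in> g y" using x vz v by (cases "y' = y") (auto simp: g_def)
 qed
 show "\<exists>T. t \<in> T \<and> openin (top_of_set (ball 0 tau - {0})) T \<and>
   (\<exists>v. \<Union>v = ?c \<inter> fst -` T \<and> (\<forall>u\<in>v. openin (top_of_set ?c) u) \<and> pairwise disjnt v \<and>
    (\<forall>u\<in>v. \<exists>q. homeomorphism u T fst q))"
 proof (intro exI[of _ U] conjI exI[of _ "g ` Gam t"] ballI)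
  show "t \<in> U" by fact
  show "openin (top_of_set (ball 0 tau - {0})) U" using U by (intro open_subset) auto
  show "\<Union> (g ` Gam t) = ?c \<inter> fst -` U"
  proof (intro equalityI subsetI)
   fix x assume "x \<in> \<Union> (g ` Gam t)"
   then show "x \<in> ?c \<inter> fst -` U" using g_eq by auto
  next
   fix x assume "x \<in> ?c \<inter> fst -` U"
   moreover obtain v z where vz: "x = (v, z)" by (cases x)
   ultimately have v: "v \<in> U" "z \<in> Gam v" by auto
   then show "x \<in> \<Union> (g ` Gam t)" using G[OF v(1)] vz by (auto simp: g_def)
  qed
  show "pairwise disjnt (g ` Gam t)"
  proof (rule pairwiseI)
   fix a b assume "a \<in> g ` Gam t" "b \<in> g ` Gam t" "a \<noteq> b"
   then obtain y y' where "a = g y" "b = g y'" "y \<in> Gam t" "y' \<in> Gam t" "y \<noteq> y'" by blast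
   then show "disjnt a b" using inj by (auto simp: disjnt_iff g_def inj_on_def)
  qed
  fix u assume "u \<in> g ` Gam t"
  then obtain y where y: "y \<in> Gam t" "u = g y" by blast
  have "open {x \<in> U \<times> UNIV. snd x \<noteq> sig y' (fst x)}" if "y' \<in> Gam t" for y'
  proof -
   have "continuous_on (U \<times> UNIV) (%x. snd x - sig y' (fst x))"
    by (intro continuous_intros continuous_on_compose2[OF curve_sheets_cont[OF s that]]) auto
   from continuous_open_preimage[OF this open_Times[OF U(1) open_UNIV], of "-{0}"]
   show ?thesis by (simp add: vimage_def Int_def open_delete Compl_eq_Diff_UNIV)
  qed
  then have "open ((U \<times> UNIV) \<inter> (\<Inter>y'\<in>Gam t - {y}. {x \<in> U \<times> UNIV. snd x \<noteq> sig y' (fst x)}))"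
   using \<open>finite (Gam t)\<close> U(1) by (intro open_Int open_INT open_Times) auto
  then show "openin (top_of_set ?c) u" unfolding y(2) g_eq[OF y(1)] by (rule openin_open_Int)
  have "homeomorphism u U fst (%s. (s, sig y s))"
   unfolding y(2) g_def
   by (rule homeomorphismI) (auto intro!: continuous_intros curve_sheets_cont[OF s y(1)])
  then show "\<exists>q. homeomorphism u U fst q" by blast
 qed
qed

text \<open>A convex set is simply connected, so its inclusion into the punctured disc lifts to the
  covering; locally the lift is a sheet and therefore holomorphic.\<close>

lemma multi_curve_section:
 assumes mc: "multi_curve tau N Gam" and Del: "open Del" "convex Del" "Del \<subseteq> ball 0 tau - {0}" "t0 \<in> Del"
  and y: "y \<in> Gam t0"
 shows "\<exists>zeta. continuous_on Del zeta \<and> (\<forall>i. (%s. zeta s $ i) holomorphic_on Del) \<and> zeta t0 = y \<and> (\<forall>s\<in>Del. zeta s \<in> Gam s)"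
proof -
 let ?c = "{(t, y). t \<in> ball 0 tau - {0} \<and> y \<in> Gam t}"
 have "(t0, y) \<in> ?c" using Del y by auto
 moreover have "simply_connected Del" "locally path_connected Del"
  using Del(1,2) by (simp_all add: convex_imp_simply_connected open_imp_locally_path_connected)
 moreover have "(%t. t) \<in> Del \<rightarrow> ball 0 tau - {0}" using Del(3) by auto
 moreover have "t0 = fst (t0, y)" by simp
 ultimately obtain g where g: "continuous_on Del g" "g \<in> Del \<rightarrow> ?c" "g t0 = (t0, y)" "\<And>t. t \<in> Del ==> fst (g t) = t"
  by (rule covering_space_lift_strong[OF multi_curve_covering[OF mc] _ Del(4) _ _ continuous_on_id])
   (rule that, assumption, assumption, assumption, simp)
 define zeta where "zeta t = snd (g t)" for t
 have cont: "continuous_on Del zeta" unfolding zeta_def by (intro continuous_intros g)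
 have inGam: "zeta t \<in> Gam t" if "t \<in> Del" for t
 proof -
  have "g t \<in> ?c" by (rule funcset_mem[OF g(2) that])
  then show ?thesis using g(4)[OF that] by (auto simp: zeta_def split: prod.splits)
 qed
 have "(%s. zeta s $ i) holomorphic_on Del" for i
 proof (rule holomorphic_onI)
  fix t assume t: "t \<in> Del"
  then have t': "t \<in> ball 0 tau - {0}" using Del by blast
  have "finite (Gam t)" and ex: "\<exists>U sig. curve_sheets tau Gam t U sig" using mc t' by (auto simp: multi_curve_def)
  obtain U sig where s: "curve_sheets tau Gam t U sig" using ex by (elim exE)
  obtain W where W: "open W" "t \<in> W" "W \<subseteq> U \<inter> Del" "\<And>s. s \<in> W ==> zeta s = sig (zeta t) s"
   using curve_sheets_section[OF s \<open>finite (Gam t)\<close> cont Del(1) t inGam] by blast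
  have "(%s. sig (zeta t) s $ i) holomorphic_on W"
   by (rule holomorphic_on_subset[OF curve_sheetsD(5)[OF s inGam[OF t]]]) (use W(3) in blast)
  then have "(%s. zeta s $ i) holomorphic_on W"
   by (rule holomorphic_transform) (simp add: W(4))
  then show "(%s. zeta s $ i) field_differentiable at t within Del"
   using W(1,2) holomorphic_on_imp_differentiable_at field_differentiable_at_within by blast
 qed
 then show ?thesis using cont inGam g(3) by (intro exI[of _ zeta]) (auto simp: zeta_def)
qed

section \<open>Generic equations and tangent fields\<close>

text \<open>\<open>tangent_space\<close> asks for curves that stay in \<open>M\<close> for all
  times; a curve given for small times is continued by the constant \<open>x\<close>, which leaves
  its velocity at \<open>0\<close> unchanged.\<close>

lemma tangent_spaceI_local:
 assumes "gam 0 = x" "eta > 0" "\<And>t. \<bar>t\<bar> < eta ==> gam t \<in> M" "(gam has_vector_derivative v) (at (0::real))"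
 shows "v \<in> tangent_space M x"
proof -
 define gam' where "gam' t = (if \<bar>t\<bar> < eta then gam t else x)" for t
 have "(gam' has_vector_derivative v) (at 0)"
  by (rule has_vector_derivative_transform_within_open[where S="ball 0 eta", OF assms(4)])
   (use assms(2) in "auto simp: gam'_def")
 moreover have "x \<in> M" using assms(3)[of 0] assms(1,2) by simp
 ultimately show ?thesis
  unfolding tangent_space_def using assms by (auto simp: gam'_def intro!: exI[of _ gam'])
qed

lemma tangent_space_mono: "A \<subseteq> B ==> tangent_space A x \<subseteq> tangent_space B x"
 unfolding tangent_space_def by blast

lemma tangent_space_matrix:
 assumes "v \<in> tangent_space ((*v) M -` X) y"
 shows "M *v v \<in> tangent_space X (M *v (y :: complex ^ 'm))"
proof -
 obtain gam where g: "gam 0 = y" "\<forall>t. gam t \<in> (*v) M -` X" "(gam has_vector_derivative v) (at (0::real))"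
  using assms unfolding tangent_space_def by blast
 have "bounded_linear ((*v) M)"
  by (rule linear_conv_bounded_linear[THEN iffD1]) (rule matrix_vector_mul_linear)
 from bounded_linear.has_vector_derivative[OF this g(3)] g(1,2) show ?thesis
  unfolding tangent_space_def by (auto intro!: exI[of _ "%t. M *v gam t"])
qed

section \<open>Kernel fields of a system with diagonal Jacobian\<close>

lemma fd_dep:
 fixes f :: "complex ^ 'm => complex"
 assumes "dep T f"
 shows "dep T (%x. fd f x v)"
 unfolding dep_def
proof (intro allI impI)
 fix x y :: "complex ^ 'm" assume eq: "\<forall>k\<in>T. x $ k = y $ k"
 have "f (x + h) = f (y + h)" for h by (rule depD[OF assms]) (simp add: eq)
 moreover from this[of 0] have "f x = f y" by simp
 ultimately have "fd f x = fd f y"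
  unfolding frechet_derivative_def has_derivative_at by simp
 then show "fd f x v = fd f y v" by simp
qed

lemma fd_dep_0:
 fixes f :: "complex ^ 'm => complex"
 assumes "dep T f" "hol f V" "x \<in> V" "k \<notin> T"
 shows "fd f x (axis k 1) = 0"
proof -
 have "((%t. f (x + t *s axis k 1)) has_field_derivative fd f (x + 0 *s axis k 1) (axis k 1)) (at 0)"
  by (rule hol_line[OF assms(2)]) (use assms(3) in simp)
 moreover have "f (x + t *s axis k 1) = f x" for t
  by (rule depD[OF assms(1)]) (use assms(4) in "auto simp: axis_def")
 ultimately have "((%t. f x) has_field_derivative fd f x (axis k 1)) (at 0)" by simp
 then show ?thesis using DERIV_unique[OF _ DERIV_const] by blast
qed

text \<open>The Jacobian determinant of the system \<open>g i = 0\<close> with respect to the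
  dependent coordinates. The matrix is diagonal, since \<open>g i\<close> involves no dependent
  coordinate besides its own.\<close>

definition pivot :: "'m::finite set => ('m => complex ^ 'm => complex) => complex ^ 'm => complex" where
 "pivot S g x = (\<Prod>i\<in>-S. fd (g i) x (axis i 1))"

text \<open>Cramer's solution for the kernel vector over the base direction \<open>j\<close>,
  multiplied by \<open>pivot\<close>; with denominators cleared it is holomorphic also where
  \<open>pivot\<close> vanishes.\<close>

definition field_dir :: "'m::finite set => ('m => complex ^ 'm => complex) => 'm => complex ^ 'm => complex ^ 'm" where
 "field_dir S g j x = (\<chi> k. if k \<in> S then if k = j then pivot S g x else 0
   else - fd (g k) x (axis j 1) * (\<Prod>i\<in>-S-{k}. fd (g i) x (axis i 1)))"

context
 fixes S :: "'m::finite set" and g :: "'m => complex ^ 'm => complex" and V :: "(complex ^ 'm) set"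
 assumes hol_g: "\<And>i. i \<notin> S ==> hol (g i) V" and V: "open V"
  and dep_g: "\<And>i. i \<notin> S ==> dep (insert i S) (g i)"
begin

lemma pivot_hol: "hol (pivot S g) V"
 unfolding pivot_def by (intro hol_prod hol_fd hol_g V) auto

lemma field_dir_hol: "holomorphic_map (field_dir S g j) V"
 unfolding holomorphic_map_def
proof
 fix k show "hol (%x. field_dir S g j x $ k) V"
 proof (cases "k \<in> S")
  case True
  then show ?thesis using pivot_hol by (cases "k = j") (simp_all add: field_dir_def hol_const)
 next
  case False
  then show ?thesis
   by (simp add: field_dir_def)
    (intro hol_mult hol_minus hol_prod hol_fd hol_g V; simp)
 qed
qed

lemma pivot_kernel:
 assumes x: "x \<in> V" and v: "\<And>i. i \<notin> S ==> fd (g i) x v = 0"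
 shows "pivot S g x *s v = (\<Sum>j\<in>S. v $ j *s field_dir S g j x)"
proof (rule vec_eq_iff[THEN iffD2], rule allI)
 fix k
 show "(pivot S g x *s v) $ k = (\<Sum>j\<in>S. v $ j *s field_dir S g j x) $ k"
 proof (cases "k \<in> S")
  case True
  have "(\<Sum>j\<in>S. v $ j *s field_dir S g j x) $ k = (\<Sum>j\<in>S. v $ j * field_dir S g j x $ k)" by simp
  also have "\<dots> = (\<Sum>j\<in>S. if k = j then v $ j * pivot S g x else 0)"
   by (intro sum.cong refl) (use True in "simp add: field_dir_def")
  also have "\<dots> = v $ k * pivot S g x" using True by simp
  finally show ?thesis by (simp add: mult.commute)
 next
  case False
  let ?d = "%l. fd (g k) x (axis l 1)" and ?R = "\<Prod>i\<in>-S-{k}. fd (g i) x (axis i 1)"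
  have "0 = fd (g k) x v" using v False by simp
  also have "\<dots> = (\<Sum>l\<in>UNIV. v $ l * ?d l)" by (rule fd_expand[OF hol_g[OF False] x])
  also have "\<dots> = (\<Sum>l\<in>insert k S. v $ l * ?d l)"
   by (rule sum.mono_neutral_right) (use fd_dep_0[OF dep_g[OF False] hol_g[OF False] x] in auto)
  also have "\<dots> = v $ k * ?d k + (\<Sum>l\<in>S. v $ l * ?d l)" using False by simp
  finally have "v $ k * ?d k = - (\<Sum>l\<in>S. v $ l * ?d l)" by (simp add: eq_neg_iff_add_eq_0)
  moreover have "pivot S g x = ?d k * ?R"
   unfolding pivot_def using False by (simp add: prod.remove[of "-S" k])
  ultimately have "(pivot S g x *s v) $ k = - (\<Sum>l\<in>S. v $ l * ?d l) * ?R"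
   by (simp add: mult.assoc[symmetric] mult.commute)
  also have "\<dots> = (\<Sum>j\<in>S. v $ j *s field_dir S g j x) $ k"
   using False by (simp add: field_dir_def sum_distrib_right sum_negf mult.assoc)
  finally show ?thesis .
 qed
qed

lemma pivot_span:
 assumes "x \<in> V" "\<And>i. i \<notin> S ==> fd (g i) x v = 0" "pivot S g x \<noteq> 0"
 shows "v \<in> vec.span ((%xi. xi x) ` field_dir S g ` S)"
proof -
 have "v = inverse (pivot S g x) *s (pivot S g x *s v)" using assms(3) by (simp add: vec_eq_iff)
 also have "pivot S g x *s v = (\<Sum>j\<in>S. v $ j *s field_dir S g j x)" by (rule pivot_kernel[OF assms(1,2)])
 also have "inverse (pivot S g x) *s \<dots> \<in> vec.span ((%xi. xi x) ` field_dir S g ` S)"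
  by (intro vec.span_scale vec.span_sum vec.span_base) auto
 finally show ?thesis .
qed

text \<open>The derivative of the section \<open>sig\<close> in the direction of the
  \<open>j\<close>-th axis scaled by \<open>pivot\<close> lies in the kernel and has the base
  components of \<open>field_dir\<close>; as \<open>pivot\<close> is nonzero, the two agree.\<close>

lemma field_dir_tangent:
 assumes y: "y \<in> U" "open U" and sig: "holomorphic_map sig U" "sig y = y"
  and sigX: "\<And>x. x \<in> U ==> sig x \<in> X" and sigV: "\<And>x. x \<in> U ==> sig x \<in> V"
  and sigS: "\<And>x k. x \<in> U ==> k \<in> S ==> sig x $ k = x $ k"
  and sigg: "\<And>x i. x \<in> U ==> i \<notin> S ==> g i (sig x) = 0"
  and nz: "pivot S g y \<noteq> 0" and j: "j \<in> S"
 shows "field_dir S g j y \<in> tangent_space X y"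
proof -
 define a where "a = pivot S g y *s axis j (1::complex)"
 define D where "D v = (\<chi> i. fd (%z. sig z $ i) y v)" for v
 have D: "(sig has_derivative D) (at y)" unfolding D_def by (rule holomorphic_map_deriv[OF sig(1) y(1)])
 have "D a $ k = a $ k" if "k \<in> S" for k
 proof -
  have "((%z. sig z $ k) has_derivative (%v. v $ k)) (at y)"
   by (rule has_derivative_transform_within_open[OF _ y(2,1)])
    (use sigS that in "auto intro!: bounded_linear_imp_has_derivative bounded_linear_vec_nth")
  from fd_eqI[OF this] show ?thesis by (simp add: D_def)
 qed
 then have Dk: "D a $ k = (if k = j then pivot S g y else 0)" if "k \<in> S" for k
  using that by (auto simp: a_def axis_def)
 have yV: "y \<in> V" using sigV[OF y(1)] sig(2) by simp
 have Dg: "fd (g i) y (D a) = 0" if i: "i \<notin> S" for i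
 proof -
  have "((%x. g i (sig x)) has_derivative (%v. fd (g i) (sig y) (D v))) (at y)"
   by (rule has_derivative_compose[OF D hol_deriv(1)[OF hol_g[OF i]]]) (simp add: sig(2) yV)
  moreover have "((%x. g i (sig x)) has_derivative (%v. 0)) (at y)"
   by (rule has_derivative_transform_within_open[OF _ y(2,1), of "%x. 0"]) (use sigg i in auto)
  ultimately have "(%v. fd (g i) (sig y) (D v)) = (%v. 0)" by (rule has_derivative_unique)
  from fun_cong[OF this, of a] show ?thesis by (simp add: sig(2))
 qed
 have "pivot S g y *s D a = (\<Sum>k\<in>S. D a $ k *s field_dir S g k y)" by (rule pivot_kernel[OF yV Dg])
 also have "\<dots> = (\<Sum>k\<in>S. if k = j then pivot S g y *s field_dir S g k y else 0)"
  by (intro sum.cong) (auto simp: Dk)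
 also have "\<dots> = pivot S g y *s field_dir S g j y" using j by simp
 finally have Da: "D a = field_dir S g j y" using nz by (simp add: vec_eq_iff)
 obtain kap where kap: "kap > 0" "ball y kap \<subseteq> U" using y open_contains_ball by blast
 define eta where "eta = kap / (norm a + 1)"
 have "y + t *\<^sub>R a \<in> U" if "\<bar>t\<bar> < eta" for t
 proof -
  have "\<bar>t\<bar> * (norm a + 1) < kap" using that by (simp add: eta_def pos_less_divide_eq add_nonneg_pos)
  then have "norm (t *\<^sub>R a) < kap" by (simp add: algebra_simps)
  then show ?thesis using kap(2) by (auto simp: dist_norm)
 qed
 moreover have "((%t. sig (y + t *\<^sub>R a)) has_vector_derivative D a) (at 0)"
 proof -
  have "((%t. y + t *\<^sub>R a) has_vector_derivative a) (at (0::real))"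
   by (auto intro!: derivative_eq_intros)
  moreover have "(sig has_derivative D) (at (y + 0 *\<^sub>R a))" using D by simp
  ultimately have "((%t. sig (y + t *\<^sub>R a)) has_derivative (%t. D (t *\<^sub>R a))) (at 0)"
   unfolding has_vector_derivative_def by (rule has_derivative_compose)
  then show ?thesis
   unfolding has_vector_derivative_def by (simp add: linear_cmul[OF has_derivative_linear[OF D]])
 qed
 ultimately have "D a \<in> tangent_space X y"
  by (intro tangent_spaceI_local[of "%t. sig (y + t *\<^sub>R a)" _ eta])
   (use sig(2) sigX kap(1) in "auto simp: eta_def add_nonneg_pos")
 then show ?thesis by (simp add: Da)
qed

end

text \<open>Points of a sequence are thickened to relatively open pieces of \<open>X\<close>, so
  that one may move within each piece to a more generic point.\<close>

definition shrinking :: "(complex ^ 'm) set => (nat => (complex ^ 'm) set) => bool" where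
 "shrinking X U \<longleftrightarrow> (\<forall>\<^sub>F k in sequentially. U k \<noteq> {} \<and> (\<exists>O'. open O' \<and> U k = X \<inter> O')) \<and>
   (\<forall>eps>0. \<forall>\<^sub>F k in sequentially. U k \<subseteq> ball 0 eps)"

abbreviation adapted where
 "adapted X e F Xi disc y \<equiv> y \<in> ball 0 e \<and> disc y \<noteq> (0::complex) \<and> (\<forall>f\<in>F. f y = (0::complex)) \<and>
   (\<forall>xi\<in>Xi. xi y \<in> tangent_space X y)"

text \<open>A substitute for generators of the full ideal of \<open>X\<close>. Off the zeros of
  \<open>disc\<close>, vectors killed by all differentials of \<open>F\<close> are spanned by the
  fields \<open>Xi\<close>; and infinitely many pieces contain a point with \<open>disc\<close>
  nonzero at which \<open>F\<close> vanishes and the fields are tangent to \<open>X\<close>. The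
  zero set of \<open>F\<close> is compared with \<open>X\<close> at these points only.\<close>

definition reduced_near :: "(complex ^ 'm) set => (nat => (complex ^ 'm) set) => bool" where
 "reduced_near X U \<longleftrightarrow> (\<exists>e F Xi disc. e > 0 \<and> finite F \<and> finite Xi \<and> (\<forall>f\<in>F. hol f (ball 0 e)) \<and>
   hol disc (ball 0 e) \<and> (\<forall>xi\<in>Xi. holomorphic_map xi (ball 0 e)) \<and>
   (\<forall>x\<in>ball 0 e. disc x \<noteq> 0 --> (\<forall>v. (\<forall>f\<in>F. fd f x v = 0) --> v \<in> vec.span ((%xi. xi x) ` Xi))) \<and>
   (\<exists>\<^sub>F k in sequentially. \<exists>y\<in>U k. adapted X e F Xi disc y))"

lemma reduced_near_mono:
 assumes "A \<subseteq> B" "reduced_near A U"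
 shows "reduced_near B U"
proof -
 obtain e F Xi disc where 1: "e > 0" "finite F" "finite Xi" "\<forall>f\<in>F. hol f (ball 0 e)"
   "hol disc (ball 0 e)" "\<forall>xi\<in>Xi. holomorphic_map xi (ball 0 e)"
   "\<forall>x\<in>ball 0 e. disc x \<noteq> 0 --> (\<forall>v. (\<forall>f\<in>F. fd f x v = 0) --> v \<in> vec.span ((%xi. xi x) ` Xi))"
   and 2: "\<exists>\<^sub>F k in sequentially. \<exists>y\<in>U k. adapted A e F Xi disc y"
  using assms(2) unfolding reduced_near_def by (elim exE conjE)
 have "\<exists>\<^sub>F k in sequentially. \<exists>y\<in>U k. adapted B e F Xi disc y"
  using 2
 proof (rule frequently_elim1)
  fix k assume "\<exists>y\<in>U k. adapted A e F Xi disc y"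
  then obtain y where y: "y \<in> U k" "y \<in> ball 0 e" "disc y \<noteq> 0" "\<forall>f\<in>F. f y = 0" "\<forall>xi\<in>Xi. xi y \<in> tangent_space A y"
   by (elim bexE conjE)
  have "\<forall>xi\<in>Xi. xi y \<in> tangent_space B y"
  proof
   fix xi assume "xi \<in> Xi"
   then show "xi y \<in> tangent_space B y" by (rule subsetD[OF tangent_space_mono[OF assms(1)] bspec[OF y(5)]])
  qed
  with y(1-4) show "\<exists>y\<in>U k. adapted B e F Xi disc y"
   by (intro bexI[of _ y] conjI)
 qed
 with 1 show ?thesis
  unfolding reduced_near_def
  by (intro exI[of _ e] exI[of _ F] exI[of _ Xi] exI[of _ disc] conjI)
qed

context
 fixes M M' :: "complex ^ 'm ^ 'm"
 assumes MM: "M ** M' = mat 1" "M' ** M = mat 1"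
begin

lemma shrinking_matrix:
 assumes "shrinking X U"
 shows "shrinking ((*v) M -` X) (%k. (*v) M -` U k)"
 unfolding shrinking_def
proof (intro conjI allI impI)
 have "\<forall>\<^sub>F k in sequentially. U k \<noteq> {} \<and> (\<exists>O'. open O' \<and> U k = X \<inter> O')"
  using assms unfolding shrinking_def by blast
 then show "\<forall>\<^sub>F k in sequentially. (*v) M -` U k \<noteq> {} \<and> (\<exists>O'. open O' \<and> (*v) M -` U k = (*v) M -` X \<inter> O')"
 proof (rule eventually_mono)
  fix k assume k: "U k \<noteq> {} \<and> (\<exists>O'. open O' \<and> U k = X \<inter> O')"
  then obtain x O' where x: "x \<in> U k" and O': "open O'" "U k = X \<inter> O'" by blast
  have "M' *v x \<in> (*v) M -` U k" using x by (simp add: matrix_inv[OF MM])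
  moreover have "open ((*v) M -` O')" by (rule open_vimage[OF O'(1) matrix_cont])
  ultimately show "(*v) M -` U k \<noteq> {} \<and> (\<exists>O'. open O' \<and> (*v) M -` U k = (*v) M -` X \<inter> O')"
   using O'(2) by (intro conjI exI[of _ "(*v) M -` O'"]) auto
 qed
 fix eps :: real assume "eps > 0"
 have "open ((*v) M' -` ball 0 eps)" "0 \<in> (*v) M' -` ball 0 eps"
  using open_vimage[OF open_ball matrix_cont] \<open>eps > 0\<close> by auto
 then obtain e where e: "e > 0" "ball 0 e \<subseteq> (*v) M' -` ball 0 eps" using open_contains_ball by blast
 have "\<forall>\<^sub>F k in sequentially. U k \<subseteq> ball 0 e" using assms e(1) unfolding shrinking_def by blast
 then show "\<forall>\<^sub>F k in sequentially. (*v) M -` U k \<subseteq> ball 0 eps"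
 proof (rule eventually_mono)
  fix k assume k: "U k \<subseteq> ball 0 e"
  show "(*v) M -` U k \<subseteq> ball 0 eps"
  proof
   fix x assume "x \<in> (*v) M -` U k"
   then have "M *v x \<in> (*v) M' -` ball 0 eps" using k e(2) by blast
   then show "x \<in> ball 0 eps" by (simp add: matrix_inv[OF MM])
  qed
 qed
qed

lemma reduced_near_matrix:
 assumes sh: "shrinking X U" and "reduced_near ((*v) M -` X) (%k. (*v) M -` U k)"
 shows "reduced_near X U"
proof -
 obtain e F Xi disc where 1: "e > 0" "finite F" "finite Xi" "\<forall>f\<in>F. hol f (ball 0 e)"
   "hol disc (ball 0 e)" "\<forall>xi\<in>Xi. holomorphic_map xi (ball 0 e)"
   "\<forall>x\<in>ball 0 e. disc x \<noteq> 0 --> (\<forall>v. (\<forall>f\<in>F. fd f x v = 0) --> v \<in> vec.span ((%xi. xi x) ` Xi))"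
   and 2: "\<exists>\<^sub>F k in sequentially. \<exists>y\<in>(*v) M -` U k. y \<in> ball 0 e \<and> disc y \<noteq> 0 \<and> (\<forall>f\<in>F. f y = 0) \<and>
    (\<forall>xi\<in>Xi. xi y \<in> tangent_space ((*v) M -` X) y)"
  using assms(2) unfolding reduced_near_def by (elim exE conjE)
 have inv: "M *v (M' *v x) = x" "M' *v (M *v x) = x" for x by (rule matrix_inv[OF MM])+
 have o: "open ((*v) M -` ball 0 e)" "open ((*v) M' -` ball 0 e)" "0 \<in> (*v) M' -` ball 0 e"
  using open_vimage[OF open_ball matrix_cont] \<open>e > 0\<close> by auto
 then obtain e' where e': "e' > 0" "ball 0 e' \<subseteq> (*v) M' -` ball 0 e" using open_contains_ball by blast
 have hM: "holomorphic_map ((*v) N) (ball 0 e')" for N :: "complex ^ 'm ^ 'm"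
  by (rule holomorphic_map_matrix)
 have comp: "hol (%x. f (M' *v x)) (ball 0 e')" if "hol f (ball 0 e)" for f
  by (rule hol_compose[OF that hM]) (use e'(2) in auto)
 have fdM: "fd (%x. f (M' *v x)) x v = fd f (M' *v x) (M' *v v)"
  if "hol f (ball 0 e)" "x \<in> ball 0 e'" for f x v
 proof -
  have "((*v) M' has_derivative (*v) M') (at x)"
   by (rule bounded_linear_imp_has_derivative) (rule matrix_vector_mul_bounded_linear)
  from has_derivative_compose[OF this hol_deriv(1)[OF that(1)]]
  show ?thesis using that(2) e'(2) by (intro fun_cong[OF fd_eqI]) auto
 qed
 define F' where "F' = (%f x. f (M' *v x)) ` F"
 define Xi' where "Xi' = (%xi x. M *v xi (M' *v x)) ` Xi"
 have "\<forall>f\<in>F'. hol f (ball 0 e')" using 1(4) comp by (auto simp: F'_def)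
 moreover have "hol (%x. disc (M' *v x)) (ball 0 e')" by (rule comp[OF 1(5)])
 moreover have "\<forall>xi\<in>Xi'. holomorphic_map xi (ball 0 e')"
 proof -
  have "holomorphic_map (%x. M *v xi (M' *v x)) (ball 0 e')" if "xi \<in> Xi" for xi
   unfolding holomorphic_map_def matrix_vector_mult_def[of M]
   using comp 1(6) that
   by (auto intro!: hol_sum hol_mult hol_const simp: holomorphic_map_def)
  then show ?thesis by (auto simp: Xi'_def)
 qed
 moreover have "v \<in> vec.span ((%xi. xi x) ` Xi')"
  if x: "x \<in> ball 0 e'" "disc (M' *v x) \<noteq> 0" and v: "\<forall>f\<in>F'. fd f x v = 0" for x v
 proof -
  have x': "M' *v x \<in> ball 0 e" using x(1) e'(2) by auto
  have "\<forall>f\<in>F. fd f (M' *v x) (M' *v v) = 0" using v fdM x(1) 1(4) by (auto simp: F'_def)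
  then have "M' *v v \<in> vec.span ((%xi. xi (M' *v x)) ` Xi)" using 1(7) x' x(2) by blast
  then have "M *v (M' *v v) \<in> (*v) M ` vec.span ((%xi. xi (M' *v x)) ` Xi)" by blast
  also have "\<dots> = vec.span ((*v) M ` (%xi. xi (M' *v x)) ` Xi)"
   by (rule vec.linear_span_image[symmetric]) (rule matrix_vector_mul_linear_gen)
  finally show ?thesis by (simp add: inv Xi'_def image_image)
 qed
 moreover have "\<exists>\<^sub>F k in sequentially. \<exists>y\<in>U k. y \<in> ball 0 e' \<and> disc (M' *v y) \<noteq> 0 \<and> (\<forall>f\<in>F'. f y = 0) \<and>
    (\<forall>xi\<in>Xi'. xi y \<in> tangent_space X y)"
 proof -
  have "\<forall>\<^sub>F k in sequentially. U k \<subseteq> ball 0 e'" using sh e'(1) unfolding shrinking_def by blast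
  from frequently_eventually_conj[OF 2 this] show ?thesis
  proof (rule frequently_elim1)
   fix k assume k: "U k \<subseteq> ball 0 e' \<and> (\<exists>y\<in>(*v) M -` U k. y \<in> ball 0 e \<and> disc y \<noteq> 0 \<and> (\<forall>f\<in>F. f y = 0) \<and>
    (\<forall>xi\<in>Xi. xi y \<in> tangent_space ((*v) M -` X) y))"
   then obtain y where y': "y \<in> (*v) M -` U k" and y: "disc y \<noteq> 0" "\<forall>f\<in>F. f y = 0"
    "\<forall>xi\<in>Xi. xi y \<in> tangent_space ((*v) M -` X) y" by (elim bexE conjE)
   have Uk: "M *v y \<in> U k" "M *v y \<in> ball 0 e'" using y' k by blast+
   have "\<forall>xi\<in>Xi'. xi (M *v y) \<in> tangent_space X (M *v y)"
   proof -
    have "M *v xi y \<in> tangent_space X (M *v y)" if "xi \<in> Xi" for xi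
     by (rule tangent_space_matrix) (rule bspec[OF y(3) that])
    then show ?thesis by (auto simp: Xi'_def inv)
   qed
   then show "\<exists>y\<in>U k. y \<in> ball 0 e' \<and> disc (M' *v y) \<noteq> 0 \<and> (\<forall>f\<in>F'. f y = 0) \<and>
    (\<forall>xi\<in>Xi'. xi y \<in> tangent_space X y)"
    using Uk y by (intro bexI[of _ "M *v y"] conjI) (simp_all add: F'_def inv)
  qed
 qed
 ultimately show ?thesis
  unfolding reduced_near_def using e'(1) 1(2,3)
  by (intro exI[of _ e'] exI[of _ F'] exI[of _ Xi'] exI[of _ "%x. disc (M' *v x)"] conjI)
   (auto simp: F'_def Xi'_def)
qed

end

definition partial_iter :: "'m => nat => (complex ^ 'm => complex) => complex ^ 'm => complex" where
 "partial_iter i k f = ((%f x. fd f x (axis i 1)) ^^ k) f"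

lemma partial_iter_simps [simp]: "partial_iter i 0 f = f"
 "partial_iter i (Suc k) f = (%x. fd (partial_iter i k f) x (axis i 1))"
 by (simp_all add: partial_iter_def)

lemma partial_iter_hol: "hol f V ==> open V ==> hol (partial_iter i k f) V"
 by (induction k) (auto intro: hol_fd)

lemma partial_iter_dep: "dep T f ==> dep T (partial_iter i k f)"
 by (induction k) (auto intro: fd_dep)

section \<open>Iterated partial derivatives and simple roots\<close>

lemma higher_deriv_upd:
 assumes "hol f V" "open V" "upd x i w \<in> V"
 shows "(deriv ^^ k) (%w. f (upd x i w)) w = partial_iter i k f (upd x i w)"
 using assms(3)
proof (induction k arbitrary: w)
 case 0 then show ?case by simp
next
 case (Suc k)
 have "\<forall>\<^sub>F w' in nhds w. w' \<in> {w. upd x i w \<in> V}"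
  using open_upd_preimage[OF assms(2)] Suc.prems by (intro eventually_nhds_in_open) auto
 then have "\<forall>\<^sub>F w' in nhds w. (deriv ^^ k) (%w. f (upd x i w)) w' = partial_iter i k f (upd x i w')"
  by (rule eventually_mono) (simp add: Suc.IH)
 then have "deriv ((deriv ^^ k) (%w. f (upd x i w))) w = deriv (%w'. partial_iter i k f (upd x i w')) w"
  by (rule deriv_cong_ev) simp
 also have "\<dots> = fd (partial_iter i k f) (upd x i w) (axis i 1)"
  by (rule DERIV_imp_deriv, rule deriv_upd[OF partial_iter_hol[OF assms(1,2)] Suc.prems])
 finally show ?case by simp
qed

text \<open>Otherwise all Taylor coefficients of \<open>f i\<close> on its axis vanish, against
  \<open>reg_f\<close>.\<close>

lemma (in branched_cover) partial_nonzero_0: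
 assumes i: "i \<notin> S"
 shows "\<exists>m. partial_iter i m (f i) 0 \<noteq> 0"
proof (rule ccontr)
 assume "\<not> ?thesis"
 then have 0: "partial_iter i m (f i) 0 = 0" for m by blast
 have sub: "upd 0 i w \<in> V" if "w \<in> cball 0 r" for w by (rule upd_V[OF V_topology(4) i that])
 have "(%w. f i (upd 0 i w)) holomorphic_on ball 0 r"
  by (rule holomorphic_on_upd[OF hol_fV[OF i] sub]) auto
 moreover have "complex_of_real (r / 2) \<in> ball 0 r" using r by simp
 moreover have "(deriv ^^ n) (%w. f i (upd 0 i w)) 0 = 0" for n
  unfolding higher_deriv_upd[OF hol_fV[OF i] V_topology(1) sub[of 0, simplified, OF less_imp_le[OF r(1)], folded upd_0]]
  by (simp add: axis_def flip: zero_vec_def) (rule 0)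
 ultimately have "f i (upd 0 i (complex_of_real (r / 2))) = 0" by (rule holomorphic_fun_eq_0_on_ball)
 moreover have "f i (axis i (complex_of_real (r / 2))) \<noteq> 0" using r by (intro reg_f[OF i]) auto
 ultimately show False by simp
qed

lemma shrinking_sub:
 assumes "shrinking X U" "\<forall>\<^sub>F k in sequentially. U k \<subseteq> X'" "X' \<subseteq> X"
 shows "shrinking X' U"
 unfolding shrinking_def
proof (intro conjI)
 have "\<forall>\<^sub>F k in sequentially. U k \<noteq> {} \<and> (\<exists>O'. open O' \<and> U k = X \<inter> O')"
  using assms(1) unfolding shrinking_def by blast
 then show "\<forall>\<^sub>F k in sequentially. U k \<noteq> {} \<and> (\<exists>O'. open O' \<and> U k = X' \<inter> O')"
  using assms(2)
 proof eventually_elim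
  case (elim k)
  then obtain O' where "open O'" "U k = X \<inter> O'" by blast
  then show ?case using elim assms(3) by blast
 qed
 show "\<forall>eps>0. \<forall>\<^sub>F k in sequentially. U k \<subseteq> ball 0 eps" using assms(1) unfolding shrinking_def by blast
qed

text \<open>The equations \<open>f i\<close> may have multiple roots on \<open>X\<close>. At a point
  off the zeros of \<open>disc\<close>, the derivative of \<open>f i\<close> just below the first
  nonvanishing one has a simple root, so these derivatives form a system with \<open>pivot\<close>
  nonzero. Their orders are bounded near the origin, hence one choice of orders serves infinitely
  many pieces. If the pieces eventually lie in the zeros of \<open>disc\<close>, the dimension
  drops.\<close>

theorem reduced_equations_dim:
 fixes X :: "(complex ^ 'm) set"
 assumes "local_dim_le d X" "analytic_near X 0" "shrinking X U"
 shows "reduced_near X U"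
 using assms
proof (induction d arbitrary: X U rule: less_induct)
 case (less d X0 U0)
 obtain M M' :: "complex ^ 'm ^ 'm" and S e0 where M: "M ** M' = mat 1" "M' ** M = mat 1" "card S = d" "e0 > 0"
  "\<forall>y\<in>ball 0 e0. (\<forall>k\<in>S. y $ k = 0) --> M *v y \<in> X0 --> y = 0"
  using less.prems(1) unfolding local_dim_le_def by blast
 define X where "X = (*v) M -` X0"
 define U where "U k = (*v) M -` U0 k" for k
 have an: "analytic_near X 0"
  using less.prems(2) by (simp add: X_def analytic_near_matrix[OF M(1,2)])
 have sh: "shrinking X U" unfolding X_def U_def by (rule shrinking_matrix[OF M(1,2) less.prems(3)])
 have iso: "x = 0" if "x \<in> ball 0 e0" "\<forall>k\<in>S. x $ k = 0" "x \<in> X" for x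
  using M(5) that unfolding X_def by blast
 have "\<exists>rho r r1 f FA FB disc0. cover_germ S f rho r r1 X X FA FB disc0"
  by (rule cover_germ_exists[OF an an M(4)]) (rule iso)
 then obtain rho r r1 f FA FB disc0 where cg: "cover_germ S f rho r r1 X X FA FB disc0" by (elim exE)
 interpret cover_germ S f rho r r1 X X FA FB disc0 by (rule cg)
 have "\<forall>i\<in>-S. \<exists>m. partial_iter i m (f i) 0 \<noteq> 0" using partial_nonzero_0 by blast
 then obtain m0 where m0: "\<forall>i\<in>-S. partial_iter i (m0 i) (f i) 0 \<noteq> 0" by (rule bchoice[THEN exE])
 define G where "G i k = partial_iter i k (f i)" for i k
 have G_hol: "hol (G i k) V" if "i \<notin> S" for i k
  unfolding G_def by (rule partial_iter_hol[OF hol_fV[OF that] V_topology(1)])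
 have G_dep: "dep (insert i S) (G i k)" if "i \<notin> S" for i k
  unfolding G_def by (rule partial_iter_dep[OF dep_f[OF that]])
 have G_Suc: "fd (G i k) x (axis i 1) = G i (Suc k) x" for i k x by (simp add: G_def)
 have "open (D \<inter> (\<Inter>i\<in>-S. {x\<in>V. G i (m0 i) x \<noteq> 0}))"
  by (intro open_Int D_topology open_INT ballI open_nonzero G_hol V_topology) auto
 moreover have "0 \<in> D \<inter> (\<Inter>i\<in>-S. {x\<in>V. G i (m0 i) x \<noteq> 0})"
  using m0 V_topology(4) D_topology(4) by (simp add: G_def)
 ultimately obtain e where e: "e > 0" "ball 0 e \<subseteq> D \<inter> (\<Inter>i\<in>-S. {x\<in>V. G i (m0 i) x \<noteq> 0})"
  by (rule openE)
 have eD: "ball 0 e \<subseteq> D" and eV: "ball 0 e \<subseteq> V" and em: "\<And>i x. i \<notin> S ==> x \<in> ball 0 e ==> G i (m0 i) x \<noteq> 0"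
  using e(2) D_topology(5) by blast+
 \<comment> \<open>The derivatives join the functions whose vanishing is constant along sheets; a
   derivative that is zero at a point of \<open>X\<close> is then zero along the whole
   sheet.\<close>
 define Q where "Q = FB \<union> (\<Union>i\<in>-S. G i ` {..m0 i})"
 have "finite Q" using fin by (simp add: Q_def)
 moreover have "hol q V" if "q \<in> Q" for q
  using that hol_FB G_hol by (auto simp: Q_def)
 ultimately obtain disc where disc0: "hol disc V \<and> dep S disc \<and> (\<exists>x\<in>V. disc x \<noteq> 0) \<and>
  (\<forall>x0\<in>V. disc x0 \<noteq> 0 --> (\<exists>U sig. local_sheets Q x0 U sig))"
  by (rule sheets[THEN exE])
 note disc = conjunct1[OF disc0] conjunct1[OF conjunct2[OF disc0]]
  conjunct1[OF conjunct2[OF conjunct2[OF disc0]]] conjunct2[OF conjunct2[OF conjunct2[OF disc0]]]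
 have Ue: "\<forall>\<^sub>F k in sequentially. U k \<subseteq> ball 0 e \<and> U k \<subseteq> X"
 proof -
  have "\<forall>\<^sub>F k in sequentially. U k \<subseteq> ball 0 e" and
   "\<forall>\<^sub>F k in sequentially. U k \<noteq> {} \<and> (\<exists>O'. open O' \<and> U k = X \<inter> O')"
   using sh e(1) unfolding shrinking_def by blast+
  then show ?thesis by eventually_elim blast
 qed
 define J where "J = PiE (-S) (%i. {..m0 i})"
 have "finite J" unfolding J_def by (intro finite_PiE) auto
 define good where "good n y \<longleftrightarrow> y \<in> ball 0 e \<and> y \<in> X \<and> disc y \<noteq> 0 \<and>
  (\<forall>i\<in>-S. n i \<le> m0 i \<and> G i (n i) y = 0 \<and> G i (Suc (n i)) y \<noteq> 0)" for n y
 have ex_good: "\<exists>n\<in>J. good n y" if y: "y \<in> ball 0 e" "y \<in> X" "disc y \<noteq> 0" for y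
 proof -
  have "\<exists>l. l < m0 i \<and> G i l y = 0 \<and> G i (Suc l) y \<noteq> 0" if i: "i \<notin> S" for i
  proof -
   \<comment> \<open>The first nonvanishing derivative. It is not the one of order zero, as
     \<open>f i\<close> vanishes on \<open>X\<close>; the derivative one order lower therefore
     exists and has a simple root at \<open>y\<close>.\<close>
   define l where "l = (LEAST l. G i l y \<noteq> 0)"
   have l: "G i l y \<noteq> 0" "l \<le> m0 i" using em[OF i y(1)] unfolding l_def by (rule LeastI, rule Least_le)
   have "G i 0 y = 0" using Bf[of y i] y(2) i eV y(1) by (auto simp: G_def)
   then obtain l' where l': "l = Suc l'" using l(1) by (cases l) auto
   then have "G i l' y = 0" using not_less_Least[of l' "%l. G i l y \<noteq> 0"] by (simp add: l_def[symmetric])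
   then show ?thesis using l l' by (intro exI[of _ l']) simp
  qed
  then have "\<forall>i\<in>-S. \<exists>l. l < m0 i \<and> G i l y = 0 \<and> G i (Suc l) y \<noteq> 0" by blast
  then obtain n where n: "\<forall>i\<in>-S. n i < m0 i \<and> G i (n i) y = 0 \<and> G i (Suc (n i)) y \<noteq> 0"
   by (rule bchoice[THEN exE])
  then show ?thesis using y by (intro bexI[of _ "restrict n (-S)"]) (auto simp: good_def J_def less_imp_le)
 qed
 have "reduced_near X U"
 proof (cases "\<exists>\<^sub>F k in sequentially. \<exists>y\<in>U k. disc y \<noteq> 0")
  case True
  have "\<exists>\<^sub>F k in sequentially. \<exists>n\<in>J. \<exists>y\<in>U k. good n y"
   using frequently_eventually_conj[OF True Ue]
  proof (rule frequently_elim1)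
   fix k assume k: "(U k \<subseteq> ball 0 e \<and> U k \<subseteq> X) \<and> (\<exists>y\<in>U k. disc y \<noteq> 0)"
   then obtain y where y: "y \<in> U k" "disc y \<noteq> 0" by blast
   then show "\<exists>n\<in>J. \<exists>y\<in>U k. good n y" using ex_good[of y] k by blast
  qed
  \<comment> \<open>Pigeonhole over the finitely many systems of orders.\<close>
  from frequently_bex_finite[OF \<open>finite J\<close> this]
  obtain n where n: "\<exists>\<^sub>F k in sequentially. \<exists>y\<in>U k. good n y" by (elim bexE)
  define g where "g i = G i (n i)" for i
  have g_hol: "\<And>i. i \<notin> S ==> hol (g i) V" and g_dep: "\<And>i. i \<notin> S ==> dep (insert i S) (g i)"
   unfolding g_def by (rule G_hol, assumption, rule G_dep)
  note ctx = g_hol V_topology(1) g_dep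
  have tang: "pivot S g y \<noteq> 0 \<and> (\<forall>i\<in>-S. g i y = 0) \<and> (\<forall>j\<in>S. field_dir S g j y \<in> tangent_space X y)"
   if y: "good n y" for y
  proof -
   have yV: "y \<in> V" "y \<in> D" "y \<in> X" "disc y \<noteq> 0" using y eV eD by (auto simp: good_def)
   have yn: "n i \<le> m0 i" "g i y = 0" "fd (g i) y (axis i 1) \<noteq> 0" if "i \<notin> S" for i
    using y that by (auto simp: good_def g_def G_Suc)
   have yZ: "y \<in> Z y" by (rule B_in_Z[OF yV(2,3)])
   have nz: "pivot S g y \<noteq> 0" using yn(3) by (simp add: pivot_def)
   from disc(4)[THEN bspec, OF yV(1), THEN mp, OF yV(4)]
   obtain W sig where W0: "open W" "y \<in> W" "W \<subseteq> V"
    and s1: "\<forall>y'\<in>Z y. holomorphic_map (sig y') W \<and> sig y' y = y' \<and> (\<forall>x\<in>W. \<forall>q\<in>Q. q (sig y' x) = 0 \<longleftrightarrow> q y' = 0)"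
    and s2: "\<forall>x\<in>W. inj_on (%y. sig y x) (Z y) \<and> Z x = (%y. sig y x) ` Z y"
    by (elim exE conjE)
   note s3 = bspec[OF s1 yZ]
   note W = W0(1,2) conjunct1[OF s3] conjunct1[OF conjunct2[OF s3]]
   have st: "q (sig y x) = 0 \<longleftrightarrow> q y = 0" if "x \<in> W" "q \<in> Q" for x q
    by (rule bspec[OF bspec[OF conjunct2[OF conjunct2[OF s3]] that(1)] that(2)])
   have ZW: "sig y x \<in> Z x" if "x \<in> W" for x
    using conjunct2[OF bspec[OF s2 that]] imageI[OF yZ, of "%y. sig y x"] by (simp only:)
   have sigV: "sig y x \<in> V" if "x \<in> W" for x using ZW[OF that] D_topology(5) by (auto simp: Z_def)
   have "field_dir S g j y \<in> tangent_space X y" if "j \<in> S" for j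
   proof (rule field_dir_tangent[OF ctx W(2,1,3,4) _ sigV _ _ nz that])
    fix x assume x: "x \<in> W"
    show "sig y x \<in> X"
    proof -
     have "\<forall>q\<in>FB. q y = 0" using B_eq yV(1,3) by blast
     then have "\<forall>q\<in>FB. q (sig y x) = 0" using st[OF x] by (auto simp: Q_def)
     then show ?thesis using B_eq sigV[OF x] by blast
    qed
    show "sig y x $ k = x $ k" if "k \<in> S" for k using ZW[OF x] that by (auto simp: Z_def)
    show "g i (sig y x) = 0" if "i \<notin> S" for i
     using st[OF x, of "g i"] yn(1,2)[OF that] that by (auto simp: Q_def g_def)
   qed
   then show ?thesis using nz yn(2) by auto
  qed
  show ?thesis
   unfolding reduced_near_def
  proof (rule exI[of _ e], rule exI[of _ "g ` (- S)"], rule exI[of _ "field_dir S g ` S"], rule exI[of _ "pivot S g"],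
    intro conjI ballI impI allI)
   show "e > 0" "finite (g ` (- S))" "finite (field_dir S g ` S)" using e(1) by auto
   show "hol h (ball 0 e)" if "h \<in> g ` (- S)" for h
    using that g_hol hol_subset[OF _ eV] by auto
   show "hol (pivot S g) (ball 0 e)"
    by (rule hol_subset[OF pivot_hol[OF ctx] eV])
   show "holomorphic_map xi (ball 0 e)" if "xi \<in> field_dir S g ` S" for xi
    using that field_dir_hol[OF ctx] hol_subset[OF _ eV] by (auto simp: holomorphic_map_def)
   show "v \<in> vec.span ((%xi. xi x) ` field_dir S g ` S)"
    if "x \<in> ball 0 e" "pivot S g x \<noteq> 0" "\<forall>f\<in>g ` (- S). fd f x v = 0" for x v
    by (rule pivot_span[OF ctx]) (use that eV in auto)
   show "\<exists>\<^sub>F k in sequentially. \<exists>y\<in>U k. y \<in> ball 0 e \<and> pivot S g y \<noteq> 0 \<and> (\<forall>f\<in>g ` (- S). f y = 0) \<and>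
    (\<forall>xi\<in>field_dir S g ` S. xi y \<in> tangent_space X y)"
    using n
   proof (rule frequently_elim1)
    fix k assume "\<exists>y\<in>U k. good n y"
    then obtain y where y: "y \<in> U k" "good n y" by blast
    have "y \<in> ball 0 e" using y(2) by (simp add: good_def)
    then show "\<exists>y\<in>U k. y \<in> ball 0 e \<and> pivot S g y \<noteq> 0 \<and> (\<forall>f\<in>g ` (- S). f y = 0) \<and>
     (\<forall>xi\<in>field_dir S g ` S. xi y \<in> tangent_space X y)"
     using tang[OF y(2)] y(1) by (intro bexI[of _ y] conjI) auto
   qed
  qed
 next
  case False
  let ?X' = "{x\<in>X. disc x = 0}"
  have "\<forall>\<^sub>F k in sequentially. \<forall>y\<in>U k. disc y = 0" using False by (simp add: frequently_def)
  then have sub: "\<forall>\<^sub>F k in sequentially. U k \<subseteq> ?X'" using Ue by eventually_elim blast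
  have sh': "shrinking ?X' U" by (rule shrinking_sub[OF sh sub]) auto
  obtain y where "y \<in> V" "disc y \<noteq> 0" using disc(3) by blast
  then have "(\<exists>e>0. \<forall>x\<in>ball 0 e. disc x \<noteq> 0) \<or> (card S > 0 \<and> local_dim_le (card S - 1) ?X')"
   by (intro dim_drop[OF M(4) iso disc(1) V_topology(1,2,4) disc(2)]) auto
  moreover have "\<not> (\<exists>e>0. \<forall>x\<in>ball 0 e. disc x \<noteq> 0)"
  proof
   assume "\<exists>e>0. \<forall>x\<in>ball 0 e. disc x \<noteq> 0"
   then obtain e' where e': "e' > 0" "\<forall>x\<in>ball 0 e'. disc x \<noteq> 0" by blast
   have "\<forall>\<^sub>F k in sequentially. U k \<subseteq> ball 0 e'" and
    "\<forall>\<^sub>F k in sequentially. U k \<noteq> {} \<and> (\<exists>O'. open O' \<and> U k = X \<inter> O')"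
    using sh e'(1) unfolding shrinking_def by blast+
   then have "\<forall>\<^sub>F k in sequentially. False" using sub by eventually_elim (use e'(2) in blast)
   then show False by simp
  qed
  ultimately have d: "d > 0" "local_dim_le (d - 1) ?X'" using M(3) by auto
  have "analytic_near ({x\<in>V. disc x = 0}) 0"
   unfolding analytic_near_def
   by (intro exI[of _ V] exI[of _ "{disc}"]) (use V_topology disc in auto)
  with an have "analytic_near (X \<inter> {x\<in>V. disc x = 0}) 0" by (rule analytic_near_Int)
  then have an': "analytic_near ?X' 0" by (rule analytic_near_cong[OF _ V_topology(1,4)]) auto
  have "reduced_near ?X' U" by (rule less.IH[OF _ d(2) an' sh']) (use d(1) in simp)
  then show ?thesis by (rule reduced_near_mono[rotated]) auto
 qed
 then show ?case unfolding X_def U_def by (rule reduced_near_matrix[OF M(1,2) less.prems(3)])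
qed

lemmas reduced_equations = reduced_equations_dim[OF local_dim_le_UNIV]

section \<open>Charts\<close>

text \<open>Difference quotients of a curve read in the chart lie in \<open>S\<close>, which is
  closed; conversely segments in \<open>S\<close> give curves in \<open>M\<close>. The statement
  uses real subspaces and Frechet derivatives at one point, so it serves complex and real
  \<open>C^1\<close> charts alike.\<close>

lemma tangent_space_chart:
 fixes M :: "(complex ^ 'n) set" and phi psi :: "complex ^ 'n => complex ^ 'n"
 assumes VW: "open V" "open W" "x \<in> V" and hom: "homeomorphism V W phi psi" and im: "phi ` (M \<inter> V) = W \<inter> S"
  and S: "subspace S" and phi: "(phi has_derivative phi') (at x)"
 shows "v \<in> tangent_space M x ==> phi' v \<in> S"
  and "x \<in> M ==> (psi has_derivative psi') (at (phi x)) ==> w \<in> S ==> psi' w \<in> tangent_space M x"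
  and "(psi has_derivative psi') (at (phi x)) ==> psi' (phi' v) = v"
  and "(psi has_derivative psi') (at (phi x)) ==> phi' (psi' v) = v"
proof -
 have inv: "\<And>z. z \<in> V ==> psi (phi z) = z" "\<And>z. z \<in> W ==> phi (psi z) = z" "\<And>z. z \<in> V ==> phi z \<in> W"
  "\<And>z. z \<in> W ==> psi z \<in> V"
  using hom unfolding homeomorphism_def by auto
 have wx: "phi x \<in> W" using inv(3) VW(3) .
 show 3: "psi' (phi' v) = v" if psi: "(psi has_derivative psi') (at (phi x))" for v
 proof -
  have "((%z. psi (phi z)) has_derivative (%v. psi' (phi' v))) (at x)" by (rule has_derivative_compose[OF phi psi])
  moreover have "((%z. psi (phi z)) has_derivative (%v. v)) (at x)"
   by (rule has_derivative_transform_within_open[OF has_derivative_ident VW(1,3)]) (simp add: inv)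
  ultimately show ?thesis by (metis has_derivative_unique)
 qed
 show "phi' (psi' v) = v" if psi: "(psi has_derivative psi') (at (phi x))" for v
 proof -
  have "(phi has_derivative phi') (at (psi (phi x)))" using phi inv(1)[OF VW(3)] by simp
  from has_derivative_compose[OF psi this]
  have "((%z. phi (psi z)) has_derivative (%v. phi' (psi' v))) (at (phi x))" .
  moreover have "((%z. phi (psi z)) has_derivative (%v. v)) (at (phi x))"
   by (rule has_derivative_transform_within_open[OF has_derivative_ident VW(2) wx]) (simp add: inv)
  ultimately show ?thesis by (metis has_derivative_unique)
 qed
 show "phi' v \<in> S" if v: "v \<in> tangent_space M x" for v
 proof -
  obtain gam where g: "gam 0 = x" "\<forall>t. gam t \<in> M" "(gam has_vector_derivative v) (at (0::real))"
   using v unfolding tangent_space_def by blast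
  have der: "((%t. phi (gam t)) has_vector_derivative phi' v) (at 0)"
  proof -
   have "(phi has_derivative phi') (at (gam 0))" using phi g(1) by simp
   from has_derivative_compose[OF g(3)[unfolded has_vector_derivative_def] this]
   show ?thesis
    unfolding has_vector_derivative_def by (simp add: linear_cmul[OF has_derivative_linear[OF phi]])
  qed
  have "isCont gam 0" using g(3) has_vector_derivative_continuous by blast
  then have "\<forall>\<^sub>F t in at 0. gam t \<in> V"
   using g(1) VW(1,3) unfolding isCont_def by (auto dest: topological_tendstoD)
  then have ev: "\<forall>\<^sub>F t in at 0. (phi (gam t) - phi x) /\<^sub>R t \<in> S"
  proof (rule eventually_mono)
   fix t assume "gam t \<in> V"
   then have "phi (gam t) \<in> S" "phi x \<in> S" using g(1,2) im VW(3) by (metis IntI IntE imageI)+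
   then show "(phi (gam t) - phi x) /\<^sub>R t \<in> S" using S by (intro subspace_scale subspace_diff)
  qed
  have "((%t. (phi (gam t) - phi x) /\<^sub>R t) \<longlongrightarrow> phi' v) (at 0)"
  proof -
   have "((%t. norm (phi (gam (0 + t)) - phi (gam 0) - t *\<^sub>R phi' v) / norm t) \<longlongrightarrow> 0) (at 0)"
    using der unfolding has_vector_derivative_def has_derivative_at by blast
   moreover have "norm (phi (gam (0 + t)) - phi (gam 0) - t *\<^sub>R phi' v) / norm t = norm ((phi (gam t) - phi x) /\<^sub>R t - phi' v)"
    if "t \<noteq> 0" for t
   proof -
    have "(phi (gam t) - phi x) /\<^sub>R t - phi' v = (phi (gam t) - phi x - t *\<^sub>R phi' v) /\<^sub>R t"
     using that by (simp add: scaleR_diff_right)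
    then show ?thesis using g(1) by (simp add: divide_inverse mult.commute)
   qed
   ultimately have "((%t. norm ((phi (gam t) - phi x) /\<^sub>R t - phi' v)) \<longlongrightarrow> 0) (at 0)"
    by (subst LIM_cong[OF refl _ refl]) auto
   then show ?thesis by (subst LIM_zero_iff[symmetric]) (rule tendsto_norm_zero_cancel)
  qed
  from Lim_in_closed_set[OF closed_subspace[OF S] ev _ this] show ?thesis by simp
 qed
 show "psi' w \<in> tangent_space M x" if "x \<in> M" and psi: "(psi has_derivative psi') (at (phi x))" and w: "w \<in> S" for w
 proof -
  have xS: "phi x \<in> S" using im VW(3) that(1) by blast
  have "open ((%t::real. phi x + t *\<^sub>R w) -` W)" by (intro open_vimage VW continuous_intros)
  moreover have "0 \<in> (%t::real. phi x + t *\<^sub>R w) -` W" using wx by simp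
  ultimately obtain eta where eta: "eta > 0" "ball 0 eta \<subseteq> (%t::real. phi x + t *\<^sub>R w) -` W" by (rule openE)
  show ?thesis
  proof (rule tangent_spaceI_local[of "%t. psi (phi x + t *\<^sub>R w)", OF _ eta(1)])
   show "psi (phi x + 0 *\<^sub>R w) = x" using inv(1) VW(3) by simp
   show "psi (phi x + t *\<^sub>R w) \<in> M" if "\<bar>t\<bar> < eta" for t
   proof -
    have "phi x + t *\<^sub>R w \<in> W" using eta(2) that by auto
    moreover have "phi x + t *\<^sub>R w \<in> S" using S xS w by (intro subspace_add subspace_scale)
    ultimately obtain m where "m \<in> M \<inter> V" "phi m = phi x + t *\<^sub>R w" using im by (metis IntI imageE)
    then show ?thesis using inv(1) by (metis IntE)
   qed
   have "((%t. phi x + t *\<^sub>R w) has_derivative (%t. t *\<^sub>R w)) (at (0::real))"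
    by (auto intro!: derivative_eq_intros)
   moreover have "(psi has_derivative psi') (at (phi x + 0 *\<^sub>R w))" using psi by simp
   ultimately have "((%t. psi (phi x + t *\<^sub>R w)) has_derivative (%t. psi' (t *\<^sub>R w))) (at (0::real))"
    by (rule has_derivative_compose)
   then show "((%t. psi (phi x + t *\<^sub>R w)) has_vector_derivative psi' w) (at 0)"
    unfolding has_vector_derivative_def by (simp add: linear_cmul[OF has_derivative_linear[OF psi]])
  qed
 qed
qed

section \<open>The pairing of covectors and vectors\<close>

definition pair :: "complex ^ 'n => complex ^ 'n => complex" where
 "pair h v = (\<Sum>i\<in>UNIV. h $ i * v $ i)"

lemma hyperplane_eq: "hyperplane h = {v. pair h v = 0}"
 by (simp add: hyperplane_def pair_def)

lemma pair_simps:
 "pair h (v + w) = pair h v + pair h w" "pair h (c *s v) = c * pair h v" "pair (h + k) v = pair h v + pair k v"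
 "pair (c *s h) v = c * pair h v" "pair h 0 = 0" "pair 0 v = 0" "pair h (axis i 1) = h $ i"
 "pair h (v - w) = pair h v - pair h w" "pair h (sum g A) = (\<Sum>a\<in>A. pair h (g a))"
 by (simp_all add: pair_def algebra_simps sum.distrib sum_distrib_left sum_subtractf axis_def if_distrib cong: if_cong)
  (rule sum.swap)

lemma pair_bound: "cmod (pair h v) \<le> real CARD('n) * (norm h * norm (v :: complex ^ 'n))"
proof -
 have "cmod (pair h v) \<le> (\<Sum>i\<in>UNIV. cmod (h $ i) * cmod (v $ i))"
  unfolding pair_def by (rule order_trans[OF norm_sum]) (simp add: norm_mult)
 also have "\<dots> \<le> (\<Sum>i\<in>(UNIV::'n set). norm h * norm v)"
  by (intro sum_mono mult_mono cmod_nth_le) auto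
 finally show ?thesis by simp
qed

lemma continuous_pair [continuous_intros]:
 "continuous_on A f ==> continuous_on A g ==> continuous_on A (%x. pair (f x) (g x))"
 unfolding pair_def by (intro continuous_intros)

lemma vec_subspace_imp_subspace: "vec.subspace S ==> subspace (S :: (complex ^ 'n) set)"
 unfolding subspace_def vec.subspace_def
proof (intro conjI ballI allI)
 assume *: "0 \<in> S \<and> (\<forall>x\<in>S. \<forall>y\<in>S. x + y \<in> S) \<and> (\<forall>c. \<forall>x\<in>S. c *s x \<in> S)"
 show "0 \<in> S" using * by blast
 show "x + y \<in> S" if "x \<in> S" "y \<in> S" for x y using * that by blast
 show "c *\<^sub>R x \<in> S" if "x \<in> S" for c x
 proof -
  have "c *\<^sub>R x = complex_of_real c *s x" by (simp add: vec_eq_iff scaleR_conv_of_real[where 'a=complex])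
  then show ?thesis using * that by simp
 qed
qed

text \<open>Pull \<open>h\<close> back along the derivative of the chart at \<open>y\<close>
  followed by that of its inverse at \<open>phi x\<close>. The result depends continuously on
  \<open>y\<close>, equals \<open>h\<close> at \<open>y = x\<close>, and kills the tangent space at
  \<open>y\<close>, which is carried into the one at \<open>x\<close>.\<close>

lemma tangent_hyperplane_perturb:
 fixes X :: "(complex ^ 'n) set"
 assumes reg: "x \<in> regular_points X" and tan: "tangent_space X x \<subseteq> hyperplane h" and "eps > 0"
 shows "\<exists>O'. open O' \<and> x \<in> O' \<and> (\<forall>y\<in>O'. \<exists>h'. norm (h' - h) < eps \<and> tangent_space X y \<subseteq> hyperplane h')"
proof -
 have xX: "x \<in> X" and sm: "submanifold_at holomorphic_map vec.subspace X x"
  using reg by (auto simp: regular_points_def)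
 obtain V W S and phi psi :: "complex ^ 'n => complex ^ 'n" where *: "open V \<and> open W \<and> x \<in> V \<and> homeomorphism V W phi psi \<and> holomorphic_map phi V \<and>
   holomorphic_map psi W \<and> vec.subspace S \<and> phi ` (X \<inter> V) = W \<inter> S"
  using sm unfolding submanifold_at_def by (elim exE) (rule that)
 have VW: "open V" "open W" "x \<in> V" and hom: "homeomorphism V W phi psi"
  and hol: "holomorphic_map phi V" "holomorphic_map psi W" and S: "vec.subspace S" and im: "phi ` (X \<inter> V) = W \<inter> S"
  using * by blast+
 have S': "subspace S" by (rule vec_subspace_imp_subspace[OF S])
 have wx: "phi x \<in> W" using hom VW(3) unfolding homeomorphism_def by blast
 define P where "P y v = (\<chi> i. fd (%z. phi z $ i) y v)" for y v
 define R where "R v = (\<chi> i. fd (%z. psi z $ i) (phi x) v)" for v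
 have P: "(phi has_derivative P y) (at y)" if "y \<in> V" for y
  unfolding P_def by (rule holomorphic_map_deriv[OF hol(1) that])
 have R: "(psi has_derivative R) (at (phi x))"
  unfolding R_def by (rule holomorphic_map_deriv[OF hol(2) wx])
 note ch = tangent_space_chart[OF VW(1,2) _ hom im S' P]
 have Rlin: "R (v + w) = R v + R w" "R (c *s v) = c *s R v" "R (sum f A) = (\<Sum>a\<in>A. R (f a))" for v w c f and A :: "'n set"
 proof -
  note l = has_derivative_linear[OF R]
  show "R (v + w) = R v + R w" by (rule linear_add[OF l])
  show "R (sum f A) = (\<Sum>a\<in>A. R (f a))" by (rule linear_sum[OF l])
  show "R (c *s v) = c *s R v"
   using hol(2) wx by (simp add: R_def vec_eq_iff holomorphic_map_def hol_deriv(2)[of _ W])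
 qed
 define H where "H y = (\<chi> i. pair h (R (P y (axis i 1))))" for y
 have H: "pair (H y) v = pair h (R (P y v))" if "y \<in> V" for y v
 proof -
  have "P y v = (\<Sum>i\<in>UNIV. v $ i *s P y (axis i 1))"
   using fd_expand[of "%z. phi z $ _" V y v] hol(1) that
   by (simp add: P_def vec_eq_iff holomorphic_map_def)
  then show ?thesis by (simp add: Rlin pair_simps) (simp add: pair_def H_def mult.commute)
 qed
 have "H x = h"
 proof -
  have "H x $ i = h $ i" for i
   using ch(3)[OF VW(3,3) R, of "axis i 1"] by (simp add: H_def pair_simps)
  then show ?thesis by (simp add: vec_eq_iff)
 qed
 have "continuous_on V H"
  unfolding H_def
 proof (intro continuous_on_vec_lambda continuous_pair continuous_on_const)
  fix i
  have "continuous_on V (%y. P y (axis i 1))"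
   unfolding P_def
   by (intro continuous_on_vec_lambda hol_continuous_on hol_fd VW)
    (use hol(1) in "simp add: holomorphic_map_def")
  moreover have "continuous_on UNIV R"
   using has_derivative_bounded_linear[OF R] by (rule linear_continuous_on)
  ultimately show "continuous_on V (%y. R (P y (axis i 1)))"
   by (auto intro: continuous_on_compose2)
 qed
 then have "open {y\<in>V. H y \<in> ball h eps}"
  using continuous_open_preimage[OF _ VW(1) open_ball] by (simp add: vimage_def Int_def)
 moreover have "x \<in> {y\<in>V. H y \<in> ball h eps}" using VW(3) \<open>H x = h\<close> \<open>eps > 0\<close> by simp
 moreover have tan: "tangent_space X y \<subseteq> hyperplane (H y)" if y: "y \<in> V" for y
 proof
  fix v assume "v \<in> tangent_space X y"
  then have "P y v \<in> S" by (rule ch(1)[OF y y])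
  then have "R (P y v) \<in> tangent_space X x" by (rule ch(2)[OF VW(3,3) xX R])
  then show "v \<in> hyperplane (H y)" using tan H[OF y] by (auto simp: hyperplane_eq)
 qed
 ultimately show ?thesis
 proof (intro exI[of _ "{y\<in>V. H y \<in> ball h eps}"] conjI ballI)
  fix y assume "y \<in> {y\<in>V. H y \<in> ball h eps}"
  then show "\<exists>h'. norm (h' - h) < eps \<and> tangent_space X y \<subseteq> hyperplane h'"
   using tan by (intro exI[of _ "H y"]) (auto simp: dist_norm norm_minus_commute)
 qed
qed

section \<open>Limits of tangent hyperplanes\<close>

text \<open>Extended by \<open>0\<close>, the function is \<open>t^n\<close> times a function
  without zeros, with \<open>n > 0\<close>, so the expression in the last hypothesis tends to
  \<open>n\<close>.\<close>

lemma log_derivative_limit: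
 assumes "tau > 0" and hol: "sig holomorphic_on ball 0 tau - {0}" and nz: "\<And>t. t \<in> ball 0 tau - {0} ==> sig t \<noteq> 0"
  and lim: "(sig \<longlongrightarrow> 0) (at 0)" and ld: "((%t. t * deriv sig t / sig t) \<longlongrightarrow> 0) (at (0::complex))"
 shows False
proof -
 let ?g = "%t. if t = 0 then 0 else sig t"
 have g: "?g holomorphic_on ball 0 tau" by (rule removable_singularity[OF hol open_ball lim])
 have "\<not> ?g constant_on ball 0 tau"
 proof
  assume "?g constant_on ball 0 tau"
  then obtain c where c: "\<forall>t\<in>ball 0 tau. ?g t = c" unfolding constant_on_def by blast
  have "c = 0" using c[rule_format, of 0] \<open>tau > 0\<close> by simp
  moreover have "complex_of_real (tau / 2) \<in> ball 0 tau - {0}" using \<open>tau > 0\<close> by auto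
  ultimately show False using c[rule_format, of "complex_of_real (tau / 2)"] nz[of "complex_of_real (tau / 2)"] by auto
 qed
 then obtain k r n where k: "0 < n" "0 < r" "k holomorphic_on ball 0 r"
  "\<And>w. w \<in> ball 0 r ==> ?g w = (w - 0)^n * k w" "\<And>w. w \<in> ball 0 r ==> k w \<noteq> 0"
 proof (rule holomorphic_factor_zero_nonconstant[OF g open_ball connected_ball, rotated 2])
  show "0 \<in> ball 0 tau" "(if (0::complex) = 0 then 0 else sig 0) = 0" using \<open>tau > 0\<close> by simp_all
  fix k r n assume a: "0 < n" "0 < r" "k holomorphic_on ball 0 r"
   "\<And>w. w \<in> ball 0 r ==> ?g w = (w - 0)^n * k w" "\<And>w. w \<in> ball 0 r ==> k w \<noteq> 0"
  show thesis by (rule that[OF a(1-3)]) (rule a(4), assumption, rule a(5))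
 qed
 have eq: "t * deriv sig t / sig t = of_nat n + t * deriv k t / k t" if t: "t \<in> ball 0 r - {0}" for t
 proof -
  have kd: "(k has_field_derivative deriv k t) (at t)"
   by (rule holomorphic_derivI[OF k(3) open_ball]) (use t in auto)
  have "((%w. w ^ n * k w) has_field_derivative (of_nat n * t ^ (n - 1) * k t + t ^ n * deriv k t)) (at t)"
   by (auto intro!: derivative_eq_intros kd)
  then have "(sig has_field_derivative (of_nat n * t ^ (n - 1) * k t + t ^ n * deriv k t)) (at t)"
  proof (rule has_field_derivative_transform_within_open[where S="ball 0 r - {0}"])
   show "w ^ n * k w = sig w" if "w \<in> ball 0 r - {0}" for w using k(4)[of w] that by simp
  qed (use t in auto)
  then have d: "deriv sig t = of_nat n * t ^ (n - 1) * k t + t ^ n * deriv k t" by (rule DERIV_imp_deriv)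
  have s: "sig t = t ^ n * k t" using k(4)[of t] t by simp
  obtain m where m: "n = Suc m" using k(1) by (cases n) auto
  have "t \<noteq> 0" "k t \<noteq> 0" using t k(5) by auto
  then show ?thesis unfolding d s by (simp add: m field_simps)
 qed
 have "isCont (%t. of_nat n + t * deriv k t / k t) 0"
 proof -
  have "continuous_on (ball 0 r) (%t. of_nat n + t * deriv k t / k t)"
   by (intro continuous_intros holomorphic_on_imp_continuous_on k(3) holomorphic_deriv open_ball) (use k(5) in auto)
  then show ?thesis using k(2) by (simp add: continuous_on_eq_continuous_at)
 qed
 then have "((%t. of_nat n + t * deriv k t / k t) \<longlongrightarrow> of_nat n) (at 0)" unfolding isCont_def by simp
 moreover have "\<forall>\<^sub>F t in at 0. t \<in> ball 0 r - {0}"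
  by (rule eventually_mono[OF eventually_at_ball'[OF k(2), of 0 UNIV]]) auto
 then have "\<forall>\<^sub>F t in at 0. of_nat n + t * deriv k t / k t = t * deriv sig t / sig t"
  by (rule eventually_mono) (simp add: eq)
 ultimately have "((%t. t * deriv sig t / sig t) \<longlongrightarrow> of_nat n) (at 0)" by (rule Lim_transform_eventually)
 from tendsto_unique[OF _ this ld] k(1) show False by simp
qed

lemma DERIV_prod_log:
 fixes f :: "'a => complex => complex"
 assumes "finite A" "\<And>a. a \<in> A ==> (f a has_field_derivative f' a) (at t)" "\<And>a. a \<in> A ==> f a t \<noteq> 0"
 shows "((%t. \<Prod>a\<in>A. f a t) has_field_derivative ((\<Prod>a\<in>A. f a t) * (\<Sum>a\<in>A. f' a / f a t))) (at t)"
 using assms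
proof (induction A rule: finite_induct)
 case (insert a A)
 have "((%t. f a t * (\<Prod>a\<in>A. f a t)) has_field_derivative
   (f' a * (\<Prod>a\<in>A. f a t) + ((\<Prod>a\<in>A. f a t) * (\<Sum>a\<in>A. f' a / f a t)) * f a t)) (at t)"
  by (rule DERIV_mult[OF insert.prems(1)[OF insertI1] insert.IH]) (rule insert.prems; simp)+
 moreover have "f' a * (\<Prod>a\<in>A. f a t) + ((\<Prod>a\<in>A. f a t) * (\<Sum>a\<in>A. f' a / f a t)) * f a t =
   f a t * (\<Prod>a\<in>A. f a t) * (f' a / f a t + (\<Sum>a\<in>A. f' a / f a t))"
  using insert.prems(2)[of a] by (simp add: field_simps)
 ultimately show ?case using insert.hyps by simp
qed simp

text \<open>A triple \<open>(s, u, h)\<close> is coded as a vector indexed by \<open>('n + 'n) option\<close>.\<close>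

definition scal :: "complex ^ ('n::finite + 'n) option => complex" where "scal z = z $ None"
definition vect :: "complex ^ ('n::finite + 'n) option => complex ^ 'n" where "vect z = (\<chi> i. z $ Some (Inl i))"
definition covect :: "complex ^ ('n::finite + 'n) option => complex ^ 'n" where "covect z = (\<chi> i. z $ Some (Inr i))"
definition triple :: "complex => complex ^ 'n::finite => complex ^ 'n => complex ^ ('n + 'n) option" where
 "triple s u h = (\<chi> k. case k of None => s | Some (Inl i) => u $ i | Some (Inr i) => h $ i)"

lemma triple_simps [simp]: "scal (triple s u h) = s" "vect (triple s u h) = u" "covect (triple s u h) = h"
 by (simp_all add: scal_def vect_def covect_def triple_def)

lemma continuous_triple [continuous_intros]: "continuous_on UNIV scal" "continuous_on UNIV vect" "continuous_on UNIV covect"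
 unfolding scal_def vect_def covect_def by (intro continuous_intros continuous_on_vec_lambda)+

lemma norm_triple_le: "norm (triple s u h) \<le> cmod s + real CARD('n) * norm u + real CARD('n) * norm (h :: complex ^ 'n)"
proof -
 have inj: "inj (Inl :: 'n => 'n + 'n)" "inj (Inr :: 'n => 'n + 'n)" by (auto intro: injI)
 have U: "(UNIV :: ('n + 'n) option set) = insert None (Some ` (range Inl \<union> range Inr))"
  by (auto simp: UNIV_option_conv UNIV_sum)
 have "norm (triple s u h) \<le> (\<Sum>k\<in>UNIV. cmod (triple s u h $ k))" unfolding norm_vec_def by (rule L2_set_le_sum) simp
 also have "\<dots> = cmod s + (\<Sum>k\<in>Some ` (range Inl \<union> range Inr). cmod (triple s u h $ k))"
  unfolding U by (subst sum.insert) (auto simp: triple_def)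
 also have "(\<Sum>k\<in>Some ` (range Inl \<union> range Inr). cmod (triple s u h $ k)) =
   (\<Sum>k\<in>range Inl. cmod (triple s u h $ Some k)) + (\<Sum>k\<in>range Inr. cmod (triple s u h $ Some k))"
  by (subst sum.reindex, simp, unfold o_def, rule sum.union_disjoint) auto
 also have "(\<Sum>k\<in>range Inl. cmod (triple s u h $ Some k)) = (\<Sum>i\<in>UNIV. cmod (u $ i))"
  by (subst sum.reindex[OF inj(1)]) (simp add: triple_def)
 also have "\<dots> \<le> (\<Sum>i\<in>(UNIV::'n set). norm u)" by (intro sum_mono cmod_nth_le)
 also have "(\<Sum>k\<in>range Inr. cmod (triple s u h $ Some k)) = (\<Sum>i\<in>UNIV. cmod (h $ i))"
  by (subst sum.reindex[OF inj(2)]) (simp add: triple_def)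
 also have "\<dots> \<le> (\<Sum>i\<in>(UNIV::'n set). norm h)" by (intro sum_mono cmod_nth_le)
 finally show ?thesis by simp
qed

lemma triple_diff: "triple s u h - triple s' u' h' = triple (s - s') (u - u') (h - h')"
 by (auto simp: triple_def vec_eq_iff split: option.split sum.split)

text \<open>The product \<open>sig\<close> of the first components over all branches is single
  valued on the punctured disc and has a logarithmic derivative equal to the sum over the branches.
  If the limit pairing were nonzero, \<open>rel\<close> would bound each summand by the derivative
  of the vector part, which Cauchy's estimate makes negligible.\<close>

theorem curve_pairing:
 fixes Gam :: "complex => (complex ^ ('n::finite + 'n) option) set"
 assumes mc: "multi_curve tau N Gam" and lim: "curve_limit Gam p0" and s0: "scal p0 = 0"
  and nz: "\<And>t z. z \<in> Gam t ==> scal z \<noteq> 0"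
  and rel: "\<And>t U c. open U ==> t \<in> U ==> U \<subseteq> ball 0 tau - {0} ==> (\<And>i. (%s. c s $ i) holomorphic_on U) ==>
   (\<And>s. s \<in> U ==> c s \<in> Gam s) ==>
   deriv (%s. scal (c s)) t * pair (covect (c t)) (vect (c t)) =
   - scal (c t) * pair (covect (c t)) (\<chi> i. deriv (%s. vect (c s) $ i) t)"
 shows "pair (covect p0) (vect p0) = 0"
proof (rule ccontr)
 define c0 where "c0 = pair (covect p0) (vect p0)"
 assume "pair (covect p0) (vect p0) \<noteq> 0"
 then have c0: "c0 \<noteq> 0" by (simp add: c0_def)
 have tau: "tau > 0" and N: "N > 0" using mc by (auto simp: multi_curve_def)
 define sig where "sig t = (\<Prod>z\<in>Gam t. scal z)" for t
 define n where "n = real CARD('n)"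
 have n: "n \<ge> 1" by (simp add: n_def Suc_leI)
 define H where "H = norm (covect p0) + 1"
 have H: "H > 0" by (simp add: H_def add_nonneg_pos)
 have lim': "\<exists>tau'>0. \<forall>t\<in>ball 0 tau' - {0}. Gam t \<subseteq> O'" if O': "open O'" "p0 \<in> O'" for O'
 proof -
  obtain eps where "eps > 0" "ball p0 eps \<subseteq> O'" using O' by (rule openE)
  then show ?thesis using lim unfolding curve_limit_def by (meson subset_trans)
 qed
 have fin: "finite (Gam t)" "card (Gam t) = N" and ex: "\<exists>U sig. curve_sheets tau Gam t U sig" if "t \<in> ball 0 tau - {0}" for t :: complex
  using mc that by (auto simp: multi_curve_def)
 have scal_hol: "(%s. scal (c s)) holomorphic_on U" if "\<And>i. (%s. c s $ i) holomorphic_on U" for c U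
  using that unfolding scal_def .
 \<comment> \<open>\<open>s' y\<close> is the derivative of the first component along the branch
   through \<open>y\<close>; it is the same for every section through \<open>y\<close>, so the
   section may be chosen later on a large disc.\<close>
 have sig_deriv: "\<exists>s'. (sig has_field_derivative (sig t * (\<Sum>y\<in>Gam t. s' y / scal y))) (at t) \<and>
   (\<forall>Del zeta. open Del \<and> t \<in> Del \<and> continuous_on Del zeta \<and> (\<forall>s\<in>Del. zeta s \<in> Gam s) --> deriv (%s. scal (zeta s)) t = s' (zeta t))"
  if t: "t \<in> ball 0 tau - {0}" for t :: complex
 proof -
  obtain U g where sh: "curve_sheets tau Gam t U g" using ex[OF t] by (elim exE)
  note s = curve_sheetsD[OF sh]
  define s' where "s' y = deriv (%s. scal (g y s)) t" for y
  have d: "((%s. scal (g y s)) has_field_derivative s' y) (at t)" if "y \<in> Gam t" for y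
   unfolding s'_def by (rule holomorphic_derivI[OF scal_hol[OF s(5)[OF that]] s(1,2)])
  have "((%s. \<Prod>y\<in>Gam t. scal (g y s)) has_field_derivative
    ((\<Prod>y\<in>Gam t. scal (g y t)) * (\<Sum>y\<in>Gam t. s' y / scal (g y t)))) (at t)"
   by (rule DERIV_prod_log[OF fin(1)[OF t] d]) (auto simp: s(4) nz)
  also have "(\<Prod>y\<in>Gam t. scal (g y t)) = sig t" unfolding sig_def by (rule prod.cong) (simp_all add: s(4))
  also have "(\<Sum>y\<in>Gam t. s' y / scal (g y t)) = (\<Sum>y\<in>Gam t. s' y / scal y)" by (rule sum.cong) (simp_all add: s(4))
  finally have D1: "(sig has_field_derivative (sig t * (\<Sum>y\<in>Gam t. s' y / scal y))) (at t)"
  proof (rule has_field_derivative_transform_within_open[OF _ s(1,2)])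
   fix v assume v: "v \<in> U"
   show "(\<Prod>y\<in>Gam t. scal (g y v)) = sig v"
    unfolding sig_def s(7)[OF v] by (simp add: prod.reindex[OF s(6)[OF v]])
  qed
  have D2: "deriv (%s. scal (zeta s)) t = s' (zeta t)"
   if "open Del" "t \<in> Del" "continuous_on Del zeta" "\<forall>s\<in>Del. zeta s \<in> Gam s" for Del zeta
  proof -
   have "\<exists>W. open W \<and> t \<in> W \<and> W \<subseteq> U \<inter> Del \<and> (\<forall>s\<in>W. zeta s = g (zeta t) s)"
    by (rule curve_sheets_section[OF sh fin(1)[OF t] that(3,1,2)]) (rule bspec[OF that(4)])
   then obtain W where W: "open W" "t \<in> W" "\<forall>s\<in>W. zeta s = g (zeta t) s" by (elim exE conjE)
   have "\<forall>\<^sub>F v in nhds t. v \<in> W" by (rule eventually_nhds_in_open[OF W(1,2)])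
   then have "\<forall>\<^sub>F v in nhds t. scal (zeta v) = scal (g (zeta t) v)"
    by (rule eventually_mono) (rule arg_cong[where f=scal], rule bspec[OF W(3)])
   then show ?thesis unfolding s'_def by (rule deriv_cong_ev) simp
  qed
  show ?thesis
   by (rule exI[of _ s'], intro conjI allI impI, rule D1, elim conjE, rule D2)
 qed
 have hol: "sig holomorphic_on ball 0 tau - {0}"
  unfolding holomorphic_on_def field_differentiable_def
  using sig_deriv has_field_derivative_at_within by blast
 have signz: "sig t \<noteq> 0" if "t \<in> ball 0 tau - {0}" for t :: complex
  using fin(1)[OF that] nz by (simp add: sig_def)
 have siglim: "(sig \<longlongrightarrow> 0) (at 0)"
 proof (rule tendstoI)
  fix eps :: real assume "eps > 0"
  define eps' where "eps' = min (eps / 2) 1"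
  have eps': "eps' > 0" "eps' < eps" "eps' \<le> 1" using \<open>eps > 0\<close> by (auto simp: eps'_def)
  have "open (scal -` ball (0::complex) eps' :: (complex ^ ('n + 'n) option) set)" "p0 \<in> scal -` ball 0 eps'"
   using open_vimage[OF open_ball continuous_triple(1)] s0 eps'(1) by auto
  from lim'[OF this] obtain tau' where tau': "tau' > 0" "\<forall>t\<in>ball 0 tau' - {0}. Gam t \<subseteq> scal -` ball 0 eps'" by (elim exE conjE)
  have "dist (sig t) 0 < eps" if t: "t \<in> ball 0 (min tau tau') - {0}" for t :: complex
  proof -
   have t': "t \<in> ball 0 tau - {0}" "t \<in> ball 0 tau' - {0}" using t by auto
   have b: "cmod (scal z) < eps'" if "z \<in> Gam t" for z using subsetD[OF bspec[OF tau'(2) t'(2)] that] by simp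
   have "cmod (sig t) = (\<Prod>z\<in>Gam t. cmod (scal z))" by (simp add: sig_def prod_norm)
   also have "\<dots> \<le> (\<Prod>z\<in>Gam t. eps')" by (intro prod_mono) (use b in "auto intro: less_imp_le")
   also have "\<dots> = eps' ^ N" by (simp add: fin(2)[OF t'(1)])
   also have "\<dots> \<le> eps' ^ 1" by (rule power_decreasing) (use N eps' in auto)
   finally show ?thesis using eps'(2) by simp
  qed
  then show "\<forall>\<^sub>F t in at 0. dist (sig t) 0 < eps"
   using eventually_at_ball'[of "min tau tau'" 0 UNIV] tau tau'(1) by (auto elim: eventually_mono)
 qed
 have ld: "((%t. t * deriv sig t / sig t) \<longlongrightarrow> 0) (at 0)"
 proof (rule tendstoI)
  fix eps :: real assume eps: "eps > 0"
  \<comment> \<open>Chosen so that the final bound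
    \<open>n * (H * (n * (4 * kap))) / (cmod c0 / 2)\<close> equals
    \<open>eps / (2 * real N)\<close>.\<close>
  define kap where "kap = eps * cmod c0 / (16 * n * n * H * real N)"
  have kap: "kap > 0" using eps c0 n H N by (simp add: kap_def)
  define O' :: "(complex ^ ('n + 'n) option) set" where
   "O' = (%z. pair (covect z) (vect z)) -` ball c0 (cmod c0 / 2) \<inter> covect -` ball (covect p0) 1 \<inter> vect -` ball (vect p0) kap"
  have "open O'" unfolding O'_def
   by (intro open_Int open_vimage open_ball continuous_intros)
  moreover have "p0 \<in> O'" using c0 kap by (simp add: O'_def c0_def)
  ultimately have "\<exists>tau'>0. \<forall>t\<in>ball 0 tau' - {0}. Gam t \<subseteq> O'" by (rule lim')
  then obtain tau' where tau': "tau' > 0" "\<forall>t\<in>ball 0 tau' - {0}. Gam t \<subseteq> O'" by (elim exE conjE)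
  have "dist (t * deriv sig t / sig t) 0 < eps" if t: "t \<in> ball 0 (min tau tau' / 2) - {0}" for t :: complex
  proof -
   have t': "t \<in> ball 0 tau - {0}" "t \<in> ball 0 tau' - {0}" using t tau tau'(1) by auto
   \<comment> \<open>A convex disc that avoids \<open>0\<close>, so a branch is single valued on it.
     Its radius is proportional to \<open>cmod t\<close>, whence the factor
     \<open>4 / cmod t\<close> from Cauchy's estimate cancels against the factor
     \<open>t\<close>.\<close>
   define Del where "Del = ball t (cmod t / 2)"
   have Del: "open Del" "convex Del" "t \<in> Del" using t by (auto simp: Del_def)
   have sub: "Del \<subseteq> ball 0 (min tau tau') - {0}"
   proof
    fix v assume "v \<in> Del"
    then have v: "cmod (t - v) < cmod t / 2" by (simp add: Del_def dist_norm)
    have "cmod v \<le> cmod t + cmod (t - v)" using norm_triangle_ineq4[of t "t - v"] by simp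
    moreover have "0 \<le> cmod (t - v)" "cmod t * 2 < tau" "cmod t * 2 < tau'" using t by simp_all
    ultimately have "cmod v < tau" "cmod v < tau'" using v by linarith+
    then have "cmod v < min tau tau'" by simp
    moreover have "v \<noteq> 0" using v by auto
    ultimately show "v \<in> ball 0 (min tau tau') - {0}" by simp
   qed
   from sig_deriv[OF t'(1)]
   obtain s' where d: "(sig has_field_derivative (sig t * (\<Sum>y\<in>Gam t. s' y / scal y))) (at t)"
    and s': "\<forall>Del zeta. open Del \<and> t \<in> Del \<and> continuous_on Del zeta \<and> (\<forall>s\<in>Del. zeta s \<in> Gam s) --> deriv (%s. scal (zeta s)) t = s' (zeta t)"
    by (elim exE conjE)
   have eq: "t * deriv sig t / sig t = (\<Sum>y\<in>Gam t. t * s' y / scal y)"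
   proof -
    have "t * deriv sig t / sig t = t * (\<Sum>y\<in>Gam t. s' y / scal y)"
     unfolding DERIV_imp_deriv[OF d] using signz[OF t'(1)] by simp
    then show ?thesis by (simp add: sum_distrib_left)
   qed
   have bound: "cmod (t * s' y / scal y) \<le> eps / (2 * real N)" if y: "y \<in> Gam t" for y
   proof -
    have sub': "Del \<subseteq> ball 0 tau - {0}" using sub by auto
    from multi_curve_section[OF mc Del(1,2) sub' Del(3) y]
    obtain zeta where zeta: "continuous_on Del zeta" "\<forall>i. (%s. zeta s $ i) holomorphic_on Del" "zeta t = y" "\<forall>s\<in>Del. zeta s \<in> Gam s"
     by (elim exE conjE)
    have in': "zeta v \<in> O'" if "v \<in> Del" for v
    proof -
     have "zeta v \<in> Gam v" using zeta(4) that by blast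
     moreover have "v \<in> ball 0 tau' - {0}" using sub that by auto
     ultimately show ?thesis using tau'(2) by blast
    qed
    have sy: "s' y = deriv (%s. scal (zeta s)) t" using s' zeta Del by metis
    define u' where "u' = (\<chi> i. deriv (%s. vect (zeta s) $ i) t)"
    have rel': "s' y * pair (covect y) (vect y) = - scal y * pair (covect y) u'"
    proof -
     have "deriv (%s. scal (zeta s)) t * pair (covect (zeta t)) (vect (zeta t)) =
       - scal (zeta t) * pair (covect (zeta t)) (\<chi> i. deriv (%s. vect (zeta s) $ i) t)"
      by (rule rel[OF Del(1,3) sub']) (rule spec[OF zeta(2)], rule bspec[OF zeta(4)])
     then show ?thesis unfolding zeta(3) sy u'_def .
    qed
    have u': "cmod (t * u' $ i) \<le> 4 * kap" for i
    proof -
     let ?f = "%s. vect (zeta s) $ i - vect p0 $ i"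
     have hol_f: "?f holomorphic_on Del" unfolding vect_def using zeta(2) by (auto intro!: holomorphic_intros)
     have cb: "cball t (cmod t / 4) \<subseteq> Del"
     proof
      fix x assume "x \<in> cball t (cmod t / 4)"
      moreover have "cmod t > 0" using t by simp
      ultimately show "x \<in> Del" unfolding Del_def mem_cball mem_ball by linarith
     qed
     have "cmod ((deriv ^^ 1) ?f t) \<le> fact 1 * kap / (cmod t / 4) ^ 1"
     proof (rule Cauchy_inequality)
      show "?f holomorphic_on ball t (cmod t / 4)" by (rule holomorphic_on_subset[OF hol_f]) (use cb ball_subset_cball in blast)
      show "continuous_on (cball t (cmod t / 4)) ?f"
       by (rule holomorphic_on_imp_continuous_on[OF holomorphic_on_subset[OF hol_f cb]])
      show "0 < cmod t / 4" using t by simp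
      fix x assume "cmod (t - x) = cmod t / 4"
      then have "x \<in> Del" using cb by (auto simp: dist_norm)
      then have "norm (vect p0 - vect (zeta x)) < kap" using in'[of x] by (simp add: O'_def dist_norm)
      moreover have "cmod (?f x) = cmod ((vect p0 - vect (zeta x)) $ i)" by (simp add: norm_minus_commute)
      ultimately show "cmod (?f x) \<le> kap"
       using cmod_nth_le[of "vect p0 - vect (zeta x)" i] by linarith
     qed
     moreover have "deriv ?f t = u' $ i"
     proof -
      have h: "(%s. vect (zeta s) $ i) holomorphic_on Del" unfolding vect_def using zeta(2) by auto
      have "(?f has_field_derivative (deriv (%s. vect (zeta s) $ i) t - 0)) (at t)"
       by (intro DERIV_diff DERIV_const holomorphic_derivI[OF h Del(1,3)])
      then show ?thesis by (simp add: u'_def DERIV_imp_deriv)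
     qed
     ultimately have "cmod (u' $ i) \<le> kap * 4 / cmod t" by simp
     then show ?thesis using t by (simp add: norm_mult field_simps)
    qed
    have "norm (t *s u') \<le> (\<Sum>i\<in>UNIV. cmod ((t *s u') $ i))" unfolding norm_vec_def by (rule L2_set_le_sum) simp
    also have "\<dots> \<le> (\<Sum>i\<in>(UNIV::'n set). 4 * kap)" by (intro sum_mono) (use u' in simp)
    finally have nu: "norm (t *s u') \<le> n * (4 * kap)" by (simp add: n_def)
    have yO: "y \<in> O'" using in'[OF Del(3)] zeta(3) by simp
    have "norm (covect y) \<le> norm (covect p0) + norm (covect p0 - covect y)"
     using norm_triangle_ineq4[of "covect p0" "covect p0 - covect y"] by simp
    also have "\<dots> \<le> H" using yO by (simp add: O'_def H_def dist_norm)
    finally have nc: "norm (covect y) \<le> H" .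
    have "cmod (c0 - pair (covect y) (vect y)) < cmod c0 / 2" using yO by (simp add: O'_def dist_norm)
    then have p: "cmod (pair (covect y) (vect y)) > cmod c0 / 2"
     using norm_triangle_ineq2[of c0 "c0 - pair (covect y) (vect y)"] norm_triangle_ineq[of "c0 - pair (covect y) (vect y)" "pair (covect y) (vect y)"] by simp
    have sc: "scal y \<noteq> 0" by (rule nz[OF y])
    have pz: "pair (covect y) (vect y) \<noteq> 0" using p by auto
    have "t * s' y / scal y = - pair (covect y) (t *s u') / pair (covect y) (vect y)"
     using rel' sc pz by (simp add: pair_simps field_simps)
    then have "cmod (t * s' y / scal y) = cmod (pair (covect y) (t *s u')) / cmod (pair (covect y) (vect y))"
     by (simp add: norm_divide)
    also have "\<dots> \<le> (n * (H * (n * (4 * kap)))) / (cmod c0 / 2)"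
    proof (rule frac_le)
     have "cmod (pair (covect y) (t *s u')) \<le> n * (norm (covect y) * norm (t *s u'))" unfolding n_def by (rule pair_bound)
     also have "\<dots> \<le> n * (H * (n * (4 * kap)))"
      by (intro mult_left_mono mult_mono nc nu) (use n H in auto)
     finally show "cmod (pair (covect y) (t *s u')) \<le> n * (H * (n * (4 * kap)))" .
    qed (use p c0 n H kap in auto)
    also have "\<dots> = eps / (2 * real N)"
     using c0 n H N by (simp add: kap_def field_simps)
    finally show ?thesis .
   qed
   have "cmod (t * deriv sig t / sig t) \<le> (\<Sum>y\<in>Gam t. eps / (2 * real N))"
    unfolding eq by (rule order_trans[OF norm_sum sum_mono[OF bound]])
   also have "\<dots> < eps" using fin(2)[OF t'(1)] N eps by simp
   finally show ?thesis by simp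
  qed
  then show "\<forall>\<^sub>F t in at 0. dist (t * deriv sig t / sig t) 0 < eps"
   using eventually_at_ball'[of "min tau tau' / 2" 0 UNIV] tau tau'(1) by (auto elim: eventually_mono)
 qed
 show False by (rule log_derivative_limit[OF tau hol signz siglim ld])
qed

section \<open>Limits of points and tangent hyperplanes\<close>

abbreviation near_conormal where
 "near_conormal X e h eps c u h' \<equiv> c \<noteq> 0 \<and> cmod c < eps \<and> norm (u - e) < eps \<and> norm (h' - h) < eps \<and>
   c *s u \<in> regular_points X \<and> tangent_space X (c *s u) \<subseteq> hyperplane h'"

text \<open>The exceptional divisor in terms of representatives: the point is written as
  \<open>c *s u\<close>, so that it can tend to the origin while its direction \<open>u\<close>
  tends to \<open>e\<close>.\<close>

definition limiting_pair :: "(complex ^ 'n) set => complex ^ 'n => complex ^ 'n => bool" where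
 "limiting_pair X e h \<longleftrightarrow> (\<forall>eps>0. \<exists>c u h'. near_conormal X e h eps c u h')"

lemma has_derivative_vec_curve:
 fixes g :: "complex => complex ^ 'n"
 assumes "\<And>i. ((%v. g v $ i) has_field_derivative w $ i) (at t)"
 shows "(g has_derivative (%h. h *s w)) (at t)"
proof -
 have "((%v. g v $ i *s axis i (1::complex)) has_derivative (%h. (w $ i * h) *s axis i 1)) (at t)" for i
  using bounded_linear.has_derivative[OF bounded_linear_smult_left assms[of i, unfolded has_field_derivative_def]] .
 then have "((%v. \<Sum>i\<in>UNIV. g v $ i *s axis i (1::complex)) has_derivative (%h. \<Sum>i\<in>UNIV. (w $ i * h) *s axis i 1)) (at t)"
  by (intro has_derivative_sum)
 moreover have "(\<Sum>i\<in>UNIV. (w $ i * h) *s axis i 1) = h *s w" for h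
  by (subst (2) vec_as_sum) (simp add: vec.scale_sum_right mult.commute)
 ultimately show ?thesis by (simp flip: vec_as_sum)
qed

lemma subspace_hyperplane: "vec.subspace (hyperplane h)"
 by (simp add: vec.subspace_def hyperplane_eq pair_simps)

text \<open>The blow-down map, forgetting the covector.\<close>

definition prodv :: "complex ^ ('n::finite + 'n) option => complex ^ 'n" where
 "prodv z = scal z *s vect z"

lemma holomorphic_prodv: "holomorphic_map prodv V"
 unfolding holomorphic_map_def prodv_def scal_def vect_def
 by (auto intro!: hol_mult hol_nth)

text \<open>Related to Whitney's theorem that limits of secants lie in limits of tangent spaces. In
  the space of triples, the limit is approached within an analytic set \<open>B\<close> off an
  analytic set \<open>A\<close>, so a curve can be selected. Along it the velocity of the point
  \<open>s u\<close> is killed by the differentials of \<open>F\<close>, hence lies in the span of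
  \<open>Xi\<close>, hence in the hyperplane.\<close>

theorem limiting_pair_incident:
 fixes X :: "(complex ^ 'n) set"
 assumes an: "analytic_near X 0" and lp: "limiting_pair X e h"
 shows "pair h e = 0"
proof -
 define eps where "eps k = 1 / (real k + 1)" for k
 have eps: "eps k > 0" "eps k \<le> 1" for k by (simp_all add: eps_def)
 have epslim: "\<forall>\<^sub>F k in sequentially. a * eps k < b" if "b > 0" for a b
 proof -
  have "eps \<longlonglongrightarrow> 0" using LIMSEQ_inverse_real_of_nat by (simp add: eps_def[abs_def] inverse_eq_divide add.commute)
  then have "(%k. a * eps k) \<longlonglongrightarrow> 0" by (rule tendsto_mult_right_zero)
  then show ?thesis by (rule order_tendstoD) (rule that)
 qed
 define n where "n = real CARD('n)"
 have "\<forall>k. \<exists>c u h'. c \<noteq> 0 \<and> cmod c < eps k \<and> norm (u - e) < eps k \<and> norm (h' - h) < eps k \<and>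
   c *s u \<in> regular_points X \<and> tangent_space X (c *s u) \<subseteq> hyperplane h'"
  using lp eps(1) unfolding limiting_pair_def by blast
 then obtain c where "\<forall>k. \<exists>u h'. c k \<noteq> 0 \<and> cmod (c k) < eps k \<and> norm (u - e) < eps k \<and> norm (h' - h) < eps k \<and>
   c k *s u \<in> regular_points X \<and> tangent_space X (c k *s u) \<subseteq> hyperplane h'"
  by (rule choice[THEN exE])
 then obtain u where "\<forall>k. \<exists>h'. c k \<noteq> 0 \<and> cmod (c k) < eps k \<and> norm (u k - e) < eps k \<and> norm (h' - h) < eps k \<and>
   c k *s u k \<in> regular_points X \<and> tangent_space X (c k *s u k) \<subseteq> hyperplane h'"
  by (rule choice[THEN exE])
 then obtain hh where *: "\<forall>k. c k \<noteq> 0 \<and> cmod (c k) < eps k \<and> norm (u k - e) < eps k \<and> norm (hh k - h) < eps k \<and>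
   c k *s u k \<in> regular_points X \<and> tangent_space X (c k *s u k) \<subseteq> hyperplane (hh k)"
  by (rule choice[THEN exE])
 have c: "c k \<noteq> 0" "cmod (c k) < eps k" and u: "norm (u k - e) < eps k" and hh: "norm (hh k - h) < eps k"
  and reg: "c k *s u k \<in> regular_points X" and tan: "tangent_space X (c k *s u k) \<subseteq> hyperplane (hh k)" for k
  using *[rule_format, of k] by blast+
 have "\<forall>k. \<exists>O'. open O' \<and> c k *s u k \<in> O' \<and> (\<forall>y\<in>O'. \<exists>h'. norm (h' - hh k) < eps k \<and> tangent_space X y \<subseteq> hyperplane h')"
  using tangent_hyperplane_perturb[OF reg tan eps(1)] by blast
 then obtain O1 where O1: "\<forall>k. open (O1 k) \<and> c k *s u k \<in> O1 k \<and> (\<forall>y\<in>O1 k. \<exists>h'. norm (h' - hh k) < eps k \<and> tangent_space X y \<subseteq> hyperplane h')"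
  by (rule choice[THEN exE])
 \<comment> \<open>The radius is relative to \<open>c k\<close>: after division by
   \<open>c k\<close> the direction has moved by less than \<open>eps k\<close>.\<close>
 define O2 where "O2 k = O1 k \<inter> ball (c k *s u k) (cmod (c k) * eps k)" for k
 have O2: "open (O2 k)" "c k *s u k \<in> O2 k" for k
  using O1 c(1) eps(1) by (auto simp: O2_def open_Int)
 define U where "U k = X \<inter> O2 k" for k
 have Unorm: "norm y < (norm e + 2) * eps k" if "y \<in> U k" for y k
 proof -
  have "norm (u k) \<le> norm e + norm (u k - e)" using norm_triangle_ineq[of e "u k - e"] by simp
  then have "norm (u k) \<le> norm e + 1" using u[of k] eps(2)[of k] by simp
  then have "norm (c k *s u k) \<le> eps k * (norm e + 1)"
   unfolding norm_vector_smult by (intro mult_mono less_imp_le[OF c(2)]) (use eps(1)[of k] in auto)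
  moreover have "norm (c k *s u k - y) < cmod (c k) * eps k" using that by (simp add: U_def O2_def dist_norm)
  moreover have "cmod (c k) * eps k \<le> 1 * eps k"
   by (rule mult_right_mono) (use c(2)[of k] eps[of k] in linarith)+
  moreover have "norm y \<le> norm (c k *s u k) + norm (c k *s u k - y)"
   using norm_triangle_ineq4[of "c k *s u k" "c k *s u k - y"] by simp
  ultimately show ?thesis by (simp add: algebra_simps)
 qed
 have "shrinking X U"
  unfolding shrinking_def
 proof (intro conjI allI impI)
  have "c k *s u k \<in> U k" for k using O2(2) reg by (simp add: U_def regular_points_def)
  then show "\<forall>\<^sub>F k in sequentially. U k \<noteq> {} \<and> (\<exists>O'. open O' \<and> U k = X \<inter> O')"
   using O2(1) unfolding U_def by (intro always_eventually allI conjI) blast+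
  fix b :: real assume "b > 0"
  from epslim[OF this] show "\<forall>\<^sub>F k in sequentially. U k \<subseteq> ball 0 b"
   by (rule eventually_mono) (use Unorm in "force intro: order.strict_trans")
 qed
 then have "reduced_near X U" by (rule reduced_equations[OF an])
 then obtain r F Xi disc where r: "r > 0" and fin: "finite F" "finite Xi" and holF: "\<forall>f\<in>F. hol f (ball 0 r)"
  and holdisc: "hol disc (ball 0 r)" and holXi: "\<forall>xi\<in>Xi. holomorphic_map xi (ball 0 r)"
  and span: "\<forall>x\<in>ball 0 r. disc x \<noteq> 0 --> (\<forall>v. (\<forall>f\<in>F. fd f x v = 0) --> v \<in> vec.span ((%xi. xi x) ` Xi))"
  and freq: "\<exists>\<^sub>F k in sequentially. \<exists>y\<in>U k. adapted X r F Xi disc y"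
  unfolding reduced_near_def by (elim exE conjE)
 define V where "V = prodv -` ball (0 :: complex ^ 'n) r"
 \<comment> \<open>The covector is tested against the holomorphic fields \<open>Xi\<close> in place
   of the tangent spaces of \<open>X\<close>, which makes the condition analytic; \<open>A\<close>
   removes the triples with \<open>scal\<close> or \<open>disc\<close> zero.\<close>
 define B where "B = {z. z \<in> V \<and> (\<forall>f\<in>F. f (prodv z) = 0) \<and> (\<forall>xi\<in>Xi. pair (covect z) (xi (prodv z)) = 0)}"
 define A where "A = {z. z \<in> V \<and> scal z * disc (prodv z) = 0}"
 define p0 where "p0 = triple 0 e h"
 have V: "open V" "p0 \<in> V"
  unfolding V_def using r
  by (auto intro!: open_vimage holomorphic_map_continuous_on[OF holomorphic_prodv] simp: prodv_def p0_def)
 have comp: "hol (%z. f (prodv z)) V" if "hol f (ball 0 r)" for f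
  by (rule hol_compose[OF that holomorphic_prodv]) (simp add: V_def)
 have "analytic_near A p0"
  unfolding analytic_near_def
 proof (intro exI[of _ V] exI[of _ "{%z. scal z * disc (prodv z)}"] conjI V)
  show "\<forall>f\<in>{%z. scal z * disc (prodv z)}. hol f V"
   by (auto intro!: hol_mult comp[OF holdisc] simp: scal_def hol_nth)
 qed (auto simp: A_def)
 moreover have "analytic_near B p0"
  unfolding analytic_near_def
 proof (intro exI[of _ V] exI[of _ "(%f z. f (prodv z)) ` F \<union> (%xi z. pair (covect z) (xi (prodv z))) ` Xi"] conjI V ballI)
  fix g assume "g \<in> (%f z. f (prodv z)) ` F \<union> (%xi z. pair (covect z) (xi (prodv z))) ` Xi"
  then show "hol g V"
   using comp holF holXi unfolding pair_def covect_def holomorphic_map_def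
   by (auto intro!: hol_sum hol_mult hol_nth)
 qed (use fin in "auto simp: B_def")
 moreover have "p0 \<in> closure (B - A)"
  unfolding closure_approachable
 proof (intro allI impI)
  fix b :: real assume "b > 0"
  \<comment> \<open>The scalar contributes \<open>eps k\<close>; vector and covector are each within
    \<open>2 * eps k\<close> of their limits and contribute \<open>2 * n * eps k\<close>.\<close>
  from frequently_eventually_conj[OF freq epslim[OF this, of "1 + 4 * n"]]
  obtain k where k: "(1 + 4 * n) * eps k < b \<and> (\<exists>y\<in>U k. adapted X r F Xi disc y)"
   by (rule frequentlyE)
  then obtain y where y: "y \<in> U k" "y \<in> ball 0 r" "disc y \<noteq> 0" "\<forall>f\<in>F. f y = 0" "\<forall>xi\<in>Xi. xi y \<in> tangent_space X y"
   by (elim conjE bexE)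
  have "y \<in> O1 k" using y(1) by (simp add: U_def O2_def)
  then obtain h' where h': "norm (h' - hh k) < eps k" "tangent_space X y \<subseteq> hyperplane h'" using O1 by blast
  define z where "z = triple (c k) (inverse (c k) *s y) h'"
  have pz: "prodv z = y" using c(1)[of k] by (simp add: prodv_def z_def vec_eq_iff)
  have "z \<in> B - A"
   using y h'(2) c(1)[of k] pz by (auto simp: A_def B_def V_def z_def hyperplane_eq)
  moreover have "dist z p0 < b"
  proof -
   have "norm (h' - h) < 2 * eps k" using norm_triangle_ineq[of "h' - hh k" "hh k - h"] h'(1) hh[of k] by simp
   moreover have "norm (inverse (c k) *s y - e) < 2 * eps k"
   proof -
    have eq: "inverse (c k) *s y - u k = inverse (c k) *s (y - c k *s u k)"
     using c(1)[of k] by (simp add: vec_eq_iff right_diff_distrib)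
    have "norm (inverse (c k) *s y - u k) = norm (y - c k *s u k) / cmod (c k)"
     unfolding eq norm_vector_smult by (simp add: norm_inverse divide_inverse mult.commute)
    also have "\<dots> < eps k"
     using y(1) c(1)[of k] by (simp add: U_def O2_def dist_norm norm_minus_commute divide_less_eq mult.commute)
    finally show ?thesis using norm_triangle_ineq[of "inverse (c k) *s y - u k" "u k - e"] u[of k] by simp
   qed
   moreover have "n > 0" by (simp add: n_def)
   ultimately have "cmod (c k) + n * norm (inverse (c k) *s y - e) + n * norm (h' - h) < eps k + n * (2 * eps k) + n * (2 * eps k)"
    using c(2)[of k] by (intro add_strict_mono mult_strict_left_mono)
   moreover have "dist z p0 \<le> cmod (c k) + n * norm (inverse (c k) *s y - e) + n * norm (h' - h)"
    unfolding dist_norm z_def p0_def triple_diff n_def using norm_triple_le[of "c k - 0"] by simp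
   ultimately show ?thesis using k by (simp add: algebra_simps)
  qed
  ultimately show "\<exists>z\<in>B - A. dist z p0 < b" by blast
 qed
 ultimately have "\<exists>tau N Gam. multi_curve tau N Gam \<and> (\<forall>t. Gam t \<subseteq> B - A) \<and> curve_limit Gam p0"
  by (rule multi_curve_exists)
 then obtain tau N Gam where mc: "multi_curve tau N Gam" and sub: "\<forall>t. Gam t \<subseteq> B - A" and lim: "curve_limit Gam p0"
  by (elim exE conjE)
 have "pair (covect p0) (vect p0) = 0"
 proof (rule curve_pairing[OF mc lim])
  show "scal p0 = 0" by (simp add: p0_def)
  show "scal z \<noteq> 0" if "z \<in> Gam t" for t z
  proof -
   have "z \<in> B - A" using sub that by blast
   then show ?thesis by (auto simp: A_def B_def)
  qed
  fix t W and d :: "complex => complex ^ ('n + 'n) option"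
  assume W: "open W" "t \<in> W" "W \<subseteq> ball 0 tau - {0}" and hol: "\<And>i. (%s. d s $ i) holomorphic_on W"
   and dGam: "\<And>s. s \<in> W ==> d s \<in> Gam s"
  have dB: "d s \<in> B" "d s \<notin> A" if "s \<in> W" for s using dGam[OF that] sub by blast+
  define s' where "s' = deriv (%s. scal (d s)) t"
  define u' where "u' = (\<chi> i. deriv (%s. vect (d s) $ i) t)"
  have hs: "(%s. scal (d s)) holomorphic_on W" and hu: "(%s. vect (d s) $ i) holomorphic_on W" for i
   using hol by (simp_all add: scal_def vect_def)
  have ds: "((%s. scal (d s)) has_field_derivative s') (at t)"
   unfolding s'_def by (rule holomorphic_derivI[OF hs W(1,2)])
  have du: "((%s. vect (d s) $ i) has_field_derivative u' $ i) (at t)" for i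
   unfolding u'_def vec_lambda_beta by (rule holomorphic_derivI[OF hu W(1,2)])
  define w where "w = s' *s vect (d t) + scal (d t) *s u'"
  have dp: "((%s. prodv (d s)) has_derivative (%h. h *s w)) (at t)"
  proof (rule has_derivative_vec_curve)
   fix i
   have "((%s. scal (d s) * vect (d s) $ i) has_field_derivative w $ i) (at t)"
    using DERIV_mult[OF ds du[of i]] by (simp add: w_def mult.commute)
   then show "((%s. prodv (d s) $ i) has_field_derivative w $ i) (at t)" by (simp add: prodv_def)
  qed
  have pt: "prodv (d t) \<in> ball 0 r" "disc (prodv (d t)) \<noteq> 0"
   using dB[OF W(2)] by (auto simp: A_def B_def V_def)
  have curve: "((%s. f (prodv (d s))) has_field_derivative fd f (prodv (d t)) w) (at t)" if "f \<in> F" for f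
   by (rule hol_curve[OF bspec[OF holF that] dp pt(1)])
  have "fd f (prodv (d t)) w = 0" if f: "f \<in> F" for f
  proof -
   have "((%s. f (prodv (d s))) has_field_derivative 0) (at t)"
   proof (rule has_field_derivative_transform_within_open[OF DERIV_const W(1,2)])
    fix v assume "v \<in> W"
    from dB(1)[OF this] have "\<forall>f\<in>F. f (prodv (d v)) = 0"
     unfolding B_def mem_Collect_eq by (elim conjE)
    from bspec[OF this f] show "0 = f (prodv (d v))" by (rule sym)
   qed
   from DERIV_unique[OF curve[OF f] this] show ?thesis .
  qed
  then have "\<forall>f\<in>F. fd f (prodv (d t)) w = 0" by (intro ballI)
  with bspec[OF span pt(1)] pt(2) have "w \<in> vec.span ((%xi. xi (prodv (d t))) ` Xi)" by (elim impE allE)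
  also have "\<dots> \<subseteq> hyperplane (covect (d t))"
   by (rule vec.span_minimal[OF _ subspace_hyperplane]) (use dB(1)[OF W(2)] in "auto simp: hyperplane_eq B_def")
  finally have "pair (covect (d t)) w = 0" by (simp add: hyperplane_eq)
  then show "deriv (%s. scal (d s)) t * pair (covect (d t)) (vect (d t)) =
   - scal (d t) * pair (covect (d t)) (\<chi> i. deriv (%s. vect (d s) $ i) t)"
   unfolding s'_def[symmetric] u'_def[symmetric] by (simp add: w_def pair_simps eq_neg_iff_add_eq_0)
 qed
 then show ?thesis by (simp add: p0_def)
qed

section \<open>Projective spaces\<close>

lemma line_eq: "line u = range (%c. c *s u)"
 by (simp add: line_def vec.span_singleton)

lemma line_scale: "c \<noteq> 0 ==> line (c *s u) = line u"
proof -
 assume c: "c \<noteq> 0"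
 have "d *s u = (d / c) *s (c *s u)" for d using c by (simp add: vec_eq_iff)
 moreover have "d *s (c *s u) = (d * c) *s u" for d by (simp add: vec_eq_iff)
 ultimately show ?thesis unfolding line_eq by (metis (no_types, lifting) image_cong image_subset_iff rangeI subset_antisym)
qed

lemma line_eqD: "line u = line v ==> u \<noteq> 0 ==> \<exists>c. c \<noteq> 0 \<and> u = c *s v"
proof -
 assume eq: "line u = line v" and "u \<noteq> 0"
 have "u \<in> line u" by (simp add: line_def vec.span_base)
 then have "u \<in> line v" by (simp only: eq)
 then show ?thesis using \<open>u \<noteq> 0\<close> by (auto simp: line_eq)
qed

lemma hyperplane_scale: "c \<noteq> 0 ==> hyperplane (c *s h) = hyperplane h"
 by (simp add: hyperplane_eq pair_simps)

text \<open>The hyperplane of \<open>k\<close> contains the vectors with entries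
  \<open>k $ i\<close> and \<open>- k $ j\<close> on two axes, so all two by two minors of
  \<open>h\<close> and \<open>k\<close> that involve a fixed nonzero entry of \<open>k\<close>
  vanish.\<close>

lemma hyperplane_eqD:
 assumes eq: "hyperplane h = hyperplane k" and "h \<noteq> 0" "k \<noteq> 0"
 shows "\<exists>c. c \<noteq> 0 \<and> h = c *s k"
proof -
 obtain i where i: "k $ i \<noteq> 0" using \<open>k \<noteq> 0\<close> by (auto simp: vec_eq_iff)
 have "h $ j * k $ i = h $ i * k $ j" for j
 proof -
  have "k $ i *s axis j 1 - k $ j *s axis i (1::complex) \<in> hyperplane k"
   by (simp add: hyperplane_eq pair_simps)
  then have "k $ i *s axis j 1 - k $ j *s axis i (1::complex) \<in> hyperplane h" by (simp add: eq)
  then show ?thesis by (simp add: hyperplane_eq pair_simps mult.commute)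
 qed
 then have h: "h = (h $ i / k $ i) *s k" using i by (simp add: vec_eq_iff field_simps)
 then have "h $ i / k $ i \<noteq> 0" using \<open>h \<noteq> 0\<close> by (metis vec.scale_zero_left)
 then show ?thesis using h by blast
qed

lemma topspace_proj: "topspace proj_space = line ` (- {0})" "topspace dual_proj_space = hyperplane ` (- {0})"
 by (simp_all add: proj_space_def dual_proj_space_def topspace_quotient_topology)

lemma openin_proj:
 "openin proj_space U \<longleftrightarrow> U \<subseteq> line ` (- {0}) \<and> open {u. u \<noteq> 0 \<and> line u \<in> U}"
 "openin dual_proj_space U' \<longleftrightarrow> U' \<subseteq> hyperplane ` (- {0}) \<and> open {h. h \<noteq> 0 \<and> hyperplane h \<in> U'}"
 unfolding proj_space_def dual_proj_space_def openin_quotient_topology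
 by (simp_all add: openin_open_eq open_delete Compl_eq_Diff_UNIV conj_commute
   flip: Collect_conj_eq cong: conj_cong) (auto simp: openin_open_eq open_Compl)

text \<open>Both quotient maps are open, since the saturation of an open set is the union of its
  dilates.\<close>

lemma open_image_proj:
 assumes "open (O' :: (complex ^ 'n) set)"
 shows "openin proj_space (line ` (O' - {0}))" "openin dual_proj_space (hyperplane ` (O' - {0}))"
proof -
 have sat: "open {u. \<exists>c. c \<noteq> 0 \<and> c *s u \<in> O' - {0}}"
 proof -
  have "{u. \<exists>c. c \<noteq> 0 \<and> c *s u \<in> O' - {0}} = (\<Union>c\<in>-{0}. (%u. c *s u) -` (O' - {0}))" by auto
  also have "open \<dots>"
   by (intro open_UN ballI open_vimage open_delete assms continuous_on_smult continuous_on_const continuous_on_id)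
  finally show ?thesis .
 qed
 have "{u. u \<noteq> 0 \<and> line u \<in> line ` (O' - {0})} = {u. \<exists>c. c \<noteq> 0 \<and> c *s u \<in> O' - {0}}"
 proof (intro equalityI subsetI)
  fix u assume "u \<in> {u. u \<noteq> 0 \<and> line u \<in> line ` (O' - {0})}"
  then obtain v where v: "u \<noteq> 0" "line u = line v" "v \<in> O'" "v \<noteq> 0" by auto
  from line_eqD[OF v(2)[symmetric] v(4)] obtain c where "c \<noteq> 0" "v = c *s u" by blast
  then show "u \<in> {u. \<exists>c. c \<noteq> 0 \<and> c *s u \<in> O' - {0}}" using v(3,4) by blast
 next
  fix u assume "u \<in> {u. \<exists>c. c \<noteq> 0 \<and> c *s u \<in> O' - {0}}"
  then obtain c where c: "c \<noteq> 0" "c *s u \<in> O' - {0}" by blast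
  then have "u \<noteq> 0" "line u = line (c *s u)" using line_scale[OF c(1), of u] by auto
  then show "u \<in> {u. u \<noteq> 0 \<and> line u \<in> line ` (O' - {0})}" using c(2) by blast
 qed
 then show "openin proj_space (line ` (O' - {0}))" using sat by (auto simp: openin_proj)
 have "{u. u \<noteq> 0 \<and> hyperplane u \<in> hyperplane ` (O' - {0})} = {u. \<exists>c. c \<noteq> 0 \<and> c *s u \<in> O' - {0}}"
 proof (intro equalityI subsetI)
  fix u assume "u \<in> {u. u \<noteq> 0 \<and> hyperplane u \<in> hyperplane ` (O' - {0})}"
  then obtain v where v: "u \<noteq> 0" "hyperplane u = hyperplane v" "v \<in> O'" "v \<noteq> 0" by auto
  from hyperplane_eqD[OF v(2)[symmetric] v(4,1)] obtain c where "c \<noteq> 0" "v = c *s u" by blast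
  then show "u \<in> {u. \<exists>c. c \<noteq> 0 \<and> c *s u \<in> O' - {0}}" using v(3,4) by blast
 next
  fix u assume "u \<in> {u. \<exists>c. c \<noteq> 0 \<and> c *s u \<in> O' - {0}}"
  then obtain c where c: "c \<noteq> 0" "c *s u \<in> O' - {0}" by blast
  then have "u \<noteq> 0" "hyperplane u = hyperplane (c *s u)" using hyperplane_scale[OF c(1), of u] by auto
  then show "u \<in> {u. u \<noteq> 0 \<and> hyperplane u \<in> hyperplane ` (O' - {0})}" using c(2) by blast
 qed
 then show "openin dual_proj_space (hyperplane ` (O' - {0}))" using sat by (auto simp: openin_proj)
qed

section \<open>The conormal modification and its exceptional divisor through representatives\<close>

abbreviation "dual_product X \<equiv> prod_topology (top_of_set X) dual_proj_space"

lemma conormalI: "x \<in> X ==> h \<noteq> 0 ==>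
  (\<And>eps. eps > 0 ==> \<exists>x' h'. x' \<in> regular_points X \<and> norm (x' - x) < eps \<and> norm (h' - h) < eps \<and>
   tangent_space X x' \<subseteq> hyperplane h') ==> (x, hyperplane h) \<in> conormal X"
 unfolding conormal_def in_closure_of
proof (intro conjI allI impI)
 assume x: "x \<in> X" and h: "h \<noteq> 0"
  and lim: "\<And>eps. eps > 0 ==> \<exists>x' h'. x' \<in> regular_points X \<and> norm (x' - x) < eps \<and> norm (h' - h) < eps \<and>
   tangent_space X x' \<subseteq> hyperplane h'"
 show "(x, hyperplane h) \<in> topspace (dual_product X)"
  using x h by (simp add: topspace_proj)
 fix T assume "(x, hyperplane h) \<in> T \<and> openin (dual_product X) T"
 then obtain U N where UN: "openin (top_of_set X) U" "openin dual_proj_space N" "x \<in> U" "hyperplane h \<in> N" "U \<times> N \<subseteq> T"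
  unfolding openin_prod_topology_alt by blast
 obtain U' where U': "open U'" "U = X \<inter> U'" using UN(1) unfolding openin_open by blast
 obtain e1 where e1: "e1 > 0" "ball x e1 \<subseteq> U'" using U' UN(3) open_contains_ball by blast
 have "open {h. h \<noteq> 0 \<and> hyperplane h \<in> N}" "h \<in> {h. h \<noteq> 0 \<and> hyperplane h \<in> N}"
  using UN(2,4) h by (auto simp: openin_proj)
 then obtain e2 where e2: "e2 > 0" "ball h e2 \<subseteq> {h. h \<noteq> 0 \<and> hyperplane h \<in> N}" by (rule openE)
 obtain x' h' where *: "x' \<in> regular_points X" "norm (x' - x) < min e1 e2" "norm (h' - h) < min e1 e2"
   "tangent_space X x' \<subseteq> hyperplane h'"
  using lim[of "min e1 e2"] e1(1) e2(1) by auto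
 have "x' \<in> ball x e1" "h' \<in> ball h e2" using * by (auto simp: dist_norm norm_minus_commute)
 then have "x' \<in> U'" and "h' \<in> {h. h \<noteq> 0 \<and> hyperplane h \<in> N}" using e1(2) e2(2) by blast+
 then have "x' \<in> U'" "h' \<noteq> 0" "hyperplane h' \<in> N" by simp_all
 moreover have "x' \<in> X" using *(1) by (simp add: regular_points_def)
 ultimately have "(x', hyperplane h') \<in> T" "h' \<noteq> 0" using UN(5) U'(2) by blast+
 then show "\<exists>y. y \<in> {(x, H). x \<in> regular_points X \<and> H \<in> topspace dual_proj_space \<and> tangent_space X x \<subseteq> H} \<and> y \<in> T"
  using *(1,4) by (intro exI[of _ "(x', hyperplane h')"]) (auto simp: topspace_proj)
qed

lemma conormalD:
 assumes "(x, hyperplane h) \<in> conormal X" "h \<noteq> 0" "open O'" "x \<in> O'" "eps > 0"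
 shows "\<exists>x' h'. x' \<in> regular_points X \<and> x' \<in> O' \<and> h' \<noteq> 0 \<and> norm (h' - h) < eps \<and> tangent_space X x' \<subseteq> hyperplane h'"
proof -
 let ?T = "(X \<inter> O') \<times> hyperplane ` (ball h eps - {0})"
 have "x \<in> X" using assms(1) by (auto simp: conormal_def in_closure_of)
 then have "(x, hyperplane h) \<in> ?T" using assms by auto
 moreover have "openin (dual_product X) ?T"
  by (simp add: openin_prod_Times_iff open_image_proj openin_open_Int assms(3))
 ultimately have "\<exists>y. y \<in> {(x, H). x \<in> regular_points X \<and> H \<in> topspace dual_proj_space \<and> tangent_space X x \<subseteq> H} \<and> y \<in> ?T"
  by (intro mp[OF spec[OF conjunct2[OF assms(1)[unfolded conormal_def in_closure_of]]]] conjI)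
 then obtain y where y: "y \<in> {(x, H). x \<in> regular_points X \<and> H \<in> topspace dual_proj_space \<and> tangent_space X x \<subseteq> H}" "y \<in> ?T"
  by (elim exE conjE)
 obtain x' H where "y = (x', H)" by (cases y)
 then have x': "x' \<in> regular_points X" "tangent_space X x' \<subseteq> H" "x' \<in> O'"
  and H: "H \<in> hyperplane ` (ball h eps - {0})"
  using y by simp_all
 obtain h' where "H = hyperplane h'" "h' \<in> ball h eps - {0}" using H by (rule imageE)
 with x' show ?thesis by (intro exI[of _ x'] exI[of _ h']) (simp add: dist_norm norm_minus_commute)
qed

text \<open>Two closures are unfolded. The point of the blow-up is approximated by a conormal pair
  over some \<open>x\<close> different from \<open>0\<close>, and that pair by a tangent hyperplane
  at a regular point so close to \<open>x\<close> that its line is still near that of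
  \<open>e\<close>.\<close>

lemma limiting_pair_if_exceptional:
 assumes E: "(line e, hyperplane h) \<in> exceptional_divisor X" and "e \<noteq> 0" "h \<noteq> 0"
 shows "limiting_pair X e h"
 unfolding limiting_pair_def
proof (intro allI impI)
 fix eps0 :: real assume "eps0 > 0"
 define eps where "eps = min eps0 (norm e / 2)"
 have eps: "eps > 0" "eps \<le> eps0" "eps \<le> norm e / 2" using \<open>eps0 > 0\<close> \<open>e \<noteq> 0\<close> by (auto simp: eps_def)
 define r where "r = eps * (norm e / 2)"
 have r: "r > 0" using eps(1) \<open>e \<noteq> 0\<close> by (simp add: r_def)
 have cl: "((0, hyperplane h), line e) \<in> conormal_blowup X" using E by (simp add: exceptional_divisor_def)
 then have top: "0 \<in> X" "(0, hyperplane h) \<in> conormal X"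
  by (auto simp: conormal_blowup_def in_closure_of)
 let ?Tl = "((X \<inter> ball 0 r) \<times> hyperplane ` (ball h eps - {0})) \<inter> conormal X"
 let ?T = "?Tl \<times> line ` (ball e eps - {0})"
 have "((0, hyperplane h), line e) \<in> ?T" using top r eps(1) assms by auto
 moreover have "openin (dual_product X) ((X \<inter> ball 0 r) \<times> hyperplane ` (ball h eps - {0}))"
  by (simp add: openin_prod_Times_iff open_image_proj openin_open_Int)
 then have "openin (subtopology (dual_product X) (conormal X)) ?Tl"
  by (rule openin_subtopology_Int)
 then have "openin (prod_topology (subtopology (dual_product X) (conormal X)) proj_space) ?T"
  unfolding openin_prod_Times_iff using open_image_proj(1)[OF open_ball] by (intro disjI2 conjI)
 ultimately have "\<exists>y. y \<in> {((x, H), line x) |x H. (x, H) \<in> conormal X \<and> x \<noteq> 0} \<and> y \<in> ?T"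
  by (intro mp[OF spec[OF conjunct2[OF cl[unfolded conormal_blowup_def in_closure_of]]]] conjI)
 then obtain x H where x: "x \<noteq> 0" "(x, H) \<in> conormal X" "(x, H) \<in> ?Tl" "line x \<in> line ` (ball e eps - {0})"
  by blast
 have "H \<in> hyperplane ` (ball h eps - {0})" using x(3) by blast
 then obtain k where "k \<in> ball h eps - {0}" and k3: "H = hyperplane k" by blast
 then have k: "k \<in> ball h eps" "k \<noteq> 0" "H = hyperplane k" by blast+
 define O' where "O' = ball 0 r \<inter> {u. u \<noteq> 0 \<and> line u \<in> line ` (ball e eps - {0})}"
 have O': "open O'" "x \<in> O'"
  using open_image_proj(1)[OF open_ball, of e eps] x by (auto simp: O'_def openin_proj)
 have "eps - dist h k > 0" using k by simp
 from conormalD[OF x(2)[unfolded k(3)] k(2) O' this] obtain x' h' where x': "x' \<in> regular_points X" "x' \<in> O'"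
  "norm (h' - k) < eps - dist h k" "tangent_space X x' \<subseteq> hyperplane h'" by blast
 have x'': "x' \<noteq> 0" "norm x' < r" "line x' \<in> line ` (ball e eps - {0})" using x'(2) by (simp_all add: O'_def)
 from x''(3) obtain u where "line x' = line u" "u \<in> ball e eps - {0}" by (rule imageE)
 then have u: "u \<in> ball e eps" "u \<noteq> 0" "line x' = line u" "x' \<noteq> 0" "norm x' < r" using x'' by blast+
 obtain c where c: "c \<noteq> 0" "x' = c *s u" using line_eqD[OF u(3,4)] by blast
 have "norm e \<le> norm u + norm (e - u)" using norm_triangle_ineq[of u "e - u"] by simp
 then have "norm e / 2 \<le> norm u" using u(1) eps(3) by (simp add: dist_norm)
 then have "cmod c * (norm e / 2) \<le> norm x'" unfolding c(2) norm_vector_smult by (intro mult_left_mono) auto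
 then have "cmod c * (norm e / 2) < eps * (norm e / 2)" using u(5) by (simp add: r_def)
 then have "cmod c < eps" using \<open>e \<noteq> 0\<close> by simp
 moreover have "norm (h' - h) < eps" using x'(3) norm_triangle_ineq[of "h' - k" "k - h"] by (simp add: dist_norm norm_minus_commute)
 moreover have "norm (u - e) < eps" using u(1) by (simp add: dist_norm norm_minus_commute)
 ultimately show "\<exists>c u h'. near_conormal X e h eps0 c u h'"
  using eps(2) c x'(1,4) by (intro exI[of _ c] exI[of _ u] exI[of _ h']) auto
qed

lemma exceptional_if_limiting_pair:
 assumes lp: "limiting_pair X e h" and "e \<noteq> 0" "h \<noteq> 0" "0 \<in> X"
 shows "(line e, hyperplane h) \<in> exceptional_divisor X"
proof -
 have near: "\<exists>c u h'. c \<noteq> 0 \<and> u \<noteq> 0 \<and> h' \<noteq> 0 \<and> norm (c *s u) < eps \<and> norm (u - e) < eps \<and> norm (h' - h) < eps \<and>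
   c *s u \<in> regular_points X \<and> tangent_space X (c *s u) \<subseteq> hyperplane h'" if "eps > 0" for eps
 proof -
  define kap where "kap = min (min eps (eps / (2 * norm e))) (min (norm e) (norm h))"
  have kap: "kap > 0" "kap \<le> eps" "kap \<le> eps / (2 * norm e)" "kap \<le> norm e" "kap \<le> norm h" using that assms by (auto simp: kap_def)
  obtain c u h' where *: "c \<noteq> 0" "cmod c < kap" "norm (u - e) < kap" "norm (h' - h) < kap"
   "c *s u \<in> regular_points X" "tangent_space X (c *s u) \<subseteq> hyperplane h'"
   using lp kap(1) unfolding limiting_pair_def by blast
  have "u \<noteq> 0" "h' \<noteq> 0" using *(3,4) kap(4,5) by auto
  moreover have "norm u \<le> 2 * norm e" using norm_triangle_ineq[of e "u - e"] *(3) kap(4) by simp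
  then have "norm (c *s u) \<le> cmod c * (2 * norm e)" unfolding norm_vector_smult by (intro mult_left_mono) auto
  then have "norm (c *s u) < eps" using *(2) kap(3) \<open>e \<noteq> 0\<close> mult_strict_right_mono[of "cmod c" "eps / (2 * norm e)" "2 * norm e"] by simp
  ultimately show ?thesis using * kap(2) by (intro exI[of _ c] exI[of _ u] exI[of _ h']) auto
 qed
 have con: "(0, hyperplane h) \<in> conormal X"
 proof (rule conormalI[OF assms(4,3)])
  fix eps :: real assume "eps > 0"
  from near[OF this] show "\<exists>x' h'. x' \<in> regular_points X \<and> norm (x' - 0) < eps \<and> norm (h' - h) < eps \<and>
   tangent_space X x' \<subseteq> hyperplane h'" by fastforce
 qed
 have "((0, hyperplane h), line e) \<in> conormal_blowup X"
  unfolding conormal_blowup_def in_closure_of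
 proof (intro conjI allI impI)
  show "((0, hyperplane h), line e) \<in> topspace (prod_topology (subtopology (dual_product X)
    (conormal X)) proj_space)"
   using con assms by (auto simp: topspace_proj)
  fix T assume "((0, hyperplane h), line e) \<in> T \<and>
   openin (prod_topology (subtopology (dual_product X) (conormal X)) proj_space) T"
  then obtain T1 N where T1: "openin (subtopology (dual_product X) (conormal X)) T1"
   "openin proj_space N" "(0, hyperplane h) \<in> T1" "line e \<in> N" "T1 \<times> N \<subseteq> T"
   unfolding openin_prod_topology_alt[of _ proj_space] by blast
  obtain T2 where T2: "openin (dual_product X) T2" "T1 = T2 \<inter> conormal X"
   using T1(1) unfolding openin_subtopology by blast
  have "(0, hyperplane h) \<in> T2" using T1(3) T2(2) by blast
  from T2(1)[unfolded openin_prod_topology_alt, rule_format, OF this]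
  obtain U N' where UN: "openin (top_of_set X) U" "openin dual_proj_space N'" "0 \<in> U" "hyperplane h \<in> N'" "U \<times> N' \<subseteq> T2"
   by (elim exE conjE)
  obtain U' where U': "open U'" "U = X \<inter> U'" using UN(1) unfolding openin_open by blast
  obtain e1 where e1: "e1 > 0" "ball 0 e1 \<subseteq> U'" using U' UN(3) open_contains_ball by blast
  have "open {h. h \<noteq> 0 \<and> hyperplane h \<in> N'}" "h \<in> {h. h \<noteq> 0 \<and> hyperplane h \<in> N'}"
   using UN(2,4) assms by (auto simp: openin_proj)
  then obtain e2 where e2: "e2 > 0" "ball h e2 \<subseteq> {h. h \<noteq> 0 \<and> hyperplane h \<in> N'}" by (rule openE)
  have "open {u. u \<noteq> 0 \<and> line u \<in> N}" "e \<in> {u. u \<noteq> 0 \<and> line u \<in> N}"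
   using T1(2,4) assms by (auto simp: openin_proj)
  then obtain e3 where e3: "e3 > 0" "ball e e3 \<subseteq> {u. u \<noteq> 0 \<and> line u \<in> N}" by (rule openE)
  obtain c u h' where *: "c \<noteq> 0" "u \<noteq> 0" "h' \<noteq> 0" "norm (c *s u) < min e1 (min e2 e3)" "norm (u - e) < min e1 (min e2 e3)"
   "norm (h' - h) < min e1 (min e2 e3)"
   "c *s u \<in> regular_points X" "tangent_space X (c *s u) \<subseteq> hyperplane h'"
   using near[of "min e1 (min e2 e3)"] e1(1) e2(1) e3(1) by auto
  have xX: "c *s u \<in> X" using *(7) by (simp add: regular_points_def)
  have mem: "c *s u \<in> ball 0 e1" "h' \<in> ball h e2" "u \<in> ball e e3" using *(4-6) by (auto simp: dist_norm norm_minus_commute)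
  have m: "c *s u \<in> U" "hyperplane h' \<in> N'" "line u \<in> N" using mem e1(2) e2(2) e3(2) U'(2) xX by auto
  have "(c *s u, hyperplane h') \<in> conormal X"
   by (rule conormalI[OF xX *(3)]) (use *(7,8) in \<open>force intro: exI[of _ "c *s u"] exI[of _ h']\<close>)
  moreover have "line (c *s u) \<in> N" by (simp only: line_scale[OF *(1)] m(3))
  ultimately have "((c *s u, hyperplane h'), line (c *s u)) \<in> T" using T1(5) T2(2) UN(5) m(1,2) by blast
  moreover have "c *s u \<noteq> 0" using *(1,2) by (simp add: vec_eq_iff)
  ultimately show "\<exists>y. y \<in> {((x, H), line x) |x H. (x, H) \<in> conormal X \<and> x \<noteq> 0} \<and> y \<in> T"
   using \<open>(c *s u, hyperplane h') \<in> conormal X\<close> by blast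
 qed
 then show ?thesis by (simp add: exceptional_divisor_def)
qed

lemma exceptionalE:
 assumes "(l, H) \<in> exceptional_divisor X"
 shows "\<exists>e h. e \<noteq> 0 \<and> h \<noteq> 0 \<and> l = line e \<and> H = hyperplane h"
 using assms by (auto simp: exceptional_divisor_def conormal_blowup_def in_closure_of topspace_proj)

section \<open>Analytic sets of pairs and their affine cones\<close>

lemma analytic_subset_iff:
 assumes "open U"
 shows "analytic_subset U A \<longleftrightarrow> A \<subseteq> U \<and> (\<forall>p\<in>U. analytic_near A p)"
proof
 assume "analytic_subset U A"
 then show "A \<subseteq> U \<and> (\<forall>p\<in>U. analytic_near A p)"
  unfolding analytic_subset_def analytic_near_def by blast
next
 assume *: "A \<subseteq> U \<and> (\<forall>p\<in>U. analytic_near A p)"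
 show "analytic_subset U A"
  unfolding analytic_subset_def
 proof (intro conjI ballI)
  show "A \<subseteq> U" using * by blast
  fix p assume p: "p \<in> U"
  then obtain V F where V: "open V" "p \<in> V" "finite F" "\<forall>f\<in>F. hol f V" "A \<inter> V = {z\<in>V. \<forall>f\<in>F. f z = 0}"
   using * unfolding analytic_near_def by blast
  have "A \<inter> (V \<inter> U) = {z\<in>V \<inter> U. \<forall>f\<in>F. f z = 0}" using V(5) by blast
  moreover have "\<forall>f\<in>F. hol f (V \<inter> U)" using V(4) hol_subset[OF _ Int_lower1] by blast
  ultimately show "\<exists>V F. open V \<and> p \<in> V \<and> V \<subseteq> U \<and> finite F \<and> (\<forall>f\<in>F. hol f V) \<and> A \<inter> V = {z\<in>V. \<forall>f\<in>F. f z = 0}"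
   using V(1-3) p assms by (intro exI[of _ "V \<inter> U"] exI[of _ F]) auto
 qed
qed

abbreviation pairs :: "(complex ^ ('n::finite + 'n)) set" where
 "pairs \<equiv> {z. left_part z \<noteq> 0 \<and> right_part z \<noteq> 0}"

definition cone_over :: "((complex ^ 'n) set \<times> (complex ^ 'n) set) set => (complex ^ ('n::finite + 'n)) set" where
 "cone_over A = {z\<in>pairs. (line (left_part z), hyperplane (right_part z)) \<in> A}"

definition join :: "complex ^ 'n => complex ^ 'n => complex ^ ('n::finite + 'n)" where
 "join u h = (\<chi> k. case k of Inl i => u $ i | Inr i => h $ i)"

lemma join_simps [simp]: "left_part (join u h) = u" "right_part (join u h) = h" "join (left_part z) (right_part z) = z"
 by (auto simp: left_part_def right_part_def join_def vec_eq_iff split: sum.split)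

lemma parts_hol: "holomorphic_map left_part V" "holomorphic_map right_part V"
 by (simp_all add: holomorphic_map_def left_part_def right_part_def hol_nth)

lemma parts_cont: "continuous_on A left_part" "continuous_on A right_part"
 by (rule holomorphic_map_continuous_on[OF parts_hol(1)], rule holomorphic_map_continuous_on[OF parts_hol(2)])

lemma open_pairs: "open (pairs :: (complex ^ ('n::finite + 'n)) set)"
proof -
 have eq: "(pairs :: (complex ^ ('n + 'n)) set) = left_part -` (- {0}) \<inter> right_part -` (- {0})" by auto
 show ?thesis unfolding eq by (intro open_Int open_vimage parts_cont open_Compl closed_singleton)
qed

lemma proj_analytic_iff:
 "proj_analytic A \<longleftrightarrow> A \<subseteq> topspace proj_space \<times> topspace dual_proj_space \<and> (\<forall>p\<in>pairs. analytic_near (cone_over A) p)"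
proof -
 have "{z. left_part z \<noteq> 0 \<and> right_part z \<noteq> 0 \<and> (line (left_part z), hyperplane (right_part z)) \<in> A} = cone_over A"
  by (auto simp: cone_over_def)
 moreover have "cone_over A \<subseteq> pairs" by (auto simp: cone_over_def)
 ultimately show ?thesis unfolding proj_analytic_def by (simp add: analytic_subset_iff[OF open_pairs])
qed

lemma cone_over_mono: "A \<subseteq> B ==> cone_over A \<subseteq> cone_over B"
 by (auto simp: cone_over_def)

lemma proj_topE:
 assumes "q \<in> topspace proj_space \<times> topspace dual_proj_space"
 shows "\<exists>z\<in>pairs. q = (line (left_part z), hyperplane (right_part z))"
proof -
 obtain u h where "u \<noteq> 0" "h \<noteq> 0" "q = (line u, hyperplane h)" using assms by (auto simp: topspace_proj)
 then show ?thesis by (intro bexI[of _ "join u h"]) auto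
qed

lemma cone_over_mono_iff:
 assumes "A \<subseteq> topspace proj_space \<times> topspace dual_proj_space"
 shows "cone_over A \<subseteq> cone_over B \<longleftrightarrow> A \<subseteq> B"
proof
 assume sub: "cone_over A \<subseteq> cone_over B"
 show "A \<subseteq> B"
 proof
  fix q assume q: "q \<in> A"
  then obtain z where z: "z \<in> pairs" "q = (line (left_part z), hyperplane (right_part z))"
   using proj_topE assms by blast
  then have "z \<in> cone_over B" using sub q by (auto simp: cone_over_def)
  then show "q \<in> B" using z by (simp add: cone_over_def)
 qed
qed (rule cone_over_mono)

text \<open>The action of pairs of nonzero scalars, whose orbits in \<open>pairs\<close> are the
  fibres of the projection to lines and hyperplanes.\<close>

definition scale_pair :: "complex => complex => complex ^ ('n::finite + 'n) => complex ^ ('n + 'n)" where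
 "scale_pair c d z = join (c *s left_part z) (d *s right_part z)"

lemma scale_pair_parts [simp]: "left_part (scale_pair c d z) = c *s left_part z" "right_part (scale_pair c d z) = d *s right_part z"
 by (simp_all add: scale_pair_def)

lemma smult_eq_0 [simp]: "c *s (u :: complex ^ 'n) = 0 \<longleftrightarrow> c = 0 \<or> u = 0"
 by (auto simp: vec_eq_iff)

lemma scale_pair_cone: "c \<noteq> 0 ==> d \<noteq> 0 ==> scale_pair c d z \<in> cone_over A \<longleftrightarrow> z \<in> cone_over A"
 by (simp add: cone_over_def line_scale hyperplane_scale)

lemma closure_scale_pair:
 assumes cd: "c \<noteq> 0" "d \<noteq> 0"
 shows "scale_pair c d z \<in> closure (cone_over B - cone_over A) \<longleftrightarrow> z \<in> closure (cone_over B - cone_over A)"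
proof -
 have cont: "continuous_on UNIV (scale_pair c d :: complex ^ ('n::finite + 'n) => _)" for c d
  unfolding scale_pair_def join_def left_part_def right_part_def
 proof (rule continuous_on_vec_lambda)
  fix i :: "'n + 'n"
  show "continuous_on UNIV (%x :: complex ^ ('n + 'n). case i of Inl i => (c *s (\<chi> i. x $ Inl i)) $ i | Inr i => (d *s (\<chi> i. x $ Inr i)) $ i)"
   by (cases i) (auto intro!: continuous_intros)
 qed
 have inv: "scale_pair c d (scale_pair (inverse c) (inverse d) z) = z" "scale_pair (inverse c) (inverse d) (scale_pair c d z) = z" for z
  using cd by (simp_all add: scale_pair_def)
 have "scale_pair c d -` (cone_over B - cone_over A) = cone_over B - cone_over A"
  using scale_pair_cone[OF cd] by blast
 moreover have "closure (scale_pair c d -` (cone_over B - cone_over A)) = scale_pair c d -` closure (cone_over B - cone_over A)"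
  by (rule closure_vimage_homeo[OF cont cont inv])
 ultimately have "scale_pair c d -` closure (cone_over B - cone_over A) = closure (cone_over B - cone_over A)" by simp
 from arg_cong[OF this, of "%S. z \<in> S"] show ?thesis by simp
qed

text \<open>Otherwise the closure of \<open>B - A\<close> would be a proper analytic subset of \<open>B\<close> which together with \<open>A\<close>
 covers \<open>B\<close>.\<close>

lemma irreducible_nowhere_dense:
 fixes A B :: "((complex ^ 'n) set \<times> (complex ^ 'n) set) set"
 assumes A: "proj_analytic A" and B: "proj_irreducible B" and "A \<subseteq> B" "A \<noteq> B"
 shows "cone_over A \<subseteq> closure (cone_over B - cone_over A)"
proof -
 have anB: "proj_analytic B" using B by (simp add: proj_irreducible_def)
 let ?K = "closure (cone_over B - cone_over A)"
 \<comment> \<open>The closure is invariant under scaling, so its part in \<open>pairs\<close> is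
   the full cone over its image.\<close>
 define B1 where "B1 = (%z. (line (left_part z), hyperplane (right_part z))) ` (?K \<inter> pairs)"
 have cone1: "cone_over B1 = ?K \<inter> pairs"
 proof (intro equalityI subsetI)
  fix z assume z: "z \<in> cone_over B1"
  then obtain z' where z': "z' \<in> ?K" "z' \<in> pairs" "z \<in> pairs"
    "line (left_part z) = line (left_part z')" "hyperplane (right_part z) = hyperplane (right_part z')"
   by (auto simp: cone_over_def B1_def)
  obtain c where c: "c \<noteq> 0" "left_part z = c *s left_part z'" using line_eqD[OF z'(4)] z'(3) by blast
  obtain d where d: "d \<noteq> 0" "right_part z = d *s right_part z'" using hyperplane_eqD[OF z'(5)] z'(2,3) by blast
  have "z = scale_pair c d z'" using c(2) d(2) unfolding scale_pair_def by (metis join_simps(3))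
  then show "z \<in> ?K \<inter> pairs" using closure_scale_pair[OF c(1) d(1)] z'(1,3) by blast
 qed (auto simp: cone_over_def B1_def)
 have an1: "\<forall>p\<in>pairs. analytic_near (cone_over B1) p"
 proof
  fix p :: "complex ^ ('n + 'n)" assume p: "p \<in> pairs"
  have "analytic_near ?K p"
   by (rule closure_diff_analytic) (use A anB p in "auto simp: proj_analytic_iff")
  then show "analytic_near (cone_over B1) p"
   by (rule analytic_near_cong[OF _ open_pairs p]) (auto simp: cone1)
 qed
 have top1: "B1 \<subseteq> topspace proj_space \<times> topspace dual_proj_space"
  by (auto simp: B1_def topspace_proj)
 then have pa1: "proj_analytic B1" using an1 by (simp add: proj_analytic_iff)
 have "cone_over B1 \<subseteq> cone_over B"
 proof
  fix z assume "z \<in> cone_over B1"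
  then have z: "z \<in> ?K" "z \<in> pairs" by (auto simp: cone1)
  then obtain V F where V: "open V" "z \<in> V" "\<forall>f\<in>F. hol f V" "cone_over B \<inter> V = {z\<in>V. \<forall>f\<in>F. f z = 0}"
   using anB unfolding proj_analytic_iff analytic_near_def by blast
  have "f z = 0" if f: "f \<in> F" for f
  proof (rule ccontr)
   assume "f z \<noteq> 0"
   moreover have "open {z\<in>V. f z \<noteq> 0}" by (rule open_nonzero) (use V f in auto)
   ultimately have "{z\<in>V. f z \<noteq> 0} \<inter> (cone_over B - cone_over A) \<noteq> {}"
    using z(1) V(2) open_Int_closure_eq_empty[of "{z\<in>V. f z \<noteq> 0}" "cone_over B - cone_over A"] by blast
   then show False using V(4) f by blast
  qed
  then show "z \<in> cone_over B" using V(2,4) by blast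
 qed
 then have "B1 \<subseteq> B" by (simp add: cone_over_mono_iff[OF top1])
 moreover have "B \<subseteq> A \<union> B1"
 proof
  fix q assume q: "q \<in> B"
  then obtain z where z: "z \<in> pairs" "q = (line (left_part z), hyperplane (right_part z))"
   using proj_topE anB unfolding proj_analytic_iff by blast
  show "q \<in> A \<union> B1"
  proof (cases "q \<in> A")
   case False
   then have "z \<in> cone_over B - cone_over A" using q z by (auto simp: cone_over_def)
   then have "z \<in> ?K \<inter> pairs" using closure_subset z(1) by blast
   then show ?thesis using z(2) by (auto simp: B1_def)
  qed simp
 qed
 ultimately have un: "B = A \<union> B1" using \<open>A \<subseteq> B\<close> by blast
 from B[unfolded proj_irreducible_def, THEN conjunct2, THEN conjunct2, rule_format, OF conjI[OF A conjI[OF pa1 un]]]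
 have eq: "B1 = B" using \<open>A \<noteq> B\<close> by (elim disjE) simp_all
 have "cone_over B1 \<subseteq> ?K" unfolding cone1 by (rule Int_lower1)
 then have "cone_over B \<subseteq> ?K" unfolding eq .
 with cone_over_mono[OF \<open>A \<subseteq> B\<close>] show ?thesis by (rule subset_trans)
qed

text \<open>Points are cut out by two by two minors. They provide the first member of the chains in
  \<open>component_exists\<close>.\<close>

lemma proj_irreducible_singleton:
 fixes u h :: "complex ^ 'n"
 assumes "u \<noteq> 0" "h \<noteq> 0"
 shows "proj_irreducible {(line u, hyperplane h)}"
proof -
 let ?F = "(%(i, j) z. left_part z $ i * u $ j - left_part z $ j * u $ i) ` UNIV \<union>
  (%(i, j) z. right_part z $ i * h $ j - right_part z $ j * h $ i) ` UNIV"
 have par: "(\<forall>i j. v $ i * w $ j - v $ j * w $ i = 0) \<longleftrightarrow> (\<exists>c. c \<noteq> 0 \<and> v = c *s w)" if vw: "v \<noteq> 0" "w \<noteq> 0" for v w :: "complex ^ 'n"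
 proof
  assume *: "\<forall>i j. v $ i * w $ j - v $ j * w $ i = 0"
  obtain j where j: "w $ j \<noteq> 0" using vw(2) by (auto simp: vec_eq_iff)
  have v: "v = (v $ j / w $ j) *s w" using * j by (simp add: vec_eq_iff field_simps)
  then have "v $ j / w $ j \<noteq> 0" using vw(1) by (metis vec.scale_zero_left)
  then show "\<exists>c. c \<noteq> 0 \<and> v = c *s w" using v by blast
 qed auto
 have cone: "cone_over {(line u, hyperplane h)} \<inter> pairs = {z\<in>pairs. \<forall>f\<in>?F. f z = 0}"
 proof -
  have L: "line v = line u \<longleftrightarrow> (\<exists>c. c \<noteq> 0 \<and> v = c *s u)" if "v \<noteq> 0" for v :: "complex ^ 'n"
   using line_eqD[of v u] line_scale[of _ u] that by blast
  have H: "hyperplane v = hyperplane h \<longleftrightarrow> (\<exists>c. c \<noteq> 0 \<and> v = c *s h)" if "v \<noteq> 0" for v :: "complex ^ 'n"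
   using hyperplane_eqD[of v h] hyperplane_scale[of _ h] that assms(2) by blast
  have F: "(\<forall>f\<in>?F. f z = 0) \<longleftrightarrow> (\<forall>i j. left_part z $ i * u $ j - left_part z $ j * u $ i = 0) \<and>
    (\<forall>i j. right_part z $ i * h $ j - right_part z $ j * h $ i = 0)" for z
   by (auto simp only: ball_Un ball_simps UNIV_I split_paired_All prod.case)
  have "z \<in> cone_over {(line u, hyperplane h)} \<longleftrightarrow> (\<forall>f\<in>?F. f z = 0)" if z: "z \<in> pairs" for z
  proof -
   have nz: "left_part z \<noteq> 0" "right_part z \<noteq> 0" using z by auto
   have "z \<in> cone_over {(line u, hyperplane h)} \<longleftrightarrow> line (left_part z) = line u \<and> hyperplane (right_part z) = hyperplane h"
    using nz by (simp add: cone_over_def)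
   then show ?thesis unfolding F par[OF nz(1) assms(1)] par[OF nz(2) assms(2)] L[OF nz(1)] H[OF nz(2)] .
  qed
  then show ?thesis by blast
 qed
 have "\<forall>f\<in>?F. hol f pairs"
  by (auto simp: left_part_def right_part_def intro!: hol_diff hol_mult hol_const hol_nth)
 then have "analytic_near (cone_over {(line u, hyperplane h)}) p" if "p \<in> pairs" for p
  unfolding analytic_near_def using open_pairs cone that
  by (intro exI[of _ pairs] exI[of _ ?F] conjI) (auto simp del: Un_iff)
 then have "proj_analytic {(line u, hyperplane h)}"
  using assms by (auto simp: proj_analytic_iff topspace_proj)
 then show ?thesis unfolding proj_irreducible_def by blast
qed

text \<open>A point on no component would start an infinite strictly increasing sequence of
  irreducible sets. Each is nowhere dense in the next, so \<open>CARD('n + 'n) + 1\<close> steps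
  already contradict the bound for chains.\<close>

lemma component_exists:
 fixes E :: "((complex ^ 'n) set \<times> (complex ^ 'n) set) set"
 assumes "(line u, hyperplane h) \<in> E" "u \<noteq> 0" "h \<noteq> 0"
 shows "\<exists>C\<in>irreducible_components E. (line u, hyperplane h) \<in> C"
proof (rule ccontr)
 assume no: "\<not> ?thesis"
 define P where "P C \<longleftrightarrow> C \<subseteq> E \<and> proj_irreducible C \<and> (line u, hyperplane h) \<in> C" for C
 have P0: "P {(line u, hyperplane h)}" using assms by (auto simp: P_def intro: proj_irreducible_singleton)
 have step: "\<exists>C'. P C' \<and> C \<subset> C'" if "P C" for C
 proof (rule ccontr)
  assume "\<not> (\<exists>C'. P C' \<and> C \<subset> C')"
  then have "C \<in> irreducible_components E"
   using that by (auto simp: irreducible_components_def P_def)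
  then show False using no that by (auto simp: P_def)
 qed
 obtain C :: "nat => _" where C: "\<And>j. P (C j)" "\<And>j. C j \<subset> C (Suc j)"
  using dependent_nat_choice[of "%_. P" "%_ C C'. C \<subset> C'"] P0 step by metis
 define N where "N = Suc (CARD('n + 'n))"
 have "N \<le> CARD('n + 'n)"
 proof (rule analytic_chain_bound)
  have z: "join u h \<in> pairs" using assms by simp
  show "analytic_near (cone_over (C j)) (join u h)" for j
   using C(1)[of j] z by (simp add: P_def proj_irreducible_def proj_analytic_iff)
  show "join u h \<in> cone_over (C 0)" using C(1)[of 0] z by (simp add: P_def cone_over_def)
  show "cone_over (C j) \<subseteq> cone_over (C (Suc j))" for j by (rule cone_over_mono) (use C(2) in blast)
  show "\<exists>U. open U \<and> join u h \<in> U \<and> cone_over (C j) \<inter> U \<subseteq> closure (cone_over (C (Suc j)) - cone_over (C j))" for j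
  proof -
   have "cone_over (C j) \<subseteq> closure (cone_over (C (Suc j)) - cone_over (C j))"
    by (rule irreducible_nowhere_dense) (use C(1)[of j] C(1)[of "Suc j"] C(2)[of j] in "auto simp: P_def proj_irreducible_def")
   then show ?thesis by (intro exI[of _ UNIV]) auto
  qed
 qed
 then show False by (simp add: N_def)
qed

section \<open>Components over a linear subspace\<close>

lemma regular_points_linear:
 assumes "vec.subspace Y"
 shows "regular_points Y = (Y :: (complex ^ 'n) set)" "x \<in> Y ==> tangent_space Y x = Y"
proof -
 have id: "holomorphic_map (%x. x) (UNIV :: (complex ^ 'n) set)" by (simp add: holomorphic_map_def hol_nth)
 have hom: "homeomorphism (UNIV :: (complex ^ 'n) set) UNIV (%x. x) (%x. x)" by (simp add: homeomorphism_def)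
 have "submanifold_at holomorphic_map vec.subspace Y x" for x
  unfolding submanifold_at_def
  by (rule exI[of _ UNIV], rule exI[of _ UNIV], rule exI[of _ "%x. x"], rule exI[of _ "%x. x"], rule exI[of _ Y])
   (simp add: assms id hom)
 then show "regular_points Y = Y" by (auto simp: regular_points_def)
 assume x: "x \<in> Y"
 note ch = tangent_space_chart[OF open_UNIV open_UNIV UNIV_I hom _ vec_subspace_imp_subspace[OF assms] has_derivative_ident]
 show "tangent_space Y x = Y"
  using ch(1)[of Y] ch(2)[of Y, OF _ x has_derivative_ident] by auto
qed

abbreviation bad_limit where
 "bad_limit X Y \<equiv> \<exists>e h. limiting_pair X e h \<and> e \<notin> Y \<and> \<not> Y \<subseteq> hyperplane h"

text \<open>All tangent spaces of \<open>Y\<close> equal \<open>Y\<close>, and missing a fixed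
  vector is an open condition on covectors.\<close>

lemma conormal_fibre_linear:
 fixes Y :: "(complex ^ 'n) set"
 assumes Y: "vec.subspace Y" and h: "h \<noteq> 0"
 shows "hyperplane h \<in> conormal_fibre Y \<longleftrightarrow> Y \<subseteq> hyperplane h"
proof
 assume "hyperplane h \<in> conormal_fibre Y"
 then have *: "(0, hyperplane h) \<in> conormal Y" by (simp add: conormal_fibre_def)
 show "Y \<subseteq> hyperplane h"
 proof
  fix y assume y: "y \<in> Y"
  show "y \<in> hyperplane h"
  proof (rule ccontr)
   assume "y \<notin> hyperplane h"
   then have "h \<in> (%k. pair k y) -` (- {0})" by (simp add: hyperplane_eq)
   moreover have "open ((%k. pair k y) -` (- {0}))"
    by (intro open_vimage continuous_intros)
   ultimately obtain e where e: "e > 0" "ball h e \<subseteq> (%k. pair k y) -` (- {0})" using open_contains_ball by blast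
   obtain x' h' where x': "x' \<in> regular_points Y" "norm (h' - h) < e" "tangent_space Y x' \<subseteq> hyperplane h'"
    using conormalD[OF * h open_UNIV UNIV_I e(1)] by blast
   have "y \<in> hyperplane h'" using x'(1,3) regular_points_linear[OF Y] y by auto
   moreover have "h' \<in> ball h e" using x'(2) by (simp add: dist_norm norm_minus_commute)
   ultimately show False using e(2) by (auto simp: hyperplane_eq)
  qed
 qed
next
 assume sub: "Y \<subseteq> hyperplane h"
 have 0: "0 \<in> Y" using Y by (rule vec.subspace_0)
 have "(0, hyperplane h) \<in> conormal Y"
  by (rule conormalI[OF 0 h], rule exI[of _ 0], rule exI[of _ h])
   (use sub 0 regular_points_linear[OF Y] in auto)
 then show "hyperplane h \<in> conormal_fibre Y" by (simp add: conormal_fibre_def)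
qed

lemma line_subset_iff: "vec.subspace Y ==> line u \<subseteq> Y \<longleftrightarrow> u \<in> Y"
 unfolding line_def using vec.span_minimal[of "{u}" Y] vec.span_base[of u "{u}"] by blast

lemma proj_analytic_restrict:
 fixes C :: "((complex ^ 'n) set \<times> (complex ^ 'n) set) set"
 assumes Y: "vec.subspace Y" "analytic_subset UNIV Y" and C: "proj_analytic C"
 shows "proj_analytic (C \<inter> {(l, H). l \<subseteq> Y})" "proj_analytic (C \<inter> {(l, H). Y \<subseteq> H})"
proof -
 have anY: "analytic_near Y p" for p using Y(2) by (simp add: analytic_subset_iff)
 have 1: "cone_over (C \<inter> {(l, H). l \<subseteq> Y}) = cone_over C \<inter> left_part -` Y"
  by (auto simp: cone_over_def line_subset_iff[OF Y(1)])
 have "analytic_near (left_part -` Y) p" for p :: "complex ^ ('n + 'n)"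
  by (rule analytic_near_preimage[OF anY parts_hol(1) open_UNIV UNIV_I])
 then show "proj_analytic (C \<inter> {(l, H). l \<subseteq> Y})"
  using C unfolding proj_analytic_iff 1 by (auto intro: analytic_near_Int)
 obtain B where B: "B \<subseteq> Y" "vec.independent B" "Y \<subseteq> vec.span B" by (rule vec.basis_exists[of Y])
 have fB: "finite B" by (rule vec.finiteI_independent[OF B(2)])
 have YH: "Y \<subseteq> hyperplane h \<longleftrightarrow> (\<forall>b\<in>B. pair h b = 0)" for h
  using vec.span_minimal[OF _ subspace_hyperplane[of h], of B] B by (auto simp: hyperplane_eq)
 have 2: "cone_over (C \<inter> {(l, H). Y \<subseteq> H}) = cone_over C \<inter> {z. \<forall>b\<in>B. pair (right_part z) b = 0}"
  by (auto simp: cone_over_def YH)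
 have "analytic_near {z. \<forall>b\<in>B. pair (right_part z) b = 0} p" for p :: "complex ^ ('n + 'n)"
  unfolding analytic_near_def
 proof (rule exI[of _ UNIV], rule exI[of _ "(%b z. pair (right_part z) b) ` B"], intro conjI)
  show "\<forall>f\<in>(%b z. pair (right_part z) b) ` B. hol f UNIV"
   unfolding pair_def right_part_def
   by (auto intro!: hol_sum hol_mult hol_const hol_nth)
 qed (use fB in auto)
 then show "proj_analytic (C \<inter> {(l, H). Y \<subseteq> H})"
  using C unfolding proj_analytic_iff 2 by (auto intro: analytic_near_Int)
qed

theorem comps2_empty_iff:
 fixes X Y :: "(complex ^ 'n) set"
 assumes Y: "vec.subspace Y" "analytic_subset UNIV Y" and "0 \<in> X"
 shows "{C \<in> comps2 X Y. \<not> pi1_cone C \<subseteq> Y} = {} \<longleftrightarrow>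
  \<not> (bad_limit X Y)"
proof -
 let ?E = "exceptional_divisor X"
 have dual: "\<exists>h. h \<noteq> 0 \<and> H = hyperplane h" if "(l, H) \<in> ?E" for l H using exceptionalE[OF that] by blast
 have comp_iff: "C \<in> comps2 X Y \<and> \<not> pi1_cone C \<subseteq> Y \<longleftrightarrow>
   C \<in> irreducible_components ?E \<and> (\<exists>q\<in>C. \<not> Y \<subseteq> snd q) \<and> (\<exists>q\<in>C. \<not> fst q \<subseteq> Y)" for C
 proof -
  have "snd ` C \<subseteq> conormal_fibre Y \<longleftrightarrow> (\<forall>q\<in>C. Y \<subseteq> snd q)" if "C \<subseteq> ?E"
  proof -
   have "snd q \<in> conormal_fibre Y \<longleftrightarrow> Y \<subseteq> snd q" if "q \<in> C" for q
   proof -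
    have "(fst q, snd q) \<in> ?E" using that \<open>C \<subseteq> ?E\<close> by auto
    from dual[OF this] obtain h where "h \<noteq> 0" "snd q = hyperplane h" by blast
    then show ?thesis using conormal_fibre_linear[OF Y(1)] by simp
   qed
   then show ?thesis by blast
  qed
  moreover have "pi1_cone C \<subseteq> Y \<longleftrightarrow> (\<forall>q\<in>C. fst q \<subseteq> Y)" by (auto simp: pi1_cone_def)
  moreover have "C \<in> irreducible_components ?E ==> C \<subseteq> ?E" by (simp add: irreducible_components_def)
  moreover have "C \<in> comps2 X Y \<longleftrightarrow> C \<in> irreducible_components ?E \<and> \<not> snd ` C \<subseteq> conormal_fibre Y"
   by (auto simp: comps2_def comps1_def comps_def)
  ultimately show ?thesis by blast
 qed
 have "(\<exists>C. C \<in> comps2 X Y \<and> \<not> pi1_cone C \<subseteq> Y) \<longleftrightarrow> (\<exists>q\<in>?E. \<not> fst q \<subseteq> Y \<and> \<not> Y \<subseteq> snd q)"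
 proof
  assume "\<exists>C. C \<in> comps2 X Y \<and> \<not> pi1_cone C \<subseteq> Y"
  then obtain C where C: "C \<in> irreducible_components ?E" "\<exists>q\<in>C. \<not> Y \<subseteq> snd q" "\<exists>q\<in>C. \<not> fst q \<subseteq> Y"
   unfolding comp_iff by blast
  have irr: "proj_irreducible C" and sub: "C \<subseteq> ?E" using C(1) by (auto simp: irreducible_components_def)
  have "\<exists>q\<in>C. \<not> fst q \<subseteq> Y \<and> \<not> Y \<subseteq> snd q"
  proof (rule ccontr)
   assume "\<not> ?thesis"
   \<comment> \<open>If no point of \<open>C\<close> has both properties, \<open>C\<close> is the
     union of two analytic parts; irreducibility makes one of them all of \<open>C\<close>, against
     \<open>C(2)\<close> or \<open>C(3)\<close>.\<close>
   then have eq: "C = C \<inter> {(l, H). l \<subseteq> Y} \<union> C \<inter> {(l, H). Y \<subseteq> H}" by fastforce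
   have an: "proj_analytic C" using irr by (simp add: proj_irreducible_def)
   note pr = proj_analytic_restrict[OF Y an]
   from irr[unfolded proj_irreducible_def, THEN conjunct2, THEN conjunct2, rule_format, OF conjI[OF pr(1) conjI[OF pr(2) eq]]]
   consider "C \<subseteq> {(l, H). l \<subseteq> Y}" | "C \<subseteq> {(l, H). Y \<subseteq> H}" by (elim disjE) blast+
   then show False
   proof cases
    case 1
    obtain q where q: "q \<in> C" "\<not> fst q \<subseteq> Y" using C(3) by (rule bexE)
    from subsetD[OF 1 q(1)] q(2) show False by (simp add: case_prod_beta)
   next
    case 2
    obtain q where q: "q \<in> C" "\<not> Y \<subseteq> snd q" using C(2) by (rule bexE)
    from subsetD[OF 2 q(1)] q(2) show False by (simp add: case_prod_beta)
   qed
  qed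
  then show "\<exists>q\<in>?E. \<not> fst q \<subseteq> Y \<and> \<not> Y \<subseteq> snd q" using sub by blast
 next
  assume "\<exists>q\<in>?E. \<not> fst q \<subseteq> Y \<and> \<not> Y \<subseteq> snd q"
  then obtain l H where lH: "(l, H) \<in> ?E" "\<not> l \<subseteq> Y" "\<not> Y \<subseteq> H" by force
  obtain e h where eh: "e \<noteq> 0" "h \<noteq> 0" "l = line e" "H = hyperplane h" using exceptionalE[OF lH(1)] by blast
  obtain C where "C \<in> irreducible_components ?E" "(l, H) \<in> C"
   using component_exists[OF lH(1)[unfolded eh] eh(1,2)] eh by blast
  then show "\<exists>C. C \<in> comps2 X Y \<and> \<not> pi1_cone C \<subseteq> Y" unfolding comp_iff using lH
   by (intro exI[of _ C] conjI) (auto intro!: bexI[of _ "(l, H)"])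
 qed
 also have "\<dots> \<longleftrightarrow> (bad_limit X Y)"
 proof
  assume "\<exists>q\<in>?E. \<not> fst q \<subseteq> Y \<and> \<not> Y \<subseteq> snd q"
  then obtain l H where lH: "(l, H) \<in> ?E" "\<not> l \<subseteq> Y" "\<not> Y \<subseteq> H" by force
  obtain e h where eh: "e \<noteq> 0" "h \<noteq> 0" "l = line e" "H = hyperplane h" using exceptionalE[OF lH(1)] by blast
  have "limiting_pair X e h" by (rule limiting_pair_if_exceptional) (use lH(1) eh in auto)
  then show "bad_limit X Y"
   using lH(2,3) line_subset_iff[OF Y(1), of e] unfolding eh(3,4) by (intro exI[of _ e] exI[of _ h] conjI) simp_all
 next
  assume "bad_limit X Y"
  then obtain e h where eh: "limiting_pair X e h" "e \<notin> Y" "\<not> Y \<subseteq> hyperplane h" by blast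
  have "e \<noteq> 0" using eh(2) vec.subspace_0[OF Y(1)] by auto
  moreover have "h \<noteq> 0" using eh(3) by (auto simp: hyperplane_eq pair_simps)
  ultimately have "(line e, hyperplane h) \<in> ?E" by (rule exceptional_if_limiting_pair[OF eh(1) _ _ assms(3)])
  then show "\<exists>q\<in>?E. \<not> fst q \<subseteq> Y \<and> \<not> Y \<subseteq> snd q"
   using eh(2,3) by (intro bexI[of _ "(line e, hyperplane h)"]) (simp_all add: line_subset_iff[OF Y(1)])
 qed
 finally have "(\<exists>C. C \<in> comps2 X Y \<and> \<not> pi1_cone C \<subseteq> Y) \<longleftrightarrow>
  (bad_limit X Y)" .
 moreover have "{C \<in> comps2 X Y. \<not> pi1_cone C \<subseteq> Y} = {} \<longleftrightarrow> \<not> (\<exists>C. C \<in> comps2 X Y \<and> \<not> pi1_cone C \<subseteq> Y)"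
  unfolding set_eq_iff by simp
 ultimately show ?thesis by (simp only:)
qed

section \<open>Condition (t1) and limiting pairs\<close>

lemma tangent_space_Diff_closed:
 assumes "closed Y" "x \<notin> Y"
 shows "tangent_space (X - Y) x = tangent_space X x"
proof
 show "tangent_space (X - Y) x \<subseteq> tangent_space X x" by (rule tangent_space_mono) auto
 show "tangent_space X x \<subseteq> tangent_space (X - Y) x"
 proof
  fix v assume "v \<in> tangent_space X x"
  then obtain gam where g: "gam 0 = x" "\<forall>t. gam t \<in> X" "(gam has_vector_derivative v) (at (0::real))"
   unfolding tangent_space_def by blast
  have "isCont gam 0" using g(3) has_vector_derivative_continuous by blast
  then have "\<forall>\<^sub>F t in at 0. gam t \<in> - Y"
   using g(1) assms unfolding isCont_def by (auto dest: topological_tendstoD)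
  then obtain eta where eta: "eta > 0" "\<And>t. t \<noteq> 0 ==> dist t 0 < eta ==> gam t \<in> - Y"
   unfolding eventually_at by blast
  show "v \<in> tangent_space (X - Y) x"
  proof (rule tangent_spaceI_local[OF g(1) eta(1) _ g(3)])
   fix t :: real assume "\<bar>t\<bar> < eta"
   then show "gam t \<in> X - Y" using eta(2)[of t] g(1,2) assms(2) by (cases "t = 0") auto
  qed
 qed
qed

text \<open>Turns a real normal vector into the complex covector whose real part is the inner
  product with it.\<close>

definition conj_vec :: "complex ^ 'n => complex ^ 'n" where "conj_vec a = (\<chi> i. cnj (a $ i))"

lemma Re_pair_conj: "Re (pair (conj_vec a) v) = a \<bullet> v"
 by (simp add: pair_def conj_vec_def inner_vec_def inner_complex_def Re_sum)

lemma norm_conj_vec [simp]: "norm (conj_vec a) = norm a"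
 by (simp add: conj_vec_def norm_vec_def)

text \<open>The imaginary part at \<open>v\<close> is, up to sign, the real part at
  \<open>\<i> *s v\<close>.\<close>

lemma complex_functional_zero:
 assumes "vec.subspace T" "\<And>v. v \<in> T ==> Re (pair h v) = 0"
 shows "T \<subseteq> hyperplane h"
proof
 fix v assume v: "v \<in> T"
 have "\<i> *s v \<in> T" by (rule vec.subspace_scale[OF assms(1) v])
 from assms(2)[OF this] assms(2)[OF v] show "v \<in> hyperplane h"
  by (simp add: hyperplane_eq pair_simps complex_eq_iff)
qed

section \<open>From a failure of transversality to a limiting pair\<close>

lemma regular_tangent_subspace:
 fixes X :: "(complex ^ 'n) set"
 assumes "x \<in> regular_points X"
 shows "vec.subspace (tangent_space X x)"
proof -
 have xX: "x \<in> X" and sm: "submanifold_at holomorphic_map vec.subspace X x"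
  using assms by (auto simp: regular_points_def)
 obtain V W S and phi psi :: "complex ^ 'n => complex ^ 'n" where *: "open V \<and> open W \<and> x \<in> V \<and> homeomorphism V W phi psi \<and> holomorphic_map phi V \<and>
   holomorphic_map psi W \<and> vec.subspace S \<and> phi ` (X \<inter> V) = W \<inter> S"
  using sm unfolding submanifold_at_def by (elim exE) (rule that)
 have VW: "open V" "open W" "x \<in> V" and hom: "homeomorphism V W phi psi"
  and hol: "holomorphic_map phi V" "holomorphic_map psi W" and S: "vec.subspace S" and im: "phi ` (X \<inter> V) = W \<inter> S"
  using * by blast+
 have wx: "phi x \<in> W" using hom VW(3) unfolding homeomorphism_def by blast
 define P where "P v = (\<chi> i. fd (%z. phi z $ i) x v)" for v
 have P: "(phi has_derivative P) (at x)" unfolding P_def by (rule holomorphic_map_deriv[OF hol(1) VW(3)])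
 note R = holomorphic_map_deriv[OF hol(2) wx]
 note ch = tangent_space_chart[OF VW hom im vec_subspace_imp_subspace[OF S] P]
 have "v \<in> tangent_space X x \<longleftrightarrow> P v \<in> S" for v
  using ch(1)[of v] ch(2)[OF xX R, of "P v"] ch(3)[OF R, of v] by auto
 then have T: "tangent_space X x = {v. P v \<in> S}" by blast
 have "P (v + w) = P v + P w" "P 0 = 0" for v w
  using has_derivative_linear[OF P] by (simp_all add: linear_add linear_0)
 moreover have "P (c *s v) = c *s P v" for c v
  using hol(1) VW(3) by (simp add: P_def vec_eq_iff holomorphic_map_def hol_deriv(2)[of _ V])
 ultimately show ?thesis
  unfolding vec.subspace_def T using S by (simp add: vec.subspace_0 vec.subspace_add vec.subspace_scale)
qed

text \<open>The sum of the tangent spaces is a proper real subspace and has a real normal vector. On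
  the tangent space of \<open>X\<close>, which is complex, the whole complex functional vanishes; on
  that of the real manifold \<open>Q\<close> only its real part does.\<close>

lemma nontransverse_conormal:
 fixes X Y Q :: "(complex ^ 'n) set"
 assumes reg: "x \<in> regular_points X" and "x \<notin> Y" "closed Y" and nt: "\<not> transverse_at Q (X - Y) x"
  and sQ: "subspace (tangent_space Q x)"
 shows "x \<in> Q \<and> (\<exists>h. norm h = 1 \<and> tangent_space X x \<subseteq> hyperplane h \<and> (\<forall>v\<in>tangent_space Q x. Re (pair h v) = 0))"
proof -
 let ?T = "tangent_space X x" and ?TQ = "tangent_space Q x"
 have T: "vec.subspace ?T" by (rule regular_tangent_subspace[OF reg])
 have nt': "x \<in> Q" "{u + v | u v. u \<in> ?TQ \<and> v \<in> ?T} \<noteq> UNIV"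
  using nt unfolding transverse_at_def tangent_space_Diff_closed[OF assms(3,2)] by auto
 have "subspace {u + v | u v. u \<in> ?TQ \<and> v \<in> ?T}"
  by (rule subspace_sums[OF sQ vec_subspace_imp_subspace[OF T]])
 then have "span {u + v | u v. u \<in> ?TQ \<and> v \<in> ?T} = {u + v | u v. u \<in> ?TQ \<and> v \<in> ?T}"
  by (rule span_eq_iff[THEN iffD2])
 with nt'(2) have "span {u + v | u v. u \<in> ?TQ \<and> v \<in> ?T} \<noteq> UNIV" by (rule ssubst[where P="%A. A \<noteq> UNIV", rotated])
 from span_not_UNIV_orthogonal[OF this] obtain a where a: "a \<noteq> 0" "\<And>w. w \<in> span {u + v | u v. u \<in> ?TQ \<and> v \<in> ?T} ==> a \<bullet> w = 0"
  by blast
 have a0: "a \<bullet> (u + v) = 0" if "u \<in> ?TQ" "v \<in> ?T" for u v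
  by (rule a(2), rule span_base) (use that in blast)
 define b where "b = a /\<^sub>R norm a"
 have b: "norm b = 1" using a(1) by (simp add: b_def)
 have "b \<bullet> v = 0" if "v \<in> ?T" for v using a0[OF subspace_0[OF sQ] that] by (simp add: b_def)
 then have "?T \<subseteq> hyperplane (conj_vec b)" by (intro complex_functional_zero[OF T]) (simp add: Re_pair_conj)
 moreover have "b \<bullet> v = 0" if "v \<in> ?TQ" for v using a0[OF that vec.subspace_0[OF T]] by (simp add: b_def)
 ultimately show ?thesis using nt'(1) b by (intro conjI exI[of _ "conj_vec b"]) (auto simp: Re_pair_conj)
qed

text \<open>Compactness of spheres gives limits \<open>e\<close> and \<open>h0\<close>. Secants of
  \<open>Q\<close> at the origin tend into \<open>L\<close>, so \<open>e\<close> lies in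
  \<open>L\<close> and not in \<open>Y\<close>. The real part of \<open>h0\<close> vanishes on
  \<open>L\<close>, hence \<open>h0\<close> does, \<open>L\<close> being complex; if it vanished on
  \<open>Y\<close> too, it would vanish on the sum, which is everything.\<close>

lemma limiting_pair_if_not_t1:
 fixes X Y :: "(complex ^ 'n) set"
 assumes Y: "vec.subspace Y" and reg: "X - Y \<subseteq> regular_points X" and nt1: "\<not> condition_t1 X Y"
 shows "bad_limit X Y"
proof -
 have clY: "closed Y" by (rule closed_subspace[OF vec_subspace_imp_subspace[OF Y]])
 have Y0: "0 \<in> Y" by (rule vec.subspace_0[OF Y])
 obtain L Q where L: "vec.subspace L" "complementary L Y" and Q: "C1_submanifold Q" "0 \<in> Q" "tangent_space Q 0 = L"
  and nt: "\<not> (\<forall>\<^sub>F x in nhds 0. transverse_at Q (X - Y) x)"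
  using nt1 unfolding condition_t1_def by blast
 have sm: "submanifold_at C1_map subspace Q 0" using Q(1,2) by (simp add: C1_submanifold_def)
 obtain V W S and phi psi :: "complex ^ 'n => complex ^ 'n" where *: "open V \<and> open W \<and> 0 \<in> V \<and> homeomorphism V W phi psi \<and> C1_map phi V \<and>
   C1_map psi W \<and> subspace S \<and> phi ` (Q \<inter> V) = W \<inter> S"
  using sm unfolding submanifold_at_def by (elim exE) (rule that)
 have VW: "open V" "open W" "0 \<in> V" and hom: "homeomorphism V W phi psi"
  and c1: "C1_map phi V" "C1_map psi W" and S: "subspace S" and im: "phi ` (Q \<inter> V) = W \<inter> S"
  using * by blast+
 obtain phi' where phi': "\<And>x. x \<in> V ==> (phi has_derivative blinfun_apply (phi' x)) (at x)" using c1(1) unfolding C1_map_def by blast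
 obtain psi' where psi': "\<And>x. x \<in> W ==> (psi has_derivative blinfun_apply (psi' x)) (at x)" "continuous_on W psi'"
  using c1(2) unfolding C1_map_def by blast
 have phiW: "phi x \<in> W" if "x \<in> V" for x using hom that unfolding homeomorphism_def by blast
 have phicont: "continuous_on V phi" using hom unfolding homeomorphism_def by blast
 note ch = tangent_space_chart[OF VW(1,2) _ hom im S phi']
 have TQ: "v \<in> tangent_space Q x \<longleftrightarrow> blinfun_apply (phi' x) v \<in> S" if "x \<in> Q" "x \<in> V" for x v
  using ch(1)[OF that(2,2), of v] ch(2)[OF that(2,2,1) psi'(1)[OF phiW[OF that(2)]], of "blinfun_apply (phi' x) v"]
   ch(3)[OF that(2,2) psi'(1)[OF phiW[OF that(2)]], of v] by auto
 have sTQ: "subspace (tangent_space Q x)" if "x \<in> Q" "x \<in> V" for x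
 proof -
  have eq: "tangent_space Q x = {v. blinfun_apply (phi' x) v \<in> S}" using TQ[OF that] by blast
  show ?thesis
   unfolding subspace_def eq using S by (simp add: blinfun.add_right blinfun.scaleR_right blinfun.zero_right subspace_0 subspace_add subspace_scale)
 qed
 have ex: "\<exists>x h. x \<in> Q \<and> x \<in> V \<and> x \<in> X - Y \<and> norm x < 1 / (real k + 1) \<and> norm h = 1 \<and> tangent_space X x \<subseteq> hyperplane h \<and>
   (\<forall>v\<in>tangent_space Q x. Re (pair h v) = 0)" for k
 proof -
  have "open (V \<inter> ball 0 (1 / (real k + 1)))" "0 \<in> V \<inter> ball 0 (1 / (real k + 1))" using VW by (auto simp: open_Int)
  then have "\<exists>x\<in>V \<inter> ball 0 (1 / (real k + 1)). \<not> transverse_at Q (X - Y) x"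
   using nt unfolding eventually_nhds by blast
  then obtain x where x: "x \<in> V" "norm x < 1 / (real k + 1)" "\<not> transverse_at Q (X - Y) x" by auto
  have xX: "x \<in> X - Y" "x \<in> Q" using x(3) unfolding transverse_at_def by blast+
  then have "x \<in> regular_points X" "x \<notin> Y" using reg by blast+
  from nontransverse_conormal[OF this clY x(3) sTQ[OF xX(2) x(1)]] show ?thesis using x(1,2) xX(1) by blast
 qed
 then have "\<forall>k. \<exists>x h. x \<in> Q \<and> x \<in> V \<and> x \<in> X - Y \<and> norm x < 1 / (real k + 1) \<and> norm h = 1 \<and> tangent_space X x \<subseteq> hyperplane h \<and>
   (\<forall>v\<in>tangent_space Q x. Re (pair h v) = 0)" by (intro allI)
 then obtain x where "\<forall>k. \<exists>h. x k \<in> Q \<and> x k \<in> V \<and> x k \<in> X - Y \<and> norm (x k) < 1 / (real k + 1) \<and> norm h = 1 \<and> tangent_space X (x k) \<subseteq> hyperplane h \<and>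
   (\<forall>v\<in>tangent_space Q (x k). Re (pair h v) = 0)" by (rule choice[THEN exE])
 then obtain h where xh: "\<forall>k. x k \<in> Q \<and> x k \<in> V \<and> x k \<in> X - Y \<and> norm (x k) < 1 / (real k + 1) \<and> norm (h k) = 1 \<and> tangent_space X (x k) \<subseteq> hyperplane (h k) \<and>
   (\<forall>v\<in>tangent_space Q (x k). Re (pair (h k) v) = 0)" by (rule choice[THEN exE])
 have xQ: "x k \<in> Q" "x k \<in> V" and xX: "x k \<in> X - Y" and xn: "norm (x k) < 1 / (real k + 1)" and hn: "norm (h k) = 1"
  and hT: "tangent_space X (x k) \<subseteq> hyperplane (h k)" for k using xh by blast+
 have hQ: "Re (pair (h k) v) = 0" if "v \<in> tangent_space Q (x k)" for k v using xh that by blast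
 have xnz: "x k \<noteq> 0" for k using xX[of k] Y0 by auto
 have xlim: "x \<longlonglongrightarrow> 0"
 proof (rule Lim_null_comparison)
  show "\<forall>\<^sub>F k in sequentially. norm (x k) \<le> 1 / (real k + 1)" using xn by (simp add: less_imp_le)
  show "(%k. 1 / (real k + 1)) \<longlonglongrightarrow> 0" using LIMSEQ_inverse_real_of_nat by (simp add: inverse_eq_divide add.commute)
 qed
 define p where "p k = (x k /\<^sub>R norm (x k), h k)" for k
 have "p k \<in> sphere 0 1 \<times> sphere 0 1" for k using hn xnz by (simp add: p_def)
 moreover have "compact (sphere (0 :: complex ^ 'n) 1 \<times> sphere (0 :: complex ^ 'n) 1)" by (intro compact_Times compact_sphere)
 ultimately obtain q r where q: "q \<in> sphere 0 1 \<times> sphere 0 1" "strict_mono r" "(p \<circ> r) \<longlonglongrightarrow> q"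
  unfolding compact_def by meson
 obtain e h0 where eh: "q = (e, h0)" by (cases q)
 have ne: "norm e = 1" "norm h0 = 1" using q(1) eh by auto
 have ulim: "(%k. x (r k) /\<^sub>R norm (x (r k))) \<longlonglongrightarrow> e" and hlim: "(%k. h (r k)) \<longlonglongrightarrow> h0"
  using tendsto_fst[OF q(3)] tendsto_snd[OF q(3)] by (simp_all add: p_def o_def eh)
 have xrlim: "(%k. x (r k)) \<longlonglongrightarrow> 0" using LIMSEQ_subseq_LIMSEQ[OF xlim q(2)] by (simp add: o_def)
 have lp: "limiting_pair X e h0"
  unfolding limiting_pair_def
 proof (intro allI impI)
  fix eps :: real assume "eps > 0"
  from tendstoD[OF ulim this] tendstoD[OF hlim this] tendstoD[OF xrlim this]
  have "\<forall>\<^sub>F k in sequentially. dist (x (r k) /\<^sub>R norm (x (r k))) e < eps \<and> dist (h (r k)) h0 < eps \<and> dist (x (r k)) 0 < eps"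
   by eventually_elim blast
  then obtain k where k: "dist (x (r k) /\<^sub>R norm (x (r k))) e < eps" "dist (h (r k)) h0 < eps" "dist (x (r k)) 0 < eps"
   using eventually_happens'[OF sequentially_bot] by blast
  have "complex_of_real (norm (x (r k))) *s (x (r k) /\<^sub>R norm (x (r k))) = x (r k)"
   using xnz[of "r k"] by (simp add: of_real_smult)
  moreover have "x (r k) \<in> regular_points X" using xX reg by blast
  ultimately show "\<exists>c u h'. near_conormal X e h0 eps c u h'"
   using k hT[of "r k"] xnz[of "r k"]
   by (intro exI[of _ "complex_of_real (norm (x (r k)))"] exI[of _ "x (r k) /\<^sub>R norm (x (r k))"] exI[of _ "h (r k)"])
    (simp add: dist_norm)
 qed
 have phi0: "phi 0 \<in> S" using im VW(3) Q(2) by blast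
 have eL: "e \<in> L"
 proof -
  let ?D = "blinfun_apply (phi' 0)"
  have d: "(phi has_derivative ?D) (at 0)" by (rule phi'[OF VW(3)])
  have "((%y. norm (phi y - phi 0 - ?D y) / norm y) \<longlongrightarrow> 0) (at 0)"
   using d unfolding has_derivative_at by simp
  moreover have "filterlim (%k. x (r k)) (at 0) sequentially"
   using xrlim xnz by (simp add: filterlim_at)
  ultimately have "(%k. norm (phi (x (r k)) - phi 0 - ?D (x (r k))) / norm (x (r k))) \<longlonglongrightarrow> 0"
   by (rule filterlim_compose)
  moreover have "norm (phi (x (r k)) - phi 0 - ?D (x (r k))) / norm (x (r k)) =
    norm ((phi (x (r k)) - phi 0) /\<^sub>R norm (x (r k)) - ?D (x (r k) /\<^sub>R norm (x (r k))))" for k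
  proof -
   have "(phi (x (r k)) - phi 0) /\<^sub>R norm (x (r k)) - ?D (x (r k) /\<^sub>R norm (x (r k))) =
     (phi (x (r k)) - phi 0 - ?D (x (r k))) /\<^sub>R norm (x (r k))"
    by (simp add: blinfun.scaleR_right scaleR_diff_right)
   then show ?thesis by (simp add: divide_inverse mult.commute)
  qed
  ultimately have "(%k. norm ((phi (x (r k)) - phi 0) /\<^sub>R norm (x (r k)) - ?D (x (r k) /\<^sub>R norm (x (r k))))) \<longlonglongrightarrow> 0" by simp
  then have l1: "(%k. (phi (x (r k)) - phi 0) /\<^sub>R norm (x (r k)) - ?D (x (r k) /\<^sub>R norm (x (r k)))) \<longlonglongrightarrow> 0"
   by (rule tendsto_norm_zero_cancel)
  have "(%k. ?D (x (r k) /\<^sub>R norm (x (r k)))) \<longlonglongrightarrow> ?D e" by (intro blinfun.tendsto tendsto_const ulim)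
  from tendsto_add[OF l1 this] have l2: "(%k. (phi (x (r k)) - phi 0) /\<^sub>R norm (x (r k))) \<longlonglongrightarrow> ?D e" by simp
  have "(phi (x (r k)) - phi 0) /\<^sub>R norm (x (r k)) \<in> S" for k
  proof -
   have "phi (x (r k)) \<in> S" using im xQ by blast
   then show ?thesis by (intro subspace_scale subspace_diff S phi0)
  qed
  then have "\<forall>\<^sub>F k in sequentially. (phi (x (r k)) - phi 0) /\<^sub>R norm (x (r k)) \<in> S" by (intro always_eventually allI)
  from Lim_in_closed_set[OF closed_subspace[OF S] this sequentially_bot l2] have "?D e \<in> S" .
  then show ?thesis using TQ[OF Q(2) VW(3)] Q(3) by blast
 qed
 have "e \<notin> Y"
 proof
  assume "e \<in> Y"
  then have "e = 0" using eL L(2) unfolding complementary_def by blast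
  then show False using ne(1) by simp
 qed
 moreover have "\<not> Y \<subseteq> hyperplane h0"
 proof
  assume sub: "Y \<subseteq> hyperplane h0"
  \<comment> \<open>The continuous derivative of the inverse chart carries a fixed vector
    \<open>s\<close> of the model subspace to tangent vectors of \<open>Q\<close> at the chosen
    points, and these converge to \<open>v\<close>.\<close>
  have "Re (pair h0 v) = 0" if v: "v \<in> L" for v
  proof -
   define s where "s = blinfun_apply (phi' 0) v"
   have s: "s \<in> S" "blinfun_apply (psi' (phi 0)) s = v"
    using TQ[OF Q(2) VW(3), of v] Q(3) v ch(3)[OF VW(3,3) psi'(1)[OF phiW[OF VW(3)]], of v] by (auto simp: s_def)
   have "(%k. phi (x (r k))) \<longlonglongrightarrow> phi 0"
    by (rule continuous_on_tendsto_compose[OF phicont xrlim VW(3)]) (simp add: xQ)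
   then have "(%k. psi' (phi (x (r k)))) \<longlonglongrightarrow> psi' (phi 0)"
    by (rule continuous_on_tendsto_compose[OF psi'(2) _ phiW[OF VW(3)]]) (simp add: phiW xQ)
   then have "(%k. blinfun_apply (psi' (phi (x (r k)))) s) \<longlonglongrightarrow> v"
    using blinfun.tendsto[OF _ tendsto_const[of s]] s(2) by metis
   then have "(%k. Re (pair (h (r k)) (blinfun_apply (psi' (phi (x (r k)))) s))) \<longlonglongrightarrow> Re (pair h0 v)"
    unfolding pair_def by (intro tendsto_intros hlim)
   moreover have "Re (pair (h (r k)) (blinfun_apply (psi' (phi (x (r k)))) s)) = 0" for k
    by (rule hQ, rule ch(2)[OF xQ(2) xQ(2) xQ(1) psi'(1)[OF phiW[OF xQ(2)]] s(1)])
   ultimately have "(%k. 0) \<longlonglongrightarrow> Re (pair h0 v)" by simp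
   then show ?thesis using LIMSEQ_unique[OF tendsto_const] by (metis (no_types))
  qed
  then have LH: "L \<subseteq> hyperplane h0" by (rule complex_functional_zero[OF L(1)])
  have "v \<in> hyperplane h0" for v
  proof -
   have "v \<in> {a + b |a b. a \<in> L \<and> b \<in> Y}" using L(2) unfolding complementary_def by simp
   then obtain a b where "a \<in> L" "b \<in> Y" "v = a + b" by blast
   then show ?thesis using vec.subspace_add[OF subspace_hyperplane] LH sub by blast
  qed
  then have "pair h0 (axis i 1) = 0" for i by (simp add: hyperplane_eq)
  then have "h0 = 0" by (simp add: pair_simps vec_eq_iff)
  then show False using ne(2) by simp
 qed
 ultimately show ?thesis using lp by blast
qed

text \<open>A basis of the intersection of \<open>Y\<close> with the hyperplane is extended by
  \<open>e\<close> to a basis of the hyperplane; the added vectors span \<open>L\<close>. Since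
  \<open>y0\<close> supplies the one direction of \<open>Y\<close> outside the hyperplane,
  \<open>L\<close> is complementary to \<open>Y\<close>, and \<open>P\<close> is the projection onto
  \<open>L\<close> along \<open>Y\<close>.\<close>

lemma adapted_projection:
 fixes Y :: "(complex ^ 'n) set"
 assumes Y: "vec.subspace Y" and e: "e \<notin> Y" "pair h e = 0" and y0: "y0 \<in> Y" "pair h y0 \<noteq> 0"
 shows "\<exists>P L. vec.subspace L \<and> L \<subseteq> hyperplane h \<and> e \<in> L \<and> (\<forall>v w. P (v + w) = P v + P w) \<and>
  (\<forall>c v. P (c *s v) = c *s P v) \<and> (\<forall>v. P v \<in> L) \<and> (\<forall>v\<in>L. P v = v) \<and> (\<forall>v\<in>Y. P v = 0) \<and> (\<forall>v. v - P v \<in> Y)"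
proof -
 let ?H = "hyperplane h"
 have split: "\<exists>c w. v = w + c *s y0 \<and> w \<in> ?H \<and> (v \<in> Y --> w \<in> Y)" for v
 proof (intro exI conjI impI)
  let ?c = "pair h v / pair h y0"
  show "v = (v - ?c *s y0) + ?c *s y0" by simp
  show "v - ?c *s y0 \<in> ?H" using y0(2) by (simp add: hyperplane_eq pair_simps)
  show "v - ?c *s y0 \<in> Y" if "v \<in> Y" by (intro vec.subspace_diff[OF Y] vec.subspace_scale[OF Y] that y0)
 qed
 obtain B1 where B1: "B1 \<subseteq> Y \<inter> ?H" "vec.independent B1" "Y \<inter> ?H \<subseteq> vec.span B1"
  by (rule vec.maximal_independent_subset[of "Y \<inter> ?H"])
 have "vec.span B1 \<subseteq> Y" by (rule vec.span_minimal[OF _ Y]) (use B1(1) in blast)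
 then have "e \<notin> vec.span B1" using e(1) by blast
 then have ind1: "vec.independent (insert e B1)" using B1(2) by (rule vec.independent_insertI)
 have "insert e B1 \<subseteq> ?H" using B1(1) e(2) by (auto simp: hyperplane_eq)
 then obtain B where B: "insert e B1 \<subseteq> B" "B \<subseteq> ?H" "vec.independent B" "?H \<subseteq> vec.span B"
  by (rule vec.maximal_independent_subset_extend[OF _ ind1])
 have spB: "vec.span B \<subseteq> ?H" by (rule vec.span_minimal[OF B(2) subspace_hyperplane])
 then have "y0 \<notin> vec.span B" using y0(2) by (auto simp: hyperplane_eq)
 then have ind2: "vec.independent (insert y0 B)" using B(3) by (rule vec.independent_insertI)
 obtain P where P: "Vector_Spaces.linear (*s) (*s) P" "\<forall>b\<in>insert y0 B. P b = (if b \<in> B - B1 then b else 0)"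
  using vec.linear_independent_extend[OF ind2, of "%b. if b \<in> B - B1 then b else 0"] by blast
 have Padd: "P (v + w) = P v + P w" and Psc: "P (c *s v) = c *s P v" and P0: "P 0 = 0" for v w c
  using vec.linear_add[OF P(1)] vec.linear_scale[OF P(1)] vec.linear_0[OF P(1)] by blast+
 have Py0: "P y0 = 0" using P(2) B(2) y0(2) by (auto simp: hyperplane_eq)
 define L where "L = vec.span (B - B1)"
 have L: "vec.subspace L" by (simp add: L_def vec.subspace_span)
 have PL: "P v = v" if "v \<in> L" for v
 proof -
  have "L \<subseteq> {v. P v = v}" unfolding L_def
   by (rule vec.span_minimal) (use P(2) in "auto simp: vec.subspace_def Padd Psc P0")
  then show ?thesis using that by blast
 qed
 have PB1: "P v = 0" if "v \<in> vec.span B1" for v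
 proof -
  have "vec.span B1 \<subseteq> {v. P v = 0}"
   by (rule vec.span_minimal) (use P(2) B(1) in "auto simp: vec.subspace_def Padd Psc P0")
  then show ?thesis using that by blast
 qed
 have PY: "P v = 0" if v: "v \<in> Y" for v
 proof -
  obtain c w where w: "v = w + c *s y0" "w \<in> ?H" "w \<in> Y" using split[of v] v by blast
  then have "P w = 0" using PB1 B1(3) by blast
  then show ?thesis by (simp add: w(1) Padd Psc Py0)
 qed
 have Pspan: "P v \<in> L \<and> v - P v \<in> Y" for v
 proof -
  have sub: "vec.subspace {v. P v \<in> L \<and> v - P v \<in> Y}"
   unfolding vec.subspace_def
  proof (intro conjI ballI allI CollectI; (elim CollectE conjE)?)
   show "P 0 \<in> L" "0 - P 0 \<in> Y" using vec.subspace_0[OF L] vec.subspace_0[OF Y] by (simp_all add: P0)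
   fix v w c assume v: "P v \<in> L" "v - P v \<in> Y"
   show "P (c *s v) \<in> L" unfolding Psc by (rule vec.subspace_scale[OF L v(1)])
   have "c *s v - P (c *s v) = c *s (v - P v)" by (simp add: Psc vec.scale_right_diff_distrib)
   then show "c *s v - P (c *s v) \<in> Y" using vec.subspace_scale[OF Y v(2)] by simp
   assume w: "P w \<in> L" "w - P w \<in> Y"
   show "P (v + w) \<in> L" unfolding Padd by (rule vec.subspace_add[OF L v(1) w(1)])
   have eq: "v + w - P (v + w) = (v - P v) + (w - P w)" by (simp add: Padd)
   show "v + w - P (v + w) \<in> Y" unfolding eq by (rule vec.subspace_add[OF Y v(2) w(2)])
  qed
  have "B \<subseteq> {v. P v \<in> L \<and> v - P v \<in> Y}"
  proof
   fix b assume b: "b \<in> B"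
   show "b \<in> {v. P v \<in> L \<and> v - P v \<in> Y}"
   proof (cases "b \<in> B1")
    case True
    then have "P b = 0" using PB1 vec.span_base by blast
    then show ?thesis using True B1(1) vec.subspace_0[OF L] by auto
   next
    case False
    then have "b \<in> L" using b by (auto simp: L_def intro: vec.span_base)
    then show ?thesis using PL vec.subspace_0[OF Y] by simp
   qed
  qed
  then have sB: "vec.span B \<subseteq> {v. P v \<in> L \<and> v - P v \<in> Y}" by (rule vec.span_minimal[OF _ sub])
  obtain c w where w: "v = w + c *s y0" "w \<in> ?H" using split[of v] by blast
  have "w \<in> {v. P v \<in> L \<and> v - P v \<in> Y}" using w(2) B(4) sB by blast
  moreover have "y0 \<in> {v. P v \<in> L \<and> v - P v \<in> Y}" using Py0 y0(1) vec.subspace_0[OF L] by simp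
  ultimately have "v \<in> {v. P v \<in> L \<and> v - P v \<in> Y}"
   unfolding w(1) by (intro vec.subspace_add[OF sub] vec.subspace_scale[OF sub])
  then show ?thesis by simp
 qed
 have LH: "L \<subseteq> ?H" unfolding L_def by (rule vec.span_minimal[OF _ subspace_hyperplane]) (use B(2) in blast)
 have "e \<notin> B1" using B1(1) e(1) by blast
 then have eL: "e \<in> L" using B(1) by (auto simp: L_def intro: vec.span_base)
 show ?thesis
  by (rule exI[of _ P], rule exI[of _ L], intro conjI allI ballI L LH eL Padd Psc PL PY)
   (use Pspan in simp_all)
qed

section \<open>An interpolating series of bump functions\<close>

definition bump :: "real => real" where "bump s = (max 0 (1 - 4 * (s - 1)\<^sup>2))\<^sup>2"
definition bump' :: "real => real" where "bump' s = 2 * max 0 (1 - 4 * (s - 1)\<^sup>2) * (- 8 * (s - 1))"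

lemma DERIV_max_square: "((%x. (max 0 x)\<^sup>2) has_real_derivative 2 * max 0 x) (at x)"
proof -
 consider "x > 0" | "x < 0" | "x = 0" by linarith
 then show ?thesis
 proof cases
  case 1
  have "((%x. x\<^sup>2) has_real_derivative 2 * x) (at x)" by (auto intro!: derivative_eq_intros)
  then have "((%x. (max 0 x)\<^sup>2) has_real_derivative 2 * x) (at x)"
   by (rule has_field_derivative_transform_within_open[of _ _ _ "{0<..}"]) (use 1 in auto)
  then show ?thesis using 1 by simp
 next
  case 2
  have "((%x. (max 0 x)\<^sup>2) has_real_derivative 0) (at x)"
   by (rule has_field_derivative_transform_within_open[of "%x. 0" _ _ "{..<0}"]) (use 2 in auto)
  then show ?thesis using 2 by simp
 next
  case 3
  have "(max 0 z)\<^sup>2 - (max 0 0)\<^sup>2 = max 0 z * (z - 0)" for z :: real by (simp add: max_def power2_eq_square)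
  moreover have "isCont (%z::real. max 0 z) 0" by (intro continuous_intros)
  ultimately have "((%x. (max 0 x)\<^sup>2) has_real_derivative max 0 0) (at (0::real))"
   unfolding CARAT_DERIV by (intro exI[of _ "%z. max 0 z"]) auto
  then show ?thesis using 3 by simp
 qed
qed

lemma bump_deriv: "(bump has_real_derivative bump' s) (at s)"
proof -
 have "((%s. 1 - 4 * (s - 1)\<^sup>2) has_real_derivative - 8 * (s - 1)) (at s)"
  by (auto intro!: derivative_eq_intros)
 from DERIV_chain2[OF DERIV_max_square this] show ?thesis unfolding bump_def[abs_def] bump'_def .
qed

lemma bump_cont: "continuous_on A bump'"
 unfolding bump'_def by (intro continuous_intros)

text \<open>The argument will be a squared ratio of scales, which is at least \<open>4\<close> or at
  most \<open>1/4\<close> at the other interpolation points; there both value and derivative drop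
  out.\<close>

lemma bump_outside: "\<bar>s - 1\<bar> \<ge> 1/2 ==> bump s = 0 \<and> bump' s = 0"
proof -
 assume "\<bar>s - 1\<bar> \<ge> 1/2"
 then have "(1/2)\<^sup>2 \<le> (s - 1)\<^sup>2" using power_mono[of "1/2" "\<bar>s - 1\<bar>" 2] by simp
 then have "max 0 (1 - 4 * (s - 1)\<^sup>2) = 0" by (simp add: power2_eq_square)
 then show ?thesis by (simp add: bump_def bump'_def)
qed

text \<open>Value \<open>1\<close> and slope \<open>0\<close> at the centre let a term of the series
  prescribe position and derivative independently. The bound \<open>8\<close> is
  \<open>2 * 1 * 8 * (1/2)\<close>, the last factor bounding the distance from \<open>1\<close> on
  the support.\<close>

lemma bump_bounds: "0 \<le> bump s" "bump s \<le> 1" "\<bar>bump' s\<bar> \<le> 8" "bump 1 = 1" "bump' 1 = 0"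
proof -
 have m: "0 \<le> max 0 (1 - 4 * (s - 1)\<^sup>2)" "max 0 (1 - 4 * (s - 1)\<^sup>2) \<le> 1" by (auto simp: zero_le_power2)
 show "0 \<le> bump s" by (simp add: bump_def)
 show "bump s \<le> 1" unfolding bump_def using power_mono[OF m(2,1), of 2] by simp
 show "\<bar>bump' s\<bar> \<le> 8"
 proof (cases "\<bar>s - 1\<bar> \<ge> 1/2")
  case True then show ?thesis using bump_outside by simp
 next
  case False
  have "\<bar>- 8 * (s - 1)\<bar> = 8 * \<bar>s - 1\<bar>" by (simp add: abs_if)
  then have "\<bar>bump' s\<bar> = 2 * max 0 (1 - 4 * (s - 1)\<^sup>2) * (8 * \<bar>s - 1\<bar>)"
   unfolding bump'_def abs_mult[of "2 * max 0 (1 - 4 * (s - 1)\<^sup>2)"] using m(1) by simp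
  also have "\<dots> \<le> (2 * 1) * (8 * (1/2))" by (intro mult_mono) (use m False in auto)
  finally show ?thesis by simp
 qed
 show "bump 1 = 1" "bump' 1 = 0" by (simp_all add: bump_def bump'_def)
qed

text \<open>The M-test applies to the derivatives in the operator norm, and convergence at
  \<open>0\<close> then gives convergence of the series everywhere.\<close>

lemma C1_series:
 fixes f :: "nat => 'a::real_normed_vector => 'b::banach"
 assumes d: "\<And>k x. (f k has_derivative blinfun_apply (f' k x)) (at x)" and c: "\<And>k. continuous_on UNIV (f' k)"
  and M: "\<And>k x. norm (f' k x) \<le> M k" "summable M" and 0: "\<And>k. f k 0 = 0"
 shows "\<exists>g. (\<forall>x. (%k. f k x) sums g x \<and> (g has_derivative blinfun_apply (\<Sum>k. f' k x)) (at x)) \<and>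
  continuous_on UNIV (%x. \<Sum>k. f' k x)"
proof -
 have ul: "uniform_limit UNIV (%n x. \<Sum>k<n. f' k x) (%x. \<Sum>k. f' k x) sequentially"
  by (rule Weierstrass_m_test_ev[OF _ M(2)]) (simp add: M(1))
 have cont: "continuous_on UNIV (%x. \<Sum>k. f' k x)"
  by (rule uniform_limit_theorem[OF _ ul]) (auto intro!: always_eventually continuous_on_sum c)
 have "\<exists>g. \<forall>x\<in>UNIV. (%n. f n x) sums g x \<and> (g has_derivative blinfun_apply (\<Sum>k. f' k x)) (at x within UNIV)"
 proof (rule has_derivative_series[OF convex_UNIV, where f'="%n x. blinfun_apply (f' n x)" and x=0 and l=0])
  show "(f n has_derivative blinfun_apply (f' n x)) (at x within UNIV)" for n x using d by simp
  fix e :: real assume "e > 0"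
  from uniform_limitD[OF ul this]
  show "\<forall>\<^sub>F n in sequentially. \<forall>x\<in>UNIV. \<forall>h. norm ((\<Sum>i<n. blinfun_apply (f' i x) h) - blinfun_apply (\<Sum>k. f' k x) h) \<le> e * norm h"
  proof (rule eventually_mono)
   fix n assume n: "\<forall>x\<in>UNIV. dist (\<Sum>k<n. f' k x) (\<Sum>k. f' k x) < e"
   show "\<forall>x\<in>UNIV. \<forall>h. norm ((\<Sum>i<n. blinfun_apply (f' i x) h) - blinfun_apply (\<Sum>k. f' k x) h) \<le> e * norm h"
   proof (intro ballI allI)
    fix x h
    have "norm (blinfun_apply ((\<Sum>i<n. f' i x) - (\<Sum>k. f' k x)) h) \<le> norm ((\<Sum>i<n. f' i x) - (\<Sum>k. f' k x)) * norm h"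
     by (rule norm_blinfun)
    also have "\<dots> \<le> e * norm h" using n by (intro mult_right_mono) (auto simp: dist_norm less_imp_le)
    finally show "norm ((\<Sum>i<n. blinfun_apply (f' i x) h) - blinfun_apply (\<Sum>k. f' k x) h) \<le> e * norm h"
     by (simp add: blinfun.diff_left blinfun.sum_left)
   qed
  qed
 next
  show "(0::'a) \<in> UNIV" by simp
  show "(%n. f n 0) sums 0" by (simp add: 0)
 qed
 then show ?thesis using cont by auto
qed

text \<open>Where the bump is active, \<open>norm (P z)\<close> is at most \<open>2 * t\<close>. The
  factor \<open>1 / t\<close> from differentiating the bump is thus compensated by the bound
  \<open>(gam + 2 * \<alpha>) * t\<close> for the vector it multiplies; this contributes
  \<open>8 * 4 * (gam + 2 * \<alpha>)\<close>, and the derivative of \<open>A\<close> adds one more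
  \<open>\<alpha>\<close>. The bound is independent of the scale \<open>t\<close>.\<close>

lemma bump_term:
 fixes P A :: "complex ^ 'n => complex ^ 'n"
 assumes P: "bounded_linear P" "\<And>v. norm (P v) \<le> p * norm v" "p \<ge> 0"
  and A: "bounded_linear A" "\<And>w. norm (A w) \<le> \<alpha> * norm w" "\<alpha> \<ge> 0"
  and t: "t > 0" and G: "norm G \<le> gam * t"
 shows "\<exists>f'. (\<forall>z. ((%z. bump ((P z \<bullet> P z) / t\<^sup>2) *\<^sub>R (G + A (P z))) has_derivative blinfun_apply (f' z)) (at z) \<and>
   norm (f' z) \<le> (32 * gam + 65 * \<alpha>) * p \<and>
   (\<forall>v. blinfun_apply (f' z) v = (bump' ((P z \<bullet> P z) / t\<^sup>2) * (2 * (P z \<bullet> P v) / t\<^sup>2)) *\<^sub>R (G + A (P z)) +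
    bump ((P z \<bullet> P z) / t\<^sup>2) *\<^sub>R A (P v))) \<and> continuous_on UNIV f'"
proof -
 define D where "D z v = (bump' ((P z \<bullet> P z) / t\<^sup>2) * (2 * (P z \<bullet> P v) / t\<^sup>2)) *\<^sub>R (G + A (P z)) +
    bump ((P z \<bullet> P z) / t\<^sup>2) *\<^sub>R A (P v)" for z v
 have dP: "(P has_derivative P) (at z)" and dA: "((%z. A (P z)) has_derivative (%v. A (P v))) (at z)" for z
  using bounded_linear_imp_has_derivative[OF P(1)] bounded_linear_imp_has_derivative[OF bounded_linear_compose[OF A(1) P(1)]] by blast+
 have ds: "((%z. (P z \<bullet> P z) / t\<^sup>2) has_derivative (%v. 2 * (P z \<bullet> P v) / t\<^sup>2)) (at z)" for z
 proof -
  have "((%z. P z \<bullet> P z) has_derivative (%v. P z \<bullet> P v + P v \<bullet> P z)) (at z)"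
   by (rule has_derivative_inner[OF dP dP])
  then have "((%z. (P z \<bullet> P z) /\<^sub>R t\<^sup>2) has_derivative (%v. (P z \<bullet> P v + P v \<bullet> P z) /\<^sub>R t\<^sup>2)) (at z)"
   by (rule has_derivative_scaleR_right)
  then show ?thesis by (simp add: inner_commute divide_inverse mult.commute algebra_simps)
 qed
 have der: "((%z. bump ((P z \<bullet> P z) / t\<^sup>2) *\<^sub>R (G + A (P z))) has_derivative D z) (at z)" for z
 proof -
  have db: "((%z. bump ((P z \<bullet> P z) / t\<^sup>2)) has_derivative (%v. bump' ((P z \<bullet> P z) / t\<^sup>2) * (2 * (P z \<bullet> P v) / t\<^sup>2))) (at z)"
   using has_derivative_compose[OF ds bump_deriv[unfolded has_field_derivative_def]] .
  have dG: "((%z. G + A (P z)) has_derivative (%v. A (P v))) (at z)"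
   using has_derivative_add[OF has_derivative_const dA] by simp
  from has_derivative_scaleR[OF db dG] show ?thesis unfolding D_def by (simp add: add.commute)
 qed
 have bl: "bounded_linear (D z)" for z by (rule has_derivative_bounded_linear[OF der])
 define f' where "f' z = Blinfun (D z)" for z
 have f': "blinfun_apply (f' z) = D z" for z by (simp add: f'_def bounded_linear_Blinfun_apply[OF bl])
 have contP: "continuous_on UNIV P" "continuous_on UNIV (%z. A (P z))"
  using P(1) bounded_linear_compose[OF A(1) P(1)] by (auto intro: linear_continuous_on)
 have contb: "continuous_on UNIV bump"
  using bump_deriv DERIV_isCont by (metis continuous_at_imp_continuous_on)
 have "continuous_on UNIV f'"
 proof (rule continuous_on_blinfun_componentwise)
  fix i :: "complex ^ 'n"
  have c1: "continuous_on UNIV (%z. (P z \<bullet> P z) / t\<^sup>2)" using t by (intro continuous_intros contP) auto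
  have "continuous_on UNIV (%z. bump' ((P z \<bullet> P z) / t\<^sup>2))"
   by (rule continuous_on_compose2[OF bump_cont c1 subset_UNIV])
  moreover have "continuous_on UNIV (%z. bump ((P z \<bullet> P z) / t\<^sup>2))"
   by (rule continuous_on_compose2[OF contb c1 subset_UNIV])
  ultimately show "continuous_on UNIV (%x. blinfun_apply (f' x) i)"
   unfolding f' D_def using t by (intro continuous_intros contP) auto
 qed
 moreover have "norm (f' z) \<le> (32 * gam + 65 * \<alpha>) * p" for z
 proof (rule norm_blinfun_bound)
  have "0 \<le> gam * t" using G norm_ge_zero order_trans by blast
  then have gam: "gam \<ge> 0" using t by (simp add: zero_le_mult_iff)
  then show "0 \<le> (32 * gam + 65 * \<alpha>) * p" using A(3) P(3) by simp
  fix v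
  show "norm (blinfun_apply (f' z) v) \<le> (32 * gam + 65 * \<alpha>) * p * norm v"
  proof (cases "\<bar>(P z \<bullet> P z) / t\<^sup>2 - 1\<bar> \<ge> 1/2")
   case True
   then show ?thesis using gam A(3) P(3) bump_outside by (simp add: f' D_def)
  next
   case False
   then have "(P z \<bullet> P z) / t\<^sup>2 < 4" by linarith
   then have "(norm (P z))\<^sup>2 < (2 * t)\<^sup>2" using t by (simp add: divide_less_eq power2_norm_eq_inner power_mult_distrib)
   then have z: "norm (P z) \<le> 2 * t" by (rule power2_le_imp_le[OF less_imp_le]) (use t in simp)
   let ?b = "bump' ((P z \<bullet> P z) / t\<^sup>2)" and ?c = "bump ((P z \<bullet> P z) / t\<^sup>2)"
   have "\<bar>P z \<bullet> P v\<bar> \<le> (2 * t) * norm (P v)"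
    by (rule order_trans[OF Cauchy_Schwarz_ineq2]) (intro mult_right_mono z, simp)
   then have "\<bar>2 * (P z \<bullet> P v) / t\<^sup>2\<bar> \<le> 4 * norm (P v) / t"
    using t by (simp add: abs_mult divide_simps power2_eq_square)
   then have "\<bar>?b * (2 * (P z \<bullet> P v) / t\<^sup>2)\<bar> \<le> 8 * (4 * norm (P v) / t)"
    unfolding abs_mult[of ?b] by (intro mult_mono bump_bounds) auto
   moreover have "norm (G + A (P z)) \<le> (gam + 2 * \<alpha>) * t"
   proof -
    have "norm (A (P z)) \<le> \<alpha> * (2 * t)" by (rule order_trans[OF A(2)]) (intro mult_left_mono z A(3))
    then show ?thesis using norm_triangle_ineq[of G "A (P z)"] G by (simp add: algebra_simps)
   qed
   ultimately have "norm ((?b * (2 * (P z \<bullet> P v) / t\<^sup>2)) *\<^sub>R (G + A (P z))) \<le> (8 * (4 * norm (P v) / t)) * ((gam + 2 * \<alpha>) * t)"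
    unfolding norm_scaleR by (intro mult_mono) (use t in auto)
   also have "\<dots> = (32 * gam + 64 * \<alpha>) * norm (P v)" using t by (simp add: field_simps)
   finally have 1: "norm ((?b * (2 * (P z \<bullet> P v) / t\<^sup>2)) *\<^sub>R (G + A (P z))) \<le> (32 * gam + 64 * \<alpha>) * norm (P v)" .
   have 2: "norm (?c *\<^sub>R A (P v)) \<le> 1 * (\<alpha> * norm (P v))"
    unfolding norm_scaleR by (intro mult_mono A(2)) (use bump_bounds in auto)
   have "norm (D z v) \<le> (32 * gam + 64 * \<alpha>) * norm (P v) + \<alpha> * norm (P v)"
    unfolding D_def using norm_triangle_ineq 1 2 by (smt (verit))
   also have "\<dots> = (32 * gam + 65 * \<alpha>) * norm (P v)" by (simp add: algebra_simps)
   also have "\<dots> \<le> (32 * gam + 65 * \<alpha>) * (p * norm v)" by (intro mult_left_mono P(2)) (use gam A(3) in auto)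
   finally show ?thesis by (simp add: f' mult.assoc)
  qed
 qed
 ultimately show ?thesis
  by (intro exI[of _ f'] conjI allI) (simp_all only: f' der, simp only: D_def)
qed

text \<open>Supplies the points through which \<open>Q\<close> will pass: arbitrarily close to the
  origin, with the deviation from \<open>L\<close> small relative to the distance, and the change of
  hyperplane small relative to its value on \<open>y0\<close>.\<close>

lemma interpolation_data:
 fixes X :: "(complex ^ 'n) set"
 assumes lp: "limiting_pair X e h" and "e \<noteq> 0" and Pe: "P e = e"
  and P: "bounded_linear P" "\<And>v. norm (P v) \<le> p * norm v" "p \<ge> 0" "\<And>c v. P (c *s v) = c *s P v"
  and y0: "pair h y0 \<noteq> 0" and "eta > 0" "tau > 0"
 shows "\<exists>x k. x \<in> regular_points X \<and> tangent_space X x \<subseteq> hyperplane k \<and> pair k y0 \<noteq> 0 \<and> P x \<noteq> 0 \<and> norm (P x) < tau \<and>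
  norm (x - P x) \<le> eta * norm (P x) \<and> real CARD('n) * norm y0 * norm (k - h) \<le> eta * cmod (pair k y0)"
proof -
 define K where "K = real CARD('n) * norm y0"
 define c0 where "c0 = cmod (pair h y0)"
 have c0: "c0 > 0" using y0 by (simp add: c0_def)
 have ne: "norm e > 0" using \<open>e \<noteq> 0\<close> by simp
 have K: "K \<ge> 0" by (simp add: K_def)
 \<comment> \<open>\<open>a\<close> dominates the factors by which \<open>eps\<close> is multiplied
   below, and \<open>b\<close> the tolerances that the products must respect.\<close>
 define a where "a = p + (1 + p) + 2 * norm e + K + 1"
 define b where "b = min (norm e / 2) (min (eta * (norm e / 2)) (min tau (min (c0 / 2) (eta * (c0 / 2)))))"
 have a: "a > 0" "p \<le> a" "1 + p \<le> a" "2 * norm e \<le> a" "K \<le> a" using P(3) K ne unfolding a_def by linarith+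
 have b: "b > 0" "b \<le> norm e / 2" "b \<le> eta * (norm e / 2)" "b \<le> tau" "b \<le> c0 / 2" "b \<le> eta * (c0 / 2)"
  using ne c0 assms by (auto simp: b_def)
 define eps where "eps = b / (2 * a)"
 have eps: "eps > 0" using a b by (simp add: eps_def)
 have sm: "eps * q < b" if "q \<le> a" for q
 proof -
  have "eps * q \<le> eps * a" by (intro mult_left_mono that) (use eps in simp)
  also have "\<dots> = b / 2" using a(1) by (simp add: eps_def)
  finally show ?thesis using b(1) by simp
 qed
 obtain c u k where *: "c \<noteq> 0" "cmod c < eps" "norm (u - e) < eps" "norm (k - h) < eps"
  "c *s u \<in> regular_points X" "tangent_space X (c *s u) \<subseteq> hyperplane k"
  using lp eps unfolding limiting_pair_def by blast
 have diff: "P (u - e) = P u - e" using linear_diff[OF bounded_linear.linear[OF P(1)], of u e] Pe by simp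
 have "norm (P u - e) \<le> p * norm (u - e)" using P(2)[of "u - e"] unfolding diff .
 also have "\<dots> \<le> p * eps" using *(3) P(3) by (intro mult_left_mono) auto
 finally have n1: "norm (P u - e) \<le> eps * p" by (simp add: mult.commute)
 then have "norm (P u - e) < norm e / 2" using sm[OF a(2)] b(2) by linarith
 then have Pu: "norm (P u) > norm e / 2" "norm (P u) < 2 * norm e"
  using norm_triangle_ineq3[of e "P u"] norm_triangle_ineq[of e "P u - e"] by (auto simp: norm_minus_commute)
 have "norm (u - P u) \<le> norm (u - e) + norm (P u - e)" using norm_triangle_ineq4[of "u - e" "P u - e"] by simp
 also have "\<dots> \<le> eps * (1 + p)" using *(3) n1 by (simp add: algebra_simps)
 also have "\<dots> \<le> eta * (norm e / 2)" using sm[OF a(3)] b(3) by linarith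
 also have "\<dots> \<le> eta * norm (P u)" using Pu(1) \<open>eta > 0\<close> by (intro mult_left_mono) auto
 finally have n2: "norm (u - P u) \<le> eta * norm (P u)" .
 have n3: "norm (c *s u - P (c *s u)) \<le> eta * norm (P (c *s u))"
 proof -
  have "c *s u - P (c *s u) = c *s (u - P u)" by (simp add: P(4) vec.scale_right_diff_distrib)
  then have "norm (c *s u - P (c *s u)) = cmod c * norm (u - P u)" by (simp only: norm_vector_smult)
  also have "\<dots> \<le> cmod c * (eta * norm (P u))" by (intro mult_left_mono n2) simp
  finally show ?thesis by (simp add: P(4) norm_vector_smult mult.left_commute)
 qed
 have "norm (P (c *s u)) = cmod c * norm (P u)" by (simp add: P(4) norm_vector_smult)
 also have "\<dots> \<le> eps * (2 * norm e)" using *(2) Pu(2) eps by (intro mult_mono) auto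
 also have "\<dots> < tau" using sm[OF a(4)] b(4) by linarith
 finally have n4: "norm (P (c *s u)) < tau" .
 have n5: "P (c *s u) \<noteq> 0" using *(1) Pu(1) ne by (auto simp: P(4))
 have kK: "K * norm (k - h) \<le> eps * K" using *(4) K by (subst mult.commute, intro mult_right_mono) auto
 have "pair k y0 - pair h y0 = pair (k - h) y0" by (simp add: pair_def left_diff_distrib sum_subtractf)
 then have "cmod (pair k y0 - pair h y0) \<le> K * norm (k - h)"
  using pair_bound[of "k - h" y0] by (simp add: K_def mult.commute mult.left_commute)
 then have "cmod (pair k y0 - pair h y0) < c0 / 2" using kK sm[OF a(5)] b(5) by linarith
 then have n6: "cmod (pair k y0) > c0 / 2" using norm_triangle_ineq3[of "pair h y0" "pair k y0"] by (simp add: c0_def norm_minus_commute)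
 have "K * norm (k - h) \<le> eta * (c0 / 2)" using kK sm[OF a(5)] b(6) by linarith
 also have "\<dots> \<le> eta * cmod (pair k y0)" using n6 \<open>eta > 0\<close> by (intro mult_left_mono) auto
 finally have n7: "K * norm (k - h) \<le> eta * cmod (pair k y0)" .
 have "pair k y0 \<noteq> 0" using n6 c0 by auto
 then show ?thesis using *(5,6) n3 n4 n5 n7 unfolding K_def by blast
qed

text \<open>The limiting pair is realised along a real \<open>C\<^sup>1\<close> submanifold \<open>Q\<close>, the graph over \<open>L\<close> of a series
 of bump functions with disjoint supports; each bump forces \<open>Q\<close> through a regular point of \<open>X\<close> with a
 tangent space inside the limiting hyperplane.\<close>

lemma not_t1_if_limiting_pair:
 fixes X Y :: "(complex ^ 'n) set"
 assumes Y: "vec.subspace Y" and an: "analytic_near X 0"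
  and lp: "limiting_pair X e h" and eY: "e \<notin> Y" and Yh: "\<not> Y \<subseteq> hyperplane h"
 shows "\<not> condition_t1 X Y"
proof
 assume t1: "condition_t1 X Y"
 have he: "pair h e = 0" by (rule limiting_pair_incident[OF an lp])
 obtain y0 where y0: "y0 \<in> Y" "pair h y0 \<noteq> 0" using Yh by (auto simp: hyperplane_eq)
 have Y0: "0 \<in> Y" by (rule vec.subspace_0[OF Y])
 have e0: "e \<noteq> 0" using eY Y0 by auto
 have clY: "closed Y" by (rule closed_subspace[OF vec_subspace_imp_subspace[OF Y]])
 note rY = vec_subspace_imp_subspace[OF Y]
 obtain P L where L: "vec.subspace L" "L \<subseteq> hyperplane h" "e \<in> L" and P1: "\<forall>v w. P (v + w) = P v + P w" "\<forall>c v. P (c *s v) = c *s P v"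
  and P2: "\<forall>v. P v \<in> L" "\<forall>v\<in>L. P v = v" "\<forall>v\<in>Y. P v = 0" "\<forall>v. v - P v \<in> Y"
  using adapted_projection[OF Y eY he y0] by (elim exE conjE)
 have Plin: "linear P"
 proof (rule linearI)
  show "P (v + w) = P v + P w" for v w using P1(1) by blast
  show "P (r *\<^sub>R v) = r *\<^sub>R P v" for r v using P1(2) by (simp flip: of_real_smult)
 qed
 then have Pbl: "bounded_linear P" by (simp add: linear_conv_bounded_linear)
 obtain p where p: "p \<ge> 0" "\<And>v. norm (P v) \<le> p * norm v"
  using bounded_linear.nonneg_bounded[OF Pbl] by (auto simp: mult.commute)
 have Padd: "P (v + w) = P v + P w" and PinL: "P v \<in> L" and Pid: "v \<in> L ==> P v = v" and PY: "v \<in> Y ==> P v = 0"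
  and PcY: "v - P v \<in> Y" and P0: "P 0 = 0" for v w
  using P1 P2 linear_0[OF Plin] by blast+
 have comp: "complementary L Y"
  unfolding complementary_def
 proof (intro conjI set_eqI iffI)
  fix v
  show "v \<in> {0}" if "v \<in> L \<inter> Y" using that Pid PY by fastforce
  show "v \<in> L \<inter> Y" if "v \<in> {0}" using that Y0 vec.subspace_0[OF L(1)] by simp
  have "v = P v + (v - P v)" by simp
  then show "v \<in> {u + v |u v. u \<in> L \<and> v \<in> Y}" using PinL PcY by blast
 qed simp
 \<comment> \<open>The tolerances \<open>(1/2)^j\<close> bound the derivatives of the terms and make
   their series summable.\<close>
 define data where "data j q \<longleftrightarrow> fst q \<in> regular_points X \<and> tangent_space X (fst q) \<subseteq> hyperplane (snd q) \<and> pair (snd q) y0 \<noteq> 0 \<and>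
   P (fst q) \<noteq> 0 \<and> norm (P (fst q)) < (1/2)^j \<and> norm (fst q - P (fst q)) \<le> (1/2)^j * norm (P (fst q)) \<and>
   real CARD('n) * norm y0 * norm (snd q - h) \<le> (1/2)^j * cmod (pair (snd q) y0)" for j :: nat and q
 have step: "\<exists>q. data j q \<and> norm (P (fst q)) \<le> tau" if "tau > 0" for j tau
 proof -
  have "(1/2::real)^j > 0" "min ((1/2)^j) tau > 0" using that by simp_all
  from interpolation_data[OF lp e0 Pid[OF L(3)] Pbl p(2,1) P1(2)[rule_format] y0(2) this]
  obtain x k where "x \<in> regular_points X \<and> tangent_space X x \<subseteq> hyperplane k \<and> pair k y0 \<noteq> 0 \<and> P x \<noteq> 0 \<and> norm (P x) < min ((1/2)^j) tau \<and>
   norm (x - P x) \<le> (1/2)^j * norm (P x) \<and> real CARD('n) * norm y0 * norm (k - h) \<le> (1/2)^j * cmod (pair k y0)" by (elim exE)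
  then show ?thesis by (intro exI[of _ "(x, k)"]) (simp add: data_def)
 qed
 have "\<exists>f. \<forall>j. data j (f j) \<and> norm (P (fst (f (Suc j)))) \<le> norm (P (fst (f j))) / 2"
 proof (rule dependent_nat_choice)
  show "\<exists>q. data 0 q" using step[of 1 0] by auto
  show "\<exists>q'. data (Suc j) q' \<and> norm (P (fst q')) \<le> norm (P (fst q)) / 2" if "data j q" for q j
   by (rule step) (use that in "simp add: data_def")
 qed
 \<comment> \<open>Scales that at least halve from one point to the next keep the supports of the
   bumps disjoint.\<close>
 then obtain f where f: "\<And>j. data j (f j)" "\<And>j. norm (P (fst (f (Suc j)))) \<le> norm (P (fst (f j))) / 2" by blast
 define x where "x j = fst (f j)" for j
 define k where "k j = snd (f j)" for j
 define t where "t j = norm (P (x j))" for j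
 have x: "x j \<in> regular_points X" "tangent_space X (x j) \<subseteq> hyperplane (k j)" "pair (k j) y0 \<noteq> 0" "P (x j) \<noteq> 0"
  "t j < (1/2)^j" "norm (x j - P (x j)) \<le> (1/2)^j * t j"
  "real CARD('n) * norm y0 * norm (k j - h) \<le> (1/2)^j * cmod (pair (k j) y0)" for j
  using f(1)[of j] by (simp_all add: data_def x_def k_def t_def)
 have t0: "t j > 0" for j using x(4) by (simp add: t_def)
 have tS: "t (Suc j) \<le> t j / 2" for j using f(2)[of j] by (simp add: t_def x_def)
 have tlt: "t i \<le> t j / 2" if "j < i" for i j
 proof -
  have "t i \<le> t (Suc j)"
  proof (rule lift_Suc_antimono_le[of t])
   show "t (Suc n) \<le> t n" for n using tS[of n] t0[of n] by simp
  qed (use that in simp)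
  then show ?thesis using tS[of j] by simp
 qed
 \<comment> \<open>Tilts \<open>L\<close> along \<open>y0\<close> into the hyperplane of
   \<open>k j\<close>: by construction \<open>pair (k j) (w + A j w) = pair h w\<close>, which is
   zero for \<open>w\<close> in \<open>L\<close>.\<close>
 define A where "A j w = - (pair (k j - h) w / pair (k j) y0) *s y0" for j w
 have pd: "pair (k j - h) w = pair (k j) w - pair h w" for j w by (simp add: pair_def left_diff_distrib sum_subtractf)
 have AY: "A j w \<in> Y" for j w unfolding A_def by (rule vec.subspace_scale[OF Y y0(1)])
 have Abd: "norm (A j w) \<le> (1/2)^j * norm w" for j w
 proof -
  have "norm (A j w) = cmod (pair (k j - h) w) / cmod (pair (k j) y0) * norm y0"
   by (simp add: A_def norm_vector_smult norm_divide)
  also have "\<dots> \<le> (real CARD('n) * (norm (k j - h) * norm w)) / cmod (pair (k j) y0) * norm y0"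
   by (intro mult_right_mono divide_right_mono pair_bound) auto
  also have "\<dots> = (real CARD('n) * norm y0 * norm (k j - h)) / cmod (pair (k j) y0) * norm w" by simp
  also have "\<dots> \<le> (1/2)^j * norm w"
   by (intro mult_right_mono) (use x(7)[of j] x(3)[of j] in "simp_all add: divide_le_eq")
  finally show ?thesis .
 qed
 have Abl: "bounded_linear (A j)" for j
 proof (rule bounded_linear_intro)
  show "A j (v + w) = A j v + A j w" for v w
   by (simp add: A_def pair_simps add_divide_distrib vec.scale_left_distrib)
  show "A j (r *\<^sub>R v) = r *\<^sub>R A j v" for r v
   unfolding of_real_smult[symmetric] by (simp add: A_def pair_simps vec.scale_scale)
  show "norm (A j v) \<le> norm v * (1/2)^j" for v using Abd[of j v] by (simp add: mult.commute)
 qed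
 \<comment> \<open>The constant term that makes the graph pass through \<open>x j\<close>: at
   \<open>P (x j)\<close> the sum with \<open>A j\<close> is \<open>x j - P (x j)\<close>.\<close>
 define G where "G j = x j - P (x j) - A j (P (x j))" for j
 have GY: "G j \<in> Y" for j unfolding G_def by (intro vec.subspace_diff[OF Y] PcY AY)
 have Gbd: "norm (G j) \<le> (2 * (1/2)^j) * t j" for j
  using norm_triangle_ineq4[of "x j - P (x j)" "A j (P (x j))"] x(6)[of j] Abd[of j "P (x j)"] by (simp add: G_def t_def)
 define F where "F j z = bump ((P z \<bullet> P z) / (t j)\<^sup>2) *\<^sub>R (G j + A j (P z))" for j z
 define D where "D j z v = (bump' ((P z \<bullet> P z) / (t j)\<^sup>2) * (2 * (P z \<bullet> P v) / (t j)\<^sup>2)) *\<^sub>R (G j + A j (P z)) +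
    bump ((P z \<bullet> P z) / (t j)\<^sup>2) *\<^sub>R A j (P v)" for j z v
 have "\<forall>j. \<exists>f'. (\<forall>z. (F j has_derivative blinfun_apply (f' z)) (at z) \<and> norm (f' z) \<le> (32 * (2 * (1/2)^j) + 65 * (1/2)^j) * p \<and>
   (\<forall>v. blinfun_apply (f' z) v = D j z v)) \<and> continuous_on UNIV f'"
  unfolding F_def[abs_def] D_def by (intro allI bump_term Pbl p Abl Abd t0 Gbd) simp
 then obtain F' where F': "\<forall>j. (\<forall>z. (F j has_derivative blinfun_apply (F' j z)) (at z) \<and> norm (F' j z) \<le> (32 * (2 * (1/2)^j) + 65 * (1/2)^j) * p \<and>
   (\<forall>v. blinfun_apply (F' j z) v = D j z v)) \<and> continuous_on UNIV (F' j)"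
  by (rule choice[THEN exE])
 have F'd: "(F j has_derivative blinfun_apply (F' j z)) (at z)" and F'b: "norm (F' j z) \<le> (32 * (2 * (1/2)^j) + 65 * (1/2)^j) * p"
  and F'D: "blinfun_apply (F' j z) v = D j z v" and F'c: "continuous_on UNIV (F' j)" for j z v
  using F' by blast+
 have F0: "F j 0 = 0" for j using bump_outside[of 0] by (simp add: F_def P0)
 have summ: "summable (%j. (32 * (2 * (1/2)^j) + 65 * (1/2)^j) * p)"
  by (intro summable_mult2 summable_add summable_mult summable_geometric) auto
 obtain g where g: "\<And>z. (%j. F j z) sums g z" "\<And>z. (g has_derivative blinfun_apply (\<Sum>j. F' j z)) (at z)"
  and g'c: "continuous_on UNIV (%z. \<Sum>j. F' j z)"
  using C1_series[OF F'd F'c F'b summ F0] by blast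
 define g' where "g' z = (\<Sum>j. F' j z)" for z
 have FY: "F j z \<in> Y" for j z unfolding F_def by (intro subspace_scale[OF rY] subspace_add[OF rY] GY AY)
 have gY: "g z \<in> Y" for z
 proof (rule Lim_in_closed_set[OF clY _ sequentially_bot])
  show "(%n. \<Sum>j<n. F j z) \<longlonglongrightarrow> g z" using g(1) by (simp add: sums_def)
  show "\<forall>\<^sub>F n in sequentially. (\<Sum>j<n. F j z) \<in> Y" by (intro always_eventually allI subspace_sum[OF rY] FY)
 qed
 have Pg: "P (g z) = 0" for z by (rule PY[OF gY])
 have gcong: "g z = g z'" if "P z = P z'" for z z'
 proof -
  have "F j z = F j z'" for j by (simp add: F_def that)
  then have "(%j. F j z) = (%j. F j z')" by (intro ext)
  then show ?thesis using sums_unique2[OF g(1)[of z]] g(1)[of z'] by simp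
 qed
 \<comment> \<open>At \<open>x i\<close> every term with index other than \<open>i\<close> vanishes
   together with its derivative, so the series can be evaluated and differentiated there term by
   term.\<close>
 have ratio: "bump ((P (x i) \<bullet> P (x i)) / (t j)\<^sup>2) = 0 \<and> bump' ((P (x i) \<bullet> P (x i)) / (t j)\<^sup>2) = 0" if ij: "i \<noteq> j" for i j
 proof (rule bump_outside)
  have eq: "(P (x i) \<bullet> P (x i)) / (t j)\<^sup>2 = (t i / t j)\<^sup>2" by (simp add: t_def power2_norm_eq_inner power_divide)
  consider "i < j" | "j < i" using ij by linarith
  then show "\<bar>(P (x i) \<bullet> P (x i)) / (t j)\<^sup>2 - 1\<bar> \<ge> 1/2"
  proof cases
   case 1
   then have "2 \<le> t i / t j" using tlt[OF 1] t0[of j] by (simp add: le_divide_eq)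
   from power_mono[OF this, of 2] show ?thesis unfolding eq by simp
  next
   case 2
   then have "t i / t j \<le> 1/2" using tlt[OF 2] t0[of j] by (simp add: divide_le_eq)
   moreover have "0 \<le> t i / t j" using t0[of i] t0[of j] by simp
   ultimately have "(t i / t j)\<^sup>2 \<le> (1/2)\<^sup>2" by (rule power_mono)
   then have "(t i / t j)\<^sup>2 \<le> 1/4" by (simp only: power_one_over) simp
   then show ?thesis unfolding eq by linarith
  qed
 qed
 have one: "(P (x j) \<bullet> P (x j)) / (t j)\<^sup>2 = 1" for j using t0[of j] by (simp add: t_def power2_norm_eq_inner)
 have gx: "g (x j) = x j - P (x j)" for j
 proof -
  have "(%i. F i (x j)) sums (\<Sum>i\<in>{j}. F i (x j))" by (rule sums_finite) (use ratio[of j] in "auto simp: F_def")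
  moreover have "F j (x j) = x j - P (x j)" unfolding F_def one by (simp add: bump_bounds G_def)
  ultimately show ?thesis using sums_unique2[OF g(1)[of "x j"]] by simp
 qed
 have g'x: "blinfun_apply (g' (x j)) v = A j (P v)" for j v
 proof -
  have "F' i (x j) = 0" if "i \<notin> {j}" for i
  proof (rule blinfun_eqI)
   fix v show "blinfun_apply (F' i (x j)) v = blinfun_apply 0 v" using ratio[of j i] that by (simp add: F'D D_def)
  qed
  then have "g' (x j) = (\<Sum>i\<in>{j}. F' i (x j))" unfolding g'_def by (intro suminf_finite) auto
  then show ?thesis by (simp add: F'D D_def one bump_bounds)
 qed
 have g'0: "g' 0 = 0"
 proof -
  have "F' i 0 = 0" for i
   by (rule blinfun_eqI) (use bump_outside[of 0] in "simp add: F'D D_def P0")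
  then show ?thesis by (simp add: g'_def)
 qed
 have g0: "g 0 = 0" using sums_unique2[OF g(1)[of 0]] F0 by simp
 \<comment> \<open>The graph of \<open>g\<close> over \<open>L\<close>. As \<open>g\<close> takes
   values in \<open>Y\<close> and depends on \<open>P z\<close> alone, subtracting \<open>g\<close>
   is a global chart that flattens \<open>Q\<close> to \<open>L\<close>, with addition of
   \<open>g\<close> as inverse.\<close>
 define Q where "Q = {z. z - P z = g z}"
 define phi where "phi z = z - g z" for z
 define psi where "psi z = z + g z" for z
 have Pphi: "P (phi z) = P z" "P (psi z) = P z" for z
  using linear_diff[OF Plin, of z "g z"] by (simp_all add: phi_def psi_def Padd Pg)
 have inv: "phi (psi z) = z" "psi (phi z) = z" for z
  using gcong[OF Pphi(2)[of z]] gcong[OF Pphi(1)[of z]] by (simp_all add: phi_def psi_def)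
 have gcont: "continuous_on UNIV g" using g(2) has_derivative_continuous by (metis continuous_at_imp_continuous_on)
 have hom: "homeomorphism UNIV UNIV phi psi"
  by (rule homeomorphismI) (auto simp: inv, auto simp: phi_def[abs_def] psi_def[abs_def] intro!: continuous_intros gcont)
 have dphi: "(phi has_derivative blinfun_apply (id_blinfun - g' z)) (at z)"
  and dpsi: "(psi has_derivative blinfun_apply (id_blinfun + g' z)) (at z)" for z
  unfolding phi_def[abs_def] psi_def[abs_def] blinfun.diff_left blinfun.add_left blinfun_apply_id_blinfun id_def g'_def
  by (intro has_derivative_diff has_derivative_add has_derivative_ident g(2))+
 have C1: "C1_map phi UNIV" "C1_map psi UNIV"
  unfolding C1_map_def
  by (rule exI[of _ "%z. id_blinfun - g' z"], use dphi g'c in \<open>auto simp: g'_def intro!: continuous_intros\<close>,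
    rule exI[of _ "%z. id_blinfun + g' z"], use dpsi g'c in "auto simp: g'_def intro!: continuous_intros")
 have im: "phi ` (Q \<inter> UNIV) = UNIV \<inter> L"
 proof (intro equalityI subsetI)
  fix l assume "l \<in> phi ` (Q \<inter> UNIV)"
  then obtain z where z: "z - P z = g z" "l = z - g z" by (auto simp: Q_def phi_def)
  have "l = z - (z - P z)" by (simp only: z)
  then have "l = P z" by simp
  then show "l \<in> UNIV \<inter> L" using PinL by simp
 next
  fix l assume l: "l \<in> UNIV \<inter> L"
  have "psi l - P (psi l) = g (psi l)" using Pid[of l] l Pphi(2)[of l] gcong[OF Pphi(2)[of l]] by (simp add: psi_def)
  then have "psi l \<in> Q" by (simp add: Q_def)
  then show "l \<in> phi ` (Q \<inter> UNIV)" using inv(1)[of l] by (metis Int_UNIV_right image_eqI)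
 qed
 have sm: "submanifold_at C1_map subspace Q q" for q
  unfolding submanifold_at_def
  by (rule exI[of _ UNIV], rule exI[of _ UNIV], rule exI[of _ phi], rule exI[of _ psi], rule exI[of _ L])
   (use hom C1 im vec_subspace_imp_subspace[OF L(1)] in simp)
 then have C1Q: "C1_submanifold Q" by (simp add: C1_submanifold_def)
 have Q0: "0 \<in> Q" by (simp add: Q_def P0 g0)
 note ch = tangent_space_chart[OF open_UNIV open_UNIV UNIV_I hom im vec_subspace_imp_subspace[OF L(1)] dphi]
 have TQ0: "tangent_space Q 0 = L"
 proof (intro equalityI subsetI)
  fix v assume "v \<in> tangent_space Q 0"
  from ch(1)[OF this] show "v \<in> L" by (simp add: g'0)
 next
  fix v assume v: "v \<in> L"
  have "phi 0 = 0" by (simp add: phi_def g0)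
  with ch(2)[OF Q0 _ v, of "blinfun_apply (id_blinfun + g' 0)"] dpsi[of 0] show "v \<in> tangent_space Q 0" by (simp add: g'0)
 qed
 have "\<forall>\<^sub>F z in nhds 0. transverse_at Q (X - Y) z"
  using t1 L(1) comp C1Q Q0 TQ0 unfolding condition_t1_def by blast
 then obtain eps where eps: "eps > 0" "\<And>z. dist z 0 < eps ==> transverse_at Q (X - Y) z"
  unfolding eventually_nhds_metric by blast
 obtain j where j: "(1/2::real)^j < eps / 2" using real_arch_pow_inv[of "eps / 2" "1/2"] eps(1) by auto
 have "norm (x j) \<le> norm (P (x j)) + norm (x j - P (x j))" using norm_triangle_ineq[of "P (x j)" "x j - P (x j)"] by simp
 also have "\<dots> \<le> t j + 1 * t j"
 proof -
  have "(1/2::real)^j * t j \<le> 1 * t j" by (intro mult_right_mono) (use t0[of j] in "auto simp: power_le_one")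
  then show ?thesis using x(6)[of j] by (simp add: t_def)
 qed
 also have "\<dots> < eps" using x(5)[of j] j by simp
 finally have tr: "transverse_at Q (X - Y) (x j)" using eps(2) by simp
 have xQ: "x j \<in> Q" by (simp add: Q_def gx)
 have "x j \<notin> Y" using x(4)[of j] PY by blast
 then have mem: "x j \<in> Q \<inter> (X - Y)" using xQ x(1)[of j] by (simp add: regular_points_def)
 have TX: "tangent_space (X - Y) (x j) \<subseteq> hyperplane (k j)"
  using tangent_space_mono[of "X - Y" X "x j"] x(2)[of j] by blast
 have TQ: "tangent_space Q (x j) \<subseteq> hyperplane (k j)"
 proof
  fix v assume "v \<in> tangent_space Q (x j)"
  from ch(1)[OF this] have l: "v - A j (P v) \<in> L" by (simp add: blinfun.diff_left g'x)
  have "P (v - A j (P v)) = P v" using linear_diff[OF Plin, of v "A j (P v)"] PY[OF AY] by simp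
  with Pid[OF l] have v: "v = P v + A j (P v)" by (simp add: algebra_simps)
  have "pair h (P v) = 0" using PinL L(2) by (auto simp: hyperplane_eq)
  then have "pair (k j) (P v + A j (P v)) = 0" using x(3)[of j] by (simp add: pair_simps A_def pd)
  then show "v \<in> hyperplane (k j)" using v by (simp add: hyperplane_eq)
 qed
 \<comment> \<open>Both tangent spaces lie in the hyperplane of \<open>k j\<close>, while
   transversality would put \<open>y0\<close> into their sum.\<close>
 have "y0 \<in> {u + v |u v. u \<in> tangent_space Q (x j) \<and> v \<in> tangent_space (X - Y) (x j)}"
  using tr mem unfolding transverse_at_def by simp
 then have "y0 \<in> hyperplane (k j)"
  using TX TQ vec.subspace_add[OF subspace_hyperplane[of "k j"]] by blast
 then show False using x(3)[of j] by (simp add: hyperplane_eq)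
qed

theorem proposition3p2:
 fixes X Y :: "(complex ^ 'n) set"
 assumes "analytic_subset UNIV X"
  and "analytic_subset UNIV Y"
  and "Y \<subseteq> X"
  and "0 \<in> Y"
  and "vec.subspace Y"
  and "singular_set X \<subseteq> Y"
 shows "condition_t1 X Y \<longleftrightarrow> {C \<in> comps2 X Y. \<not> pi1_cone C \<subseteq> Y} = {}"
proof -
 have "analytic_near X 0" using assms(1) by (simp add: analytic_subset_iff)
 then have "condition_t1 X Y ==> \<not> (bad_limit X Y)"
  using not_t1_if_limiting_pair[OF assms(5)] by blast
 moreover have "X - Y \<subseteq> regular_points X" using assms(6) by (auto simp: singular_set_def)
 then have "\<not> condition_t1 X Y ==> bad_limit X Y"
  by (rule limiting_pair_if_not_t1[OF assms(5)])
 moreover have "0 \<in> X" using assms(3,4) by blast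
 ultimately show ?thesis using comps2_empty_iff[OF assms(5,2)] by blast
qed

end
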